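(* Let $\mathcal{W}=\mathcal{W}(\ell_1,\ell_2,\Gamma)$ be an algebra of Weyl type over $\mathbb{F}$. Let $\mathrm{Aut}(\mathcal{W})$ be the automorphism group of the associative algebra $(\mathcal{W},\cdot)$ and $\mathrm{Aut}(\mathcal{W},[\cdot,\cdot])$ the automorphism group of the Lie algebra $(\mathcal{W},[\cdot,\cdot])$. Let $$E=\{\sigma_\tau\sigma_u\sigma_v:\ \tau\in\mathrm{Aut}_2(A_1),\ u\in A,\ v\in\mathbb{F}^\ell\},$$ a subgroup of $\mathrm{Aut}(\mathcal{W})$, and let $\sigma_1$ be the Lie algebra automorphism of $\mathcal{W}$ of order $2$ given by $\sigma_1(x^{\alpha,\vec i}\partial^\mu)=-(-\partial)^\mu\cdot x^{\alpha,\vec i}$. Then $$\mathrm{Aut}(\mathcal{W})\cong E\qquad\text{and}\qquad \mathrm{Aut}(\mathcal{W},[\cdot,\cdot])\cong E\rtimes\langle\sigma_1\rangle,$$ where the isomorphisms are the ones induced by the inclusions of $E$ and $\langle\sigma_1\rangle$ in these automorphism groups ($\sigma_1$ acting on $E$ by conjugation).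
   Context: $\mathbb{F}$ is a field of characteristic $0$; $\mathbb{Z}_+$ is the set of nonnegative integers. Let $\ell_1,\ell_2\ge 0$ be integers with $\ell=\ell_1+\ell_2>0$. Let $\Gamma$ be a nondegenerate additive subgroup of $\mathbb{F}^\ell$, i.e. a subgroup containing an $\mathbb{F}$-basis of $\mathbb{F}^\ell$; its elements are written as row vectors $\alpha=(\alpha_1,\dots,\alpha_\ell)$. Put $J_1=\mathbb{Z}_+^{\ell_1}\times\{0\}^{\ell_2}$ and $J=\mathbb{Z}_+^{\ell}$, and let $1_{[p]}$ be the $p$-th standard unit vector. $A$ is the semigroup algebra $\mathbb{F}[\Gamma\times J_1]$, with basis $\{x^{\alpha,\vec i}: \alpha\in\Gamma,\ \vec i\in J_1\}$ and product $x^{\alpha,\vec i}x^{\beta,\vec j}=x^{\alpha+\beta,\vec i+\vec j}$; write $1=x^{0,0}$, $x^\alpha=x^{\alpha,0}$, $x^{\vec i}=x^{0,\vec i}$. Let $A_1=\mathrm{span}\{x^\alpha:\alpha\in\Gamma\}$, the group algebra of $\Gamma$. Define commuting derivations $\partial_1,\dots,\partial_\ell$ of $A$ by $\partial_p(x^{\alpha,\vec i})=\alpha_p x^{\alpha,\vec i}+i_p x^{\alpha,\vec i-1_{[p]}}$ (the last term being $0$ if $i_p=0$), and let $D=\mathrm{span}_{\mathbb{F}}\{\partial_1,\dots,\partial_\ell\}$. $\mathbb{F}[D]$ is the polynomial algebra in $\partial_1,\dots,\partial_\ell$, with basis $\partial^\mu=\prod_p\partial_p^{\mu_p}$, $\mu\in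 J$. The associative algebra of Weyl type is the vector space $\mathcal{W}=\mathcal{W}(\ell_1,\ell_2,\Gamma)=A\otimes\mathbb{F}[D]$, with basis $\{x^{\alpha,\vec i}\partial^\mu\}$ and product $$u\partial^\mu\cdot v\partial^\nu=\sum_{\lambda\in J}\binom{\mu}{\lambda}u\,\partial^\lambda(v)\,\partial^{\mu+\nu-\lambda}\qquad(u,v\in A,\ \mu,\nu\in J),$$ where $\binom{\mu}{\lambda}=\prod_p\binom{\mu_p}{\lambda_p}$ (with $\binom{i}{j}=0$ if $i<j$) and $\partial^\lambda(v)$ is the result of applying the operator $\partial^\lambda$ to $v$. The Lie algebra of Weyl type is the same space with bracket $[a,b]=a\cdot b-b\cdot a$. The associative algebra $\mathcal{W}$ is generated by the $x^\alpha$ ($\alpha\in\Gamma$), the $x^{1_{[p]}}$ ($1\le p\le\ell_1$) and the $\partial_q$ ($1\le q\le \ell$). The following automorphisms of the associative algebra $\mathcal{W}$ are used. (1) Let $\mathrm{Aut}_2(\Gamma)$ be the group of block matrices $G=\begin{pmatrix}M&0\\P&Q\end{pmatrix}\in GL_\ell(\mathbb{F})$, with $M\in GL_{\ell_1}(\mathbb{F})$ and $Q\in GL_{\ell_2}(\mathbb{F})$, such that $\Gamma G=\Gamma$. Let $\mathrm{Hom}(\Gamma,\mathbb{F}^* )$ be the group of maps $f:\Gamma\to\mathbb{F}^*$ with $f(\alpha+\beta)=f(\alpha)f(\beta)$. $\mathrm{Aut}_2(A_1)$ is the group of algebra automorphisms $\tau=(G,f)$ of $A_1$ of the form $\tau(x^\alpha)=f(\alpha)x^{\alpha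 G^{-1}}$ with $G\in\mathrm{Aut}_2(\Gamma)$, $f\in\mathrm{Hom}(\Gamma,\mathbb{F}^* )$. For such $\tau$, $\sigma_\tau$ is the unique automorphism of the associative algebra $\mathcal{W}$ with $\sigma_\tau(x^\alpha)=f(\alpha)x^{\alpha G^{-1}}$, $(\sigma_\tau(\partial_1),\dots,\sigma_\tau(\partial_\ell))=(\partial_1,\dots,\partial_\ell)G$, and $(\sigma_\tau(x^{1_{[1]}}),\dots,\sigma_\tau(x^{1_{[\ell_1]}}))=(x^{1_{[1]}},\dots,x^{1_{[\ell_1]}})(M^{\mathrm t})^{-1}$. (2) For $u\in A$, $\mathrm{ad}\,u$ is locally nilpotent on $\mathcal{W}$ and $\sigma_u=\exp(\mathrm{ad}\,u)$ (it depends only on $u$ modulo $\mathbb{F}$). (3) For $v=(v_1,\dots,v_\ell)\in\mathbb{F}^\ell$, $\sigma_v$ is the unique automorphism of the associative algebra $\mathcal{W}$ with $\sigma_v(x^\alpha)=x^\alpha$ for $\alpha\in\Gamma$, $\sigma_v(\partial_p)=\partial_p$ and $\sigma_v(x^{1_{[p]}})=x^{1_{[p]}}+v_p$ for $1\le p\le\ell_1$, and $\sigma_v(\partial_q)=\partial_q+v_q$ for $\ell_1+1\le q\le\ell$. In the definition of $\sigma_1$ (a linear map defined on the basis $x^{\alpha,\vec i}\partial^\mu$), $(-\partial)^\mu=\prod_p(-\partial_p)^{\mu_p}$ and $(-\partial)^\mu\cdot x^{\alpha,\vec i}$ is the product in the associative algebra $\mathcal{W}$. *)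

theory Defs
  imports
    "HOL-Library.Poly_Mapping"
    "HOL-Library.Product_Plus"
    "HOL-Algebra.Bij"
    "HOL-Algebra.Generated_Groups"
    "HOL-Algebra.Multiplicative_Group"
    "Jordan_Normal_Form.Matrix"
begin

section \<open>Conventions\<close>

text \<open>
  Coordinates are numbered from \<open>0\<close>: the index \<open>p\<close> with \<open>1 \<le> p \<le> l\<close> of the usual notation
  is \<open>p - 1 < l\<close> here. Vectors over the field and multi-indices are finitely supported
  functions on \<open>nat\<close>; \<open>F\<^sup>n\<close> and \<open>Z\<^sub>+\<^sup>n\<close> are those supported in \<open>{..<n}\<close>. In particular the
  multi-indices with the last \<open>l2\<close> of \<open>l1 + l2\<close> entries zero are exactly \<open>multi_indices l1\<close>.
\<close>

type_synonym 'f fvec = "nat \<Rightarrow>\<^sub>0 'f"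
type_synonym mindex = "nat \<Rightarrow>\<^sub>0 nat"

text \<open>
  The product on \<open>'f salg\<close> is the convolution product of the library, so this type is the
  semigroup algebra of all of \<open>'f fvec \<times> mindex\<close>; the algebra \<open>A\<close> is the subset \<open>salg_carrier\<close>.

  An element of \<open>'f weyl\<close> maps \<open>\<mu>\<close> to the coefficient in \<open>A\<close> of \<open>\<partial>\<^sup>\<mu>\<close>, which renders
  \<open>A \<otimes> F[D]\<close>. The library's \<open>*\<close> on this type is the commutative product of polynomials in the
  \<open>\<partial>\<^sub>p\<close>; the product of the Weyl algebra is \<open>weyl_mult\<close> below.
\<close>

type_synonym 'f salg = "('f fvec \<times> mindex) \<Rightarrow>\<^sub>0 'f"
type_synonym 'f weyl = "mindex \<Rightarrow>\<^sub>0 'f salg"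

abbreviation coef :: "('k \<Rightarrow>\<^sub>0 'v::zero) \<Rightarrow> 'k \<Rightarrow> 'v" where
  "coef \<equiv> Poly_Mapping.lookup"

abbreviation supp :: "('k \<Rightarrow>\<^sub>0 'v::zero) \<Rightarrow> 'k set" where
  "supp \<equiv> Poly_Mapping.keys"

section \<open>Vectors and matrices\<close>

definition scale :: "'f::field \<Rightarrow> ('k \<Rightarrow>\<^sub>0 'f) \<Rightarrow> ('k \<Rightarrow>\<^sub>0 'f)" where
  "scale c v = Poly_Mapping.map ((*) c) v"

lemma lookup_scale: "coef (scale c v) k = c * coef v k"
  by (simp add: scale_def Poly_Mapping.map.rep_eq when_def)

interpretation pm: vector_space "scale :: 'f::field \<Rightarrow> ('k \<Rightarrow>\<^sub>0 'f) \<Rightarrow> ('k \<Rightarrow>\<^sub>0 'f)"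
  by unfold_locales (auto intro!: poly_mapping_eqI simp: lookup_scale lookup_add algebra_simps)

definition vecs :: "nat \<Rightarrow> 'f::field fvec set" where
  "vecs n = {v. supp v \<subseteq> {..<n}}"

definition multi_indices :: "nat \<Rightarrow> mindex set" where
  "multi_indices n = {i. supp i \<subseteq> {..<n}}"

definition unit_index :: "nat \<Rightarrow> mindex" where
  "unit_index p = Poly_Mapping.single p 1"

definition nondegenerate_subgroup :: "nat \<Rightarrow> 'f::field fvec set \<Rightarrow> bool" where
  "nondegenerate_subgroup n \<Gamma> \<longleftrightarrow>
     \<Gamma> \<subseteq> vecs n \<and> 0 \<in> \<Gamma> \<and> (\<forall>\<alpha>\<in>\<Gamma>. \<forall>\<beta>\<in>\<Gamma>. \<alpha> + \<beta> \<in> \<Gamma>) \<and> (\<forall>\<alpha>\<in>\<Gamma>. - \<alpha> \<in> \<Gamma>) \<and>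
     (\<exists>B\<subseteq>\<Gamma>. pm.independent B \<and> pm.span B = vecs n)"

text \<open>The row vector \<open>\<alpha>G\<close>.\<close>

definition row_mult :: "nat \<Rightarrow> 'f::field fvec \<Rightarrow> 'f mat \<Rightarrow> 'f fvec" where
  "row_mult n \<alpha> G = (\<Sum>q<n. Poly_Mapping.single q (\<Sum>p<n. coef \<alpha> p * G $$ (p, q)))"

definition GL :: "nat \<Rightarrow> 'f::field mat set" where
  "GL n = Units (ring_mat TYPE('f) n ())"

definition GL_inv :: "nat \<Rightarrow> 'f::field mat \<Rightarrow> 'f mat" where
  "GL_inv n G = inv\<^bsub>ring_mat TYPE('f) n ()\<^esub> G"

section \<open>The algebra of Weyl type\<close>

definition salg_carrier :: "nat \<Rightarrow> 'f::field fvec set \<Rightarrow> 'f salg set" where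
  "salg_carrier l1 \<Gamma> = {u. supp u \<subseteq> \<Gamma> \<times> multi_indices l1}"

definition xmono :: "'f::field fvec \<Rightarrow> mindex \<Rightarrow> 'f salg" where
  "xmono \<alpha> i = Poly_Mapping.single (\<alpha>, i) 1"

definition xderiv :: "nat \<Rightarrow> 'f::field salg \<Rightarrow> 'f salg" where
  "xderiv p u = (\<Sum>(\<alpha>, i)\<in>supp u. scale (coef u (\<alpha>, i))
     (scale (coef \<alpha> p) (xmono \<alpha> i) + scale (of_nat (coef i p)) (xmono \<alpha> (i - unit_index p))))"

text \<open>The \<open>xderiv p\<close> commute, so the order of the factors in \<open>\<partial>\<^sup>\<kappa>\<close> is immaterial.\<close>

definition xderiv_pow :: "mindex \<Rightarrow> 'f::field salg \<Rightarrow> 'f salg" where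
  "xderiv_pow \<kappa> = foldr (\<lambda>p g. (xderiv p ^^ coef \<kappa> p) \<circ> g) (sorted_list_of_set (supp \<kappa>)) id"

definition weyl_carrier :: "nat \<Rightarrow> nat \<Rightarrow> 'f::field fvec set \<Rightarrow> 'f weyl set" where
  "weyl_carrier l1 l2 \<Gamma> =
     {w. supp w \<subseteq> multi_indices (l1 + l2) \<and> (\<forall>\<mu>. coef w \<mu> \<in> salg_carrier l1 \<Gamma>)}"

definition wscale :: "'f::field \<Rightarrow> 'f weyl \<Rightarrow> 'f weyl" where
  "wscale c w = Poly_Mapping.map (scale c) w"

text \<open>
  Factors with \<open>\<kappa>\<^sub>p = 0\<close> are \<open>1\<close> and are left out. In \<open>weyl_mult\<close> only those \<open>\<kappa>\<close> are summed for
  which the coefficient is nonzero, namely \<open>\<kappa> \<le> \<mu>\<close> componentwise. (The library's order on finitely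
  supported functions is lexicographic and is not used.)
\<close>

definition mbinom :: "mindex \<Rightarrow> mindex \<Rightarrow> nat" where
  "mbinom \<mu> \<kappa> = (\<Prod>p\<in>supp \<kappa>. coef \<mu> p choose coef \<kappa> p)"

definition weyl_mult :: "'f::field weyl \<Rightarrow> 'f weyl \<Rightarrow> 'f weyl" where
  "weyl_mult a b = (\<Sum>\<mu>\<in>supp a. \<Sum>\<nu>\<in>supp b. \<Sum>\<kappa>\<in>{\<kappa>. \<forall>p. coef \<kappa> p \<le> coef \<mu> p}.
     Poly_Mapping.single (\<mu> + \<nu> - \<kappa>)
       (scale (of_nat (mbinom \<mu> \<kappa>)) (coef a \<mu> * xderiv_pow \<kappa> (coef b \<nu>))))"

definition weyl_bracket :: "'f::field weyl \<Rightarrow> 'f weyl \<Rightarrow> 'f weyl" where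
  "weyl_bracket a b = weyl_mult a b - weyl_mult b a"

definition emb :: "'f::field salg \<Rightarrow> 'f weyl" where
  "emb u = Poly_Mapping.single 0 u"

text \<open>
  \<open>wx \<alpha>\<close>, \<open>wt p\<close>, \<open>wd p\<close> are the generators \<open>x\<^sup>\<alpha>\<close>, \<open>x\<^bsup>1[p]\<^esup>\<close> and \<open>\<partial>\<^sub>p\<close>.
\<close>

definition wx :: "'f::field fvec \<Rightarrow> 'f weyl" where
  "wx \<alpha> = emb (xmono \<alpha> 0)"

definition wt :: "nat \<Rightarrow> 'f::field weyl" where
  "wt p = emb (xmono 0 (unit_index p))"

definition wd :: "nat \<Rightarrow> 'f::field weyl" where
  "wd p = Poly_Mapping.single (unit_index p) (xmono 0 0)"

definition wone :: "'f::field weyl" where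
  "wone = emb (xmono 0 0)"

section \<open>Automorphism groups\<close>

text \<open>
  Automorphisms are extensional bijections of the carrier, as in \<open>BijGroup\<close>, whose operation is
  composition; \<open>m\<close> is the product or the bracket. Preservation of the unit element by
  automorphisms of the associative algebra follows from bijectivity.
\<close>

definition aut_group ::
  "('f weyl \<Rightarrow> 'f weyl \<Rightarrow> 'f weyl) \<Rightarrow> 'f::field weyl set \<Rightarrow> ('f weyl \<Rightarrow> 'f weyl) monoid" where
  "aut_group m W = (BijGroup W)\<lparr>carrier := {\<phi> \<in> Bij W.
     (\<forall>a\<in>W. \<forall>b\<in>W. \<phi> (a + b) = \<phi> a + \<phi> b) \<and>
     (\<forall>c. \<forall>a\<in>W. \<phi> (wscale c a) = wscale c (\<phi> a)) \<and>
     (\<forall>a\<in>W. \<forall>b\<in>W. \<phi> (m a b) = m (\<phi> a) (\<phi> b))}\<rparr>"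

definition Aut_assoc :: "nat \<Rightarrow> nat \<Rightarrow> 'f::field fvec set \<Rightarrow> ('f weyl \<Rightarrow> 'f weyl) monoid" where
  "Aut_assoc l1 l2 \<Gamma> = aut_group weyl_mult (weyl_carrier l1 l2 \<Gamma>)"

definition Aut_Lie :: "nat \<Rightarrow> nat \<Rightarrow> 'f::field fvec set \<Rightarrow> ('f weyl \<Rightarrow> 'f weyl) monoid" where
  "Aut_Lie l1 l2 \<Gamma> = aut_group weyl_bracket (weyl_carrier l1 l2 \<Gamma>)"

section \<open>The special automorphisms\<close>

definition upper_left :: "nat \<Rightarrow> 'f mat \<Rightarrow> 'f mat" where
  "upper_left n G = mat n n (\<lambda>(i, j). G $$ (i, j))"

definition Aut2_grp :: "nat \<Rightarrow> nat \<Rightarrow> 'f::field fvec set \<Rightarrow> 'f mat set" where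
  "Aut2_grp l1 l2 \<Gamma> = {G \<in> GL (l1 + l2).
     (\<exists>M\<in>GL l1. \<exists>P\<in>carrier_mat l2 l1. \<exists>Q\<in>GL l2. G = four_block_mat M (0\<^sub>m l1 l2) P Q) \<and>
     (\<lambda>\<alpha>. row_mult (l1 + l2) \<alpha> G) ` \<Gamma> = \<Gamma>}"

text \<open>\<open>Hom(\<Gamma>, F\<^sup>*)\<close>; values outside \<open>\<Gamma>\<close> are irrelevant.\<close>

definition characters :: "'f::field fvec set \<Rightarrow> ('f fvec \<Rightarrow> 'f) set" where
  "characters \<Gamma> = {f. (\<forall>\<alpha>\<in>\<Gamma>. f \<alpha> \<noteq> 0) \<and> (\<forall>\<alpha>\<in>\<Gamma>. \<forall>\<beta>\<in>\<Gamma>. f (\<alpha> + \<beta>) = f \<alpha> * f \<beta>)}"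

text \<open>
  The automorphism \<open>x\<^sup>\<alpha> \<mapsto> f(\<alpha>) x\<^bsup>\<alpha>G\<inverse>\<^esup>\<close> of the group algebra of \<open>\<Gamma>\<close> is represented by the pair
  \<open>(G, f)\<close>; since \<open>\<Gamma>\<close> spans, it determines \<open>G\<close>, and it determines \<open>f\<close> on \<open>\<Gamma>\<close>.
\<close>

definition Aut2_A1 :: "nat \<Rightarrow> nat \<Rightarrow> 'f::field fvec set \<Rightarrow> ('f mat \<times> ('f fvec \<Rightarrow> 'f)) set" where
  "Aut2_A1 l1 l2 \<Gamma> = Aut2_grp l1 l2 \<Gamma> \<times> characters \<Gamma>"

text \<open>
  The \<open>\<partial>\<^sub>p\<close> and the \<open>x\<^bsup>1[p]\<^esup>\<close> are transformed as row vectors: the images are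
  \<open>(\<partial>\<^sub>1, ..., \<partial>\<^sub>l)G\<close> and \<open>(x\<^bsup>1[1]\<^esup>, ..., x\<^bsup>1[l1]\<^esup>)(M\<^sup>t)\<^sup>-\<^sup>1\<close>, with \<open>M\<close> the upper left block of \<open>G\<close>.
\<close>

definition sigma_tau ::
  "nat \<Rightarrow> nat \<Rightarrow> 'f::field fvec set \<Rightarrow> 'f mat \<times> ('f fvec \<Rightarrow> 'f) \<Rightarrow> 'f weyl \<Rightarrow> 'f weyl" where
  "sigma_tau l1 l2 \<Gamma> = (\<lambda>(G, f). THE \<phi>. \<phi> \<in> carrier (Aut_assoc l1 l2 \<Gamma>) \<and>
     (\<forall>\<alpha>\<in>\<Gamma>. \<phi> (wx \<alpha>) = wscale (f \<alpha>) (wx (row_mult (l1 + l2) \<alpha> (GL_inv (l1 + l2) G)))) \<and>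
     (\<forall>p<l1 + l2. \<phi> (wd p) = (\<Sum>q<l1 + l2. wscale (G $$ (q, p)) (wd q))) \<and>
     (\<forall>p<l1. \<phi> (wt p) =
        (\<Sum>s<l1. wscale (GL_inv l1 (transpose_mat (upper_left l1 G)) $$ (s, p)) (wt s))))"

text \<open>
  For \<open>u\<close> in \<open>A\<close> only finitely many terms of the exponential series at a given \<open>w\<close> are nonzero,
  and \<open>Sum_any\<close> is the sum of these.
\<close>

definition sigma_exp ::
  "nat \<Rightarrow> nat \<Rightarrow> 'f::field_char_0 fvec set \<Rightarrow> 'f salg \<Rightarrow> 'f weyl \<Rightarrow> 'f weyl" where
  "sigma_exp l1 l2 \<Gamma> u = (\<lambda>w\<in>weyl_carrier l1 l2 \<Gamma>.
     Sum_any (\<lambda>k::nat. wscale (1 / fact k) ((weyl_bracket (emb u) ^^ k) w)))"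

definition sigma_vec ::
  "nat \<Rightarrow> nat \<Rightarrow> 'f::field fvec set \<Rightarrow> 'f fvec \<Rightarrow> 'f weyl \<Rightarrow> 'f weyl" where
  "sigma_vec l1 l2 \<Gamma> v = (THE \<phi>. \<phi> \<in> carrier (Aut_assoc l1 l2 \<Gamma>) \<and>
     (\<forall>\<alpha>\<in>\<Gamma>. \<phi> (wx \<alpha>) = wx \<alpha>) \<and>
     (\<forall>p<l1. \<phi> (wd p) = wd p \<and> \<phi> (wt p) = wt p + wscale (coef v p) wone) \<and>
     (\<forall>q. l1 \<le> q \<and> q < l1 + l2 \<longrightarrow> \<phi> (wd q) = wd q + wscale (coef v q) wone))"

definition E_set :: "nat \<Rightarrow> nat \<Rightarrow> 'f::field_char_0 fvec set \<Rightarrow> ('f weyl \<Rightarrow> 'f weyl) set" where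
  "E_set l1 l2 \<Gamma> =
     {compose W (sigma_tau l1 l2 \<Gamma> \<tau>) (compose W (sigma_exp l1 l2 \<Gamma> u) (sigma_vec l1 l2 \<Gamma> v))
      | W \<tau> u v. W = weyl_carrier l1 l2 \<Gamma> \<and>
          \<tau> \<in> Aut2_A1 l1 l2 \<Gamma> \<and> u \<in> salg_carrier l1 \<Gamma> \<and> v \<in> vecs (l1 + l2)}"

text \<open>
  \<open>(-\<partial>)\<^sup>\<mu>\<close>. Here \<open>*\<close> is the commutative product of polynomials in the \<open>\<partial>\<^sub>p\<close>, which is the product
  of \<open>F[D]\<close>.
\<close>

definition neg_dpow :: "mindex \<Rightarrow> 'f::field weyl" where
  "neg_dpow \<mu> = (\<Prod>p\<in>supp \<mu>. (- wd p) ^ coef \<mu> p)"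

definition sigma1 :: "nat \<Rightarrow> nat \<Rightarrow> 'f::field fvec set \<Rightarrow> 'f weyl \<Rightarrow> 'f weyl" where
  "sigma1 l1 l2 \<Gamma> = (\<lambda>w\<in>weyl_carrier l1 l2 \<Gamma>.
     \<Sum>\<mu>\<in>supp w. \<Sum>(\<alpha>, i)\<in>supp (coef w \<mu>).
       wscale (coef (coef w \<mu>) (\<alpha>, i)) (- weyl_mult (neg_dpow \<mu>) (emb (xmono \<alpha> i))))"

section \<open>Semidirect products\<close>

definition semidirect ::
  "('a, 'c) monoid_scheme \<Rightarrow> ('b, 'd) monoid_scheme \<Rightarrow> ('b \<Rightarrow> 'a \<Rightarrow> 'a) \<Rightarrow> ('a \<times> 'b) monoid" where
  "semidirect N H \<theta> = \<lparr>carrier = carrier N \<times> carrier H,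
     monoid.mult = (\<lambda>(n, h) (n', h'). (n \<otimes>\<^bsub>N\<^esub> \<theta> h n', h \<otimes>\<^bsub>H\<^esub> h')),
     one = (\<one>\<^bsub>N\<^esub>, \<one>\<^bsub>H\<^esub>)\<rparr>"

definition conj_action :: "('a, 'b) monoid_scheme \<Rightarrow> 'a set \<Rightarrow> 'a \<Rightarrow> 'a \<Rightarrow> 'a" where
  "conj_action G N h = (\<lambda>n\<in>N. h \<otimes>\<^bsub>G\<^esub> n \<otimes>\<^bsub>G\<^esub> inv\<^bsub>G\<^esub> h)"

end

theory Submission
  imports Defs
begin

text \<open>
  A Lie automorphism \<open>\<phi>\<close> carries \<open>A\<close>, the set of locally ad-nilpotent elements, to itself, and it sends
  \<open>1\<close>, which spans the center, to a scalar \<open>c\<close>. It sends each \<open>x\<^sup>\<alpha>\<close> to a scalar multiple of some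
  \<open>x\<^sup>\<beta>\<close>, because products of the images of common eigenvectors are again images of eigenvectors, so that
  the image of \<open>x\<^sup>\<alpha>\<close> is a unit of \<open>A\<close>; and it sends \<open>\<partial>\<^sub>p\<close> to a combination of the \<open>\<partial>\<^sub>q\<close> plus an
  element of \<open>A\<close>. Composing with some \<open>\<sigma>\<^sub>\<tau>\<close> makes \<open>\<phi>\<close> fix every \<open>\<partial>\<^sub>p\<close> modulo \<open>A\<close>. The corrections in
  \<open>A\<close> form a closed family, and closed families are exact up to constants along the last \<open>l2\<close>
  directions, so some \<open>\<sigma>\<^sub>u \<sigma>\<^sub>v\<close> removes them. Now \<open>\<phi>\<close> fixes the \<open>\<partial>\<^sub>p\<close> and multiplies the \<open>x\<^sup>\<alpha>\<close> by \<open>c\<close>;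
  comparing brackets of \<open>x\<^sup>\<alpha> h\<^sup>2\<close> and \<open>x\<^bsup>-\<alpha>\<^esup> h\<^sup>2\<close> for a suitable \<open>h\<close> in \<open>D\<close> forces \<open>c = 1\<close> or
  \<open>c = -1\<close>, and \<open>\<phi>\<close> is the identity if \<open>c = 1\<close>. Associative automorphisms have \<open>c = 1\<close>, and composing
  with \<open>\<sigma>\<^sub>1\<close> changes the sign of \<open>c\<close>.
\<close>

section \<open>Multi-indices\<close>

text \<open>A Lie automorphism says nothing about products, so every use of the associative
  structure has to be recovered from brackets. Characteristic 0 enters through rational-valued
  additive weights on the exponents: they make \<open>A\<close> a domain whose units are monomials,
  and lowering the order by brackets with the \<open>tw q\<close> makes the whole algebra a domain.
  Without zero divisors a locally nilpotent derivation must kill units. Multiplicativity of the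
  factors in \<phi>(x^a) = f(a) x^(\<pi> a) fails by exactly c and is read off from the images of
  the x^a \<partial>_p. In the normalized case the elements x^a h only acquire a shift by (1 - c) /
  2, whatever c is; quadratic elements are the first to exclude other values of c. For c = 1,
  elements of nonzero weight are reached by integrating along a direction in which the weight does
  not vanish. Weight zero offers no such direction; it is reached as the first-order Taylor term of
  a conjugation by x^a, extended from a in \<Gamma> to all vectors by linearity.\<close>

lemma coef_unit_index [simp]: "coef (unit_index p) q = (if q = p then 1 else 0)"
  by (simp add: unit_index_def lookup_single when_def)

lemma unit_index_neq_0 [simp]: "unit_index p \<noteq> 0"
  by (metis add.commute add_0 coef_unit_index lookup_zero zero_neq_one)

lemma unit_index_in [simp]: "unit_index p \<in> multi_indices n \<longleftrightarrow> p < n"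
  by (simp add: multi_indices_def unit_index_def)

lemma zero_in_multi_indices [simp]: "0 \<in> multi_indices n"
  by (simp add: multi_indices_def)

lemma multi_indices_iff: "i \<in> multi_indices n \<longleftrightarrow> (\<forall>p\<ge>n. coef i p = 0)"
  unfolding multi_indices_def by (auto simp: in_keys_iff subset_iff) (metis leI less_numeral_extra(3))

lemma add_in_multi_indices [simp]:
  "i + j \<in> multi_indices n \<longleftrightarrow> i \<in> multi_indices n \<and> j \<in> multi_indices n"
  by (auto simp: multi_indices_iff lookup_add)

lemma diff_in_multi_indices [simp]: "i \<in> multi_indices n \<Longrightarrow> i - j \<in> multi_indices n"
  by (auto simp: multi_indices_iff lookup_minus)

lemma diff_unit_index_add: "0 < coef i p \<Longrightarrow> i - unit_index p + unit_index p = i"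
  by (rule poly_mapping_eqI) (auto simp: lookup_add lookup_minus)

definition mdeg :: "mindex \<Rightarrow> nat" where
  "mdeg i = (\<Sum>p\<in>supp i. coef i p)"

lemma mdeg_add [simp]: "mdeg (i + j) = mdeg i + mdeg j"
  unfolding mdeg_def by (rule setsum_keys_plus_distrib) auto

lemma mdeg_zero [simp]: "mdeg 0 = 0"
  by (simp add: mdeg_def)

lemma mdeg_unit_index [simp]: "mdeg (unit_index p) = 1"
  by (simp add: mdeg_def unit_index_def)

lemma mdeg_eq_0_iff [simp]: "mdeg i = 0 \<longleftrightarrow> i = 0"
  unfolding mdeg_def by (auto simp: in_keys_iff intro!: poly_mapping_eqI)

lemma mindex_cases:
  obtains "i = (0::mindex)" | j p where "i = j + unit_index p"
proof (cases "i = 0")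
  case False
  then obtain p where "0 < coef i p"
    by (metis gr0I lookup_zero poly_mapping_eqI)
  then show ?thesis
    using that(2) diff_unit_index_add by metis
qed (use that in blast)

lemma mindex_induct [case_names zero add_unit]:
  assumes "P (0::mindex)" "\<And>i p. P i \<Longrightarrow> P (i + unit_index p)"
  shows "P i"
proof (induction "mdeg i" arbitrary: i rule: less_induct)
  case less
  then show ?case
    using assms by (cases i rule: mindex_cases) auto
qed

lemma multi_indices_induct [consumes 1, case_names zero add_unit]:
  assumes "i \<in> multi_indices n" "P 0"
    "\<And>i p. i \<in> multi_indices n \<Longrightarrow> p < n \<Longrightarrow> P i \<Longrightarrow> P (i + unit_index p)"
  shows "P i"
  using assms(1) by (induction i rule: mindex_induct) (use assms in auto)

lemma poly_mapping_induct [case_names zero single add]: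
  assumes "P 0" "\<And>k c. P (Poly_Mapping.single k c)" "\<And>f g. P f \<Longrightarrow> P g \<Longrightarrow> P (f + g)"
  shows "P (f :: 'k \<Rightarrow>\<^sub>0 'v::comm_monoid_add)"
proof -
  have "f = (\<Sum>k\<in>supp f. Poly_Mapping.single k (coef f k))"
    by (rule poly_mapping_eqI) (auto simp: lookup_sum lookup_single when_def in_keys_iff)
  moreover have "P (\<Sum>k\<in>S. Poly_Mapping.single k (coef f k))" if "finite S" for S
    using that by induction (use assms in auto)
  ultimately show ?thesis
    by (metis finite_keys)
qed

section \<open>The derivations\<close>

lemma scale_eq_mult: "scale c u = Poly_Mapping.single 0 c * (u :: 'f::field salg)"
  by (simp add: scale_def mult_map_scale_conv_mult)

lemma scale_of_nat: "scale (of_nat n) u = of_nat n * (u :: 'f::field salg)"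
  by (simp add: scale_eq_mult)

text \<open>Reading the derivation coefficientwise reduces additivity, commutation and the later
  support arguments to identities in the field.\<close>

lemma coef_xderiv:
  "coef (xderiv p u) (\<alpha>, i) =
     coef \<alpha> p * coef u (\<alpha>, i) + of_nat (Suc (coef i p)) * coef u (\<alpha>, i + unit_index p)"
proof -
  let ?S = "insert (\<alpha>, i) (insert (\<alpha>, i + unit_index p) (supp u))"
  have ne: "i + unit_index p \<noteq> i"
    by (metis coef_unit_index lookup_add add_cancel_right_right zero_neq_one)
  have "coef (xderiv p u) (\<alpha>, i) = (\<Sum>(\<beta>, j)\<in>supp u. coef u (\<beta>, j) *
      (coef \<beta> p * (if (\<beta>, j) = (\<alpha>, i) then 1 else 0) +
       of_nat (coef j p) * (if \<beta> = \<alpha> \<and> j - unit_index p = i then 1 else 0)))"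
    unfolding xderiv_def
    by (auto simp: lookup_sum lookup_scale lookup_add xmono_def lookup_single when_def
        intro!: sum.cong split: prod.splits)
  also have "\<dots> = (\<Sum>(\<beta>, j)\<in>supp u.
      (if (\<beta>, j) = (\<alpha>, i) then coef \<alpha> p * coef u (\<alpha>, i) else 0) +
      (if (\<beta>, j) = (\<alpha>, i + unit_index p) then
         of_nat (Suc (coef i p)) * coef u (\<alpha>, i + unit_index p) else 0))"
  \<comment> \<open>Subtraction of multi-indices is truncated: if \<open>coef j p = 0\<close> then
    \<open>j - unit_index p\<close> is \<open>j\<close> itself, and the factor
    \<open>of_nat (coef j p)\<close> removes the spurious term. Otherwise \<open>j\<close> is
    recovered by adding \<open>unit_index p\<close> back.\<close>
  proof (intro sum.cong refl, clarify)
    fix \<beta> j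
    have *: "j = j - unit_index p + unit_index p" if "coef j p \<noteq> 0"
      using that diff_unit_index_add[of j p] by simp
    show "coef u (\<beta>, j) *
      (coef \<beta> p * (if (\<beta>, j) = (\<alpha>, i) then 1 else 0) +
       of_nat (coef j p) * (if \<beta> = \<alpha> \<and> j - unit_index p = i then 1 else 0)) =
      (if (\<beta>, j) = (\<alpha>, i) then coef \<alpha> p * coef u (\<alpha>, i) else 0) +
      (if (\<beta>, j) = (\<alpha>, i + unit_index p) then
         of_nat (Suc (coef i p)) * coef u (\<alpha>, i + unit_index p) else 0)"
      using ne * by (cases "coef j p = 0") (auto simp: lookup_add algebra_simps)
  qed
  also have "\<dots> = (\<Sum>k\<in>supp u. (if k = (\<alpha>, i) then coef \<alpha> p * coef u (\<alpha>, i) else 0)) +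
      (\<Sum>k\<in>supp u. (if k = (\<alpha>, i + unit_index p) then
         of_nat (Suc (coef i p)) * coef u (\<alpha>, i + unit_index p) else 0))"
    unfolding sum.distrib[symmetric] by (intro sum.cong) (simp_all only: split_paired_all prod.case)
  also have "\<dots> = coef \<alpha> p * coef u (\<alpha>, i) + of_nat (Suc (coef i p)) * coef u (\<alpha>, i + unit_index p)"
    by (simp only: sum.delta finite_keys) (auto simp: in_keys_iff)
  finally show ?thesis .
qed

lemma xderiv_add: "xderiv p (u + v) = xderiv p u + xderiv p v"
  by (rule poly_mapping_eqI) (auto simp: coef_xderiv lookup_add algebra_simps)

lemma xderiv_zero [simp]: "xderiv p 0 = 0"
  by (rule poly_mapping_eqI) (auto simp: coef_xderiv)

lemma xderiv_single:
  "xderiv p (Poly_Mapping.single (\<alpha>, i) c) = Poly_Mapping.single (\<alpha>, i) (coef \<alpha> p * c) +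
     Poly_Mapping.single (\<alpha>, i - unit_index p) (of_nat (coef i p) * c)"
proof (rule poly_mapping_eqI, clarify)
  fix \<beta> j
  have *: "i = i - unit_index p + unit_index p" if "coef i p \<noteq> 0"
    using that diff_unit_index_add[of i p] by simp
  show "coef (xderiv p (Poly_Mapping.single (\<alpha>, i) c)) (\<beta>, j) =
    coef (Poly_Mapping.single (\<alpha>, i) (coef \<alpha> p * c) +
     Poly_Mapping.single (\<alpha>, i - unit_index p) (of_nat (coef i p) * c)) (\<beta>, j)"
    using * by (cases "coef i p = 0")
      (auto simp: coef_xderiv lookup_add lookup_single when_def)
qed

lemma xderiv_commute: "xderiv p (xderiv q u) = xderiv q (xderiv p u)"
  by (rule poly_mapping_eqI, clarify, cases "p = q")
    (auto simp: coef_xderiv lookup_add algebra_simps)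

text \<open>Both sides are additive in each factor, so only a product of two monomials has to be
  checked; there the truncated exponents agree wherever their coefficient is nonzero.\<close>

lemma xderiv_mult: "xderiv p (u * v) = xderiv p u * v + u * xderiv p v"
proof (induction u rule: poly_mapping_induct)
  case (single k c)
  show ?case
  proof (induction v rule: poly_mapping_induct)
    case (single l d)
    obtain \<alpha> i where k: "k = (\<alpha>, i)" by fastforce
    obtain \<beta> j where l: "l = (\<beta>, j)" by fastforce
    have 1: "Poly_Mapping.single (\<alpha> + \<beta>, i + j - unit_index p) (of_nat (coef i p) * (c * d)) =
        Poly_Mapping.single (\<alpha> + \<beta>, i - unit_index p + j) (of_nat (coef i p) * (c * d))"
    proof (cases "coef i p = 0")
      case False
      then have "i + j - unit_index p = i - unit_index p + j"
        by (intro poly_mapping_eqI) (auto simp: lookup_add lookup_minus)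
      then show ?thesis by simp
    qed auto
    have 2: "Poly_Mapping.single (\<alpha> + \<beta>, i + j - unit_index p) (of_nat (coef j p) * (c * d)) =
        Poly_Mapping.single (\<alpha> + \<beta>, i + (j - unit_index p)) (of_nat (coef j p) * (c * d))"
    proof (cases "coef j p = 0")
      case False
      then have "i + j - unit_index p = i + (j - unit_index p)"
        by (intro poly_mapping_eqI) (auto simp: lookup_add lookup_minus)
      then show ?thesis by simp
    qed auto
    show ?case
      using 1 2 by (simp add: k l mult_single xderiv_single lookup_add distrib_right distrib_left
          single_add mult.assoc mult.left_commute)
  qed (auto simp: xderiv_add algebra_simps)
qed (auto simp: xderiv_add algebra_simps)

lemma xderiv_one [simp]: "xderiv p 1 = 0"
  using xderiv_mult[of p 1 1] by simp

lemma xderiv_of_nat [simp]: "xderiv p (of_nat n) = 0"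
  by (induction n) (auto simp: xderiv_add)

lemma xderiv_uminus: "xderiv p (- u) = - xderiv p u"
  by (metis add.right_inverse add_eq_0_iff xderiv_add xderiv_zero)

lemma xderiv_diff: "xderiv p (u - v) = xderiv p u - xderiv p v"
  by (metis diff_conv_add_uminus xderiv_add xderiv_uminus)

lemma xderiv_sum: "xderiv p (sum f S) = (\<Sum>x\<in>S. xderiv p (f x))"
  by (induction S rule: infinite_finite_induct) (auto simp: xderiv_add)

lemma xderiv_const [simp]: "xderiv p (Poly_Mapping.single 0 c) = 0"
  by (simp add: zero_prod_def xderiv_single)

text \<open>The recursion pattern of \<open>xderiv_pow\<close> for arbitrary operators, so that one
  set of lemmas serves both the iterated derivations and the later products of ring
  elements.\<close>

definition mindex_iterate :: "(nat \<Rightarrow> 'a \<Rightarrow> 'a) \<Rightarrow> mindex \<Rightarrow> 'a \<Rightarrow> 'a" where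
  "mindex_iterate F \<kappa> = foldr (\<lambda>p g. (F p ^^ coef \<kappa> p) \<circ> g) (sorted_list_of_set (supp \<kappa>)) id"

lemma foldr_iterate_add_unit:
  assumes "distinct xs" and F: "\<And>p q u. F p (F q u) = F q (F p u)"
  shows "foldr (\<lambda>p g. (F p ^^ coef (\<kappa> + unit_index q) p) \<circ> g) xs id u =
    (if q \<in> set xs then F q (foldr (\<lambda>p g. (F p ^^ coef \<kappa> p) \<circ> g) xs id u)
     else foldr (\<lambda>p g. (F p ^^ coef \<kappa> p) \<circ> g) xs id u)"
proof -
  define G where "G \<kappa> xs = foldr (\<lambda>p g. (F p ^^ coef \<kappa> p) \<circ> g) xs id u" for \<kappa> xs
  have G: "G \<kappa> [] = u" "G \<kappa> (p # xs) = (F p ^^ coef \<kappa> p) (G \<kappa> xs)" for \<kappa> p xs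
    by (simp_all add: G_def)
  have comm: "F q ((F p ^^ n) v) = (F p ^^ n) (F q v)" for n p v
    by (induction n arbitrary: v) (auto simp: F[of q p])
  have "G (\<kappa> + unit_index q) xs = (if q \<in> set xs then F q (G \<kappa> xs) else G \<kappa> xs)"
    using assms(1) by (induction xs) (auto simp: G lookup_add comm)
  then show ?thesis by (simp only: G_def)
qed

text \<open>Indices with exponent 0 contribute the identity. Two multi-indices with different
  supports can therefore be compared along one common list.\<close>

lemma mindex_iterate_supset:
  assumes "finite S" "supp \<kappa> \<subseteq> S"
  shows "mindex_iterate F \<kappa> = foldr (\<lambda>p g. (F p ^^ coef \<kappa> p) \<circ> g) (sorted_list_of_set S) id"
proof -
  have filt: "foldr (\<lambda>p g. (F p ^^ coef \<kappa> p) \<circ> g) xs id =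
      foldr (\<lambda>p g. (F p ^^ coef \<kappa> p) \<circ> g) (filter (\<lambda>p. p \<in> supp \<kappa>) xs) id" for xs
    by (induction xs) (auto simp: in_keys_iff)
  have "filter (\<lambda>p. p \<in> supp \<kappa>) (sorted_list_of_set S) = sorted_list_of_set (supp \<kappa>)"
    using assms by (intro sorted_distinct_set_unique) (auto intro: sorted_wrt_filter)
  then show ?thesis
    by (simp add: mindex_iterate_def filt[of "sorted_list_of_set S"])
qed

lemma mindex_iterate_add_unit:
  assumes "\<And>p q u. F p (F q u) = F q (F p u)"
  shows "mindex_iterate F (\<kappa> + unit_index q) u = F q (mindex_iterate F \<kappa> u)"
proof -
  let ?S = "insert q (supp \<kappa>)"
  have "supp (\<kappa> + unit_index q) \<subseteq> ?S"
    using Poly_Mapping.keys_add[of \<kappa> "unit_index q"] by (auto simp: unit_index_def)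
  then show ?thesis
    by (subst (1 2) mindex_iterate_supset[of ?S])
      (auto simp del: sorted_list_of_set_insert_remove simp: foldr_iterate_add_unit assms)
qed

lemma mindex_iterate_zero [simp]: "mindex_iterate F 0 u = u"
  by (simp add: mindex_iterate_def)

lemma xderiv_pow_add_unit:
  fixes u :: "'f::field salg"
  shows "xderiv_pow (\<kappa> + unit_index q) u = xderiv q (xderiv_pow \<kappa> u)"
proof -
  have eq: "xderiv_pow \<mu> u = mindex_iterate xderiv \<mu> u" for \<mu>
    by (simp add: mindex_iterate_def xderiv_pow_def)
  show ?thesis
    unfolding eq by (rule mindex_iterate_add_unit) (rule xderiv_commute)
qed

lemma xderiv_pow_unit_add: "xderiv_pow (unit_index q + \<kappa>) u = xderiv q (xderiv_pow \<kappa> u)"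
  by (simp add: add.commute xderiv_pow_add_unit)

lemma xderiv_pow_zero [simp]: "xderiv_pow 0 u = u"
  by (simp add: xderiv_pow_def)

lemma xderiv_pow_unit_index [simp]: "xderiv_pow (unit_index q) u = xderiv q u"
  using xderiv_pow_add_unit[of 0 q u] by simp

lemma xderiv_pow_add: "xderiv_pow \<mu> (u + v) = xderiv_pow \<mu> u + xderiv_pow \<mu> v"
  by (induction \<mu> rule: mindex_induct) (auto simp: xderiv_pow_add_unit xderiv_add)

lemma xderiv_pow_0 [simp]: "xderiv_pow \<mu> 0 = 0"
  by (induction \<mu> rule: mindex_induct) (auto simp: xderiv_pow_add_unit)

lemma xderiv_xderiv_pow: "xderiv p (xderiv_pow \<mu> u) = xderiv_pow \<mu> (xderiv p u)"
  by (induction \<mu> rule: mindex_induct) (auto simp: xderiv_pow_add_unit xderiv_commute[of p])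

lemma xderiv_pow_plus: "xderiv_pow (\<mu> + \<nu>) u = xderiv_pow \<mu> (xderiv_pow \<nu> u)"
  by (induction \<nu> rule: mindex_induct)
    (auto simp: xderiv_pow_add_unit xderiv_xderiv_pow add.assoc[symmetric])

subsection \<open>Leibniz formula\<close>

definition below :: "mindex \<Rightarrow> mindex set" where
  "below \<mu> = {\<kappa>. \<forall>p. coef \<kappa> p \<le> coef \<mu> p}"

lemma below_zero [simp]: "below 0 = {0}"
  by (auto simp: below_def intro!: poly_mapping_eqI)

text \<open>An index below \<mu> + 1_q but not below \<mu> can violate the bound only at
  \<open>q\<close>, so it is positive there and can be lowered.\<close>

lemma below_add_unit: "below (\<mu> + unit_index q) = below \<mu> \<union> (\<lambda>\<kappa>. \<kappa> + unit_index q) ` below \<mu>"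
proof (intro equalityI subsetI)
  fix \<kappa> assume k: "\<kappa> \<in> below (\<mu> + unit_index q)"
  show "\<kappa> \<in> below \<mu> \<union> (\<lambda>\<kappa>. \<kappa> + unit_index q) ` below \<mu>"
  proof (cases "\<kappa> \<in> below \<mu>")
    case False
    then obtain p where p: "\<not> coef \<kappa> p \<le> coef \<mu> p" by (auto simp: below_def)
    have le: "coef \<kappa> r \<le> coef \<mu> r + (if r = q then 1 else 0)" for r
      using k by (simp add: below_def lookup_add)
    have "p = q" using p le[of p] by (cases "p = q") auto
    then have "0 < coef \<kappa> q" using p by simp
    then have "\<kappa> = (\<kappa> - unit_index q) + unit_index q" by (simp add: diff_unit_index_add)
    moreover have "coef \<kappa> r - (if r = q then 1 else 0) \<le> coef \<mu> r" for r
      using le[of r] by (cases "r = q") auto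
    then have "\<kappa> - unit_index q \<in> below \<mu>"
      by (simp add: below_def lookup_minus)
    ultimately show ?thesis by blast
  qed auto
next
  fix \<kappa> assume "\<kappa> \<in> below \<mu> \<union> (\<lambda>\<kappa>. \<kappa> + unit_index q) ` below \<mu>"
  then obtain \<nu> where "\<nu> \<in> below \<mu>" "\<kappa> = \<nu> \<or> \<kappa> = \<nu> + unit_index q" by blast
  then show "\<kappa> \<in> below (\<mu> + unit_index q)"
    by (auto simp: below_def lookup_add le_SucI)
qed

lemma finite_below [simp]: "finite (below \<mu>)"
  by (induction \<mu> rule: mindex_induct) (auto simp: below_add_unit)

lemma mbinom_supset:
  assumes "finite S" "supp \<kappa> \<subseteq> S"
  shows "mbinom \<mu> \<kappa> = (\<Prod>p\<in>S. coef \<mu> p choose coef \<kappa> p)"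
  unfolding mbinom_def using assms by (intro prod.mono_neutral_left) (auto simp: in_keys_iff)

lemma mbinom_eq_0:
  assumes "\<kappa> \<notin> below \<mu>"
  shows "mbinom \<mu> \<kappa> = 0"
proof -
  obtain p where "\<not> coef \<kappa> p \<le> coef \<mu> p" using assms by (auto simp: below_def)
  then have "p \<in> supp \<kappa>" "coef \<mu> p choose coef \<kappa> p = 0" by (auto simp: in_keys_iff)
  then show ?thesis by (auto simp: mbinom_def)
qed

lemma mbinom_0_right [simp]: "mbinom \<mu> 0 = 1"
  by (simp add: mbinom_def)

text \<open>Pascal's rule in the coordinate \<open>q\<close>; the factors at the other coordinates
  form the common product \<open>?R\<close>.\<close>

lemma mbinom_add_unit:
  "mbinom (\<mu> + unit_index q) \<kappa> =
     mbinom \<mu> \<kappa> + (if 0 < coef \<kappa> q then mbinom \<mu> (\<kappa> - unit_index q) else 0)"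
proof -
  let ?S = "insert q (supp \<kappa>)" and ?R = "\<Prod>p\<in>supp \<kappa> - {q}. coef \<mu> p choose coef \<kappa> p"
  have S: "finite ?S" "supp \<kappa> \<subseteq> ?S" by auto
  have S': "supp (\<kappa> - unit_index q) \<subseteq> ?S" by (auto simp: in_keys_iff lookup_minus)
  have 1: "mbinom \<mu> \<kappa> = (coef \<mu> q choose coef \<kappa> q) * ?R"
    by (subst mbinom_supset[OF S]) (simp add: prod.insert_remove)
  have 2: "mbinom (\<mu> + unit_index q) \<kappa> = (Suc (coef \<mu> q) choose coef \<kappa> q) * ?R"
    by (subst mbinom_supset[OF S]) (auto simp: prod.insert_remove lookup_add intro!: prod.cong)
  have 3: "mbinom \<mu> (\<kappa> - unit_index q) = (coef \<mu> q choose (coef \<kappa> q - 1)) * ?R"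
    by (subst mbinom_supset[OF S(1) S'])
      (auto simp: prod.insert_remove lookup_minus intro!: prod.cong)
  show ?thesis
    by (cases "coef \<kappa> q") (auto simp: 1 2 3 algebra_simps)
qed

text \<open>The Leibniz formula, one derivative at a time: differentiating the left factor raises
  \<kappa>, differentiating the right one does not, and Pascal's rule adds the two
  contributions.\<close>

lemma xderiv_pow_mult:
  "xderiv_pow \<mu> (u * v) =
     (\<Sum>\<kappa>\<in>below \<mu>. of_nat (mbinom \<mu> \<kappa>) * (xderiv_pow \<kappa> u * xderiv_pow (\<mu> - \<kappa>) v))"
proof (induction \<mu> rule: mindex_induct)
  case (add_unit \<mu> q)
  let ?F = "\<lambda>\<kappa>. xderiv_pow \<kappa> u * xderiv_pow (\<mu> + unit_index q - \<kappa>) v"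
  let ?B = "below (\<mu> + unit_index q)"
  have shift: "\<mu> + unit_index q - \<kappa> = \<mu> - \<kappa> + unit_index q" if "\<kappa> \<in> below \<mu>" for \<kappa>
    using that by (intro poly_mapping_eqI) (auto simp: below_def lookup_add lookup_minus Suc_diff_le)
  have cancel: "\<mu> + unit_index q - (\<kappa> + unit_index q) = \<mu> - \<kappa>" for \<kappa>
    by (intro poly_mapping_eqI) (auto simp: lookup_add lookup_minus)
  have "(\<Sum>\<kappa>\<in>?B. of_nat (mbinom (\<mu> + unit_index q) \<kappa>) * ?F \<kappa>) =
      (\<Sum>\<kappa>\<in>?B. of_nat (mbinom \<mu> \<kappa>) * ?F \<kappa>) +
      (\<Sum>\<kappa>\<in>?B. if 0 < coef \<kappa> q then of_nat (mbinom \<mu> (\<kappa> - unit_index q)) * ?F \<kappa> else 0)"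
    unfolding sum.distrib[symmetric]
    by (intro sum.cong) (auto simp: mbinom_add_unit algebra_simps)
  also have "(\<Sum>\<kappa>\<in>?B. of_nat (mbinom \<mu> \<kappa>) * ?F \<kappa>) = (\<Sum>\<kappa>\<in>below \<mu>. of_nat (mbinom \<mu> \<kappa>) * ?F \<kappa>)"
    by (intro sum.mono_neutral_right) (auto simp: below_add_unit mbinom_eq_0)
  \<comment> \<open>The sum is reduced to the indices of the form \<kappa> + 1_q with \<kappa> below
    \<mu>; elsewhere in \<open>?B\<close> either the condition fails or the lowered index is not
    below \<mu> and its binomial vanishes.\<close>
  also have "(\<Sum>\<kappa>\<in>?B. if 0 < coef \<kappa> q then of_nat (mbinom \<mu> (\<kappa> - unit_index q)) * ?F \<kappa> else 0) =
      (\<Sum>\<kappa>\<in>(\<lambda>\<kappa>. \<kappa> + unit_index q) ` below \<mu>.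
         of_nat (mbinom \<mu> (\<kappa> - unit_index q)) * ?F \<kappa>)"
  proof (rule sum.mono_neutral_cong_right)
    show "\<forall>\<kappa>\<in>?B - (\<lambda>\<kappa>. \<kappa> + unit_index q) ` below \<mu>.
      (if 0 < coef \<kappa> q then of_nat (mbinom \<mu> (\<kappa> - unit_index q)) * ?F \<kappa> else 0) = 0"
    proof clarify
      fix \<kappa> assume "\<kappa> \<notin> (\<lambda>\<kappa>. \<kappa> + unit_index q) ` below \<mu>"
      then have "\<kappa> - unit_index q \<notin> below \<mu>" if "0 < coef \<kappa> q"
        using that diff_unit_index_add[of \<kappa> q] by force
      then show "(if 0 < coef \<kappa> q then of_nat (mbinom \<mu> (\<kappa> - unit_index q)) * ?F \<kappa> else 0) = 0"
        by (simp add: mbinom_eq_0)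
    qed
  qed (auto simp: below_add_unit lookup_add)
  also have "\<dots> = (\<Sum>\<kappa>\<in>below \<mu>. of_nat (mbinom \<mu> \<kappa>) * ?F (\<kappa> + unit_index q))"
    by (subst sum.reindex) (auto simp: inj_on_def)
  also have "(\<Sum>\<kappa>\<in>below \<mu>. of_nat (mbinom \<mu> \<kappa>) * ?F \<kappa>) +
      (\<Sum>\<kappa>\<in>below \<mu>. of_nat (mbinom \<mu> \<kappa>) * ?F (\<kappa> + unit_index q)) =
      xderiv_pow (\<mu> + unit_index q) (u * v)"
    unfolding xderiv_pow_add_unit add_unit xderiv_sum sum.distrib[symmetric]
    by (intro sum.cong refl)
      (simp add: xderiv_mult shift cancel xderiv_pow_add_unit xderiv_pow_unit_add distrib_left
        add.commute)
  finally show ?case by (rule sym)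
qed auto

section \<open>The algebra as an algebra of operators\<close>

text \<open>The differential operator that \<open>w\<close> denotes. Products become compositions
  and the action is faithful in characteristic 0, so identities of the Weyl algebra can be checked
  on operators.\<close>

definition weyl_op :: "'f::field weyl \<Rightarrow> 'f salg \<Rightarrow> 'f salg" where
  "weyl_op w v = (\<Sum>\<mu>\<in>supp w. coef w \<mu> * xderiv_pow \<mu> v)"

lemma weyl_op_add: "weyl_op (a + b) v = weyl_op a v + weyl_op b v"
  unfolding weyl_op_def by (rule setsum_keys_plus_distrib) (auto simp: distrib_right)

lemma weyl_op_zero [simp]: "weyl_op 0 v = 0"
  by (simp add: weyl_op_def)

lemma weyl_op_single [simp]: "weyl_op (Poly_Mapping.single \<mu> u) v = u * xderiv_pow \<mu> v"
  by (cases "u = 0") (auto simp: weyl_op_def)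

lemma weyl_op_sum: "weyl_op (sum f S) v = (\<Sum>x\<in>S. weyl_op (f x) v)"
  by (induction S rule: infinite_finite_induct) (auto simp: weyl_op_add)

lemma weyl_op_add_right: "weyl_op w (u + v) = weyl_op w u + weyl_op w v"
  by (simp add: weyl_op_def xderiv_pow_add distrib_left sum.distrib)

lemma weyl_op_0_right [simp]: "weyl_op w 0 = 0"
  by (simp add: weyl_op_def)

lemma weyl_mult_add_left: "weyl_mult (a + a') b = weyl_mult a b + weyl_mult a' b"
proof -
  define f where "f \<mu> u = (\<Sum>\<nu>\<in>supp b. \<Sum>\<kappa>\<in>{\<kappa>. \<forall>p. coef \<kappa> p \<le> coef \<mu> p}.
     Poly_Mapping.single (\<mu> + \<nu> - \<kappa>)
       (scale (of_nat (mbinom \<mu> \<kappa>)) (u * xderiv_pow \<kappa> (coef b \<nu>))))" for \<mu> u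
  have "f \<mu> 0 = 0" "f \<mu> (u + v) = f \<mu> u + f \<mu> v" for \<mu> u v
    unfolding f_def
    by (auto simp: scale_eq_mult distrib_right distrib_left single_add sum.distrib)
  then have "(\<Sum>\<mu>\<in>supp (a + a'). f \<mu> (coef (a + a') \<mu>)) =
      (\<Sum>\<mu>\<in>supp a. f \<mu> (coef a \<mu>)) + (\<Sum>\<mu>\<in>supp a'. f \<mu> (coef a' \<mu>))"
    by (intro setsum_keys_plus_distrib)
  then show ?thesis by (simp add: weyl_mult_def f_def)
qed

lemma weyl_mult_add_right: "weyl_mult a (b + b') = weyl_mult a b + weyl_mult a b'"
proof -
  define f where "f \<mu> \<nu> v = (\<Sum>\<kappa>\<in>{\<kappa>. \<forall>p. coef \<kappa> p \<le> coef \<mu> p}.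
     Poly_Mapping.single (\<mu> + \<nu> - \<kappa>)
       (scale (of_nat (mbinom \<mu> \<kappa>)) (coef a \<mu> * xderiv_pow \<kappa> v)))" for \<mu> \<nu> v
  have "f \<mu> \<nu> 0 = 0" "f \<mu> \<nu> (u + v) = f \<mu> \<nu> u + f \<mu> \<nu> v" for \<mu> \<nu> u v
    unfolding f_def
    by (auto simp: xderiv_pow_add scale_eq_mult distrib_left single_add sum.distrib)
  then have "(\<Sum>\<nu>\<in>supp (b + b'). f \<mu> \<nu> (coef (b + b') \<nu>)) =
      (\<Sum>\<nu>\<in>supp b. f \<mu> \<nu> (coef b \<nu>)) + (\<Sum>\<nu>\<in>supp b'. f \<mu> \<nu> (coef b' \<nu>))" for \<mu>
    by (intro setsum_keys_plus_distrib)
  then show ?thesis by (simp add: weyl_mult_def f_def sum.distrib)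
qed

lemma weyl_mult_zero [simp]: "weyl_mult 0 b = 0" "weyl_mult a 0 = 0"
  by (simp_all add: weyl_mult_def)

lemma weyl_mult_single:
  "weyl_mult (Poly_Mapping.single \<mu> u) (Poly_Mapping.single \<nu> v) =
     (\<Sum>\<kappa>\<in>below \<mu>. Poly_Mapping.single (\<mu> + \<nu> - \<kappa>)
       (of_nat (mbinom \<mu> \<kappa>) * (u * xderiv_pow \<kappa> v)))"
  by (cases "u = 0"; cases "v = 0") (auto simp: weyl_mult_def below_def scale_of_nat)

text \<open>On monomials this is the Leibniz formula for \<partial>^\<mu> applied to v times
  \<partial>^\<nu> z; the summation in \<open>weyl_mult\<close> is that formula with z left
  out.\<close>

lemma weyl_op_mult: "weyl_op (weyl_mult a b) z = weyl_op a (weyl_op b z)"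
proof (induction a rule: poly_mapping_induct)
  case (single \<mu> u)
  show ?case
  proof (induction b rule: poly_mapping_induct)
    case (single \<nu> v)
    have *: "\<mu> + \<nu> - \<kappa> = \<mu> - \<kappa> + \<nu>" if "\<kappa> \<in> below \<mu>" for \<kappa>
      using that by (intro poly_mapping_eqI) (auto simp: below_def lookup_add lookup_minus)
    show ?case
      by (simp add: weyl_mult_single weyl_op_sum xderiv_pow_mult sum_distrib_left * xderiv_pow_plus
          mult.assoc mult.left_commute cong: sum.cong)
  qed (auto simp: weyl_mult_add_right weyl_op_add weyl_op_add_right)
qed (auto simp: weyl_mult_add_left weyl_op_add)

text \<open>Formal differentiation with respect to the symbol \<partial>_q. As an operator it is the
  commutator with multiplication by t_q, which makes it a way to lower the order.\<close>

definition symbol_deriv :: "nat \<Rightarrow> 'f::field weyl \<Rightarrow> 'f weyl" where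
  "symbol_deriv q w =
     (\<Sum>\<mu>\<in>supp w. Poly_Mapping.single (\<mu> - unit_index q) (of_nat (coef \<mu> q) * coef w \<mu>))"

lemma coef_symbol_deriv:
  "coef (symbol_deriv q w) \<mu> = of_nat (Suc (coef \<mu> q)) * coef w (\<mu> + unit_index q)"
proof -
  have "coef (symbol_deriv q w) \<mu> =
      (\<Sum>\<nu>\<in>supp w. if \<nu> - unit_index q = \<mu> then of_nat (coef \<nu> q) * coef w \<nu> else 0)"
    by (auto simp: symbol_deriv_def lookup_sum lookup_single when_def intro!: sum.cong)
  also have "\<dots> = (\<Sum>\<nu>\<in>supp w. if \<nu> = \<mu> + unit_index q then
      of_nat (Suc (coef \<mu> q)) * coef w (\<mu> + unit_index q) else 0)"
  proof (intro sum.cong refl)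
    fix \<nu>
    have "\<nu> = \<nu> - unit_index q + unit_index q" if "coef \<nu> q \<noteq> 0"
      using that diff_unit_index_add[of \<nu> q] by simp
    then show "(if \<nu> - unit_index q = \<mu> then of_nat (coef \<nu> q) * coef w \<nu> else 0) =
      (if \<nu> = \<mu> + unit_index q then of_nat (Suc (coef \<mu> q)) * coef w (\<mu> + unit_index q) else 0)"
      by (cases "coef \<nu> q = 0") (auto simp: lookup_add)
  qed
  finally show ?thesis by (simp add: in_keys_iff)
qed

text \<open>The Leibniz expansion stops after two terms because the derivatives of t_q are
  constant.\<close>

lemma xderiv_pow_mult_t:
  fixes v :: "'f::field salg"
  shows "xderiv_pow \<mu> (xmono 0 (unit_index q) * v) = xmono 0 (unit_index q) * xderiv_pow \<mu> v +
     of_nat (coef \<mu> q) * xderiv_pow (\<mu> - unit_index q) v"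
proof (induction \<mu> rule: mindex_induct)
  case (add_unit \<mu> p)
  have t: "xderiv p (xmono 0 (unit_index q) :: 'f salg) = (if p = q then 1 else 0)"
    by (auto simp: xmono_def xderiv_single zero_prod_def[symmetric])
  show ?case
  proof (cases "p = q")
    case True
    have *: "of_nat (coef \<mu> q) * xderiv q (xderiv_pow (\<mu> - unit_index q) v) =
        of_nat (coef \<mu> q) * xderiv_pow \<mu> v"
      by (cases "coef \<mu> q = 0") (simp_all add: diff_unit_index_add flip: xderiv_pow_add_unit)
    have t': "xderiv q (xmono 0 (unit_index q) :: 'f salg) = 1" using t True by simp
    show ?thesis
      using True by (simp add: xderiv_pow_add_unit add_unit xderiv_add xderiv_mult t' lookup_add *
          distrib_right)
  next
    case False
    then have "\<mu> + unit_index p - unit_index q = \<mu> - unit_index q + unit_index p"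
      by (intro poly_mapping_eqI) (auto simp: lookup_add lookup_minus)
    then show ?thesis
      using False t by (auto simp: xderiv_pow_add_unit add_unit xderiv_add xderiv_mult lookup_add)
  qed
qed auto

lemma weyl_op_symbol_deriv:
  "weyl_op (symbol_deriv q w) v =
     weyl_op w (xmono 0 (unit_index q) * v) - xmono 0 (unit_index q) * weyl_op w v"
proof -
  have "weyl_op w (xmono 0 (unit_index q) * v) = xmono 0 (unit_index q) * weyl_op w v +
      (\<Sum>\<mu>\<in>supp w. of_nat (coef \<mu> q) * coef w \<mu> * xderiv_pow (\<mu> - unit_index q) v)"
    unfolding weyl_op_def xderiv_pow_mult_t sum_distrib_left sum.distrib[symmetric]
    by (intro sum.cong refl) (simp only: distrib_left mult.assoc mult.left_commute)
  then show ?thesis by (simp add: symbol_deriv_def weyl_op_sum)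
qed

text \<open>Induction on the order: the commutators of the zero operator with all t_q vanish, so by
  induction all symbol derivatives are 0, and in characteristic 0 only the coefficient of
  \<partial>^0 is left, which is the value at 1. Every t_q is available because the type carries all
  exponents, not only those of \<open>A\<close>.\<close>

lemma weyl_op_eq_0D:
  fixes w :: "'f::field_char_0 weyl"
  assumes "\<And>v. weyl_op w v = 0"
  shows "w = 0"
proof -
  have "w = 0" if "\<And>v. weyl_op w v = 0" "\<forall>\<mu>\<in>supp w. mdeg \<mu> \<le> n" for n and w :: "'f weyl"
    using that
  proof (induction n arbitrary: w)
    case 0
    then have "w = Poly_Mapping.single 0 (coef w 0)"
      by (intro poly_mapping_eqI) (auto simp: lookup_single when_def in_keys_iff)
    moreover from this have "coef w 0 = 0"
      using 0(1)[of 1] by (metis mult_1_right weyl_op_single xderiv_pow_zero)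
    ultimately show ?case by simp
  next
    case (Suc n)
    have sd: "symbol_deriv q w = 0" for q
    proof (rule Suc.IH)
      show "\<forall>\<mu>\<in>supp (symbol_deriv q w). mdeg \<mu> \<le> n"
      proof
        fix \<mu> assume "\<mu> \<in> supp (symbol_deriv q w)"
        then have "\<mu> + unit_index q \<in> supp w" by (auto simp: in_keys_iff coef_symbol_deriv)
        with Suc.prems(2) have "mdeg (\<mu> + unit_index q) \<le> Suc n" by (rule bspec)
        then show "mdeg \<mu> \<le> n" by simp
      qed
    qed (simp add: weyl_op_symbol_deriv Suc.prems(1))
    have nz: "of_nat (Suc m) * u = 0 \<longleftrightarrow> u = 0" for m and u :: "'f salg"
      by (simp only: scale_of_nat[symmetric] pm.scale_eq_0_iff of_nat_eq_0_iff nat.simps simp_thms)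
    have "coef w (\<mu> + unit_index q) = 0" for \<mu> q
      using arg_cong[OF sd[of q], of "\<lambda>w. coef w \<mu>"] by (simp add: coef_symbol_deriv nz del: of_nat_Suc)
    then have "coef w \<mu> = 0" if "\<mu> \<noteq> 0" for \<mu>
      using that by (cases \<mu> rule: mindex_cases) auto
    then have "w = Poly_Mapping.single 0 (coef w 0)"
      by (intro poly_mapping_eqI) (auto simp: lookup_single when_def)
    moreover from this have "coef w 0 = 0"
      using Suc.prems(1)[of 1] by (metis mult_1_right weyl_op_single xderiv_pow_zero)
    ultimately show ?case by simp
  qed
  moreover have "\<forall>\<mu>\<in>supp w. mdeg \<mu> \<le> Max (mdeg ` supp w)" by simp
  ultimately show ?thesis using assms by blast
qed

lemma weyl_op_uminus: "weyl_op (- a) v = - weyl_op a v"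
  by (metis add.right_inverse add_eq_0_iff weyl_op_add weyl_op_zero)

lemma weyl_eqI:
  fixes a b :: "'f::field_char_0 weyl"
  assumes "\<And>v. weyl_op a v = weyl_op b v"
  shows "a = b"
  using weyl_op_eq_0D[of "a - b"] assms
  by (metis add.right_inverse diff_conv_add_uminus eq_iff_diff_eq_0 weyl_op_add weyl_op_uminus)

text \<open>A copy of the type is made because \<open>*\<close> on \<open>'f weyl\<close> already
  denotes the commutative product. On the copy the Weyl product is the ring multiplication, and the
  general ring lemmas apply.\<close>

typedef (overloaded) 'f walg = "UNIV :: 'f::field_char_0 weyl set"
  morphisms rep_walg abs_walg ..

declare abs_walg_inverse [simplified, simp] rep_walg_inverse [simp]

lemma walg_eqI: "rep_walg a = rep_walg b \<Longrightarrow> a = b"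
  by (metis rep_walg_inverse)

instantiation walg :: (field_char_0) ring_1
begin

definition "0 = abs_walg 0"
definition "1 = abs_walg wone"
definition "a + b = abs_walg (rep_walg a + rep_walg b)"
definition "a - b = abs_walg (rep_walg a - rep_walg b)"
definition "- a = abs_walg (- rep_walg a)"
definition "a * b = abs_walg (weyl_mult (rep_walg a) (rep_walg b))"

lemma rep_walg_simps:
  "rep_walg 0 = 0" "rep_walg 1 = wone" "rep_walg (a + b) = rep_walg a + rep_walg b"
  "rep_walg (a - b) = rep_walg a - rep_walg b" "rep_walg (- a) = - rep_walg a"
  "rep_walg (a * b) = weyl_mult (rep_walg a) (rep_walg b)"
  unfolding zero_walg_def one_walg_def plus_walg_def minus_walg_def uminus_walg_def times_walg_def
  by (rule abs_walg_inverse[OF UNIV_I])+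

lemma weyl_op_wone [simp]: "weyl_op wone v = v"
  using weyl_op_single[of 0 1 v] by (simp add: wone_def emb_def xmono_def zero_prod_def[symmetric])

text \<open>Associativity and the unit laws are inherited from composition of operators by
  faithfulness.\<close>

instance
proof
  fix a b c :: "'a walg"
  show "a * b * c = a * (b * c)"
    by (rule walg_eqI, rule weyl_eqI, simp only: rep_walg_simps weyl_op_mult)
  show "1 * a = a"
    by (rule walg_eqI, rule weyl_eqI, simp only: rep_walg_simps weyl_op_mult weyl_op_wone)
  show "a * 1 = a"
    by (rule walg_eqI, rule weyl_eqI, simp only: rep_walg_simps weyl_op_mult weyl_op_wone)
  show "a + b + c = a + (b + c)"
    by (rule walg_eqI, simp only: rep_walg_simps add.assoc)
  show "a + b = b + a"
    by (rule walg_eqI, simp only: rep_walg_simps add.commute)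
  show "0 + a = a" "- a + a = 0" "a - b = a + - b"
    by (rule walg_eqI, simp only: rep_walg_simps add_0 left_minus diff_conv_add_uminus)+
  show "(a + b) * c = a * c + b * c" "a * (b + c) = a * b + a * c"
    by (rule walg_eqI, simp only: rep_walg_simps weyl_mult_add_left weyl_mult_add_right)+
  have "weyl_op (rep_walg (0 :: 'a walg)) 1 \<noteq> weyl_op (rep_walg (1 :: 'a walg)) 1"
    by (simp add: rep_walg_simps)
  then show "(0::'a walg) \<noteq> 1" by metis
qed

end


section \<open>Calculus in the Weyl algebra\<close>

definition walg_of :: "'f::field_char_0 salg \<Rightarrow> 'f walg" where
  "walg_of u = abs_walg (emb u)"

definition pd :: "nat \<Rightarrow> 'f::field_char_0 walg" where
  "pd p = abs_walg (wd p)"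

definition pd_pow :: "mindex \<Rightarrow> 'f::field_char_0 walg" where
  "pd_pow \<mu> = abs_walg (Poly_Mapping.single \<mu> 1)"

abbreviation cf :: "'f::field_char_0 walg \<Rightarrow> mindex \<Rightarrow> 'f salg" where
  "cf w \<equiv> coef (rep_walg w)"

abbreviation kst :: "'f::field_char_0 \<Rightarrow> 'f walg" where
  "kst c \<equiv> walg_of (Poly_Mapping.single 0 c)"

abbreviation xw :: "'f::field_char_0 fvec \<Rightarrow> 'f walg" where
  "xw \<alpha> \<equiv> walg_of (xmono \<alpha> 0)"

abbreviation tw :: "nat \<Rightarrow> 'f::field_char_0 walg" where
  "tw p \<equiv> walg_of (xmono 0 (unit_index p))"

definition br :: "'a::ring_1 \<Rightarrow> 'a \<Rightarrow> 'a" where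
  "br a b = a * b - b * a"

abbreviation walg_op :: "'f::field_char_0 walg \<Rightarrow> 'f salg \<Rightarrow> 'f salg" where
  "walg_op w \<equiv> weyl_op (rep_walg w)"

lemma abs_walg_inverse' [simp]: "rep_walg (abs_walg w) = w"
  by (rule abs_walg_inverse[OF UNIV_I])

lemma walg_op_eqI: "(\<And>v. walg_op a v = walg_op b v) \<Longrightarrow> a = b"
  by (intro walg_eqI weyl_eqI)

lemma weyl_op_diff: "weyl_op (a - b) v = weyl_op a v - weyl_op b v"
  by (simp add: diff_conv_add_uminus weyl_op_add weyl_op_uminus del: add_uminus_conv_diff)

lemma walg_op_simps [simp]:
  "walg_op 0 v = 0" "walg_op 1 v = v" "walg_op (a + b) v = walg_op a v + walg_op b v"
  "walg_op (a - b) v = walg_op a v - walg_op b v" "walg_op (- a) v = - walg_op a v"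
  "walg_op (a * b) v = walg_op a (walg_op b v)"
  by (simp_all add: rep_walg_simps weyl_op_add weyl_op_diff weyl_op_uminus weyl_op_mult)

lemma walg_op_walg_of [simp]: "walg_op (walg_of u) v = u * v"
  by (simp add: walg_of_def emb_def)

lemma walg_op_pd_pow [simp]: "walg_op (pd_pow \<mu>) v = xderiv_pow \<mu> v"
  by (simp add: pd_pow_def)

lemma xmono_0_0 [simp]: "xmono 0 0 = 1"
  by (simp add: xmono_def zero_prod_def[symmetric])

lemma walg_op_pd [simp]: "walg_op (pd p) v = xderiv p v"
  by (simp add: pd_def wd_def)

lemma walg_of_add: "walg_of (u + v) = walg_of u + walg_of v"
  by (rule walg_op_eqI) (simp add: distrib_right)

lemma walg_of_diff: "walg_of (u - v) = walg_of u - walg_of v"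
  by (rule walg_op_eqI) (simp add: left_diff_distrib)

lemma walg_of_uminus: "walg_of (- u) = - walg_of u"
  by (rule walg_op_eqI) simp

lemma walg_of_mult: "walg_of (u * v) = walg_of u * walg_of v"
  by (rule walg_op_eqI) (simp add: mult.assoc)

lemma walg_of_zero [simp]: "walg_of 0 = 0"
  by (rule walg_op_eqI) simp

lemma walg_of_one [simp]: "walg_of 1 = 1"
  by (rule walg_op_eqI) simp

lemma walg_of_sum: "walg_of (sum f S) = (\<Sum>x\<in>S. walg_of (f x))"
  by (induction S rule: infinite_finite_induct) (auto simp: walg_of_add)

lemma walg_of_of_nat [simp]: "walg_of (of_nat n) = of_nat n"
  by (induction n) (auto simp: walg_of_add)

lemma walg_of_commute: "walg_of u * walg_of v = walg_of v * walg_of u"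
  by (simp add: walg_of_mult[symmetric] mult.commute)

lemma cf_walg_of [simp]: "cf (walg_of u) \<mu> = (if \<mu> = 0 then u else 0)"
  by (simp add: walg_of_def emb_def lookup_single when_def)

lemma walg_of_eq_iff [simp]: "walg_of u = walg_of v \<longleftrightarrow> u = v"
  by (metis cf_walg_of)

lemma walg_of_eq_0_iff [simp]: "walg_of u = 0 \<longleftrightarrow> u = 0"
  by (metis walg_of_eq_iff walg_of_zero)

lemma pd_walg_of: "pd p * walg_of u = walg_of u * pd p + walg_of (xderiv p u)"
  by (rule walg_op_eqI) (simp add: xderiv_mult add.commute)

lemma pd_commute: "pd p * pd q = pd q * pd p"
  by (rule walg_op_eqI) (simp add: xderiv_commute)

lemma pd_pow_zero [simp]: "pd_pow 0 = 1"
  by (rule walg_op_eqI) simp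

lemma pd_pow_unit_index [simp]: "pd_pow (unit_index p) = pd p"
  by (rule walg_op_eqI) simp

lemma pd_pow_add: "pd_pow (\<mu> + \<nu>) = pd_pow \<mu> * pd_pow \<nu>"
  by (rule walg_op_eqI) (simp add: xderiv_pow_plus)

lemma pd_pow_commute: "pd_pow \<mu> * pd_pow \<nu> = pd_pow \<nu> * pd_pow \<mu>"
  by (simp add: pd_pow_add[symmetric] add.commute)

lemma cf_simps [simp]:
  "cf 0 \<mu> = 0" "cf (a + b) \<mu> = cf a \<mu> + cf b \<mu>" "cf (a - b) \<mu> = cf a \<mu> - cf b \<mu>"
  "cf (- a) \<mu> = - cf a \<mu>"
  by (simp_all add: rep_walg_simps lookup_add lookup_minus)

lemma cf_sum: "cf (sum f S) \<mu> = (\<Sum>x\<in>S. cf (f x) \<mu>)"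
  by (induction S rule: infinite_finite_induct) auto

lemma walg_of_mult_pd_pow: "walg_of u * pd_pow \<nu> = abs_walg (Poly_Mapping.single \<nu> u)"
  by (rule walg_op_eqI) simp

lemma cf_monomial: "cf (walg_of u * pd_pow \<nu>) \<mu> = (if \<mu> = \<nu> then u else 0)"
  by (simp add: walg_of_mult_pd_pow lookup_single when_def)

lemma walg_cf_eqI: "(\<And>\<mu>. cf a \<mu> = cf b \<mu>) \<Longrightarrow> a = b"
  by (rule walg_eqI, rule poly_mapping_eqI)

lemma cf_walg_of_mult: "cf (walg_of u * w) \<mu> = u * cf w \<mu>"
proof -
  have "walg_of u * abs_walg w = abs_walg (\<Sum>\<mu>\<in>supp w. Poly_Mapping.single \<mu> (u * coef w \<mu>))"
    for w
    by (rule walg_op_eqI) (simp add: weyl_op_sum weyl_op_def[of w] sum_distrib_left mult.assoc)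
  from this[of "rep_walg w"] have "cf (walg_of u * w) \<mu> =
      (\<Sum>\<nu>\<in>supp (rep_walg w). if \<nu> = \<mu> then u * cf w \<nu> else 0)"
    by (simp add: lookup_sum lookup_single when_def)
  then show ?thesis by (simp add: in_keys_iff)
qed

lemma walg_expand: "w = (\<Sum>\<mu>\<in>supp (rep_walg w). walg_of (cf w \<mu>) * pd_pow \<mu>)"
  by (rule walg_cf_eqI) (simp add: cf_sum cf_monomial in_keys_iff)

lemma kst_zero [simp]: "kst 0 = 0"
  by simp

lemma kst_add: "kst (c + d) = kst c + kst d"
  by (simp add: single_add walg_of_add)

lemma kst_uminus: "kst (- c) = - kst c"
  by (simp add: single_uminus walg_of_uminus)

lemma kst_diff: "kst (c - d) = kst c - kst d"
  by (simp add: single_diff walg_of_diff)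

lemma kst_mult: "kst (c * d) = kst c * kst d"
  by (simp add: walg_of_mult[symmetric] mult_single)

lemma kst_sum: "(\<Sum>x\<in>S. kst (f x)) = kst (sum f S)"
  by (induction S rule: infinite_finite_induct) (auto simp: kst_add)

lemma kst_commute: "w * kst c = kst c * w"
proof (rule walg_op_eqI)
  fix v
  have "xderiv_pow \<mu> (Poly_Mapping.single 0 c * v) = Poly_Mapping.single 0 c * xderiv_pow \<mu> v" for \<mu>
    by (induction \<mu> rule: mindex_induct) (auto simp: xderiv_pow_add_unit xderiv_mult)
  then show "walg_op (w * kst c) v = walg_op (kst c * w) v"
    by (simp add: weyl_op_def[of "rep_walg w"] sum_distrib_left mult.left_commute)
qed

lemma kst_left_commute: "w * (kst c * z) = kst c * (w * z)"
  by (simp only: mult.assoc[symmetric] kst_commute)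

lemma kst_inverse: "c \<noteq> 0 \<Longrightarrow> kst (inverse c) * (kst c * w) = w"
  by (simp add: mult.assoc[symmetric] kst_mult[symmetric])

lemma kst_eq_0_iff: "kst c = 0 \<longleftrightarrow> c = 0"
  by (metis single_zero walg_of_eq_0_iff lookup_single_eq lookup_zero)

lemma kst_cancel: "c \<noteq> 0 \<Longrightarrow> kst c * a = kst c * b \<longleftrightarrow> a = b"
  by (metis kst_inverse)

lemma kst_mult_eq_0: "kst c * a = 0 \<longleftrightarrow> c = 0 \<or> a = 0"
  by (metis kst_inverse kst_eq_0_iff mult_zero_left mult_zero_right)

lemma rep_kst_mult: "rep_walg (kst c * w) = wscale c (rep_walg w)"
proof (rule poly_mapping_eqI)
  fix \<mu>
  show "cf (kst c * w) \<mu> = coef (wscale c (rep_walg w)) \<mu>"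
    unfolding cf_walg_of_mult wscale_def
    by (simp add: scale_eq_mult Poly_Mapping.map.rep_eq when_def)
qed

lemma xmono_add: "xmono \<alpha> i * xmono \<beta> j = xmono (\<alpha> + \<beta>) (i + j)"
  by (simp add: xmono_def mult_single)

lemma xw_add: "xw (\<alpha> + \<beta>) = xw \<alpha> * xw \<beta>"
  by (simp add: walg_of_mult[symmetric] xmono_add)

lemma xw_inverse: "xw \<alpha> * xw (- \<alpha>) = 1" "xw (- \<alpha>) * xw \<alpha> = 1"
  by (simp_all flip: xw_add)

lemma br_add_left: "br (a + b) c = br a c + br b c"
  by (simp add: br_def algebra_simps)

lemma br_add_right: "br a (b + c) = br a b + br a c"
  by (simp add: br_def algebra_simps)

lemma br_diff_left: "br (a - b) c = br a c - br b c"
  by (simp add: br_def algebra_simps)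

lemma br_diff_right: "br a (b - c) = br a b - br a c"
  by (simp add: br_def algebra_simps)

lemma br_minus_left: "br (- a) b = - br a b"
  by (simp add: br_def)

lemma br_minus_right: "br a (- b) = - br a b"
  by (simp add: br_def)

lemma br_zero [simp]: "br 0 a = 0" "br a 0 = 0"
  by (simp_all add: br_def)

lemma br_self [simp]: "br a a = 0"
  by (simp add: br_def)

lemma br_sum_left: "br (sum f S) b = (\<Sum>x\<in>S. br (f x) b)"
  by (simp add: br_def sum_distrib_left sum_distrib_right sum_subtractf)

lemma br_sum_right: "br b (sum f S) = (\<Sum>x\<in>S. br b (f x))"
  by (simp add: br_def sum_distrib_left sum_distrib_right sum_subtractf)

lemma br_mult_right: "br a (b * c) = br a b * c + b * br a c"
  by (simp add: br_def algebra_simps)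

lemma br_mult_left: "br (a * b) c = a * br b c + br a c * b"
  by (simp add: br_def algebra_simps)

lemma br_one [simp]: "br a 1 = 0" "br 1 a = 0"
  by (simp_all add: br_def)

lemma br_swap: "br a b = - br b a"
  by (simp add: br_def)

lemma br_kst [simp]: "br a (kst c) = 0" "br (kst c) a = 0"
  by (simp_all add: br_def kst_commute)

lemma br_kst_left: "br (kst c * a) b = kst c * br a b"
  by (simp add: br_mult_left)

lemma br_kst_right: "br a (kst c * b) = kst c * br a b"
  by (simp add: br_mult_right)

lemma br_walg_of [simp]: "br (walg_of u) (walg_of v) = 0"
  by (simp add: br_def walg_of_commute)

lemma br_pd_walg_of [simp]: "br (pd p) (walg_of u) = walg_of (xderiv p u)"
  by (simp add: br_def pd_walg_of)

lemma br_walg_of_pd [simp]: "br (walg_of u) (pd p) = - walg_of (xderiv p u)"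
  by (simp add: br_def pd_walg_of)

lemma br_pd [simp]: "br (pd p) (pd q) = 0"
  by (simp add: br_def pd_commute)

lemma br_jacobi: "br a (br b c) = br (br a b) c + br b (br a c)"
  by (simp add: br_def algebra_simps)

text \<open>The bracket with t_q differentiates the symbol, so it lowers the order by one and keeps
  the coefficients up to positive integers.\<close>

lemma cf_br_tw: "cf (br w (tw q)) \<mu> = of_nat (Suc (coef \<mu> q)) * cf w (\<mu> + unit_index q)"
proof -
  have "rep_walg (br w (tw q)) = symbol_deriv q (rep_walg w)"
    by (rule weyl_eqI) (simp only: br_def weyl_op_symbol_deriv walg_op_simps walg_op_walg_of)
  then show ?thesis by (simp only: coef_symbol_deriv)
qed

lemma of_nat_Suc_mult_eq_0: "of_nat (Suc m) * u = 0 \<longleftrightarrow> u = (0 :: 'f::field_char_0 salg)"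
  by (simp only: scale_of_nat[symmetric] pm.scale_eq_0_iff of_nat_eq_0_iff nat.simps simp_thms)

text \<open>Each nonzero multi-index has the form \<nu> + 1_q, so vanishing of all symbol
  derivatives leaves only the coefficient of \<partial>^0.\<close>

lemma commutes_tw_imp_walg_of:
  assumes "\<And>q. br w (tw q) = 0"
  shows "w = walg_of (cf w 0)"
proof (rule walg_cf_eqI)
  fix \<mu>
  have "cf w (\<nu> + unit_index q) = 0" for \<nu> q
    using cf_br_tw[of w q \<nu>] assms[of q] by (simp add: of_nat_Suc_mult_eq_0 del: of_nat_Suc)
  then show "cf w \<mu> = cf (walg_of (cf w 0)) \<mu>"
    by (cases "\<mu> = 0", simp) (cases \<mu> rule: mindex_cases, simp_all)
qed

definition ord_le :: "nat \<Rightarrow> 'f::field_char_0 walg \<Rightarrow> bool" where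
  "ord_le n w \<longleftrightarrow> (\<forall>\<mu>. cf w \<mu> \<noteq> 0 \<longrightarrow> mdeg \<mu> \<le> n)"

lemma ord_le_exists: "\<exists>n. ord_le n w"
proof
  show "ord_le (Max (mdeg ` supp (rep_walg w))) w"
    by (auto simp: ord_le_def in_keys_iff[symmetric] simp del: lookup_not_eq_zero_eq_in_keys)
qed

lemma ord_le_0: "ord_le 0 w \<longleftrightarrow> w = walg_of (cf w 0)"
proof
  assume "ord_le 0 w"
  then show "w = walg_of (cf w 0)"
    by (intro walg_cf_eqI) (auto simp: ord_le_def)
next
  assume "w = walg_of (cf w 0)"
  then have "cf w \<mu> = 0" if "\<mu> \<noteq> 0" for \<mu>
    using that by (metis cf_walg_of)
  then show "ord_le 0 w" by (auto simp: ord_le_def)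
qed

lemma ord_le_zero [simp]: "ord_le n 0"
  by (simp add: ord_le_def)

lemma ord_le_br_tw: "ord_le (Suc n) w \<Longrightarrow> ord_le n (br w (tw q))"
  by (force simp: ord_le_def cf_br_tw of_nat_Suc_mult_eq_0 simp del: of_nat_Suc)

lemma ord_le_br_tw_0: "ord_le 0 w \<Longrightarrow> br w (tw q) = 0"
  by (metis br_walg_of ord_le_0)

section \<open>Derivations of rings\<close>

text \<open>Brackets with a fixed element, on either side, are derivations; their iterates are
  controlled here once for both.\<close>

locale ring_derivation =
  fixes d :: "'a::ring_1 \<Rightarrow> 'a"
  assumes add: "d (x + y) = d x + d y" and leibniz: "d (x * y) = d x * y + x * d y"
begin

lemma zero [simp]: "d 0 = 0"
  using add[of 0 0] by simp

lemma one [simp]: "d 1 = 0"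
  using leibniz[of 1 1] by simp

lemma pow_zero [simp]: "(d ^^ n) 0 = 0"
  by (induction n) auto

lemma pow_add: "(d ^^ n) (x + y) = (d ^^ n) x + (d ^^ n) y"
  by (induction n) (auto simp: add)

lemma pow_eq_0_mono: "(d ^^ m) x = 0 \<Longrightarrow> m \<le> n \<Longrightarrow> (d ^^ n) x = 0"
  by (metis funpow_add le_add_diff_inverse2 o_apply pow_zero)

lemma of_nat [simp]: "d (of_nat n) = 0"
  by (induction n) (auto simp: add)

lemma sum: "d (sum f S) = (\<Sum>x\<in>S. d (f x))"
  by (induction S rule: infinite_finite_induct) (auto simp: add)

lemma pow_leibniz:
  "(d ^^ n) (x * y) = (\<Sum>k\<le>n. of_nat (n choose k) * ((d ^^ k) x * (d ^^ (n - k)) y))"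
proof (induction n)
  case (Suc n)
  let ?F = "\<lambda>k. (d ^^ k) x * (d ^^ (Suc n - k)) y"
  have "(d ^^ Suc n) (x * y) =
      (\<Sum>k\<le>n. of_nat (n choose k) * ?F (Suc k)) + (\<Sum>k\<le>n. of_nat (n choose k) * ?F k)"
    by (simp add: Suc sum leibniz distrib_left sum.distrib Suc_diff_le)
  also have "(\<Sum>k\<le>n. of_nat (n choose k) * ?F k) = (\<Sum>k\<le>Suc n. of_nat (n choose k) * ?F k)"
    by (simp add: binomial_eq_0)
  also have "\<dots> = ?F 0 + (\<Sum>k\<le>n. of_nat (n choose Suc k) * ?F (Suc k))"
    by (subst sum.atMost_Suc_shift) simp
  also have "(\<Sum>k\<le>n. of_nat (n choose k) * ?F (Suc k)) +
        (?F 0 + (\<Sum>k\<le>n. of_nat (n choose Suc k) * ?F (Suc k))) =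
      ?F 0 + (\<Sum>k\<le>n. of_nat (Suc n choose Suc k) * ?F (Suc k))"
    by (simp add: distrib_right sum.distrib)
  also have "\<dots> = (\<Sum>k\<le>Suc n. of_nat (Suc n choose k) * ?F k)"
    by (subst sum.atMost_Suc_shift) simp
  finally show ?case .
qed auto

lemma pow_mult_eq_0:
  assumes "(d ^^ m) x = 0" "(d ^^ n) y = 0"
  shows "(d ^^ (m + n)) (x * y) = 0"
  unfolding pow_leibniz
proof (intro sum.neutral ballI)
  fix k
  show "of_nat (m + n choose k) * ((d ^^ k) x * (d ^^ (m + n - k)) y) = 0"
    using pow_eq_0_mono[OF assms(1), of k] pow_eq_0_mono[OF assms(2), of "m + n - k"]
    by (cases "m \<le> k") auto
qed

text \<open>In the Leibniz sum any index other than \<open>m\<close> puts too many derivatives on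
  one factor. In a domain of characteristic 0 the surviving term shows that nilpotency degrees
  add.\<close>

lemma pow_mult_top:
  assumes "(d ^^ Suc m) x = 0" "(d ^^ Suc n) y = 0"
  shows "(d ^^ (m + n)) (x * y) = of_nat (m + n choose m) * ((d ^^ m) x * (d ^^ n) y)"
proof -
  have "of_nat (m + n choose k) * ((d ^^ k) x * (d ^^ (m + n - k)) y) = 0" if "k \<noteq> m" "k \<le> m + n" for k
    using that pow_eq_0_mono[OF assms(1), of k] pow_eq_0_mono[OF assms(2), of "m + n - k"]
    by (cases "m < k") auto
  then have "(d ^^ (m + n)) (x * y) =
      (\<Sum>k\<le>m + n. if k = m then of_nat (m + n choose m) * ((d ^^ m) x * (d ^^ n) y) else 0)"
    unfolding pow_leibniz by (intro sum.cong) auto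
  then show ?thesis by simp
qed

lemma exists_top:
  assumes "(d ^^ n) x = 0" "x \<noteq> 0"
  obtains m where "m < n" "(d ^^ m) x \<noteq> 0" "(d ^^ Suc m) x = 0"
proof -
  define k where "k = (LEAST k. (d ^^ k) x = 0)"
  have k: "(d ^^ k) x = 0" and le: "k \<le> n"
    unfolding k_def using assms(1) by (auto intro: LeastI Least_le)
  obtain m where m: "k = Suc m" using k assms(2) by (cases k) auto
  have "(d ^^ m) x \<noteq> 0"
    using not_less_Least[of m "\<lambda>k. (d ^^ k) x = 0"] m by (auto simp: k_def)
  then show ?thesis using k le m by (intro that[of m]) auto
qed

end

lemma ring_derivation_br: "ring_derivation (br a)"
  by unfold_locales (simp_all add: br_add_right br_mult_right)

lemma ring_derivation_br': "ring_derivation (\<lambda>x. br x a)"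
  by unfold_locales (simp_all add: br_add_left br_mult_left add.commute)

section \<open>Absence of zero divisors\<close>

text \<open>In characteristic 0 the field is a vector space over the rationals, and a nonzero vector
  extends to a basis. This supplies additive maps into an ordered group although the field itself
  carries no order.\<close>

lemma rat_linear_functional:
  fixes d :: "'f::field_char_0"
  assumes "d \<noteq> 0"
  obtains h :: "'f \<Rightarrow> rat" where "\<And>x y. h (x + y) = h x + h y" "h d \<noteq> 0"
proof -
  interpret V: vector_space "\<lambda>(q::rat) (x::'f). of_rat q * x"
    by unfold_locales (auto simp: algebra_simps of_rat_add of_rat_mult)
  interpret R: vector_space "(*) :: rat \<Rightarrow> rat \<Rightarrow> rat"
    by unfold_locales (auto simp: algebra_simps)
  interpret P: vector_space_pair "\<lambda>(q::rat) (x::'f). of_rat q * x" "(*) :: rat \<Rightarrow> rat \<Rightarrow> rat" ..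
  have "V.independent {d}"
    using assms by simp
  from P.linear_independent_extend[OF this, of "\<lambda>_. 1"]
  obtain h where h: "Vector_Spaces.linear (\<lambda>(q::rat) (x::'f). of_rat q * x) (*) h" "h d = 1"
    by auto
  show ?thesis
    using that[of h] h Vector_Spaces.linear.axioms(3)[OF h(1)] by (simp add: module_hom.add
        Vector_Spaces.linear_def module_hom_iff)
qed

text \<open>It is enough to look at one coordinate in which the two exponents differ: a
  natural-number exponent counts by itself, a field-valued one is composed with a rational
  functional.\<close>

lemma separating_functional:
  fixes k k' :: "'f::field_char_0 fvec \<times> mindex"
  assumes "k \<noteq> k'"
  obtains g :: "'f fvec \<times> mindex \<Rightarrow> rat" where "\<And>a b. g (a + b) = g a + g b" "g k \<noteq> g k'"
proof (cases "fst k = fst k'")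
  case True
  then obtain p where "coef (snd k) p \<noteq> coef (snd k') p"
    using assms by (metis poly_mapping_eqI prod_eqI)
  then show ?thesis
    using that[of "\<lambda>k. of_nat (coef (snd k) p)"] by (simp add: lookup_add)
next
  case False
  then obtain p where p: "coef (fst k) p \<noteq> coef (fst k') p"
    by (metis poly_mapping_eqI)
  then have "coef (fst k) p - coef (fst k') p \<noteq> 0" by simp
  then obtain h :: "'f \<Rightarrow> rat" where h: "\<And>x y. h (x + y) = h x + h y"
      "h (coef (fst k) p - coef (fst k') p) \<noteq> 0"
    using rat_linear_functional[of "coef (fst k) p - coef (fst k') p"] by blast
  have "h (coef (fst k) p) = h (coef (fst k) p - coef (fst k') p) + h (coef (fst k') p)"
    by (simp flip: h(1))
  then show ?thesis
    using that[of "\<lambda>k. h (coef (fst k) p)"] h by (simp add: lookup_add)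
qed

lemma coef_mult_neq_0E:
  assumes "coef (u * v) k \<noteq> 0"
  obtains a b where "k = a + b" "a \<in> supp u" "b \<in> supp v"
  using assms Poly_Mapping.keys_mult[of u v] unfolding in_keys_iff[symmetric] by blast

definition top_part :: "('k \<Rightarrow> rat) \<Rightarrow> ('k \<Rightarrow>\<^sub>0 'f::comm_monoid_add) \<Rightarrow> ('k \<Rightarrow>\<^sub>0 'f)" where
  "top_part g u = (\<Sum>k\<in>{k\<in>supp u. g k = Max (g ` supp u)}. Poly_Mapping.single k (coef u k))"

lemma coef_top_part:
  "coef (top_part g u) k = (if g k = Max (g ` supp u) then coef u k else 0)"
  by (auto simp: top_part_def lookup_sum lookup_single when_def in_keys_iff sum.If_cases
      intro!: sum.neutral)

lemma supp_top_part: "supp (top_part g u) = {k\<in>supp u. g k = Max (g ` supp u)}"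
  by (auto simp: in_keys_iff coef_top_part split: if_splits)

lemma top_part_neq_0: "u \<noteq> 0 \<Longrightarrow> top_part g u \<noteq> 0"
proof -
  assume "u \<noteq> 0"
  then have "Max (g ` supp u) \<in> g ` supp u" by (intro Max_in) auto
  then have "supp (top_part g u) \<noteq> {}" by (auto simp: supp_top_part)
  then show ?thesis by auto
qed

text \<open>A product term whose weight is the sum of the two maxima can only come from terms of
  maximal weight in both factors.\<close>

lemma coef_mult_top:
  fixes u v :: "'f::field salg" and g :: "'f fvec \<times> mindex \<Rightarrow> rat"
  assumes g: "\<And>a b. g (a + b) = g a + g b" and k: "g k = Max (g ` supp u) + Max (g ` supp v)"
  shows "coef (u * v) k = coef (top_part g u * top_part g v) k"
proof -
  let ?u = "top_part g u" and ?v = "top_part g v"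
  have 1: "coef (?u * (v - ?v)) k = 0"
  proof (rule ccontr)
    assume "coef (?u * (v - ?v)) k \<noteq> 0"
    then obtain a b where ab: "k = a + b" "a \<in> supp ?u" "b \<in> supp (v - ?v)"
      by (rule coef_mult_neq_0E)
    then have "b \<in> supp v" "g b \<noteq> Max (g ` supp v)"
      by (auto simp: in_keys_iff lookup_minus coef_top_part split: if_splits)
    then have "g b < Max (g ` supp v)"
      by (simp add: less_le)
    moreover have "g a = Max (g ` supp u)" using ab(2) by (simp add: supp_top_part)
    ultimately show False using k g[of a b] ab(1) by simp
  qed
  have 2: "coef ((u - ?u) * v) k = 0"
  proof (rule ccontr)
    assume "coef ((u - ?u) * v) k \<noteq> 0"
    then obtain a b where ab: "k = a + b" "a \<in> supp (u - ?u)" "b \<in> supp v"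
      by (rule coef_mult_neq_0E)
    then have "a \<in> supp u" "g a \<noteq> Max (g ` supp u)"
      by (auto simp: in_keys_iff lookup_minus coef_top_part split: if_splits)
    then have "g a < Max (g ` supp u)"
      by (simp add: less_le)
    moreover have "g b \<le> Max (g ` supp v)" using ab(3) by simp
    ultimately show False using k g[of a b] ab(1) by simp
  qed
  have "u * v = ?u * ?v + ?u * (v - ?v) + (u - ?u) * v" by (simp add: algebra_simps)
  then show ?thesis by (simp only: lookup_add 1 2 add_0_right)
qed

text \<open>Induction on the number of terms. If one factor has two different exponents, a weight
  separating them gives initial forms with fewer terms in all; their product is nonzero by
  induction, and it is the part of greatest weight in the product. The weight is chosen anew at each
  stage, which replaces a total order on the exponents.\<close>

lemma salg_mult_neq_0:
  fixes u v :: "'f::field_char_0 salg"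
  assumes "u \<noteq> 0" "v \<noteq> 0"
  shows "u * v \<noteq> 0"
  using assms
proof (induction "card (supp u) + card (supp v)" arbitrary: u v rule: less_induct)
  case less
  have reduce: "u * v \<noteq> 0"
    if k: "k \<in> supp u \<and> k' \<in> supp u \<or> k \<in> supp v \<and> k' \<in> supp v" "k \<noteq> k'" for k k'
  proof -
    obtain g :: "'f fvec \<times> mindex \<Rightarrow> rat" where g: "\<And>a b. g (a + b) = g a + g b" "g k \<noteq> g k'"
      using separating_functional[OF k(2)] by blast
    let ?u = "top_part g u" and ?v = "top_part g v"
    have sub: "supp ?u \<subseteq> supp u" "supp ?v \<subseteq> supp v" by (auto simp: supp_top_part)
    have "supp ?u \<subset> supp u \<or> supp ?v \<subset> supp v"
    proof -
      have "\<not> (k \<in> supp ?u \<and> k' \<in> supp ?u)" "\<not> (k \<in> supp ?v \<and> k' \<in> supp ?v)"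
        using g(2) by (auto simp: supp_top_part)
      then show ?thesis using k(1) sub by blast
    qed
    then have "card (supp ?u) + card (supp ?v) < card (supp u) + card (supp v)"
      using psubset_card_mono[of "supp u" "supp ?u"] psubset_card_mono[of "supp v" "supp ?v"]
        card_mono[OF finite_keys sub(1)] card_mono[OF finite_keys sub(2)] by (elim disjE) simp_all
    then have "?u * ?v \<noteq> 0"
      using less top_part_neq_0 by blast
    then obtain l where l: "coef (?u * ?v) l \<noteq> 0"
      by (metis lookup_zero poly_mapping_eqI)
    then obtain a b where ab: "l = a + b" "a \<in> supp ?u" "b \<in> supp ?v"
      by (rule coef_mult_neq_0E)
    then have "g l = Max (g ` supp u) + Max (g ` supp v)"
      by (simp add: g(1) supp_top_part)
    then have "coef (u * v) l \<noteq> 0"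
      using coef_mult_top[OF g(1)] l by simp
    then show ?thesis by (metis lookup_zero)
  qed
  show ?case
  proof (cases "\<exists>k l. supp u = {k} \<and> supp v = {l}")
    case True
    then obtain k l where kl: "supp u = {k}" "supp v = {l}" by blast
    have single: "w = Poly_Mapping.single j (coef w j)" if "supp w = {j}" for w :: "'f salg" and j
    proof (rule poly_mapping_eqI)
      fix i
      show "coef w i = coef (Poly_Mapping.single j (coef w j)) i"
        using that not_in_keys_iff_lookup_eq_zero[of i w] by (auto simp: lookup_single when_def)
    qed
    have "u * v = Poly_Mapping.single k (coef u k) * Poly_Mapping.single l (coef v l)"
      using single kl by metis
    then have "coef (u * v) (k + l) = coef u k * coef v l" by (simp add: mult_single)
    moreover have "k \<in> supp u" "l \<in> supp v" using kl by auto
    then have "coef u k * coef v l \<noteq> 0" using in_keys_iff[of k u] in_keys_iff[of l v] by simp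
    ultimately show ?thesis by (metis lookup_zero)
  next
    case False
    obtain k l where kl: "k \<in> supp u" "l \<in> supp v"
      using less.prems by (metis ex_in_conv keys_eq_empty)
    with False obtain k' where "k' \<in> supp u \<and> k \<noteq> k' \<or> k' \<in> supp v \<and> l \<noteq> k'" by blast
    then show ?thesis using reduce[of k k'] reduce[of l k'] kl by blast
  qed
qed

lemma coef_mult_top_neq_0:
  fixes u v :: "'f::field_char_0 salg" and g :: "'f fvec \<times> mindex \<Rightarrow> rat"
  assumes "u \<noteq> 0" "v \<noteq> 0" and g: "\<And>a b. g (a + b) = g a + g b"
  obtains k where "coef (u * v) k \<noteq> 0" "g k = Max (g ` supp u) + Max (g ` supp v)"
proof -
  let ?u = "top_part g u" and ?v = "top_part g v"
  have "?u * ?v \<noteq> 0" using assms salg_mult_neq_0 top_part_neq_0 by blast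
  then obtain l where l: "coef (?u * ?v) l \<noteq> 0"
    by (metis lookup_zero poly_mapping_eqI)
  then obtain a b where ab: "l = a + b" "a \<in> supp ?u" "b \<in> supp ?v"
    by (rule coef_mult_neq_0E)
  then have "g l = Max (g ` supp u) + Max (g ` supp v)"
    by (simp add: g supp_top_part)
  moreover from this have "coef (u * v) l \<noteq> 0"
    using coef_mult_top[OF g] l by simp
  ultimately show ?thesis using that by blast
qed

text \<open>For each weight, the spread between greatest and least value on \<open>u\<close> and
  that on \<open>v\<close> add up to the spread on a constant, which is 0. So no weight separates
  two exponents of \<open>u\<close>.\<close>

lemma salg_unit_monomial:
  fixes u v :: "'f::field_char_0 salg"
  assumes uv: "u * v = Poly_Mapping.single 0 c" and c: "c \<noteq> 0"
  obtains k where "supp u = {k}"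
proof -
  have nz: "u \<noteq> 0" "v \<noteq> 0" using uv c by (auto dest: arg_cong[of _ _ "\<lambda>u. coef u 0"])
  have "k = k'" if k: "k \<in> supp u" "k' \<in> supp u" for k k'
  proof (rule ccontr)
    assume "k \<noteq> k'"
    then obtain g :: "'f fvec \<times> mindex \<Rightarrow> rat" where g: "\<And>a b. g (a + b) = g a + g b" "g k \<noteq> g k'"
      using separating_functional by blast
    have g0: "g 0 = 0" using g(1)[of 0 0] by simp
    have M: "Max (h ` supp u) + Max (h ` supp v) = 0"
      if h: "\<And>a b. h (a + b) = h a + h b" for h :: "'f fvec \<times> mindex \<Rightarrow> rat"
    proof -
      obtain l where l: "coef (u * v) l \<noteq> 0" "h l = Max (h ` supp u) + Max (h ` supp v)"
        using coef_mult_top_neq_0[OF nz, of h] h by blast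
      then have "l = 0" using uv by (auto simp: lookup_single when_def split: if_splits)
      then show ?thesis using l(2) h[of 0 0] by simp
    qed
    \<comment> \<open>Minima are expressed as maxima of the opposite weight, so that the statement
      \<open>M\<close> about maxima covers both ends.\<close>
    let ?a = "Max (g ` supp u)" and ?b = "Max (g ` supp v)"
    let ?c = "Max ((\<lambda>k. - g k) ` supp u)" and ?d = "Max ((\<lambda>k. - g k) ` supp v)"
    have "?a + ?b = 0" "?c + ?d = 0" using M[of g] M[of "\<lambda>k. - g k"] g(1) by auto
    moreover have le: "g k \<le> ?a" "g k' \<le> ?a" "- g k \<le> ?c" "- g k' \<le> ?c"
      using k by (auto intro!: Max_ge)
    moreover obtain l where l: "l \<in> supp v" using nz(2) by (metis ex_in_conv keys_eq_empty)
    have "g l \<le> ?b" "- g l \<le> ?d" using l by (auto intro!: Max_ge)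
    ultimately show False using g(2) by linarith
  qed
  moreover obtain k where "k \<in> supp u" using nz(1) by (metis ex_in_conv keys_eq_empty)
  ultimately show ?thesis using that by blast
qed

text \<open>Leading-term argument on the orders: bracketing both factors with t_q as often as they
  allow yields nonzero factors of smaller total order, and a binomial multiple of their product is
  an iterated bracket of \<open>a * b\<close>. If both factors commute with every t_q, they lie in
  the semigroup algebra, which is a domain.\<close>

lemma walg_mult_neq_0:
  fixes a b :: "'f::field_char_0 walg"
  assumes "a \<noteq> 0" "b \<noteq> 0"
  shows "a * b \<noteq> 0"
proof -
  have "a * b \<noteq> 0" if "a \<noteq> 0" "b \<noteq> 0" "ord_le m a" "ord_le n b" for m n and a b :: "'f walg"
    using that
  proof (induction "m + n" arbitrary: m n a b rule: less_induct)
    case less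
    show ?case
    proof (cases "\<exists>q. br a (tw q) \<noteq> 0 \<or> br b (tw q) \<noteq> 0")
      case True
      then obtain q where q: "br a (tw q) \<noteq> 0 \<or> br b (tw q) \<noteq> 0" by blast
      define d :: "'f walg \<Rightarrow> 'f walg" where "d = (\<lambda>x. br x (tw q))"
      interpret ring_derivation d unfolding d_def by (rule ring_derivation_br')
      have ord: "k \<le> i \<Longrightarrow> ord_le (i - k) ((d ^^ k) w)" if "ord_le i w" for i k w
      proof (induction k)
        case (Suc k)
        then have "ord_le (Suc (i - Suc k)) ((d ^^ k) w)" by (simp add: Suc_diff_Suc)
        then show ?case by (simp add: d_def ord_le_br_tw)
      qed (use that in simp)
      have nil: "(d ^^ Suc i) w = 0" if "ord_le i w" for i w
        using ord[OF that, of i] by (simp add: d_def ord_le_br_tw_0)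
      obtain i where i: "i < Suc m" "(d ^^ i) a \<noteq> 0" "(d ^^ Suc i) a = 0"
        by (rule exists_top[OF nil[OF less.prems(3)] less.prems(1)])
      obtain j where j: "j < Suc n" "(d ^^ j) b \<noteq> 0" "(d ^^ Suc j) b = 0"
        by (rule exists_top[OF nil[OF less.prems(4)] less.prems(2)])
      \<comment> \<open>By the choice of \<open>q\<close> one of the factors is not killed by the
        first bracket, so its last nonzero iterate has positive index.\<close>
      have "0 < i + j" using q i j by (auto simp: d_def intro!: gr0I)
      then have "(m - i) + (n - j) < m + n" using i(1) j(1) by auto
      then have "(d ^^ i) a * (d ^^ j) b \<noteq> 0"
        using less.hyps[of "m - i" "n - j" "(d ^^ i) a" "(d ^^ j) b"] ord i j less.prems by simp
      then have "kst (of_nat (i + j choose i)) * ((d ^^ i) a * (d ^^ j) b) \<noteq> 0"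
        by (simp only: kst_mult_eq_0) (simp add: binomial_eq_0_iff)
      then have "(d ^^ (i + j)) (a * b) \<noteq> 0"
        using pow_mult_top[OF i(3) j(3)] by simp
      then show ?thesis by auto
    next
      case False
      then obtain u v where uv: "a = walg_of u" "b = walg_of v"
        using commutes_tw_imp_walg_of by blast
      then have "u \<noteq> 0" "v \<noteq> 0" using less.prems by auto
      then show ?thesis
        by (simp add: uv salg_mult_neq_0 flip: walg_of_mult)
    qed
  qed
  then show ?thesis using assms ord_le_exists by blast
qed

text \<open>The last nonzero iterates of the derivation on \<open>x\<close> and on \<open>y\<close>
  multiply to a nonzero element, and a binomial multiple of it is an iterate on
  \<open>x * y = 1\<close>. Iterates of positive degree kill 1, so both degrees are 0.\<close>

lemma locally_nilpotent_kills_units: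
  fixes w :: "'f::field_char_0 walg"
  assumes xy: "x * y = 1" and x: "(br w ^^ M) x = 0" and y: "(br w ^^ N) y = 0"
  shows "br w x = 0"
proof -
  define d where "d = br w"
  interpret ring_derivation d unfolding d_def by (rule ring_derivation_br)
  have nz: "x \<noteq> 0" "y \<noteq> 0" using xy by auto
  obtain m where m: "m < M" "(d ^^ m) x \<noteq> 0" "(d ^^ Suc m) x = 0"
    by (rule exists_top[OF x[folded d_def] nz(1)])
  obtain n where n: "n < N" "(d ^^ n) y \<noteq> 0" "(d ^^ Suc n) y = 0"
    by (rule exists_top[OF y[folded d_def] nz(2)])
  have "(d ^^ m) x * (d ^^ n) y \<noteq> 0" by (rule walg_mult_neq_0[OF m(2) n(2)])
  then have "kst (of_nat (m + n choose m)) * ((d ^^ m) x * (d ^^ n) y) \<noteq> 0"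
    by (simp only: kst_mult_eq_0) (simp add: binomial_eq_0_iff)
  then have neq: "(d ^^ (m + n)) 1 \<noteq> 0"
    using pow_mult_top[OF m(3) n(3)] xy by simp
  have "(d ^^ Suc k) 1 = 0" for k
    by (induction k) auto
  with neq have "m + n = 0" by (metis not0_implies_Suc)
  then show ?thesis using m(3) by (simp add: d_def)
qed


section \<open>The algebra of Weyl type\<close>

lemma walg_induct [case_names zero monomial add]:
  assumes "P 0" "\<And>u \<mu>. P (walg_of u * pd_pow \<mu>)" "\<And>a b. P a \<Longrightarrow> P b \<Longrightarrow> P (a + b)"
  shows "P w"
proof -
  have "P (\<Sum>\<mu>\<in>S. walg_of (cf w \<mu>) * pd_pow \<mu>)" if "finite S" for S
    using that by induction (use assms in auto)
  then show ?thesis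
    by (subst walg_expand) simp
qed

text \<open>Bracketing with \<open>u\<close> kills coefficients at once and \<partial>_p after two
  steps; nilpotency passes to products by the Leibniz formula and to sums by a common bound.\<close>

lemma br_walg_of_nilpotent: "\<exists>n. (br (walg_of u) ^^ n) w = 0"
proof -
  interpret ring_derivation "br (walg_of u)" by (rule ring_derivation_br)
  show ?thesis
  proof (induction w rule: walg_induct)
    case zero
    show ?case by (intro exI[of _ 0]) simp
  next
    case (monomial v \<mu>)
    have "\<exists>n. (br (walg_of u) ^^ n) (pd_pow \<mu>) = 0"
    proof (induction \<mu> rule: mindex_induct)
      case zero
      show ?case by (intro exI[of _ 1]) simp
    next
      case (add_unit \<mu> p)
      then obtain n where n: "(br (walg_of u) ^^ n) (pd_pow \<mu>) = 0" by blast
      have "(br (walg_of u) ^^ 2) (pd p) = 0" by (simp add: numeral_2_eq_2 br_minus_right)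
      from pow_mult_eq_0[OF n this] show ?case
        unfolding pd_pow_add pd_pow_unit_index by (rule exI)
    qed
    then obtain n where n: "(br (walg_of u) ^^ n) (pd_pow \<mu>) = 0" by blast
    have "(br (walg_of u) ^^ 1) (walg_of v) = 0" by simp
    from pow_mult_eq_0[OF this n] show ?case by blast
  next
    case (add a b)
    then obtain m n where "(br (walg_of u) ^^ m) a = 0" "(br (walg_of u) ^^ n) b = 0" by blast
    then have "(br (walg_of u) ^^ (m + n)) a = 0" "(br (walg_of u) ^^ (m + n)) b = 0"
      using pow_eq_0_mono le_add1 le_add2 by blast+
    then show ?case by (intro exI[of _ "m + n"]) (simp add: pow_add)
  qed
qed

lemma xderiv_xmono: "xderiv p (xmono \<alpha> 0) = Poly_Mapping.single 0 (coef \<alpha> p) * xmono \<alpha> 0"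
  by (simp add: xmono_def xderiv_single mult_single)

lemma xderiv_t: "xderiv p (xmono 0 (unit_index q)) = (if p = q then 1 else 0)"
  by (auto simp: xmono_def xderiv_single zero_prod_def[symmetric])

lemma xderiv_const_mult: "xderiv p (Poly_Mapping.single 0 c * u) = Poly_Mapping.single 0 c * xderiv p u"
  by (simp add: xderiv_mult)

lemma coef_const_mult: "coef (Poly_Mapping.single 0 c * u) k = c * coef (u :: 'f::field salg) k"
  by (simp add: lookup_scale flip: scale_eq_mult)

text \<open>The equation is a recursion in the exponent of t_p. If \<open>coef \<alpha> p\<close>
  differed from \<open>c\<close>, a nonzero coefficient would force a nonzero one with higher
  exponent, without end, against finite support. If they agree, the recursion makes the coefficients
  with positive exponent vanish.\<close>

lemma eigen_support:
  fixes u :: "'f::field_char_0 salg"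
  assumes eq: "xderiv p u = Poly_Mapping.single 0 c * u" and k: "(\<alpha>, i) \<in> supp u"
  shows "coef \<alpha> p = c \<and> coef i p = 0"
proof -
  have co: "coef \<alpha> p * coef u (\<alpha>, j) + of_nat (Suc (coef j p)) * coef u (\<alpha>, j + unit_index p) =
      c * coef u (\<alpha>, j)" for j
    using arg_cong[OF eq, of "\<lambda>u. coef u (\<alpha>, j)"] by (simp only: coef_xderiv coef_const_mult)
  have c: "coef \<alpha> p = c"
  proof (rule ccontr)
    assume ne: "coef \<alpha> p \<noteq> c"
    have step: "coef u (\<alpha>, j + unit_index p) \<noteq> 0" if "coef u (\<alpha>, j) \<noteq> 0" for j
      using co[of j] that ne by auto
    have "\<exists>j. coef u (\<alpha>, j) \<noteq> 0 \<and> n \<le> coef j p" for n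
    proof (induction n)
      case 0
      show ?case using k by (auto simp: in_keys_iff)
    next
      case (Suc n)
      then obtain j where "coef u (\<alpha>, j) \<noteq> 0" "n \<le> coef j p" by blast
      then show ?case using step by (intro exI[of _ "j + unit_index p"]) (simp add: lookup_add)
    qed
    then obtain j where j: "(\<alpha>, j) \<in> supp u" "Suc (Max ((\<lambda>k. coef (snd k) p) ` supp u)) \<le> coef j p"
      by (auto simp: in_keys_iff)
    have "coef (snd (\<alpha>, j)) p \<le> Max ((\<lambda>k. coef (snd k) p) ` supp u)"
      by (intro Max_ge imageI[OF j(1), of "\<lambda>k. coef (snd k) p"]) simp
    then show False using j(2) by simp
  qed
  have "coef i p = 0"
  proof (rule ccontr)
    assume "coef i p \<noteq> 0"
    then have i: "i - unit_index p + unit_index p = i" by (simp add: diff_unit_index_add)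
    have "of_nat (Suc (coef (i - unit_index p) p)) * coef u (\<alpha>, i) = 0"
      using co[of "i - unit_index p"] c i by simp
    then have "coef u (\<alpha>, i) = 0" by (simp only: mult_eq_0_iff of_nat_eq_0_iff) simp
    then show False using k by (simp add: in_keys_iff)
  qed
  with c show ?thesis by simp
qed

lemma supp_subset_singleton:
  assumes "supp u \<subseteq> {k}"
  shows "u = Poly_Mapping.single k (coef u k)"
proof (rule poly_mapping_eqI)
  fix j
  show "coef u j = coef (Poly_Mapping.single k (coef u k)) j"
    using assms not_in_keys_iff_lookup_eq_zero[of j u] by (auto simp: lookup_single when_def)
qed

lemma unit_index_eq_iff [simp]: "unit_index p = unit_index q \<longleftrightarrow> p = q"
  by (metis coef_unit_index zero_neq_one)

lemma mdeg_le_1_cases: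
  assumes "mdeg \<mu> \<le> 1"
  obtains "\<mu> = 0" | q where "\<mu> = unit_index q"
  using assms by (cases \<mu> rule: mindex_cases) auto

section \<open>The algebra of Weyl type as a subring\<close>

locale weyl_type =
  fixes l1 l2 :: nat and \<Gamma> :: "'f::field_char_0 fvec set"
  assumes pos: "0 < l1 + l2" and nondeg: "nondegenerate_subgroup (l1 + l2) \<Gamma>"
begin

abbreviation l :: nat where "l \<equiv> l1 + l2"

abbreviation A :: "'f salg set" where "A \<equiv> salg_carrier l1 \<Gamma>"

definition Wc :: "'f walg set" where
  "Wc = {w. (\<forall>\<mu>. cf w \<mu> \<noteq> 0 \<longrightarrow> \<mu> \<in> multi_indices l) \<and> (\<forall>\<mu>. cf w \<mu> \<in> A)}"

lemma Wc_iff: "w \<in> Wc \<longleftrightarrow> rep_walg w \<in> weyl_carrier l1 l2 \<Gamma>"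
  by (auto simp: Wc_def weyl_carrier_def in_keys_iff)

lemma Gamma_zero [simp]: "0 \<in> \<Gamma>"
  and Gamma_add: "\<alpha> \<in> \<Gamma> \<Longrightarrow> \<beta> \<in> \<Gamma> \<Longrightarrow> \<alpha> + \<beta> \<in> \<Gamma>"
  and Gamma_uminus: "\<alpha> \<in> \<Gamma> \<Longrightarrow> - \<alpha> \<in> \<Gamma>"
  and Gamma_vecs: "\<Gamma> \<subseteq> vecs l"
  using nondeg by (auto simp: nondegenerate_subgroup_def)

text \<open>This is the form in which the basis contained in \<Gamma> is used: linear conditions
  need checking on \<Gamma> only.\<close>

lemma vecs_subset_subspace:
  assumes "pm.subspace V" "\<Gamma> \<subseteq> V"
  shows "vecs l \<subseteq> V"
proof -
  obtain B where "B \<subseteq> \<Gamma>" "pm.span B = vecs l"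
    using nondeg by (auto simp: nondegenerate_subgroup_def)
  then show ?thesis using assms pm.span_minimal by blast
qed

lemma single_in_vecs [simp]: "p < l \<Longrightarrow> Poly_Mapping.single p c \<in> vecs l"
  by (auto simp: vecs_def)

lemma vecs_eqI:
  assumes "\<alpha> \<in> vecs n" "\<beta> \<in> vecs n" "\<And>p. p < n \<Longrightarrow> coef \<alpha> p = coef \<beta> p"
  shows "\<alpha> = \<beta>"
proof (rule poly_mapping_eqI)
  fix p
  show "coef \<alpha> p = coef \<beta> p"
  proof (cases "p < n")
    case False
    then have "p \<notin> supp \<alpha>" "p \<notin> supp \<beta>" using assms(1,2) by (auto simp: vecs_def)
    then show ?thesis by (simp add: in_keys_iff)
  qed (use assms(3) in simp)
qed

text \<open>The linear condition cuts out a subspace containing \<Gamma>, hence all of F^l; it is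
  then evaluated at a unit vector.\<close>

lemma orthogonal_Gamma:
  assumes "\<And>\<beta>. \<beta> \<in> \<Gamma> \<Longrightarrow> (\<Sum>q<l. coef \<beta> q * c q) = 0" "p < l"
  shows "c p = (0::'f)"
proof -
  let ?V = "{\<beta>. (\<Sum>q<l. coef \<beta> q * c q) = 0}"
  have "pm.subspace ?V"
    by (auto simp: pm.subspace_def lookup_add lookup_scale distrib_right sum.distrib mult.assoc
        simp flip: sum_distrib_left)
  then have "vecs l \<subseteq> ?V" using assms(1) by (intro vecs_subset_subspace) auto
  then have "Poly_Mapping.single p 1 \<in> ?V" using single_in_vecs[OF assms(2)] by blast
  then show ?thesis using assms(2) by (simp add: lookup_single when_def if_distrib[of "\<lambda>x. x * _"] cong: if_cong)
qed

lemma exists_coordinate: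
  assumes "\<alpha> \<in> \<Gamma>" "\<alpha> \<noteq> 0"
  obtains p where "p < l" "coef \<alpha> p \<noteq> 0"
  using assms vecs_eqI[of \<alpha> l 0] Gamma_vecs Gamma_zero by fastforce

lemma exists_nonzero_coordinate:
  assumes "p < l"
  obtains \<alpha> where "\<alpha> \<in> \<Gamma>" "coef \<alpha> p \<noteq> 0"
proof -
  have "\<exists>\<alpha>\<in>\<Gamma>. coef \<alpha> p \<noteq> 0"
  proof (rule ccontr)
    assume *: "\<not> ?thesis"
    have "(\<Sum>q<l. coef \<beta> q * (if q = p then 1 else 0)) = 0" if "\<beta> \<in> \<Gamma>" for \<beta>
      using * that assms by (simp add: if_distrib[of "\<lambda>x. _ * x"] cong: if_cong)
    from orthogonal_Gamma[of "\<lambda>q. if q = p then 1 else 0", OF this assms] show False by simp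
  qed
  then show ?thesis using that by blast
qed

lemma A_iff: "u \<in> A \<longleftrightarrow> (\<forall>\<alpha> i. (\<alpha>, i) \<in> supp u \<longrightarrow> \<alpha> \<in> \<Gamma> \<and> i \<in> multi_indices l1)"
  by (auto simp: salg_carrier_def)

lemma A_zero [simp]: "0 \<in> A"
  by (simp add: A_iff)

lemma A_add: "u \<in> A \<Longrightarrow> v \<in> A \<Longrightarrow> u + v \<in> A"
  using Poly_Mapping.keys_add[of u v] unfolding salg_carrier_def by blast

lemma A_single: "Poly_Mapping.single (\<alpha>, i) c \<in> A \<longleftrightarrow> c = 0 \<or> \<alpha> \<in> \<Gamma> \<and> i \<in> multi_indices l1"
  by (auto simp: A_iff)

lemma A_const [simp]: "Poly_Mapping.single 0 c \<in> A"
  by (simp add: zero_prod_def A_single)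

lemma A_one [simp]: "1 \<in> A"
  using A_const[of 1] by simp

lemma A_xmono: "xmono \<alpha> i \<in> A \<longleftrightarrow> \<alpha> \<in> \<Gamma> \<and> i \<in> multi_indices l1"
  by (simp add: xmono_def A_single)

lemma A_mult: "u \<in> A \<Longrightarrow> v \<in> A \<Longrightarrow> u * v \<in> A"
  unfolding A_iff
proof (intro allI impI)
  fix \<alpha> i assume *: "\<forall>\<alpha> i. (\<alpha>, i) \<in> supp u \<longrightarrow> \<alpha> \<in> \<Gamma> \<and> i \<in> multi_indices l1"
    "\<forall>\<alpha> i. (\<alpha>, i) \<in> supp v \<longrightarrow> \<alpha> \<in> \<Gamma> \<and> i \<in> multi_indices l1" "(\<alpha>, i) \<in> supp (u * v)"
  from *(3) have "coef (u * v) (\<alpha>, i) \<noteq> 0" by (simp add: in_keys_iff)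
  then obtain a b where ab: "(\<alpha>, i) = a + b" "a \<in> supp u" "b \<in> supp v"
    by (rule coef_mult_neq_0E)
  then have "(fst a, snd a) \<in> supp u" "(fst b, snd b) \<in> supp v" by auto
  with *(1,2) have "fst a \<in> \<Gamma>" "snd a \<in> multi_indices l1" "fst b \<in> \<Gamma>" "snd b \<in> multi_indices l1"
    by blast+
  moreover have "\<alpha> = fst a + fst b" "i = snd a + snd b" using ab(1) by (metis fst_add fst_conv snd_add snd_conv)+
  ultimately show "\<alpha> \<in> \<Gamma> \<and> i \<in> multi_indices l1" using Gamma_add by simp
qed

lemma A_uminus: "u \<in> A \<Longrightarrow> - u \<in> A"
  by (simp add: A_iff)

lemma A_diff: "u \<in> A \<Longrightarrow> v \<in> A \<Longrightarrow> u - v \<in> A"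
  using A_add[of u "- v"] A_uminus by simp

lemma A_sum: "(\<And>x. x \<in> S \<Longrightarrow> f x \<in> A) \<Longrightarrow> sum f S \<in> A"
  by (induction S rule: infinite_finite_induct) (auto simp: A_add)

lemma A_xderiv: "u \<in> A \<Longrightarrow> xderiv p u \<in> A"
  unfolding A_iff
proof (intro allI impI)
  fix \<alpha> i assume *: "\<forall>\<alpha> i. (\<alpha>, i) \<in> supp u \<longrightarrow> \<alpha> \<in> \<Gamma> \<and> i \<in> multi_indices l1" "(\<alpha>, i) \<in> supp (xderiv p u)"
  then have "coef (xderiv p u) (\<alpha>, i) \<noteq> 0" by (simp add: in_keys_iff)
  then have "coef u (\<alpha>, i) \<noteq> 0 \<or> coef u (\<alpha>, i + unit_index p) \<noteq> 0"
    by (auto simp: coef_xderiv)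
  then have "(\<alpha>, i) \<in> supp u \<or> (\<alpha>, i + unit_index p) \<in> supp u" by (simp add: in_keys_iff)
  then show "\<alpha> \<in> \<Gamma> \<and> i \<in> multi_indices l1" using *(1) by (metis add_in_multi_indices)
qed

lemma A_induct [consumes 1, case_names monomial add]:
  assumes "u \<in> A"
    "\<And>\<alpha> i c. \<alpha> \<in> \<Gamma> \<Longrightarrow> i \<in> multi_indices l1 \<Longrightarrow> P (Poly_Mapping.single 0 c * xmono \<alpha> i)"
    "\<And>u v. u \<in> A \<Longrightarrow> v \<in> A \<Longrightarrow> P u \<Longrightarrow> P v \<Longrightarrow> P (u + v)"
  shows "P u"
proof -
  have mono: "Poly_Mapping.single 0 c * xmono \<alpha> i = Poly_Mapping.single (\<alpha>, i) c" for c :: 'f and \<alpha> i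
    by (simp add: xmono_def mult_single)
  have "P 0" using assms(2)[of 0 0 0] by simp
  have "P (\<Sum>k\<in>S. Poly_Mapping.single k (coef u k)) \<and> (\<Sum>k\<in>S. Poly_Mapping.single k (coef u k)) \<in> A"
    if "finite S" "S \<subseteq> supp u" for S
    using that
  proof induction
    case (insert k S)
    obtain \<alpha> i where k: "k = (\<alpha>, i)" by fastforce
    then have "\<alpha> \<in> \<Gamma>" "i \<in> multi_indices l1" using insert.prems assms(1) by (auto simp: A_iff)
    then have "Poly_Mapping.single k (coef u k) \<in> A" "P (Poly_Mapping.single k (coef u k))"
      using assms(2)[of \<alpha> i "coef u k"] unfolding mono k by (auto simp: A_single)
    then show ?case using insert assms(3) A_add by auto
  qed (use \<open>P 0\<close> in auto)
  moreover have "u = (\<Sum>k\<in>supp u. Poly_Mapping.single k (coef u k))"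
    by (rule poly_mapping_eqI) (auto simp: lookup_sum lookup_single when_def in_keys_iff)
  ultimately show ?thesis by (metis finite_keys subset_refl)
qed

lemma Wc_zero [simp]: "0 \<in> Wc"
  by (simp add: Wc_def)

lemma Wc_cf: "w \<in> Wc \<Longrightarrow> cf w \<mu> \<in> A"
  by (simp add: Wc_def)

lemma Wc_index: "w \<in> Wc \<Longrightarrow> cf w \<mu> \<noteq> 0 \<Longrightarrow> \<mu> \<in> multi_indices l"
  by (simp add: Wc_def)

lemma Wc_add: "a \<in> Wc \<Longrightarrow> b \<in> Wc \<Longrightarrow> a + b \<in> Wc"
  unfolding Wc_def by (auto simp: A_add) (metis add_0)

lemma Wc_uminus: "a \<in> Wc \<Longrightarrow> - a \<in> Wc"
  unfolding Wc_def by (auto simp: A_uminus)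

lemma Wc_diff: "a \<in> Wc \<Longrightarrow> b \<in> Wc \<Longrightarrow> a - b \<in> Wc"
  using Wc_add[of a "- b"] Wc_uminus by simp

lemma Wc_sum: "(\<And>x. x \<in> S \<Longrightarrow> f x \<in> Wc) \<Longrightarrow> sum f S \<in> Wc"
  by (induction S rule: infinite_finite_induct) (auto simp: Wc_add)

lemma Wc_walg_of [simp]: "walg_of u \<in> Wc \<longleftrightarrow> u \<in> A"
  unfolding Wc_def by auto

lemma Wc_monomial: "u \<in> A \<Longrightarrow> \<mu> \<in> multi_indices l \<Longrightarrow> walg_of u * pd_pow \<mu> \<in> Wc"
  unfolding Wc_def by (auto simp: cf_monomial)

lemma Wc_one [simp]: "1 \<in> Wc"
  using Wc_walg_of[of 1] by simp

lemma Wc_pd [simp]: "p < l \<Longrightarrow> pd p \<in> Wc"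
  using Wc_monomial[of 1 "unit_index p"] by simp

lemma Wc_xw [simp]: "xw \<alpha> \<in> Wc \<longleftrightarrow> \<alpha> \<in> \<Gamma>"
  by (simp add: A_xmono)

lemma Wc_tw [simp]: "tw p \<in> Wc \<longleftrightarrow> p < l1"
  by (simp add: A_xmono)

lemma Wc_kst: "kst c \<in> Wc"
  by simp

lemma Wc_walg_of_mult: "u \<in> A \<Longrightarrow> w \<in> Wc \<Longrightarrow> walg_of u * w \<in> Wc"
  unfolding Wc_def by (auto simp: cf_walg_of_mult A_mult) (metis mult_zero_right)

lemma Wc_linear_induct [consumes 1, case_names zero monomial add]:
  assumes "w \<in> Wc" "P 0"
    "\<And>u \<mu>. u \<in> A \<Longrightarrow> \<mu> \<in> multi_indices l \<Longrightarrow> P (walg_of u * pd_pow \<mu>)"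
    "\<And>a b. a \<in> Wc \<Longrightarrow> b \<in> Wc \<Longrightarrow> P a \<Longrightarrow> P b \<Longrightarrow> P (a + b)"
  shows "P w"
proof -
  have "P (\<Sum>\<mu>\<in>S. walg_of (cf w \<mu>) * pd_pow \<mu>) \<and> (\<Sum>\<mu>\<in>S. walg_of (cf w \<mu>) * pd_pow \<mu>) \<in> Wc"
    if "finite S" "S \<subseteq> supp (rep_walg w)" for S
    using that
  proof induction
    case (insert \<mu> S)
    then have "cf w \<mu> \<in> A" "\<mu> \<in> multi_indices l"
      using assms(1) by (auto simp: Wc_def in_keys_iff)
    then show ?case using insert assms(3,4) Wc_add Wc_monomial by auto
  qed (use assms in auto)
  from this[of "supp (rep_walg w)"] show ?thesis by (subst walg_expand) simp
qed

lemma Wc_pd_mult: "w \<in> Wc \<Longrightarrow> p < l \<Longrightarrow> pd p * w \<in> Wc"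
proof (induction w rule: Wc_linear_induct)
  case (monomial u \<mu>)
  have "pd p * (walg_of u * pd_pow \<mu>) =
      walg_of u * pd_pow (unit_index p + \<mu>) + walg_of (xderiv p u) * pd_pow \<mu>"
    by (simp add: mult.assoc[symmetric] pd_walg_of distrib_right pd_pow_add)
  then show ?case using monomial by (simp add: Wc_add Wc_monomial A_xderiv)
qed (auto simp: distrib_left Wc_add)

lemma Wc_mult: "a \<in> Wc \<Longrightarrow> b \<in> Wc \<Longrightarrow> a * b \<in> Wc"
proof (induction a rule: Wc_linear_induct)
  case (monomial u \<mu>)
  have "pd_pow \<mu> * b \<in> Wc"
    using monomial(2) by (induction \<mu> rule: multi_indices_induct)
      (use monomial(3) in \<open>auto simp: pd_pow_add add.commute mult.assoc Wc_pd_mult pd_pow_commute[of _ "unit_index _", simplified]\<close>)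
  then show ?case using monomial by (simp add: mult.assoc Wc_walg_of_mult)
qed (auto simp: distrib_right Wc_add)

lemma Wc_br: "a \<in> Wc \<Longrightarrow> b \<in> Wc \<Longrightarrow> br a b \<in> Wc"
  by (simp add: br_def Wc_mult Wc_diff)

lemma Wc_kst_mult: "w \<in> Wc \<Longrightarrow> kst c * w \<in> Wc"
  by (simp add: Wc_mult Wc_kst)

lemma Wc_pd_pow: "\<mu> \<in> multi_indices l \<Longrightarrow> pd_pow \<mu> \<in> Wc"
  using Wc_monomial[of 1 \<mu>] by simp

lemma walg_of_t_step: "walg_of (xmono \<alpha> (i + unit_index p)) = tw p * walg_of (xmono \<alpha> i)"
  by (simp add: xmono_add add.commute flip: walg_of_mult)

text \<open>Each basis monomial is a product of generators, and coefficients are products with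
  constants, so properties closed under sums and products spread from the generators.\<close>

lemma Wc_generators_induct [consumes 1, case_names kst xw tw pd add mult]:
  assumes "w \<in> Wc" "\<And>c. P (kst c)" "\<And>\<alpha>. \<alpha> \<in> \<Gamma> \<Longrightarrow> P (xw \<alpha>)" "\<And>p. p < l1 \<Longrightarrow> P (tw p)"
    "\<And>p. p < l \<Longrightarrow> P (pd p)"
    "\<And>a b. a \<in> Wc \<Longrightarrow> b \<in> Wc \<Longrightarrow> P a \<Longrightarrow> P b \<Longrightarrow> P (a + b)"
    "\<And>a b. a \<in> Wc \<Longrightarrow> b \<in> Wc \<Longrightarrow> P a \<Longrightarrow> P b \<Longrightarrow> P (a * b)"
  shows "P w"
  using assms(1)
proof (induction w rule: Wc_linear_induct)
  case zero
  show ?case using assms(2)[of 0] by simp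
next
  case (monomial u \<mu>)
  have "P (walg_of u)" using monomial(1)
  proof (induction u rule: A_induct)
    case (monomial \<alpha> i c)
    have "P (walg_of (xmono \<alpha> i))" using monomial(2)
    proof (induction i rule: multi_indices_induct)
      case (add_unit i p)
      then show ?case
        unfolding walg_of_t_step using monomial(1) by (intro assms(7,4)) (auto simp: A_xmono)
    qed (use assms monomial in auto)
    then show ?case
      unfolding walg_of_mult using monomial by (intro assms(7,2)) (auto simp: A_xmono)
  qed (auto simp: walg_of_add intro!: assms(6))
  moreover have "P (pd_pow \<mu>)" using monomial(2)
  proof (induction \<mu> rule: multi_indices_induct)
    case zero
    show ?case using assms(2)[of 1] by simp
  next
    case (add_unit \<mu> p)
    then show ?case by (simp add: pd_pow_add Wc_pd_pow assms(5,7))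
  qed
  ultimately show ?case using monomial by (intro assms(7)) (auto simp: Wc_pd_pow)
qed (auto intro: assms(6))

subsection \<open>Elements of low order\<close>

lemma order_1_expand:
  assumes "ord_le 1 w" "w \<in> Wc"
  shows "w = walg_of (cf w 0) + (\<Sum>q<l. walg_of (cf w (unit_index q)) * pd q)"
proof (rule walg_cf_eqI)
  fix \<mu>
  have sum: "cf (\<Sum>q<l. walg_of (cf w (unit_index q)) * pd q) \<mu> =
      (\<Sum>q<l. if \<mu> = unit_index q then cf w (unit_index q) else 0)"
    by (simp add: cf_sum cf_monomial flip: pd_pow_unit_index)
  show "cf w \<mu> = cf (walg_of (cf w 0) + (\<Sum>q<l. walg_of (cf w (unit_index q)) * pd q)) \<mu>"
  proof (cases "mdeg \<mu> \<le> 1")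
    case True
    then show ?thesis
    proof (cases \<mu> rule: mdeg_le_1_cases)
      case (2 p)
      then have "cf w (unit_index p) = 0" if "\<not> p < l"
        using that Wc_index[OF assms(2), of \<mu>] by auto
      then show ?thesis using 2 sum by (cases "p < l") auto
    qed (use sum in auto)
  next
    case False
    then have "cf w \<mu> = 0" using assms(1) by (auto simp: ord_le_def)
    moreover have "\<mu> \<noteq> 0" "\<mu> \<noteq> unit_index q" for q using False by auto
    ultimately show ?thesis using sum by simp
  qed
qed

lemma br_order_1:
  assumes "ord_le 1 w" "w \<in> Wc"
  shows "br w (walg_of v) = walg_of (\<Sum>q<l. cf w (unit_index q) * xderiv q v)"
  by (subst order_1_expand[OF assms])
    (simp add: br_add_left br_sum_left br_mult_left walg_of_sum walg_of_mult)

lemma br_order_1_xw: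
  assumes "ord_le 1 w" "w \<in> Wc"
  shows "br w (xw \<alpha>) =
    walg_of ((\<Sum>q<l. Poly_Mapping.single 0 (coef \<alpha> q) * cf w (unit_index q)) * xmono \<alpha> 0)"
  unfolding br_order_1[OF assms] xderiv_xmono sum_distrib_right
  by (simp only: mult.assoc mult.left_commute)

text \<open>For each exponent \<open>k\<close> the coefficients form a vector orthogonal to
  \<Gamma>.\<close>

lemma coefficients_orthogonal:
  assumes "\<And>\<beta>. \<beta> \<in> \<Gamma> \<Longrightarrow> coef (\<Sum>q<l. Poly_Mapping.single 0 (coef \<beta> q) * u q) k = 0" "p < l"
  shows "coef (u p :: 'f salg) k = 0"
  using assms by (intro orthogonal_Gamma[of "\<lambda>q. coef (u q) k"]) (auto simp: lookup_sum coef_const_mult)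

lemma xmono_cancel:
  fixes u v :: "'f salg"
  shows "u * xmono \<alpha> 0 = v * xmono \<alpha> 0 \<longleftrightarrow> u = v"
proof
  assume "u * xmono \<alpha> 0 = v * xmono \<alpha> 0"
  then have "u * xmono \<alpha> 0 * xmono (- \<alpha>) 0 = v * xmono \<alpha> 0 * xmono (- \<alpha>) 0" by simp
  then show "u = v" by (simp add: mult.assoc xmono_add)
qed simp

text \<open>For \<open>q \<ge> l1\<close> the element t_q is outside the algebra, yet the bracket
  stays inside because it only shifts and rescales coefficients. This allows the order to be lowered
  in all directions.\<close>

lemma br_tw_in: "w \<in> Wc \<Longrightarrow> br w (tw q) \<in> Wc"
  unfolding Wc_def
proof (clarsimp simp del: lookup_not_eq_zero_eq_in_keys of_nat_Suc simp: cf_br_tw of_nat_Suc_mult_eq_0, intro conjI allI impI)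
  fix \<mu>
  assume *: "\<forall>\<mu>. cf w \<mu> \<noteq> 0 \<longrightarrow> \<mu> \<in> multi_indices l" "\<forall>\<mu>. cf w \<mu> \<in> A"
  show "\<mu> \<in> multi_indices l" if "cf w (\<mu> + unit_index q) \<noteq> 0"
    using *(1) that add_in_multi_indices by blast
  have "of_nat (Suc (coef \<mu> q)) \<in> A" unfolding single_of_nat[symmetric] by (rule A_const)
  then show "of_nat (Suc (coef \<mu> q)) * cf w (\<mu> + unit_index q) \<in> A"
    using *(2) A_mult by blast
qed

lemma order_le_Suc_0_if_br_tw:
  assumes "\<And>q. ord_le 0 (br w (tw q))"
  shows "ord_le 1 w"
  unfolding ord_le_def
proof (intro allI impI)
  fix \<mu> assume nz: "cf w \<mu> \<noteq> 0"
  show "mdeg \<mu> \<le> 1"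
  proof (cases \<mu> rule: mindex_cases)
    case (2 \<nu> q)
    then have "cf (br w (tw q)) \<nu> \<noteq> 0"
      using nz by (simp only: cf_br_tw of_nat_Suc_mult_eq_0 not_False_eq_True)
    then show ?thesis using assms[of q] 2 by (auto simp: ord_le_def)
  qed simp
qed

text \<open>Bracketing with t_q lowers the order and keeps the hypothesis, since t_q commutes with
  x^\<beta>. By induction these brackets lie in \<open>A\<close>, so \<open>w\<close> has order at
  most 1; its bracket with x^\<beta> is then a linear form in \<beta>, and a form vanishing on
  \<Gamma> is zero.\<close>

lemma centralizer_xw:
  assumes "w \<in> Wc" "\<And>\<beta>. \<beta> \<in> \<Gamma> \<Longrightarrow> br w (xw \<beta>) = 0"
  shows "ord_le 0 w"
proof -
  have "ord_le 0 w"
    if "ord_le n w" "w \<in> Wc" "\<And>\<beta>. \<beta> \<in> \<Gamma> \<Longrightarrow> br w (xw \<beta>) = 0" for n w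
    using that
  proof (induction n arbitrary: w)
    case (Suc n)
    have "ord_le 0 (br w (tw q))" for q
    proof (rule Suc.IH)
      show "ord_le n (br w (tw q))" using Suc.prems(1) by (rule ord_le_br_tw)
      show "br w (tw q) \<in> Wc" using Suc.prems(2) by (rule br_tw_in)
      show "br (br w (tw q)) (xw \<beta>) = 0" if "\<beta> \<in> \<Gamma>" for \<beta>
        using br_jacobi[of w "tw q" "xw \<beta>"] Suc.prems(3)[OF that] by simp
    qed
    then have o1: "ord_le 1 w" by (rule order_le_Suc_0_if_br_tw)
    have "coef (cf w (unit_index q)) k = 0" if "q < l" for q k
    proof (rule coefficients_orthogonal[OF _ that])
      fix \<beta> assume "\<beta> \<in> \<Gamma>"
      from Suc.prems(3)[OF this] have "(\<Sum>q<l. Poly_Mapping.single 0 (coef \<beta> q) * cf w (unit_index q)) *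
          xmono \<beta> 0 = 0 * xmono \<beta> 0"
        by (simp add: br_order_1_xw[OF o1 Suc.prems(2)])
      then show "coef (\<Sum>q<l. Poly_Mapping.single 0 (coef \<beta> q) * cf w (unit_index q)) k = 0"
        unfolding xmono_cancel by simp
    qed
    then have "cf w (unit_index q) = 0" if "q < l" for q
      using that by (intro poly_mapping_eqI) simp
    then have "w = walg_of (cf w 0)" by (subst order_1_expand[OF o1 Suc.prems(2)]) simp
    then show ?case by (simp only: ord_le_0)
  qed
  then show ?thesis using assms ord_le_exists by blast
qed

text \<open>By the Jacobi identity the bracket of \<open>w\<close> with t_q commutes with every
  x^\<beta>, because the elements of \<open>A\<close> commute with t_q.\<close>

lemma order_1_if_br_xw:
  assumes "w \<in> Wc" "\<And>\<beta>. \<beta> \<in> \<Gamma> \<Longrightarrow> \<exists>u. br w (xw \<beta>) = walg_of u"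
  shows "ord_le 1 w"
proof (rule order_le_Suc_0_if_br_tw, rule centralizer_xw)
  fix q \<beta> assume "\<beta> \<in> \<Gamma>"
  then obtain u where "br w (xw \<beta>) = walg_of u" using assms(2) by blast
  then show "br (br w (tw q)) (xw \<beta>) = 0"
    using br_jacobi[of w "tw q" "xw \<beta>"] br_jacobi[of "tw q" w "xw \<beta>"] br_swap[of w "tw q"]
    by (simp add: br_minus_left)
qed (rule br_tw_in[OF assms(1)])

text \<open>The eigenvalue of each \<partial>_p fixes one coordinate of the weight and excludes
  powers of t_p, so a single exponent remains.\<close>

lemma joint_eigenvector:
  assumes "u \<in> A" "\<beta> \<in> vecs l" "\<And>p. p < l \<Longrightarrow> xderiv p u = Poly_Mapping.single 0 (coef \<beta> p) * u"
  shows "u = Poly_Mapping.single 0 (coef u (\<beta>, 0)) * xmono \<beta> 0"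
proof -
  have "supp u \<subseteq> {(\<beta>, 0)}"
  proof (rule subsetI)
    fix k' assume k': "k' \<in> supp u"
    obtain \<alpha> i where k'_eq: "k' = (\<alpha>, i)" by fastforce
    with k' have k: "(\<alpha>, i) \<in> supp u" by simp
    then have "\<alpha> \<in> \<Gamma>" "i \<in> multi_indices l1" using assms(1) by (auto simp: A_iff)
    have "\<alpha> = \<beta>"
      using eigen_support[OF assms(3) k] assms(2) Gamma_vecs \<open>\<alpha> \<in> \<Gamma>\<close>
      by (intro vecs_eqI[of \<alpha> l \<beta>]) auto
    moreover have "i = 0"
    proof (rule poly_mapping_eqI)
      fix p
      show "coef i p = coef 0 p"
        using eigen_support[OF assms(3) k] \<open>i \<in> multi_indices l1\<close>
        by (cases "p < l1") (auto simp: multi_indices_iff)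
    qed
    ultimately show "k' \<in> {(\<beta>, 0)}" by (simp add: k'_eq)
  qed
  from supp_subset_singleton[OF this] show ?thesis
    by (simp add: xmono_def mult_single)
qed

lemma joint_kernel:
  assumes "u \<in> A" "\<And>p. p < l \<Longrightarrow> xderiv p u = 0"
  obtains c where "u = Poly_Mapping.single 0 c"
  using joint_eigenvector[OF assms(1), of 0] assms(2) that by (auto simp: vecs_def)

end


section \<open>Construction of homomorphisms\<close>

lemma of_nat_left_commute: "a * (of_nat n * b) = of_nat n * (a * (b :: 'a::ring_1))"
  by (simp only: mult.assoc[symmetric] mult_of_nat_commute[of n a])

lemma pd_pow_pd: "pd_pow \<mu> * (pd p * z) = pd p * (pd_pow \<mu> * (z :: 'a::field_char_0 walg))"
proof -
  have "pd_pow \<mu> * pd p = (pd p * pd_pow \<mu> :: 'a walg)"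
    using pd_pow_commute[of \<mu> "unit_index p"] by simp
  then show ?thesis by (simp only: mult.assoc[symmetric])
qed

lemma br_of_nat_right: "br a (of_nat k * b) = of_nat k * br a b"
  by (simp add: br_def right_diff_distrib of_nat_left_commute mult.assoc)

definition mindex_prod :: "(nat \<Rightarrow> 'a::ring_1) \<Rightarrow> mindex \<Rightarrow> 'a" where
  "mindex_prod G \<mu> = mindex_iterate (\<lambda>p w. G p * w) \<mu> 1"

lemma mindex_prod_zero [simp]: "mindex_prod G 0 = 1"
  by (simp add: mindex_prod_def)

lemma mindex_prod_add_unit:
  assumes "\<And>p q. G p * G q = G q * G p"
  shows "mindex_prod G (\<mu> + unit_index p) = G p * mindex_prod G \<mu>"
  unfolding mindex_prod_def using assms
  by (intro mindex_iterate_add_unit) (simp only: mult.assoc[symmetric])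

definition linear_extension ::
  "('f::field_char_0 fvec \<times> mindex \<Rightarrow> mindex \<Rightarrow> 'f walg) \<Rightarrow> 'f walg \<Rightarrow> 'f walg" where
  "linear_extension img w =
     (\<Sum>\<mu>\<in>supp (rep_walg w). \<Sum>k\<in>supp (cf w \<mu>). kst (coef (cf w \<mu>) k) * img k \<mu>)"

lemma linear_extension_add:
  "linear_extension img (a + b) = linear_extension img a + linear_extension img b"
proof -
  define f where "f \<mu> u = (\<Sum>k\<in>supp u. kst (coef u k) * img k \<mu>)" for \<mu> u
  have f_add: "f \<mu> (u + v) = f \<mu> u + f \<mu> v" for \<mu> u v
    unfolding f_def
    by (rule setsum_keys_plus_distrib[where f = "\<lambda>k c. kst c * img k \<mu>"])
      (simp_all add: kst_add distrib_right)
  have eq: "linear_extension img w = (\<Sum>\<mu>\<in>supp (rep_walg w). f \<mu> (cf w \<mu>))" for w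
    by (simp only: linear_extension_def f_def)
  have f_zero: "f \<mu> 0 = 0" for \<mu> by (simp add: f_def)
  show ?thesis
    unfolding eq rep_walg_simps
    by (rule setsum_keys_plus_distrib[where f = f]) (rule f_zero f_add)+
qed

lemma linear_extension_zero [simp]: "linear_extension img 0 = 0"
  by (simp add: linear_extension_def rep_walg_simps)

lemma linear_extension_monomial:
  "linear_extension img (walg_of (Poly_Mapping.single k c) * pd_pow \<mu>) = kst c * img k \<mu>"
proof (cases "c = 0")
  case False
  then have "Poly_Mapping.single k c \<noteq> 0" by (metis lookup_single_eq lookup_zero)
  with False show ?thesis
    unfolding walg_of_mult_pd_pow by (simp add: linear_extension_def)
qed simp

lemma walg_monomial_induct [case_names zero monomial add]:
  assumes "P 0" "\<And>k c \<mu>. P (walg_of (Poly_Mapping.single k c) * pd_pow \<mu>)"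
    "\<And>a b. P a \<Longrightarrow> P b \<Longrightarrow> P (a + b)"
  shows "P (w :: 'f::field_char_0 walg)"
proof (induction w rule: walg_induct)
  case (monomial u \<mu>)
  show ?case
    by (induction u rule: poly_mapping_induct)
      (use assms in \<open>auto simp: walg_of_add distrib_right\<close>)
qed (use assms in auto)

lemma linear_extension_kst:
  "linear_extension img (kst c * w) = kst c * linear_extension img w"
proof (induction w rule: walg_monomial_induct)
  case (monomial k d \<mu>)
  have "kst c * (walg_of (Poly_Mapping.single k d) * pd_pow \<mu>) =
      walg_of (Poly_Mapping.single k (c * d)) * pd_pow \<mu>"
    by (simp add: mult.assoc[symmetric] mult_single flip: walg_of_mult)
  then show ?case by (simp add: linear_extension_monomial kst_mult mult.assoc)
qed (simp_all add: linear_extension_add distrib_left)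

context weyl_type
begin

lemma Wc_monomial_induct [consumes 1, case_names zero monomial add]:
  assumes "w \<in> Wc" "P 0"
    "\<And>\<alpha> i c \<mu>. \<alpha> \<in> \<Gamma> \<Longrightarrow> i \<in> multi_indices l1 \<Longrightarrow> \<mu> \<in> multi_indices l \<Longrightarrow>
      P (walg_of (Poly_Mapping.single (\<alpha>, i) c) * pd_pow \<mu>)"
    "\<And>a b. a \<in> Wc \<Longrightarrow> b \<in> Wc \<Longrightarrow> P a \<Longrightarrow> P b \<Longrightarrow> P (a + b)"
  shows "P w"
  using assms(1)
proof (induction w rule: Wc_linear_induct)
  case (monomial u \<mu>)
  from monomial(1) show ?case
  proof (induction u rule: A_induct)
    case (monomial \<alpha> i c)
    then show ?case
      using assms(3)[of \<alpha> i \<mu> c] \<open>\<mu> \<in> multi_indices l\<close> by (simp add: xmono_def mult_single)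
  next
    case (add u v)
    then show ?case
      using assms(4)[of "walg_of u * pd_pow \<mu>" "walg_of v * pd_pow \<mu>"] \<open>\<mu> \<in> multi_indices l\<close>
      by (simp add: walg_of_add distrib_right Wc_monomial)
  qed
qed (use assms in auto)

text \<open>The conditions are confined to \<open>Wc\<close>, because automorphisms of the algebra
  are determined by their values there.\<close>

definition linear_map :: "('f walg \<Rightarrow> 'f walg) \<Rightarrow> bool" where
  "linear_map S \<longleftrightarrow> (\<forall>a\<in>Wc. S a \<in> Wc) \<and> (\<forall>a\<in>Wc. \<forall>b\<in>Wc. S (a + b) = S a + S b) \<and>
     (\<forall>c. \<forall>a\<in>Wc. S (kst c * a) = kst c * S a)"

definition assoc_hom :: "('f walg \<Rightarrow> 'f walg) \<Rightarrow> bool" where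
  "assoc_hom S \<longleftrightarrow> linear_map S \<and> S 1 = 1 \<and> (\<forall>a\<in>Wc. \<forall>b\<in>Wc. S (a * b) = S a * S b)"

definition lie_hom :: "('f walg \<Rightarrow> 'f walg) \<Rightarrow> bool" where
  "lie_hom S \<longleftrightarrow> linear_map S \<and> (\<forall>a\<in>Wc. \<forall>b\<in>Wc. S (br a b) = br (S a) (S b))"

lemma linear_mapD:
  assumes "linear_map S"
  shows "a \<in> Wc \<Longrightarrow> S a \<in> Wc" "a \<in> Wc \<Longrightarrow> b \<in> Wc \<Longrightarrow> S (a + b) = S a + S b"
    "a \<in> Wc \<Longrightarrow> S (kst c * a) = kst c * S a" "S 0 = 0" "a \<in> Wc \<Longrightarrow> S (- a) = - S a"
    "a \<in> Wc \<Longrightarrow> b \<in> Wc \<Longrightarrow> S (a - b) = S a - S b" "S (kst c) = kst c * S 1"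
proof -
  show 1: "a \<in> Wc \<Longrightarrow> S a \<in> Wc" "a \<in> Wc \<Longrightarrow> b \<in> Wc \<Longrightarrow> S (a + b) = S a + S b"
    "a \<in> Wc \<Longrightarrow> S (kst c * a) = kst c * S a" for a b c
    using assms by (auto simp: linear_map_def)
  show "S 0 = 0" using 1(2)[of 0 0] by simp
  show 2: "S (- a) = - S a" if "a \<in> Wc" for a
    using 1(3)[OF that, of "- 1"] by (simp add: single_uminus walg_of_uminus)
  show "S (a - b) = S a - S b" if "a \<in> Wc" "b \<in> Wc"
    using 1(2)[of a "- b"] 2[of b] that by (simp add: Wc_uminus)
  show "S (kst c) = kst c * S 1" using 1(3)[of 1 c] by simp
qed

lemma linear_map_sum:
  assumes "linear_map S" "\<And>x. x \<in> X \<Longrightarrow> f x \<in> Wc"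
  shows "S (sum f X) = (\<Sum>x\<in>X. S (f x))"
  using assms(2)
  by (induction X rule: infinite_finite_induct) (simp_all add: linear_mapD[OF assms(1)] Wc_sum)

lemma assoc_homD:
  assumes "assoc_hom S"
  shows "linear_map S" "S 1 = 1" "a \<in> Wc \<Longrightarrow> b \<in> Wc \<Longrightarrow> S (a * b) = S a * S b"
  using assms by (auto simp: assoc_hom_def)

lemma assoc_hom_lie_hom: "assoc_hom S \<Longrightarrow> lie_hom S"
  by (simp add: lie_hom_def assoc_hom_def br_def linear_mapD(6) Wc_mult)

text \<open>The elements \<open>a\<close> for which S(a b) = S(a) S(b) holds for all
  \<open>b\<close> are closed under sums and products, so generators on the left suffice.\<close>

lemma assoc_homI:
  assumes lin: "linear_map S" and one: "S 1 = 1"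
    and "\<And>\<alpha> w. \<alpha> \<in> \<Gamma> \<Longrightarrow> w \<in> Wc \<Longrightarrow> S (xw \<alpha> * w) = S (xw \<alpha>) * S w"
    and "\<And>p w. p < l1 \<Longrightarrow> w \<in> Wc \<Longrightarrow> S (tw p * w) = S (tw p) * S w"
    and "\<And>p w. p < l \<Longrightarrow> w \<in> Wc \<Longrightarrow> S (pd p * w) = S (pd p) * S w"
  shows "assoc_hom S"
  unfolding assoc_hom_def
proof (intro conjI ballI lin one)
  fix a b assume "a \<in> Wc" "b \<in> Wc"
  then show "S (a * b) = S a * S b"
  proof (induction a arbitrary: b rule: Wc_generators_induct)
    case (kst c)
    then show ?case by (simp add: linear_mapD[OF lin] one)
  next
    case (add a a')
    then show ?case by (simp add: distrib_right linear_mapD[OF lin] Wc_mult)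
  next
    case (mult a a')
    then show ?case by (simp add: mult.assoc Wc_mult)
  qed (use assms in auto)
qed

lemma assoc_hom_eqI:
  assumes S: "assoc_hom S" and T: "assoc_hom T"
    and "\<And>\<alpha>. \<alpha> \<in> \<Gamma> \<Longrightarrow> S (xw \<alpha>) = T (xw \<alpha>)" "\<And>p. p < l1 \<Longrightarrow> S (tw p) = T (tw p)"
    "\<And>p. p < l \<Longrightarrow> S (pd p) = T (pd p)" "w \<in> Wc"
  shows "S w = T w"
  using assms(6)
proof (induction w rule: Wc_generators_induct)
  case (kst c)
  show ?case
    by (simp only: linear_mapD(7)[OF assoc_homD(1)[OF S]] linear_mapD(7)[OF assoc_homD(1)[OF T]]
        assoc_homD(2)[OF S] assoc_homD(2)[OF T])
next
  case (add a b)
  then show ?case by (simp add: linear_mapD[OF assoc_homD(1)[OF S]] linear_mapD[OF assoc_homD(1)[OF T]])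
next
  case (mult a b)
  then show ?case by (simp add: assoc_homD[OF S] assoc_homD[OF T])
qed (use assms in auto)

lemma assoc_hom_id: "assoc_hom (\<lambda>w. w)"
  by (simp add: assoc_hom_def linear_map_def)

lemma linear_map_comp: "linear_map S \<Longrightarrow> linear_map T \<Longrightarrow> linear_map (\<lambda>w. S (T w))"
  by (simp add: linear_map_def)

lemma assoc_hom_comp: "assoc_hom S \<Longrightarrow> assoc_hom T \<Longrightarrow> assoc_hom (\<lambda>w. S (T w))"
  by (simp add: assoc_hom_def linear_map_comp) (simp add: linear_map_def)

lemma lie_hom_comp: "lie_hom S \<Longrightarrow> lie_hom T \<Longrightarrow> lie_hom (\<lambda>w. S (T w))"
  by (simp add: lie_hom_def linear_map_comp) (simp add: linear_map_def)

end

text \<open>The universal property: proposed images of the generators that satisfy the defining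
  relations. The relations \<open>T_T\<close> and \<open>D_D\<close> carry no bound on the indices
  because the recursion for \<open>mindex_prod\<close> asks for commuting families.\<close>

locale weyl_relations = weyl_type +
  fixes X :: "'a fvec \<Rightarrow> 'a::field_char_0 walg" and T D :: "nat \<Rightarrow> 'a walg"
  assumes X_in: "\<alpha> \<in> \<Gamma> \<Longrightarrow> X \<alpha> \<in> Wc" and T_in: "p < l1 \<Longrightarrow> T p \<in> Wc" and D_in: "p < l \<Longrightarrow> D p \<in> Wc"
    and X_zero: "X 0 = 1"
    and X_add: "\<alpha> \<in> \<Gamma> \<Longrightarrow> \<beta> \<in> \<Gamma> \<Longrightarrow> X (\<alpha> + \<beta>) = X \<alpha> * X \<beta>"
    and T_X: "\<alpha> \<in> \<Gamma> \<Longrightarrow> p < l1 \<Longrightarrow> T p * X \<alpha> = X \<alpha> * T p"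
    and T_T: "T p * T q = T q * T p" and D_D: "D p * D q = D q * D p"
    and D_X: "\<alpha> \<in> \<Gamma> \<Longrightarrow> p < l \<Longrightarrow> D p * X \<alpha> = X \<alpha> * D p + kst (coef \<alpha> p) * X \<alpha>"
    and D_T: "p < l \<Longrightarrow> q < l1 \<Longrightarrow> D p * T q = T q * D p + (if p = q then 1 else 0)"
begin

abbreviation "TT \<equiv> mindex_prod T"
abbreviation "DD \<equiv> mindex_prod D"

definition gen_hom :: "'a walg \<Rightarrow> 'a walg" where
  "gen_hom = linear_extension (\<lambda>(\<alpha>, i) \<mu>. X \<alpha> * (TT i * DD \<mu>))"

lemma TT_add: "TT (i + unit_index p) = T p * TT i"
  by (rule mindex_prod_add_unit) (rule T_T)

lemma DD_add: "DD (\<mu> + unit_index p) = D p * DD \<mu>"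
  by (rule mindex_prod_add_unit) (rule D_D)

lemma TT_in: "i \<in> multi_indices l1 \<Longrightarrow> TT i \<in> Wc"
  by (induction i rule: multi_indices_induct) (auto simp: TT_add intro: Wc_mult T_in)

lemma DD_in: "\<mu> \<in> multi_indices l \<Longrightarrow> DD \<mu> \<in> Wc"
  by (induction \<mu> rule: multi_indices_induct) (auto simp: DD_add intro: Wc_mult D_in)

text \<open>The counterpart, for the images, of the rule that \<partial>_p differentiates
  t^i.\<close>

lemma D_TT:
  assumes "p < l" "i \<in> multi_indices l1"
  shows "D p * TT i = TT i * D p + of_nat (coef i p) * TT (i - unit_index p)"
  using assms(2)
proof (induction i rule: multi_indices_induct)
  case (add_unit i q)
  have "D p * TT (i + unit_index q) = (D p * T q) * TT i" by (simp add: TT_add mult.assoc)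
  also have "\<dots> = T q * (D p * TT i) + (if p = q then TT i else 0)"
    by (simp add: D_T[OF assms(1) add_unit(2)] distrib_right mult.assoc)
  also have "\<dots> = TT (i + unit_index q) * D p +
      (of_nat (coef i p) * (T q * TT (i - unit_index p)) + (if p = q then TT i else 0))"
    by (simp add: add_unit(3) TT_add distrib_left mult.assoc of_nat_left_commute)
  also have "of_nat (coef i p) * (T q * TT (i - unit_index p)) + (if p = q then TT i else 0) =
      of_nat (coef (i + unit_index q) p) * TT (i + unit_index q - unit_index p)"
  proof (cases "p = q")
    case True
    have "of_nat (coef i p) * (T p * TT (i - unit_index p)) = of_nat (coef i p) * TT i"
      by (cases "coef i p = 0") (simp_all add: diff_unit_index_add flip: TT_add)
    with True show ?thesis by (simp add: lookup_add distrib_right)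
  next
    case False
    then have "i + unit_index q - unit_index p = i - unit_index p + unit_index q"
      by (intro poly_mapping_eqI) (auto simp: lookup_add lookup_minus)
    with False show ?thesis by (simp add: lookup_add TT_add)
  qed
  finally show ?case .
qed simp

lemma gen_hom_monomial:
  "gen_hom (walg_of (Poly_Mapping.single (\<alpha>, i) c) * pd_pow \<mu>) = kst c * (X \<alpha> * (TT i * DD \<mu>))"
  by (simp add: gen_hom_def linear_extension_monomial)

lemma gen_hom_add: "gen_hom (a + b) = gen_hom a + gen_hom b"
  by (simp add: gen_hom_def linear_extension_add)

lemma gen_hom_zero [simp]: "gen_hom 0 = 0"
  by (simp add: gen_hom_def)

lemma linear_map_gen_hom: "linear_map gen_hom"
  unfolding linear_map_def
proof (intro conjI ballI allI)
  fix a assume "a \<in> Wc"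
  then show "gen_hom a \<in> Wc"
    by (induction a rule: Wc_monomial_induct)
      (simp_all add: gen_hom_add Wc_add gen_hom_monomial Wc_kst_mult Wc_mult X_in TT_in DD_in)
qed (simp_all add: gen_hom_add, simp add: gen_hom_def linear_extension_kst)

text \<open>Left multiplication by a generator rewrites a normally ordered monomial by the
  relations; the images obey the same relations, so the rewriting commutes with
  \<open>gen_hom\<close>. Only \<partial>_p produces extra terms, one from x^\<alpha> and one from
  t^i.\<close>

lemma gen_hom_left:
  assumes "w \<in> Wc"
  shows "\<beta> \<in> \<Gamma> \<Longrightarrow> gen_hom (xw \<beta> * w) = X \<beta> * gen_hom w"
    and "p < l1 \<Longrightarrow> gen_hom (tw p * w) = T p * gen_hom w"
    and "p < l \<Longrightarrow> gen_hom (pd p * w) = D p * gen_hom w"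
proof -
  assume \<beta>: "\<beta> \<in> \<Gamma>"
  show "gen_hom (xw \<beta> * w) = X \<beta> * gen_hom w" using assms
  proof (induction w rule: Wc_monomial_induct)
    case (monomial \<alpha> i c \<mu>)
    have "xw \<beta> * (walg_of (Poly_Mapping.single (\<alpha>, i) c) * pd_pow \<mu>) =
        walg_of (Poly_Mapping.single (\<beta> + \<alpha>, i) c) * pd_pow \<mu>"
      by (simp add: mult.assoc[symmetric] xmono_def mult_single flip: walg_of_mult)
    then show ?case
      by (simp add: gen_hom_monomial X_add monomial(1) \<beta> mult.assoc kst_left_commute)
  qed (simp_all add: gen_hom_add distrib_left)
next
  assume p: "p < l1"
  show "gen_hom (tw p * w) = T p * gen_hom w" using assms
  proof (induction w rule: Wc_monomial_induct)
    case (monomial \<alpha> i c \<mu>)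
    have "tw p * (walg_of (Poly_Mapping.single (\<alpha>, i) c) * pd_pow \<mu>) =
        walg_of (Poly_Mapping.single (\<alpha>, i + unit_index p) c) * pd_pow \<mu>"
      by (simp add: mult.assoc[symmetric] xmono_def mult_single add.commute flip: walg_of_mult)
    moreover have "T p * (X \<alpha> * z) = X \<alpha> * (T p * z)" for z
      by (simp add: mult.assoc[symmetric] T_X[OF monomial(1) p])
    ultimately show ?case
      by (simp add: gen_hom_monomial TT_add mult.assoc kst_left_commute)
  qed (simp_all add: gen_hom_add distrib_left)
next
  assume p: "p < l"
  show "gen_hom (pd p * w) = D p * gen_hom w" using assms
  proof (induction w rule: Wc_monomial_induct)
    case (monomial \<alpha> i c \<mu>)
    let ?x = "Poly_Mapping.single (\<alpha>, i) c"
    have "pd p * (walg_of ?x * pd_pow \<mu>) = walg_of ?x * pd_pow (\<mu> + unit_index p) +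
        walg_of (Poly_Mapping.single (\<alpha>, i) (coef \<alpha> p * c)) * pd_pow \<mu> +
        walg_of (Poly_Mapping.single (\<alpha>, i - unit_index p) (of_nat (coef i p) * c)) * pd_pow \<mu>"
      by (simp add: mult.assoc[symmetric] pd_walg_of distrib_right pd_pow_add xderiv_single walg_of_add
          add.assoc) (simp add: mult.assoc pd_pow_commute[of _ "unit_index p", simplified])
    then have "gen_hom (pd p * (walg_of ?x * pd_pow \<mu>)) =
        kst c * (X \<alpha> * (TT i * (D p * DD \<mu>))) + kst c * (kst (coef \<alpha> p) * (X \<alpha> * (TT i * DD \<mu>))) +
        kst c * (of_nat (coef i p) * (X \<alpha> * (TT (i - unit_index p) * DD \<mu>)))"
      by (simp add: gen_hom_add gen_hom_monomial DD_add mult.commute[of "coef \<alpha> p"] kst_mult mult.assoc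
          of_nat_left_commute)
    moreover have "D p * (X \<alpha> * (TT i * DD \<mu>)) = X \<alpha> * ((D p * TT i) * DD \<mu>) +
        kst (coef \<alpha> p) * (X \<alpha> * (TT i * DD \<mu>))"
      by (simp add: mult.assoc[symmetric] D_X[OF monomial(1) p] distrib_right)
    moreover have "X \<alpha> * ((D p * TT i) * DD \<mu>) = X \<alpha> * (TT i * (D p * DD \<mu>)) +
        of_nat (coef i p) * (X \<alpha> * (TT (i - unit_index p) * DD \<mu>))"
      by (simp add: D_TT[OF p monomial(2)] distrib_right distrib_left mult.assoc of_nat_left_commute)
    ultimately show ?case
      by (simp add: gen_hom_monomial kst_left_commute[of "D p"] distrib_left)
  qed (simp_all add: gen_hom_add distrib_left)
qed

lemma gen_hom_one: "gen_hom 1 = 1"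
  using gen_hom_monomial[of 0 0 1 0] by (simp add: X_zero zero_prod_def[symmetric])

lemma gen_hom_generators:
  "\<alpha> \<in> \<Gamma> \<Longrightarrow> gen_hom (xw \<alpha>) = X \<alpha>" "p < l1 \<Longrightarrow> gen_hom (tw p) = T p" "p < l \<Longrightarrow> gen_hom (pd p) = D p"
  using gen_hom_left[of 1] gen_hom_one by simp_all

lemma assoc_hom_gen_hom: "assoc_hom gen_hom"
  by (rule assoc_homI) (simp_all add: linear_map_gen_hom gen_hom_one gen_hom_left gen_hom_generators)

end

context weyl_type
begin

subsection \<open>Affine substitutions\<close>

text \<open>Hypothesis \<open>g\<close> gives x^(\<pi> \<alpha>) the eigenvalue \<alpha>_p under the
  image of \<partial>_p, and \<open>n\<close> makes the images of \<partial>_p and t_r dual to each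
  other. The constants \<open>\<tau>\<close> and \<open>v\<close> are central and do not enter the
  brackets.\<close>

lemma weyl_relations_affine:
  assumes f: "f 0 = 1" "\<And>\<alpha> \<beta>. \<alpha> \<in> \<Gamma> \<Longrightarrow> \<beta> \<in> \<Gamma> \<Longrightarrow> f (\<alpha> + \<beta>) = f \<alpha> * (f \<beta> :: 'f)"
    and \<pi>: "\<pi> 0 = 0" "\<And>\<alpha> \<beta>. \<alpha> \<in> \<Gamma> \<Longrightarrow> \<beta> \<in> \<Gamma> \<Longrightarrow> \<pi> (\<alpha> + \<beta>) = \<pi> \<alpha> + \<pi> \<beta>"
      "\<And>\<alpha>. \<alpha> \<in> \<Gamma> \<Longrightarrow> \<pi> \<alpha> \<in> \<Gamma>"
    and g: "\<And>\<alpha> p. \<alpha> \<in> \<Gamma> \<Longrightarrow> p < l \<Longrightarrow> (\<Sum>q<l. g q p * coef (\<pi> \<alpha>) q) = coef \<alpha> p"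
    and n: "\<And>p r. p < l \<Longrightarrow> r < l1 \<Longrightarrow> (\<Sum>s<l1. g s p * n s r) = (if p = r then 1 else 0)"
  shows "weyl_relations l1 l2 \<Gamma> (\<lambda>\<alpha>. kst (f \<alpha>) * xw (\<pi> \<alpha>))
    (\<lambda>r. (\<Sum>s<l1. kst (n s r) * tw s) + kst (\<tau> r)) (\<lambda>p. (\<Sum>q<l. kst (g q p) * pd q) + kst (v p))"
proof unfold_locales
  let ?X = "\<lambda>\<alpha>. kst (f \<alpha>) * xw (\<pi> \<alpha>)" and ?T = "\<lambda>r. (\<Sum>s<l1. kst (n s r) * tw s) + kst (\<tau> r)"
    and ?D = "\<lambda>p. (\<Sum>q<l. kst (g q p) * pd q) + kst (v p)"
  have br_eq: "a * b = b * a + c" if "br a b = c" for a b c :: "'f walg"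
    using that by (simp add: br_def algebra_simps)
  show "?X \<alpha> \<in> Wc" if "\<alpha> \<in> \<Gamma>" for \<alpha> using \<pi>(3)[OF that] by (intro Wc_kst_mult) (simp add: A_xmono)
  show "?T p \<in> Wc" if "p < l1" for p by (intro Wc_add Wc_sum Wc_kst_mult Wc_kst) (simp add: A_xmono)
  show "?D p \<in> Wc" if "p < l" for p by (intro Wc_add Wc_sum Wc_kst_mult Wc_kst) simp
  show "?X 0 = 1" by (simp add: f \<pi>)
  show "?X (\<alpha> + \<beta>) = ?X \<alpha> * ?X \<beta>" if "\<alpha> \<in> \<Gamma>" "\<beta> \<in> \<Gamma>" for \<alpha> \<beta>
    using that by (simp add: f \<pi> kst_mult xw_add mult.assoc kst_left_commute[of "xw _"])
  show "?T p * ?X \<alpha> = ?X \<alpha> * ?T p" if "p < l1" for \<alpha> p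
    by (simp add: walg_of_commute flip: walg_of_mult walg_of_sum walg_of_add)
  show "?T p * ?T q = ?T q * ?T p" for p q
    by (simp add: walg_of_commute flip: walg_of_mult walg_of_sum walg_of_add)
  have "br (?D p) (?D q) = 0" for p q
    by (simp add: br_add_left br_add_right br_sum_left br_sum_right br_kst_left br_kst_right)
  from br_eq[OF this] show "?D p * ?D q = ?D q * ?D p" for p q by simp
  have "br (?D p) (?X \<alpha>) = kst (coef \<alpha> p) * ?X \<alpha>" if "\<alpha> \<in> \<Gamma>" "p < l" for p \<alpha>
  proof -
    have "br (?D p) (?X \<alpha>) = kst (f \<alpha>) * ((\<Sum>q<l. kst (g q p * coef (\<pi> \<alpha>) q)) * xw (\<pi> \<alpha>))"
      unfolding br_kst_right
      by (simp add: br_add_left br_sum_left br_kst_left xderiv_xmono walg_of_mult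
          sum_distrib_right kst_mult mult.assoc)
    also have "(\<Sum>q<l. kst (g q p * coef (\<pi> \<alpha>) q)) = kst (\<Sum>q<l. g q p * coef (\<pi> \<alpha>) q)"
      by (simp only: kst_sum)
    finally show ?thesis by (simp only: g[OF that] kst_left_commute[of "kst (f \<alpha>)"])
  qed
  from br_eq[OF this] show "?D p * ?X \<alpha> = ?X \<alpha> * ?D p + kst (coef \<alpha> p) * ?X \<alpha>"
    if "\<alpha> \<in> \<Gamma>" "p < l" for p \<alpha> using that by blast
  have "br (?D p) (?T r) = (if p = r then 1 else 0)" if "p < l" "r < l1" for p r
  proof -
    have "br (?D p) (?T r) = (\<Sum>s<l1. kst (n s r) * kst (g s p))"
      by (simp add: br_add_left br_add_right br_sum_left br_sum_right br_kst_left br_kst_right xderiv_t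
          if_distrib if_distribR cong: if_cong)
    also have "\<dots> = (\<Sum>s<l1. kst (g s p * n s r))"
      unfolding kst_mult by (intro sum.cong refl walg_of_commute)
    also have "\<dots> = kst (\<Sum>s<l1. g s p * n s r)" by (simp only: kst_sum)
    finally show ?thesis by (simp add: n[OF that])
  qed
  from br_eq[OF this] show "?D p * ?T r = ?T r * ?D p + (if p = r then 1 else 0)"
    if "p < l" "r < l1" for p r using that by blast
qed

subsection \<open>Exponentials\<close>

text \<open>The least annihilating power makes the series a finite sum; \<open>exp_ad_eq\<close>
  replaces it by any other annihilating power.\<close>

definition exp_ad :: "'f salg \<Rightarrow> 'f walg \<Rightarrow> 'f walg" where
  "exp_ad u w = (\<Sum>k<(LEAST n. (br (walg_of u) ^^ n) w = 0). kst (1 / fact k) * (br (walg_of u) ^^ k) w)"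

lemma exp_ad_eq:
  assumes "(br (walg_of u) ^^ n) w = 0"
  shows "exp_ad u w = (\<Sum>k<n. kst (1 / fact k) * (br (walg_of u) ^^ k) w)"
proof -
  interpret ring_derivation "br (walg_of u)" by (rule ring_derivation_br)
  define m where "m = (LEAST n. (br (walg_of u) ^^ n) w = 0)"
  have m: "(br (walg_of u) ^^ m) w = 0" "m \<le> n"
    unfolding m_def using assms by (auto intro: LeastI Least_le)
  have "exp_ad u w = (\<Sum>k<m. kst (1 / fact k) * (br (walg_of u) ^^ k) w)"
    by (simp add: exp_ad_def m_def)
  also have "\<dots> = (\<Sum>k<n. kst (1 / fact k) * (br (walg_of u) ^^ k) w)"
    using m pow_eq_0_mono[OF m(1)] by (intro sum.mono_neutral_left) auto
  finally show ?thesis .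
qed

lemma br_pow_in: "a \<in> Wc \<Longrightarrow> w \<in> Wc \<Longrightarrow> (br a ^^ k) w \<in> Wc"
  by (induction k) (auto intro: Wc_br)

lemma br_walg_of_pow_mult: "(br (walg_of u) ^^ k) (walg_of v * w) = walg_of v * (br (walg_of u) ^^ k) w"
  by (induction k) (simp_all add: br_mult_right)

text \<open>The bracket of \<open>u\<close> with \<partial>_p lies in the semigroup algebra and
  commutes with \<open>u\<close>, so the Leibniz expansion has two terms. At \<open>k = 0\<close>
  the truncated \<open>k - 1\<close> is harmless because of the factor
  \<open>of_nat k\<close>.\<close>

lemma br_walg_of_pow_pd_mult:
  "(br (walg_of u) ^^ k) (pd p * w) = pd p * (br (walg_of u) ^^ k) w -
     of_nat k * (walg_of (xderiv p u) * (br (walg_of u) ^^ (k - 1)) w)"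
proof (induction k)
  case (Suc k)
  have "of_nat k * br (walg_of u) (walg_of (xderiv p u) * (br (walg_of u) ^^ (k - 1)) w) =
      of_nat k * (walg_of (xderiv p u) * (br (walg_of u) ^^ k) w)"
    by (cases k) (simp_all add: br_mult_right)
  then show ?case
    by (simp add: Suc br_diff_right br_mult_right[of _ "pd p"] distrib_right br_of_nat_right)
qed simp

lemma exp_ad_add: "exp_ad u (a + b) = exp_ad u a + exp_ad u b"
proof -
  interpret ring_derivation "br (walg_of u)" by (rule ring_derivation_br)
  obtain m n where "(br (walg_of u) ^^ m) a = 0" "(br (walg_of u) ^^ n) b = 0"
    using br_walg_of_nilpotent by blast
  then have ab: "(br (walg_of u) ^^ (m + n)) a = 0" "(br (walg_of u) ^^ (m + n)) b = 0"
    using pow_eq_0_mono le_add1 le_add2 by blast+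
  then have "(br (walg_of u) ^^ (m + n)) (a + b) = 0" by (simp add: pow_add)
  from exp_ad_eq[OF this] exp_ad_eq[OF ab(1)] exp_ad_eq[OF ab(2)] show ?thesis
    by (simp add: pow_add distrib_left sum.distrib)
qed

lemma exp_ad_walg_of_mult: "exp_ad u (walg_of v * w) = walg_of v * exp_ad u w"
proof -
  obtain n where n: "(br (walg_of u) ^^ n) w = 0" using br_walg_of_nilpotent by blast
  then have n': "(br (walg_of u) ^^ n) (walg_of v * w) = 0" by (simp add: br_walg_of_pow_mult)
  show ?thesis
    unfolding exp_ad_eq[OF n] exp_ad_eq[OF n']
    by (simp add: br_walg_of_pow_mult sum_distrib_left kst_left_commute)
qed

text \<open>Conjugation by exp u shifts \<partial>_p by - \<partial>_p(u): in the second sum k / k!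
  is 1 / (k - 1)!, and reindexing returns the exponential series. With the rule for coefficients on
  the left this yields multiplicativity from the generators, without multiplying two series.\<close>

lemma exp_ad_pd_mult: "exp_ad u (pd p * w) = (pd p - walg_of (xderiv p u)) * exp_ad u w"
proof -
  obtain n where n: "(br (walg_of u) ^^ n) w = 0" using br_walg_of_nilpotent by blast
  let ?e = "walg_of (xderiv p u)" and ?d = "\<lambda>k. (br (walg_of u) ^^ k) w"
  have n1: "?d (Suc n) = 0" by (simp add: n)
  \<comment> \<open>One power more than for \<open>w\<close>, because \<partial>_p itself is killed
    only by the second bracket.\<close>
  have n': "(br (walg_of u) ^^ Suc n) (pd p * w) = 0"
    unfolding br_walg_of_pow_pd_mult by (simp add: n)
  have kst: "kst (of_nat k / fact k) = of_nat k * kst (1 / fact k :: 'f)" for k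
    using kst_mult[of "of_nat k" "1 / fact k :: 'f"] by simp
  have "exp_ad u (pd p * w) = (\<Sum>k<Suc n. pd p * (kst (1 / fact k) * ?d k)) -
      (\<Sum>k<Suc n. ?e * (kst (1 / fact k * of_nat k) * ?d (k - 1)))"
    unfolding exp_ad_eq[OF n'] br_walg_of_pow_pd_mult sum_subtractf[symmetric]
    by (intro sum.cong refl)
      (simp add: right_diff_distrib kst_left_commute[of "pd p"] kst_left_commute[of ?e] kst
        mult.assoc of_nat_left_commute)
  also have "(\<Sum>k<Suc n. ?e * (kst (1 / fact k * of_nat k) * ?d (k - 1))) =
      (\<Sum>k<n. ?e * (kst (1 / fact k) * ?d k))"
  proof -
    have "1 / fact (Suc k) * of_nat (Suc k) = (1 / fact k :: 'f)" for k
      by (simp only: fact_Suc) (simp add: del: of_nat_Suc)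
    then show ?thesis
      by (subst sum.lessThan_Suc_shift) (simp only: of_nat_0 mult_zero_right mult_zero_left kst_zero
          add_0 diff_Suc_1)
  qed
  also have "(\<Sum>k<Suc n. pd p * (kst (1 / fact k) * ?d k)) = (\<Sum>k<n. pd p * (kst (1 / fact k) * ?d k))"
    by (simp add: n)
  finally show ?thesis
    by (simp add: exp_ad_eq[OF n] left_diff_distrib sum_distrib_left sum_subtractf)
qed

lemma exp_ad_one: "exp_ad u 1 = 1"
  using exp_ad_eq[where u = u and n = 1 and w = 1] by simp

lemma exp_ad_walg_of: "exp_ad u (walg_of v) = walg_of v"
  using exp_ad_walg_of_mult[of u v 1] by (simp add: exp_ad_one)

lemma exp_ad_pd: "exp_ad u (pd p) = pd p - walg_of (xderiv p u)"
  using exp_ad_pd_mult[of u p 1] by (simp add: exp_ad_one)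

lemma assoc_hom_exp_ad:
  assumes "u \<in> A"
  shows "assoc_hom (exp_ad u)"
proof (rule assoc_homI)
  show "linear_map (exp_ad u)"
    unfolding linear_map_def
  proof (intro conjI ballI allI)
    fix w assume "w \<in> Wc"
    then show "exp_ad u w \<in> Wc"
      unfolding exp_ad_def using assms by (intro Wc_sum Wc_kst_mult br_pow_in) auto
  qed (simp_all add: exp_ad_add exp_ad_walg_of_mult)
qed (simp_all add: exp_ad_one exp_ad_walg_of_mult exp_ad_pd_mult exp_ad_walg_of exp_ad_pd)

lemma exp_ad_inverse:
  assumes "u \<in> A" "w \<in> Wc"
  shows "exp_ad (- u) (exp_ad u w) = w"
proof (rule assoc_hom_eqI[OF assoc_hom_comp[OF assoc_hom_exp_ad assoc_hom_exp_ad] assoc_hom_id])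
  fix p
  show "exp_ad (- u) (exp_ad u (pd p)) = pd p"
    using exp_ad_add[of "- u" "pd p - walg_of (xderiv p u)" "walg_of (xderiv p u)"]
    by (simp add: exp_ad_pd exp_ad_walg_of xderiv_uminus walg_of_uminus algebra_simps)
qed (use assms in \<open>simp_all add: exp_ad_walg_of A_uminus\<close>)

end

subsection \<open>The formal adjoint\<close>

text \<open>Transposition by parts: the order of factors is reversed and each \<partial>_p changes
  sign. It is an anti-automorphism, and \<open>sigma1\<close> is its negative.\<close>

definition adjoint :: "'f::field_char_0 walg \<Rightarrow> 'f walg" where
  "adjoint = linear_extension (\<lambda>(\<alpha>, i) \<mu>. kst ((- 1) ^ mdeg \<mu>) * (pd_pow \<mu> * walg_of (xmono \<alpha> i)))"

lemma adjoint_add: "adjoint (a + b) = adjoint a + adjoint b"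
  by (simp add: adjoint_def linear_extension_add)

lemma adjoint_zero [simp]: "adjoint 0 = 0"
  by (simp add: adjoint_def)

lemma adjoint_kst_mult: "adjoint (kst c * a) = kst c * adjoint a"
  by (simp add: adjoint_def linear_extension_kst)

lemma adjoint_monomial: "adjoint (walg_of u * pd_pow \<mu>) = kst ((- 1) ^ mdeg \<mu>) * (pd_pow \<mu> * walg_of u)"
proof (induction u rule: poly_mapping_induct)
  case (single k c)
  obtain \<alpha> i where k: "k = (\<alpha>, i)" by fastforce
  have eq: "walg_of (Poly_Mapping.single (\<alpha>, i) c) = kst c * walg_of (xmono \<alpha> i)"
    by (simp add: xmono_def mult_single flip: walg_of_mult)
  show ?case
    by (simp only: adjoint_def linear_extension_monomial k prod.case)
      (simp only: eq kst_left_commute[of "pd_pow \<mu>"] kst_left_commute[of "kst ((- 1) ^ mdeg \<mu>)"])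
qed (simp_all add: walg_of_add distrib_right distrib_left adjoint_add)

lemma adjoint_mult_pd: "adjoint (w * pd p) = - (pd p * adjoint w)"
proof (induction w rule: walg_induct)
  case (monomial u \<mu>)
  have "adjoint (walg_of u * pd_pow \<mu> * pd p) = adjoint (walg_of u * pd_pow (\<mu> + unit_index p))"
    by (simp add: pd_pow_add mult.assoc)
  also have "\<dots> = - (kst ((- 1) ^ mdeg \<mu>) * (pd p * (pd_pow \<mu> * walg_of u)))"
    unfolding adjoint_monomial
    by (simp add: single_uminus walg_of_uminus pd_pow_add mult.assoc pd_pow_pd)
  finally show ?case by (simp add: adjoint_monomial kst_left_commute)
qed (simp_all add: distrib_right distrib_left adjoint_add)

text \<open>Induction on the order: moving \<open>v\<close> across one \<partial>_p costs a term
  with the derivative of \<open>v\<close>, and the same term appears with opposite sign when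
  \<partial>_p passes \<open>v\<close> on the other side.\<close>

lemma adjoint_mult_walg_of: "adjoint (w * walg_of v) = walg_of v * adjoint w"
proof (induction w rule: walg_induct)
  case (monomial u \<mu>)
  show ?case
  proof (induction \<mu> arbitrary: v rule: mindex_induct)
    case zero
    show ?case
      using adjoint_monomial[of "u * v" 0] adjoint_monomial[of u 0]
      by (simp add: walg_of_mult walg_of_commute)
  next
    case (add_unit \<mu> p)
    let ?w = "walg_of u * pd_pow \<mu>"
    have "walg_of u * pd_pow (\<mu> + unit_index p) * walg_of v =
        ?w * walg_of v * pd p + ?w * walg_of (xderiv p v)"
      by (simp add: pd_pow_add mult.assoc pd_walg_of distrib_left)
    then have "adjoint (walg_of u * pd_pow (\<mu> + unit_index p) * walg_of v) =
        - (pd p * (walg_of v * adjoint ?w)) + walg_of (xderiv p v) * adjoint ?w"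
      by (simp only: adjoint_add adjoint_mult_pd add_unit)
    also have "\<dots> = walg_of v * - (pd p * adjoint ?w)"
      by (simp add: mult.assoc[symmetric] pd_walg_of distrib_right)
    also have "- (pd p * adjoint ?w) = adjoint (walg_of u * pd_pow (\<mu> + unit_index p))"
      by (simp add: adjoint_mult_pd[symmetric] pd_pow_add mult.assoc)
    finally show ?case .
  qed
qed (simp_all add: distrib_right distrib_left adjoint_add)

lemma adjoint_one: "adjoint 1 = 1"
  using adjoint_monomial[of 1 0] by simp

lemma adjoint_walg_of: "adjoint (walg_of u) = walg_of u"
  using adjoint_mult_walg_of[of 1 u] by (simp add: adjoint_one)

lemma adjoint_pd: "adjoint (pd p) = - pd p"
  using adjoint_mult_pd[of 1 p] by (simp add: adjoint_one)

text \<open>Right multiplication by coefficients and by a single \<partial>_p is already known, and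
  every monomial is built up from these on the right.\<close>

lemma adjoint_mult:
  fixes a b :: "'f::field_char_0 walg"
  shows "adjoint (a * b) = adjoint b * adjoint a"
proof (induction b arbitrary: a rule: walg_induct)
  case (monomial u \<mu>)
  have "adjoint (a * pd_pow \<mu>) = adjoint (pd_pow \<mu>) * adjoint a" for a :: "'f walg"
  proof (induction \<mu> arbitrary: a rule: mindex_induct)
    case (add_unit \<mu> p)
    have "adjoint (a * pd_pow (\<mu> + unit_index p)) = - (pd p * adjoint (a * pd_pow \<mu>))"
      by (simp add: pd_pow_add mult.assoc[symmetric] adjoint_mult_pd)
    moreover have "adjoint (pd_pow (\<mu> + unit_index p) :: 'f walg) = - (pd p * adjoint (pd_pow \<mu>))"
      by (simp add: pd_pow_add adjoint_mult_pd)
    ultimately show ?case using add_unit[of a] by (simp add: mult.assoc)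
  qed (simp add: adjoint_one)
  from this[of "a * walg_of u"] this[of "walg_of u"] show ?case
    by (simp add: adjoint_mult_walg_of adjoint_walg_of mult.assoc)
qed (simp_all add: distrib_right distrib_left adjoint_add)

context weyl_type
begin

lemma adjoint_in: "w \<in> Wc \<Longrightarrow> adjoint w \<in> Wc"
  by (induction w rule: Wc_linear_induct)
    (simp_all add: adjoint_add Wc_add adjoint_monomial Wc_kst_mult Wc_mult Wc_pd_pow)

lemma adjoint_uminus: "adjoint (- a) = - adjoint a"
  using adjoint_kst_mult[of "- 1" a] by (simp add: single_uminus walg_of_uminus)

lemma adjoint_adjoint: "w \<in> Wc \<Longrightarrow> adjoint (adjoint w) = w"
  by (induction w rule: Wc_generators_induct)
    (simp_all add: adjoint_walg_of adjoint_pd adjoint_uminus adjoint_add adjoint_mult)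

text \<open>An anti-automorphism reverses brackets, and the sign reverses them back.\<close>

lemma lie_hom_neg_adjoint: "lie_hom (\<lambda>w. - adjoint w)"
proof -
  have diff: "adjoint (a - b) = adjoint a - adjoint b" for a b
    using adjoint_add[of a "- b"] by (simp add: adjoint_uminus)
  show ?thesis
    by (simp add: lie_hom_def linear_map_def adjoint_in Wc_uminus adjoint_add adjoint_kst_mult br_def
        adjoint_mult diff adjoint_walg_of kst_commute[of "adjoint _"])
qed

end


section \<open>Normalized Lie homomorphisms\<close>

lemma walg_of_numeral [simp]: "walg_of (numeral n) = numeral n"
  using walg_of_of_nat[of "numeral n"] by (simp only: of_nat_numeral)

subsection \<open>A computation in the first Weyl algebra\<close>

text \<open>The model: X = x^\<alpha>, Y = x^(-\<alpha>), \<open>h\<close> in \<open>D\<close> with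
  eigenvalue 1 on X, and \<open>s\<close> a scalar. The commutation rules bring every expression to
  a normal form with scalars on the left and \<open>h\<close> on the right.\<close>

locale rank_one =
  fixes h X Y s :: "'a::ring_1"
  assumes hX: "h * X = X * h + X" and hY: "h * Y = Y * h - Y" and XY: "X * Y = 1" and YX: "Y * X = 1"
    and sh: "h * s = s * h" and sX: "X * s = s * X" and sY: "Y * s = s * Y"
begin

lemma assoc_rules:
  "h * (X * z) = X * (h * z) + X * z" "h * (Y * z) = Y * (h * z) - Y * z"
  "X * (Y * z) = z" "Y * (X * z) = z" "h * (s * z) = s * (h * z)" "X * (s * z) = s * (X * z)"
  "Y * (s * z) = s * (Y * z)"
  by (simp_all add: mult.assoc[symmetric] hX hY XY YX sh sX sY distrib_right left_diff_distrib)

lemmas normal_form = hX hY XY YX sh sX sY assoc_rules mult.assoc distrib_left distrib_right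
  left_diff_distrib right_diff_distrib

lemma br_Xh_Yh: "br (X * h + s * X) (Y * h + t * Y) = - 2 * h - s - t"
  if "h * t = t * h" "X * t = t * X" "Y * t = t * Y" "s * t = t * s"
proof -
  have t: "h * (t * z) = t * (h * z)" "X * (t * z) = t * (X * z)" "Y * (t * z) = t * (Y * z)" for z
    by (simp_all add: mult.assoc[symmetric] that)
  show ?thesis
    by (simp add: br_def normal_form that t mult_2)
qed

text \<open>Cancelling X against Y turns the two products into squares, of h^2 - h + s (1 - s) and
  of h^2 + h + s (1 - s). Their difference factors, and it depends on the shift \<open>s\<close>
  only through s (1 - s).\<close>

lemma br_square:
  "br (X * ((h + s) * (h + s))) (Y * ((h - s) * (h - s))) = - 4 * (h * h * h + s * (1 - s) * h)"
proof -
  have 4: "4 * z = z + z + z + z" for z :: 'a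
    by (simp only: numeral_Bit0 numeral_One distrib_right mult_1_left add.assoc)
  show ?thesis
    by (simp add: br_def normal_form 4)
qed

lemma br_cube: "br (h * h * h) X = X * (3 * (h * h) + 3 * h + 1)"
proof -
  have 3: "3 * z = z + z + z" "z * (3 * z') = z * z' + z * z' + z * z'" for z z' :: 'a
    by (simp_all only: numeral_Bit1 numeral_Bit0 numeral_One distrib_right distrib_left mult_1_left add.assoc)
  show ?thesis
    by (simp add: br_def normal_form 3)
qed

end

context weyl_type
begin

section \<open>Weight spaces and antiderivatives\<close>

definition homogeneous :: "'f fvec \<Rightarrow> 'f salg set" where
  "homogeneous \<alpha> = {u \<in> A. \<forall>k\<in>supp u. fst k = \<alpha>}"

lemma homogeneous_A: "u \<in> homogeneous \<alpha> \<Longrightarrow> u \<in> A"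
  by (simp add: homogeneous_def)

lemma homogeneous_add: "u \<in> homogeneous \<alpha> \<Longrightarrow> v \<in> homogeneous \<alpha> \<Longrightarrow> u + v \<in> homogeneous \<alpha>"
  using Poly_Mapping.keys_add[of u v] unfolding homogeneous_def by (auto intro: A_add)

lemma homogeneous_uminus: "u \<in> homogeneous \<alpha> \<Longrightarrow> - u \<in> homogeneous \<alpha>"
  by (simp add: homogeneous_def A_uminus)

lemma homogeneous_diff: "u \<in> homogeneous \<alpha> \<Longrightarrow> v \<in> homogeneous \<alpha> \<Longrightarrow> u - v \<in> homogeneous \<alpha>"
  using homogeneous_add[of u \<alpha> "- v"] homogeneous_uminus[of v] by simp

lemma homogeneous_single:
  "\<alpha> \<in> \<Gamma> \<Longrightarrow> i \<in> multi_indices l1 \<Longrightarrow> Poly_Mapping.single (\<alpha>, i) c \<in> homogeneous \<alpha>"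
  by (auto simp: homogeneous_def A_single split: if_splits)

lemma homogeneous_xderiv:
  assumes "u \<in> homogeneous \<alpha>"
  shows "xderiv p u \<in> homogeneous \<alpha>"
  unfolding homogeneous_def
proof (intro CollectI conjI ballI)
  fix k assume "k \<in> supp (xderiv p u)"
  then obtain \<beta> i where k: "k = (\<beta>, i)" "coef (xderiv p u) (\<beta>, i) \<noteq> 0"
    by (metis in_keys_iff prod.collapse)
  then have "(\<beta>, i) \<in> supp u \<or> (\<beta>, i + unit_index p) \<in> supp u"
    by (auto simp: coef_xderiv in_keys_iff)
  then show "fst k = \<alpha>" using assms k(1) by (auto simp: homogeneous_def)
qed (use assms A_xderiv homogeneous_A in blast)

text \<open>On weight \<alpha> the operator \<partial>_p is the nonzero scalar \<alpha>_p plus an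
  operator lowering the exponent of t_p. It is inverted by dividing by \<alpha>_p and correcting
  recursively.\<close>

lemma homogeneous_xderiv_surj:
  assumes p: "coef \<alpha> p \<noteq> 0" and w: "w \<in> homogeneous \<alpha>"
  obtains u where "u \<in> homogeneous \<alpha>" "xderiv p u = w"
proof -
  have single: "\<exists>u\<in>homogeneous \<alpha>. xderiv p u = Poly_Mapping.single (\<alpha>, i) c"
    if "\<alpha> \<in> \<Gamma>" "i \<in> multi_indices l1" for i c
    using that(2)
  proof (induction "coef i p" arbitrary: i c)
    case 0
    then show ?case
      using p that(1) by (intro bexI[of _ "Poly_Mapping.single (\<alpha>, i) (c / coef \<alpha> p)"])
        (simp_all add: xderiv_single homogeneous_single)
  next
    case (Suc n)
    let ?j = "i - unit_index p" and ?v = "Poly_Mapping.single (\<alpha>, i) (c / coef \<alpha> p)"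
    have "n = coef ?j p" "?j \<in> multi_indices l1" using Suc.hyps(2) Suc.prems by (auto simp: lookup_minus)
    then obtain u where u: "u \<in> homogeneous \<alpha>"
        "xderiv p u = Poly_Mapping.single (\<alpha>, ?j) (of_nat (coef i p) * (c / coef \<alpha> p))"
      using Suc.hyps(1) by blast
    have "xderiv p (?v - u) = Poly_Mapping.single (\<alpha>, i) c"
      using p by (simp add: xderiv_diff u(2) xderiv_single)
    moreover have "?v - u \<in> homogeneous \<alpha>"
      using that(1) Suc.prems u(1) by (intro homogeneous_diff homogeneous_single)
    ultimately show ?case by blast
  qed
  have "\<exists>u\<in>homogeneous \<alpha>. xderiv p u = (\<Sum>k\<in>S. Poly_Mapping.single k (coef w k))"
    if "finite S" "S \<subseteq> supp w" for S
    using that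
  proof induction
    case empty
    show ?case by (intro bexI[of _ 0]) (simp_all add: homogeneous_def)
  next
    case (insert k S)
    obtain i where k: "k = (\<alpha>, i)" using insert.prems w by (auto simp: homogeneous_def) (metis prod.collapse)
    then have "\<alpha> \<in> \<Gamma>" "i \<in> multi_indices l1"
      using insert.prems w by (auto simp: homogeneous_def A_iff)
    from single[OF this] obtain u where u: "u \<in> homogeneous \<alpha>"
      "xderiv p u = Poly_Mapping.single k (coef w k)" unfolding k by blast
    from insert obtain v where v: "v \<in> homogeneous \<alpha>"
      "xderiv p v = (\<Sum>k\<in>S. Poly_Mapping.single k (coef w k))" by blast
    show ?case
      using insert.hyps u v by (intro bexI[of _ "u + v"]) (simp_all add: xderiv_add homogeneous_add)
  qed
  from this[of "supp w"] obtain u where "u \<in> homogeneous \<alpha>"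
      "xderiv p u = (\<Sum>k\<in>supp w. Poly_Mapping.single k (coef w k))" by auto
  moreover have "w = (\<Sum>k\<in>supp w. Poly_Mapping.single k (coef w k))"
    by (rule poly_mapping_eqI) (auto simp: lookup_sum lookup_single when_def in_keys_iff)
  ultimately show ?thesis using that by simp
qed

text \<open>If \<beta>_q = 0 the antiderivative is t^2 x^\<beta> / 2; otherwise integration by parts
  gives (t - 1/b) x^\<beta> / b with b = \<beta>_q.\<close>

lemma t_xmono_antiderivative:
  assumes "q < l1" "\<beta> \<in> \<Gamma>"
  obtains u where "u \<in> A" "xderiv q u = xmono 0 (unit_index q) * xmono \<beta> 0"
proof (cases "coef \<beta> q = 0")
  case True
  let ?t = "xmono 0 (unit_index q) :: 'f salg"
  let ?u = "Poly_Mapping.single 0 (1 / 2) * (?t * ?t * xmono \<beta> 0)"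
  have "xderiv q ?u = (Poly_Mapping.single 0 (1 / 2) + Poly_Mapping.single 0 (1 / 2)) * (?t * xmono \<beta> 0)"
    by (simp add: xderiv_const_mult xderiv_mult xderiv_t xderiv_xmono True algebra_simps)
  also have "Poly_Mapping.single 0 (1 / 2) + Poly_Mapping.single 0 (1 / 2) = (1 :: 'f salg)"
    by (simp flip: single_add)
  finally show ?thesis using assms by (intro that[of ?u]) (auto intro!: A_mult simp: A_xmono)
next
  case False
  let ?t = "xmono 0 (unit_index q) :: 'f salg" and ?b = "coef \<beta> q"
  let ?u = "Poly_Mapping.single 0 (1 / ?b) * (?t * xmono \<beta> 0 - Poly_Mapping.single 0 (1 / ?b) * xmono \<beta> 0)"
  have one: "Poly_Mapping.single 0 (1 / ?b) * (Poly_Mapping.single 0 ?b * z) = z" for z :: "'f salg"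
    using False by (simp add: mult.assoc[symmetric] mult_single)
  have "xderiv q ?u = ?t * xmono \<beta> 0"
    by (simp add: xderiv_const_mult xderiv_diff xderiv_mult xderiv_t xderiv_xmono one
        right_diff_distrib distrib_left mult.left_commute[of ?t])
  then show ?thesis using assms by (intro that[of ?u]) (auto intro!: A_mult A_diff simp: A_xmono)
qed

end

text \<open>The situation after the affine and exponential parts have been divided out. The
  generators are under control, but as the map is only known to respect brackets, \<open>c\<close>
  and the action on products are still open.\<close>

locale normalized_lie_hom = weyl_type l1 l2 \<Gamma> for l1 l2 and \<Gamma> :: "'f::field_char_0 fvec set" +
  fixes \<phi> :: "'f walg \<Rightarrow> 'f walg" and c :: 'f
  assumes lie: "lie_hom \<phi>" and c: "c \<noteq> 0"
    and phi_A: "u \<in> A \<Longrightarrow> \<exists>v\<in>A. \<phi> (walg_of u) = walg_of v"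
    and phi_pd: "p < l \<Longrightarrow> \<phi> (pd p) = pd p"
    and phi_xw: "\<alpha> \<in> \<Gamma> \<Longrightarrow> \<phi> (xw \<alpha>) = kst c * xw \<alpha>"
    and phi_tw: "p < l1 \<Longrightarrow> \<phi> (tw p) = kst c * tw p"
begin

lemma lin: "linear_map \<phi>"
  using lie by (simp add: lie_hom_def)

lemmas phi_lin = linear_mapD[OF lin]

lemma phi_br: "a \<in> Wc \<Longrightarrow> b \<in> Wc \<Longrightarrow> \<phi> (br a b) = br (\<phi> a) (\<phi> b)"
  using lie by (simp add: lie_hom_def)

lemma phi_one: "\<phi> 1 = kst c"
  using phi_xw[of 0] by simp

section \<open>The action on \<open>A\<close>\<close>

definition \<Phi> :: "'f salg \<Rightarrow> 'f salg" where
  "\<Phi> u = cf (\<phi> (walg_of u)) 0"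

lemma phi_walg_of: "u \<in> A \<Longrightarrow> \<phi> (walg_of u) = walg_of (\<Phi> u)"
  using phi_A[of u] by (auto simp: \<Phi>_def)

lemma Phi_xderiv: "u \<in> A \<Longrightarrow> p < l \<Longrightarrow> \<Phi> (xderiv p u) = xderiv p (\<Phi> u)"
  using phi_br[of "pd p" "walg_of u"]
  by (simp add: phi_pd phi_walg_of A_xderiv)

lemma Phi_xmono: "\<alpha> \<in> \<Gamma> \<Longrightarrow> \<Phi> (xmono \<alpha> 0) = Poly_Mapping.single 0 c * xmono \<alpha> 0"
  using phi_xw[of \<alpha>] by (simp add: \<Phi>_def cf_walg_of_mult)

lemma Phi_t: "p < l1 \<Longrightarrow> \<Phi> (xmono 0 (unit_index p)) = Poly_Mapping.single 0 c * xmono 0 (unit_index p)"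
  using phi_tw[of p] by (simp add: \<Phi>_def cf_walg_of_mult)

text \<open>Brackets with the x^\<beta> determine an element modulo \<open>A\<close>, by
  \<open>centralizer_xw\<close>.\<close>

lemma centralizer_diff:
  assumes "a \<in> Wc" "b \<in> Wc" "\<And>\<beta>. \<beta> \<in> \<Gamma> \<Longrightarrow> br a (xw \<beta>) = br b (xw \<beta>)"
  obtains g where "g \<in> A" "a = b + walg_of g"
proof -
  have "ord_le 0 (a - b)"
    using assms by (intro centralizer_xw) (simp_all add: Wc_diff br_diff_left)
  then have "a - b = walg_of (cf (a - b) 0)" by (simp only: ord_le_0)
  then have "a = b + walg_of (cf (a - b) 0)" by (simp add: algebra_simps)
  moreover have "cf (a - b) 0 \<in> A" by (rule Wc_cf) (simp add: assms Wc_diff)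
  ultimately show ?thesis using that by blast
qed

text \<open>The bracket of z \<partial>_p with x^\<beta> is a multiple of z x^\<beta>, on which the
  map is the scalar \<open>c\<close> by assumption; the same \<open>c\<close> comes from the image
  of x^\<beta> and cancels.\<close>

lemma phi_order_1:
  assumes z: "z \<in> A" "\<And>\<beta>. \<beta> \<in> \<Gamma> \<Longrightarrow> \<Phi> (z * xmono \<beta> 0) = Poly_Mapping.single 0 c * (z * xmono \<beta> 0)"
    and p: "p < l"
  obtains g where "g \<in> A" "\<phi> (walg_of z * pd p) = walg_of z * pd p + walg_of g"
proof (rule centralizer_diff)
  show "\<phi> (walg_of z * pd p) \<in> Wc" "walg_of z * pd p \<in> Wc"
    using z p by (simp_all add: phi_lin(1) Wc_mult)
  fix \<beta> assume \<beta>: "\<beta> \<in> \<Gamma>"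
  have "kst c * br (\<phi> (walg_of z * pd p)) (xw \<beta>) = br (\<phi> (walg_of z * pd p)) (\<phi> (xw \<beta>))"
    by (simp add: phi_xw \<beta> br_kst_right)
  also have "\<dots> = \<phi> (br (walg_of z * pd p) (xw \<beta>))"
    using \<beta> by (intro phi_br[symmetric] Wc_mult Wc_pd p) (simp_all add: z(1) A_xmono)
  also have "br (walg_of z * pd p) (xw \<beta>) = kst (coef \<beta> p) * walg_of (z * xmono \<beta> 0)"
    by (simp add: br_mult_left xderiv_xmono walg_of_mult kst_left_commute[of "walg_of z"])
  also have "\<phi> \<dots> = kst c * (kst (coef \<beta> p) * walg_of (z * xmono \<beta> 0))"
  proof -
    have zx: "z * xmono \<beta> 0 \<in> A" using z(1) \<beta> by (simp add: A_mult A_xmono)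
    have "\<phi> (walg_of (z * xmono \<beta> 0)) = kst c * walg_of (z * xmono \<beta> 0)"
      using phi_walg_of[OF zx] unfolding z(2)[OF \<beta>] by (simp only: walg_of_mult)
    then have "\<phi> (kst (coef \<beta> p) * walg_of (z * xmono \<beta> 0)) =
        kst (coef \<beta> p) * (kst c * walg_of (z * xmono \<beta> 0))"
      using phi_lin(3)[of "walg_of (z * xmono \<beta> 0)" "coef \<beta> p"] zx by simp
    then show ?thesis by (simp only: kst_left_commute[of "kst (coef \<beta> p)"])
  qed
  also have "kst (coef \<beta> p) * walg_of (z * xmono \<beta> 0) = br (walg_of z * pd p) (xw \<beta>)"
    by (simp add: br_mult_left xderiv_xmono walg_of_mult kst_left_commute[of "walg_of z"])
  finally show "br (\<phi> (walg_of z * pd p)) (xw \<beta>) = br (walg_of z * pd p) (xw \<beta>)"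
    by (simp only: kst_cancel[OF c])
qed (use that in blast)

text \<open>The correction \<open>g\<close> from \<open>phi_order_1\<close> lies in the commutative
  \<open>A\<close> and drops out of the bracket with the image of \<open>u\<close>. So
  multiplication by \<open>z\<close> can be pulled out, which stands in for
  multiplicativity.\<close>

lemma Phi_mult_xderiv:
  assumes z: "z \<in> A" "\<And>\<beta>. \<beta> \<in> \<Gamma> \<Longrightarrow> \<Phi> (z * xmono \<beta> 0) = Poly_Mapping.single 0 c * (z * xmono \<beta> 0)"
    and p: "p < l" and u: "u \<in> A"
  shows "\<Phi> (z * xderiv p u) = z * \<Phi> (xderiv p u)"
proof -
  obtain g where g: "g \<in> A" "\<phi> (walg_of z * pd p) = walg_of z * pd p + walg_of g"
    using phi_order_1[OF z p] by blast
  have "walg_of (\<Phi> (z * xderiv p u)) = \<phi> (br (walg_of z * pd p) (walg_of u))"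
    using z(1) u by (simp add: br_mult_left A_mult A_xderiv phi_walg_of flip: walg_of_mult)
  also have "\<dots> = br (walg_of z * pd p + walg_of g) (walg_of (\<Phi> u))"
    using z(1) p u by (simp add: phi_br Wc_mult g phi_walg_of)
  also have "\<dots> = walg_of (z * \<Phi> (xderiv p u))"
    by (simp add: br_add_left br_mult_left Phi_xderiv u p walg_of_mult)
  finally show ?thesis by simp
qed

text \<open>Products are reached by writing one factor as a derivative. With t_q = \<partial>_q u
  and z = x^\<beta>, \<open>Phi_mult_xderiv\<close> first gives the products t_q x^\<beta>; these
  start the induction over all powers of the t_q.\<close>

lemma Phi_eq:
  assumes "u \<in> A"
  shows "\<Phi> u = Poly_Mapping.single 0 c * u"
proof -
  have x: "\<Phi> (xmono \<alpha> 0 * xmono \<beta> 0) = Poly_Mapping.single 0 c * (xmono \<alpha> 0 * xmono \<beta> 0)"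
    if "\<alpha> \<in> \<Gamma>" "\<beta> \<in> \<Gamma>" for \<alpha> \<beta>
    using that by (simp add: xmono_add Phi_xmono Gamma_add)
  have t: "\<Phi> (xmono 0 (unit_index q) * xmono \<beta> 0) =
      Poly_Mapping.single 0 c * (xmono 0 (unit_index q) * xmono \<beta> 0)" if q: "q < l1" "\<beta> \<in> \<Gamma>" for q \<beta>
  proof -
    obtain u where u: "u \<in> A" "xderiv q u = xmono 0 (unit_index q) * xmono 0 0"
      using t_xmono_antiderivative[OF q(1) Gamma_zero] by blast
    show ?thesis
      using Phi_mult_xderiv[OF _ x[OF q(2)] _ u(1), of q] q u(2)
      by (simp add: A_xmono Phi_t mult.commute mult.left_commute)
  qed
  have "\<Phi> (xmono 0 i * xmono \<beta> 0) = Poly_Mapping.single 0 c * (xmono 0 i * xmono \<beta> 0)"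
    if "i \<in> multi_indices l1" "\<beta> \<in> \<Gamma>" for i \<beta>
    using that
  proof (induction i arbitrary: \<beta> rule: multi_indices_induct)
    case zero
    then show ?case using x[of 0 \<beta>] by simp
  next
    case (add_unit i q)
    \<comment> \<open>The roles change here: t_q x^\<beta> is the derivative, and z = t^i comes from
      the induction hypothesis, which holds for all weights.\<close>
    obtain u where u: "u \<in> A" "xderiv q u = xmono 0 (unit_index q) * xmono \<beta> 0"
      using t_xmono_antiderivative[OF add_unit(2,4)] by blast
    have i: "xmono 0 i \<in> A" using add_unit(1) by (simp add: A_xmono)
    have "xmono 0 (i + unit_index q) * xmono \<beta> 0 = xmono 0 i * xderiv q u"
      by (simp add: u(2) xmono_add)
    then show ?case
      using Phi_mult_xderiv[OF i add_unit(3) _ u(1), of q] add_unit(2,4)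
      by (simp add: u(2) t mult.left_commute)
  qed
  then have mono: "\<Phi> (xmono \<beta> i) = Poly_Mapping.single 0 c * xmono \<beta> i"
    if "i \<in> multi_indices l1" "\<beta> \<in> \<Gamma>" for i \<beta>
    using that by (simp add: xmono_add)
  show ?thesis using assms
  proof (induction u rule: A_induct)
    case (monomial \<alpha> i d)
    have "walg_of (\<Phi> (Poly_Mapping.single 0 d * xmono \<alpha> i)) = \<phi> (kst d * walg_of (xmono \<alpha> i))"
      using monomial by (simp add: phi_walg_of A_mult A_xmono flip: walg_of_mult)
    also have "\<dots> = walg_of (Poly_Mapping.single 0 d * (Poly_Mapping.single 0 c * xmono \<alpha> i))"
      using monomial by (simp only: phi_lin(3) Wc_walg_of A_xmono phi_walg_of mono walg_of_mult simp_thms)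
    finally show ?case by (simp add: mult.left_commute)
  next
    case (add u v)
    have "walg_of (\<Phi> (u + v)) = \<phi> (walg_of u + walg_of v)"
      using add by (simp add: phi_walg_of A_add flip: walg_of_add)
    also have "\<dots> = walg_of (\<Phi> u + \<Phi> v)"
      using add(1,2) by (simp add: phi_lin(2) phi_walg_of walg_of_add)
    finally show ?case using add by (simp add: distrib_left)
  qed
qed

lemma phi_walg_of_eq: "u \<in> A \<Longrightarrow> \<phi> (walg_of u) = kst c * walg_of u"
  by (simp add: phi_walg_of Phi_eq walg_of_mult)

section \<open>The scalar is 1 or -1\<close>

definition Dl :: "(nat \<Rightarrow> 'f) \<Rightarrow> 'f walg" where
  "Dl e = (\<Sum>p<l. kst (e p) * pd p)"

lemma Dl_in: "Dl e \<in> Wc"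
  unfolding Dl_def by (intro Wc_sum Wc_kst_mult) simp

lemma phi_Dl: "\<phi> (Dl e) = Dl e"
  unfolding Dl_def
  by (subst linear_map_sum[OF lin]) (simp_all add: Wc_kst_mult phi_lin(3) phi_pd)

lemma br_Dl_xw: "br (Dl e) (xw \<alpha>) = kst (\<Sum>p<l. e p * coef \<alpha> p) * xw \<alpha>"
  by (simp add: Dl_def br_sum_left br_kst_left xderiv_xmono walg_of_mult kst_sum[symmetric] kst_mult
      sum_distrib_right mult.assoc)

lemma br_pd_Dl: "br (pd p) (Dl e) = 0"
  by (simp add: Dl_def br_sum_right br_kst_right)

text \<open>The correction \<open>g\<close> in \<open>A\<close> is an eigenvector of every
  \<partial>_p with eigenvalue \<alpha>_p, because both x^\<alpha> h and its image are. Hence it is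
  a multiple of x^\<alpha>.\<close>

lemma phi_xw_Dl:
  assumes \<alpha>: "\<alpha> \<in> \<Gamma>"
  obtains s where "\<phi> (xw \<alpha> * Dl e) = xw \<alpha> * Dl e + kst s * xw \<alpha>"
proof -
  have "\<exists>g\<in>A. \<phi> (xw \<alpha> * pd p) = xw \<alpha> * pd p + walg_of g" if "p < l" for p
  proof (rule phi_order_1[OF _ _ that, of "xmono \<alpha> 0"])
    show "\<Phi> (xmono \<alpha> 0 * xmono \<beta> 0) = Poly_Mapping.single 0 c * (xmono \<alpha> 0 * xmono \<beta> 0)"
      if "\<beta> \<in> \<Gamma>" for \<beta>
      using \<alpha> that by (intro Phi_eq A_mult) (simp_all add: A_xmono)
  qed (use \<alpha> in \<open>auto simp: A_xmono\<close>)
  then obtain G where G: "\<And>p. p < l \<Longrightarrow> G p \<in> A"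
      "\<And>p. p < l \<Longrightarrow> \<phi> (xw \<alpha> * pd p) = xw \<alpha> * pd p + walg_of (G p)" by metis
  define g where "g = (\<Sum>p<l. Poly_Mapping.single 0 (e p) * G p)"
  have gA: "g \<in> A" unfolding g_def using G by (intro A_sum A_mult) auto
  have expand: "xw \<alpha> * Dl e = (\<Sum>p<l. kst (e p) * (xw \<alpha> * pd p))"
    by (simp add: Dl_def sum_distrib_left kst_left_commute[of "xw \<alpha>"])
  have "\<phi> (xw \<alpha> * Dl e) = (\<Sum>p<l. kst (e p) * (xw \<alpha> * pd p + walg_of (G p)))"
    unfolding expand using \<alpha> G
    by (subst linear_map_sum[OF lin]) (simp_all add: Wc_kst_mult Wc_mult phi_lin(3) A_xmono)
  also have "\<dots> = xw \<alpha> * Dl e + walg_of g"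
    unfolding expand by (simp add: distrib_left sum.distrib g_def walg_of_sum walg_of_mult)
  finally have phi: "\<phi> (xw \<alpha> * Dl e) = xw \<alpha> * Dl e + walg_of g" .
  have in_W: "xw \<alpha> * Dl e \<in> Wc" using \<alpha> Dl_in by (simp add: Wc_mult A_xmono)
  have "xderiv p g = Poly_Mapping.single 0 (coef \<alpha> p) * g" if "p < l" for p
  proof -
    have b: "br (pd p) (xw \<alpha> * Dl e) = kst (coef \<alpha> p) * (xw \<alpha> * Dl e)"
      by (simp add: br_mult_right br_pd_Dl xderiv_xmono walg_of_mult mult.assoc)
    have "\<phi> (br (pd p) (xw \<alpha> * Dl e)) = br (pd p) (xw \<alpha> * Dl e + walg_of g)"
      using that in_W by (simp add: phi_br phi_pd phi)
    then have "kst (coef \<alpha> p) * (xw \<alpha> * Dl e + walg_of g) =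
        kst (coef \<alpha> p) * (xw \<alpha> * Dl e) + walg_of (xderiv p g)"
      unfolding b using in_W by (simp add: phi_lin(3) phi br_add_right b)
    then show ?thesis by (simp add: distrib_left flip: walg_of_mult)
  qed
  from joint_eigenvector[OF gA _ this] have "g = Poly_Mapping.single 0 (coef g (\<alpha>, 0)) * xmono \<alpha> 0"
    using \<alpha> Gamma_vecs by blast
  then have "walg_of g = kst (coef g (\<alpha>, 0)) * xw \<alpha>" by (metis walg_of_mult)
  with phi show ?thesis using that by simp
qed

lemma double_cancel: "a + a = b + b \<longleftrightarrow> a = (b :: 'f walg)"
proof
  assume "a + a = b + b"
  then have "kst 2 * a = kst 2 * b" by (simp add: mult_2)
  then show "a = b" by (subst (asm) kst_cancel) simp_all
qed simp

lemma rank_one_xw: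
  assumes "(\<Sum>p<l. e p * coef \<alpha> p) = 1"
  shows "rank_one (Dl e) (xw \<alpha>) (xw (- \<alpha>)) (kst s)"
proof
  have "(\<Sum>p<l. e p * coef (- \<alpha>) p) = - 1" using assms by (simp add: sum_negf)
  then have "br (Dl e) (xw \<alpha>) = xw \<alpha>" "br (Dl e) (xw (- \<alpha>)) = - xw (- \<alpha>)"
    unfolding br_Dl_xw assms by (simp_all add: single_uminus walg_of_uminus)
  then show "Dl e * xw \<alpha> = xw \<alpha> * Dl e + xw \<alpha>" "Dl e * xw (- \<alpha>) = xw (- \<alpha>) * Dl e - xw (- \<alpha>)"
    by (simp_all add: br_def algebra_simps)
qed (simp_all add: xw_inverse kst_commute)

text \<open>The shifts \<open>s\<close> at \<alpha> and \<open>t\<close> at -\<alpha> satisfy s + t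
  = 0, from [X h, Y h] = -2 h. The brackets of the image of h^2 with X and with Y involve
  \<open>s\<close>, and since that image must commute with X Y = 1 this gives 2 s = 1 - c. No
  restriction on \<open>c\<close> results yet.\<close>

lemma phi_xw_Dl_eq:
  assumes \<alpha>: "\<alpha> \<in> \<Gamma>" and e: "(\<Sum>p<l. e p * coef \<alpha> p) = 1"
  shows "\<phi> (xw \<alpha> * Dl e) = xw \<alpha> * Dl e + kst ((1 - c) / 2) * xw \<alpha>"
    and "kst c * br (\<phi> (Dl e * Dl e)) (xw \<alpha>) = xw \<alpha> * Dl e + xw \<alpha> * Dl e + xw \<alpha>"
proof -
  define h X Y where "h = Dl e" and "X = xw \<alpha>" and "Y = xw (- \<alpha>)"
  obtain s where s: "\<phi> (X * h) = X * h + kst s * X" using phi_xw_Dl[OF \<alpha>] unfolding h_def X_def by blast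
  obtain t where t: "\<phi> (Y * h) = Y * h + kst t * Y"
    using phi_xw_Dl[OF Gamma_uminus[OF \<alpha>]] unfolding h_def Y_def by blast
  interpret rank_one h X Y "kst s" unfolding h_def X_def Y_def by (rule rank_one_xw[OF e])
  interpret R0: rank_one h X Y 0 by unfold_locales (simp_all add: hX hY XY YX)
  have in_W: "h \<in> Wc" "X \<in> Wc" "Y \<in> Wc"
    using \<alpha> by (simp_all add: h_def X_def Y_def Dl_in A_xmono Gamma_uminus)
  note W = in_W Wc_mult Wc_add Wc_diff Wc_uminus
  have phi: "\<phi> h = h" "\<phi> X = kst c * X" "\<phi> Y = kst c * Y"
    using \<alpha> by (simp_all add: h_def X_def Y_def phi_Dl phi_xw Gamma_uminus)
  have "br (X * h) (Y * h) = - (h + h)" using R0.br_Xh_Yh[of 0] by (simp add: mult_2)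
  then have "\<phi> (- (h + h)) = br (X * h + kst s * X) (Y * h + kst t * Y)"
    using phi_br[of "X * h" "Y * h"] by (simp add: W s t)
  moreover have "\<phi> (- (h + h)) = - (h + h)" by (simp add: phi_lin W phi)
  moreover have "br (X * h + kst s * X) (Y * h + kst t * Y) = - 2 * h - kst s - kst t"
    by (rule br_Xh_Yh) (rule kst_commute)+
  ultimately have "- (h + h) = - 2 * h - kst s - kst t" by (simp only:)
  then have "kst s + kst t = 0" by (simp add: mult_2 algebra_simps)
  then have ts: "kst t = - kst s" by (simp add: eq_neg_iff_add_eq_0 add.commute)
  define S where "S = \<phi> (h * h)"
  have "br (h * h) X = X * h + X * h + X" by (simp add: br_def normal_form)
  then have "br S (kst c * X) = \<phi> (X * h + X * h + X)"
    using phi_br[of "h * h" X] by (simp add: W S_def phi)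
  then have SX: "kst c * br S X = X * h + X * h + (kst s + kst s + kst c) * X"
    by (simp add: br_kst_right phi_lin(2) W s phi distrib_right add_ac)
  have "br (h * h) Y = Y - (Y * h + Y * h)" by (simp add: br_def normal_form)
  then have "br S (kst c * Y) = \<phi> (Y - (Y * h + Y * h))"
    using phi_br[of "h * h" Y] by (simp add: W S_def phi)
  then have SY: "kst c * br S Y = (kst s + kst s + kst c) * Y - (Y * h + Y * h)"
    by (simp add: br_kst_right phi_lin(2,6) W t ts phi distrib_right algebra_simps)
  have c_rules: "X * kst c = kst c * X" "X * (kst c * z) = kst c * (X * z)" for z
    by (simp_all only: kst_commute kst_left_commute[of X])
  \<comment> \<open>The derivation \<open>br S\<close> kills X Y = 1; expanding it leaves twice 2 s
    + c - 1.\<close>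
  have "0 = kst c * br S (X * Y)" by (simp add: XY)
  also have "\<dots> = (kst c * br S X) * Y + X * (kst c * br S Y)"
    by (simp add: br_mult_right distrib_left mult.assoc c_rules)
  also have "\<dots> = (kst s + kst s + kst c - 1) + (kst s + kst s + kst c - 1)"
    unfolding SX SY by (simp add: normal_form c_rules)
  finally have "kst s + kst s + kst c - 1 = 0" using double_cancel[of _ 0] by simp
  then have "kst (s + s + c - 1) = 0" by (simp only: kst_add kst_diff single_one walg_of_one)
  then have sc: "s + s + c - 1 = 0" by (simp only: kst_eq_0_iff)
  then have "s + s = 1 - c" by (simp add: algebra_simps)
  then have s_eq: "s = (1 - c) / 2" by (simp add: field_simps)
  show "\<phi> (xw \<alpha> * Dl e) = xw \<alpha> * Dl e + kst ((1 - c) / 2) * xw \<alpha>"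
    using s by (simp only: s_eq[symmetric] X_def h_def)
  have "kst s + kst s + kst c = 1" using \<open>kst s + kst s + kst c - 1 = 0\<close> by simp
  then show "kst c * br (\<phi> (Dl e * Dl e)) (xw \<alpha>) = xw \<alpha> * Dl e + xw \<alpha> * Dl e + xw \<alpha>"
    using SX by (simp add: S_def X_def h_def)
qed

text \<open>The bracket [h^2, X h] = 2 X h^2 + X h expresses X h^2 by elements whose images are
  known; the image of h^2 itself enters only through its brackets with X and h.\<close>

lemma phi_xw_Dl_square:
  assumes \<alpha>: "\<alpha> \<in> \<Gamma>" and e: "(\<Sum>p<l. e p * coef \<alpha> p) = 1"
  defines "s \<equiv> kst ((1 - c) / 2)"
  shows "kst c * \<phi> (xw \<alpha> * (Dl e * Dl e)) = xw \<alpha> * ((Dl e + s) * (Dl e + s))"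
proof -
  define h X Y where "h = Dl e" and "X = xw \<alpha>" and "Y = xw (- \<alpha>)"
  interpret rank_one h X Y s unfolding h_def X_def Y_def s_def by (rule rank_one_xw[OF e])
  have in_W: "h \<in> Wc" "X \<in> Wc"
    using \<alpha> by (simp_all add: h_def X_def Dl_in A_xmono)
  note W = in_W Wc_mult Wc_add Wc_diff Wc_uminus
  have phi: "\<phi> h = h" "\<phi> X = kst c * X" "\<phi> (X * h) = X * h + s * X"
    using \<alpha> by (simp_all add: h_def X_def s_def phi_Dl phi_xw phi_xw_Dl_eq[OF \<alpha> e])
  define S where "S = \<phi> (h * h)"
  have SX: "kst c * br S X = X * h + X * h + X"
    using phi_xw_Dl_eq(2)[OF \<alpha> e] by (simp add: S_def X_def h_def)
  have Sh: "br S h = 0" using phi_br[of "h * h" h] by (simp add: W S_def phi br_mult_left phi_lin(4))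
  \<comment> \<open>Eliminating \<open>c\<close> in favour of the shift makes the identity
    polynomial in \<open>s\<close>, within reach of the normal form.\<close>
  have kc: "kst c = 1 - (s + s)"
  proof -
    have "kst c = kst (1 - ((1 - c) / 2 + (1 - c) / 2))" by simp
    then show ?thesis unfolding s_def by (simp only: kst_add kst_diff single_one walg_of_one)
  qed
  have "br (h * h) (X * h) = X * (h * h) + X * (h * h) + X * h" by (simp add: br_def normal_form)
  then have "\<phi> (X * (h * h) + X * (h * h) + X * h) = br S (X * h + s * X)"
    using phi_br[of "h * h" "X * h"] by (simp add: W S_def phi)
  also have "br S (X * h + s * X) = br S X * (h + s)"
    by (simp add: br_add_right br_mult_right[of S X h] Sh br_kst_right[of S _ X, folded s_def] distrib_left
        kst_commute[of "br S X", folded s_def] s_def br_kst_right kst_commute)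
  finally have "kst c * (\<phi> (X * (h * h)) + \<phi> (X * (h * h)) + (X * h + s * X)) =
      (kst c * br S X) * (h + s)"
    by (simp add: phi_lin(2) W phi mult.assoc)
  then have "kst c * \<phi> (X * (h * h)) + kst c * \<phi> (X * (h * h)) =
      (X * h + X * h + X) * (h + s) - (1 - (s + s)) * (X * h + s * X)"
    unfolding SX by (simp add: distrib_left kc[symmetric]) (simp add: algebra_simps)
  also have "\<dots> = X * ((h + s) * (h + s)) + X * ((h + s) * (h + s))"
    by (simp add: normal_form)
  finally show ?thesis by (simp only: double_cancel X_def h_def)
qed

text \<open>The bracket of X h^2 and Y h^2 is -4 h^3, so the image of h^3 is determined: c^2 times
  it is h^3 + s (1 - s) h. Bracketing with X gives a second evaluation through X h^2 and X h. The
  two differ by 2 s (1 - s) X, so the shift s = (1 - c) / 2 is 0 or 1.\<close>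

lemma c_cases: "c = 1 \<or> c = - 1"
proof -
  obtain \<alpha> p where \<alpha>: "\<alpha> \<in> \<Gamma>" "p < l" "coef \<alpha> p \<noteq> 0"
    using exists_nonzero_coordinate[OF pos] pos by blast
  \<comment> \<open>A multiple of one \<partial>_p, normalized to have eigenvalue 1 on
    x^\<alpha>.\<close>
  define e where "e = (\<lambda>q. if q = p then 1 / coef \<alpha> p else 0)"
  have e: "(\<Sum>q<l. e q * coef \<alpha> q) = 1"
    using \<alpha> by (simp add: e_def if_distrib[of "\<lambda>x. x * _"] cong: if_cong)
  define h X Y where "h = Dl e" and "X = xw \<alpha>" and "Y = xw (- \<alpha>)"
  define r where "r = (1 - c) / 2"
  define s where "s = kst r"
  interpret rank_one h X Y s unfolding h_def X_def Y_def s_def by (rule rank_one_xw[OF e])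
  interpret R0: rank_one h X Y 0 by unfold_locales (simp_all add: hX hY XY YX)
  have in_W: "h \<in> Wc" "X \<in> Wc" "Y \<in> Wc"
    using \<alpha> by (simp_all add: h_def X_def Y_def Dl_in A_xmono Gamma_uminus)
  note W = in_W Wc_mult Wc_add Wc_diff Wc_uminus
  have phi: "\<phi> h = h" "\<phi> X = kst c * X" "\<phi> (X * h) = X * h + s * X"
    using \<alpha> by (simp_all add: h_def X_def s_def r_def phi_Dl phi_xw phi_xw_Dl_eq[OF \<alpha>(1) e])
  have U: "kst c * \<phi> (X * (h * h)) = X * ((h + s) * (h + s))"
    using phi_xw_Dl_square[OF \<alpha>(1) e] by (simp add: X_def h_def s_def r_def)
  \<comment> \<open>For -\<alpha> the element with eigenvalue 1 is -h, so the square formula for Y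
    has h - s in place of h + s.\<close>
  have "Dl (\<lambda>q. - e q) = - h"
    by (simp add: Dl_def h_def single_uminus walg_of_uminus sum_negf)
  moreover have "(\<Sum>q<l. - e q * coef (- \<alpha>) q) = 1" using e by simp
  ultimately have "kst c * \<phi> (Y * (- h * - h)) = Y * ((- h + s) * (- h + s))"
    using phi_xw_Dl_square[OF Gamma_uminus[OF \<alpha>(1)], of "\<lambda>q. - e q"] by (simp add: Y_def s_def r_def)
  then have V: "kst c * \<phi> (Y * (h * h)) = Y * ((h - s) * (h - s))"
    by (simp add: algebra_simps)
  define Q where "Q = \<phi> (h * h * h)"
  have "br (X * (h * h)) (Y * (h * h)) = kst (- 4) * (h * h * h)"
    using R0.br_square by (simp add: single_uminus walg_of_uminus)
  then have "kst (- 4) * Q = br (\<phi> (X * (h * h))) (\<phi> (Y * (h * h)))"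
    using phi_br[of "X * (h * h)" "Y * (h * h)"] by (simp only: W phi_lin(3) Q_def)
  then have "kst c * (kst c * (kst (- 4) * Q)) =
      br (kst c * \<phi> (X * (h * h))) (kst c * \<phi> (Y * (h * h)))"
    by (simp only: br_kst_left br_kst_right)
  also have "\<dots> = kst (- 4) * (h * h * h + s * (1 - s) * h)"
    unfolding U V br_square by (simp add: single_uminus walg_of_uminus)
  finally have "kst (- 4) * (kst c * (kst c * Q)) = kst (- 4) * (h * h * h + s * (1 - s) * h)"
    by (simp only: kst_left_commute[of "kst c" "- 4"])
  then have Q: "kst c * (kst c * Q) = h * h * h + s * (1 - s) * h"
    by (subst (asm) kst_cancel) simp_all
  have n3: "numeral (num.Bit1 num.One) * z = z + z + z" "X * (3 * z) = X * z + X * z + X * z" for z :: "'f walg"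
    by (simp_all only: numeral_Bit1 numeral_Bit0 numeral_One distrib_right distrib_left mult_1_left add.assoc)
  have cube: "br (h * h * h) X = X * (h * h) + X * (h * h) + X * (h * h) + (X * h + X * h + X * h) + X"
    unfolding br_cube by (simp add: distrib_left n3 add_ac)
  have "kst c * br Q X = br Q (\<phi> X)" by (simp add: phi br_kst_right)
  also have "\<dots> = \<phi> (br (h * h * h) X)" unfolding Q_def by (intro phi_br[symmetric] W)
  also have "\<dots> = \<phi> (X * (h * h)) + \<phi> (X * (h * h)) + \<phi> (X * (h * h)) +
      (\<phi> (X * h) + \<phi> (X * h) + \<phi> (X * h)) + \<phi> X"
    unfolding cube by (simp add: phi_lin(2) W)
  finally have "kst c * (kst c * (kst c * br Q X)) = kst c * (kst c *
      (\<phi> (X * (h * h)) + \<phi> (X * (h * h)) + \<phi> (X * (h * h)) +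
      (\<phi> (X * h) + \<phi> (X * h) + \<phi> (X * h)) + \<phi> X))" by simp
  moreover have "kst c * (kst c * br Q X) = br (h * h * h + s * (1 - s) * h) X"
    by (simp only: br_kst_left[symmetric] Q)
  moreover have "kst c * (\<phi> (X * (h * h)) + \<phi> (X * (h * h)) + \<phi> (X * (h * h)) +
      (\<phi> (X * h) + \<phi> (X * h) + \<phi> (X * h)) + \<phi> X) =
      X * ((h + s) * (h + s)) + X * ((h + s) * (h + s)) + X * ((h + s) * (h + s)) +
      kst c * ((X * h + s * X) + (X * h + s * X) + (X * h + s * X) + kst c * X)"
    by (simp add: distrib_left U phi add_ac)
  ultimately have eq: "br (h * h * h + s * (1 - s) * h) X =
      X * ((h + s) * (h + s)) + X * ((h + s) * (h + s)) + X * ((h + s) * (h + s)) +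
      kst c * ((X * h + s * X) + (X * h + s * X) + (X * h + s * X) + kst c * X)"
    by (simp only: kst_cancel[OF c])
  have kc: "kst c = 1 - (s + s)"
  proof -
    have "kst c = kst (1 - (r + r))" by (simp add: r_def)
    then show ?thesis unfolding s_def by (simp only: kst_add kst_diff single_one walg_of_one)
  qed
  have "br (h * h * h + s * (1 - s) * h) X - (X * ((h + s) * (h + s)) + X * ((h + s) * (h + s)) +
      X * ((h + s) * (h + s)) + (1 - (s + s)) * ((X * h + s * X) + (X * h + s * X) + (X * h + s * X) +
      (1 - (s + s)) * X)) = (s - s * s) * X + (s - s * s) * X"
    by (simp add: br_def normal_form)
  with eq kc have "(s - s * s) * X + (s - s * s) * X = 0" by simp
  then have "(s - s * s) * X = 0" using double_cancel[of _ 0] by simp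
  then have "kst (r - r * r) * X = 0" by (simp only: s_def kst_diff kst_mult)
  moreover have "X \<noteq> 0" using XY by auto
  ultimately have "r * (1 - r) = 0" by (simp only: kst_mult_eq_0) (simp add: algebra_simps)
  then have "r = 0 \<or> r = 1" by simp
  then show ?thesis
  proof
    assume "r = 1"
    then have "1 - c = 2" by (simp add: r_def)
    moreover have "c = 1 - (1 - c)" by simp
    ultimately have "c = 1 - 2" by (simp only:)
    then show ?thesis by simp
  qed (simp add: r_def)
qed

end

subsection \<open>The case of trivial scalar\<close>

lemma pd_mult_pd_pow: "pd p * pd_pow \<mu> = pd_pow (\<mu> + unit_index p)"
  by (simp add: add.commute[of \<mu>] pd_pow_add)

context weyl_type
begin

text \<open>Bracketing with \<partial>_p \<partial>_q raises the order by one while differentiating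
  the coefficient; this is how all monomials of nonzero weight are reached later.\<close>

lemma br_pd_pd_monomial:
  fixes v :: "'f salg"
  shows "br (pd p * pd q) (walg_of v * pd_pow \<mu>) = walg_of (xderiv q v) * pd_pow (\<mu> + unit_index p) +
     walg_of (xderiv p (xderiv q v)) * pd_pow \<mu> + walg_of (xderiv p v) * pd_pow (\<mu> + unit_index q)"
proof -
  have pp: "br (pd r) (pd_pow \<mu>) = (0 :: 'f walg)" for r
    by (simp add: br_def pd_mult_pd_pow) (simp add: pd_pow_add)
  have "br (pd r) (walg_of v * pd_pow \<mu>) = walg_of (xderiv r v) * pd_pow \<mu>" for r
    by (simp add: br_mult_right pp)
  then have "br (pd p * pd q) (walg_of v * pd_pow \<mu>) =
      pd p * walg_of (xderiv q v) * pd_pow \<mu> + walg_of (xderiv p v) * (pd_pow \<mu> * pd q)"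
    by (simp add: br_mult_left mult.assoc)
  also have "pd p * walg_of (xderiv q v) * pd_pow \<mu> = walg_of (xderiv q v) * (pd p * pd_pow \<mu>) +
      walg_of (xderiv p (xderiv q v)) * pd_pow \<mu>"
    by (simp add: pd_walg_of distrib_right mult.assoc)
  also have "pd p * pd_pow \<mu> = (pd_pow (\<mu> + unit_index p) :: 'f walg)"
    by (rule pd_mult_pd_pow)
  also have "pd_pow \<mu> * pd q = (pd_pow (\<mu> + unit_index q) :: 'f walg)" by (simp add: pd_pow_add)
  finally show ?thesis by simp
qed

text \<open>Constant-coefficient operators of order at most \<open>n - 2\<close>: the remainder
  after the first two Taylor terms of a monomial of degree \<open>n\<close>. The bound is written as
  a sum to avoid truncated subtraction for small \<open>n\<close>.\<close>

inductive_set low_order :: "nat \<Rightarrow> 'f walg set" for n where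
  zero: "0 \<in> low_order n"
| add: "\<kappa> \<in> multi_indices l \<Longrightarrow> mdeg \<kappa> + 2 \<le> n \<Longrightarrow> w \<in> low_order n \<Longrightarrow>
    kst c * pd_pow \<kappa> + w \<in> low_order n"

lemma low_order_add: "a \<in> low_order n \<Longrightarrow> b \<in> low_order n \<Longrightarrow> a + b \<in> low_order n"
  by (induction a rule: low_order.induct) (auto simp: add.assoc intro: low_order.intros)

lemma low_order_kst: "a \<in> low_order n \<Longrightarrow> kst d * a \<in> low_order n"
proof (induction a rule: low_order.induct)
  case (add \<kappa> w c)
  have "kst d * (kst c * pd_pow \<kappa> + w) = kst (d * c) * pd_pow \<kappa> + kst d * w"
    by (simp add: distrib_left kst_mult mult.assoc)
  with add show ?case by (simp add: low_order.add)
qed (simp add: low_order.zero)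

lemma low_order_uminus: "a \<in> low_order n \<Longrightarrow> - a \<in> low_order n"
  using low_order_kst[of a n "- 1"] by (simp add: single_uminus walg_of_uminus)

lemma low_order_Suc: "a \<in> low_order n \<Longrightarrow> a \<in> low_order (Suc n)"
  by (induction a rule: low_order.induct) (auto intro: low_order.intros)

lemma low_order_pd:
  assumes "p < l"
  shows "a \<in> low_order n \<Longrightarrow> pd p * a \<in> low_order (Suc n)"
proof (induction a rule: low_order.induct)
  case (add \<kappa> w c)
  have "pd p * (kst c * pd_pow \<kappa> + w) = kst c * pd_pow (unit_index p + \<kappa>) + pd p * w"
    by (simp add: distrib_left kst_left_commute[of "pd p"] pd_pow_add)
  moreover have "kst c * pd_pow (unit_index p + \<kappa>) + pd p * w \<in> low_order (Suc n)"
    using add assms by (intro low_order.add) simp_all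
  ultimately show ?case by simp
qed (simp add: low_order.zero)

lemma low_order_sum: "(\<And>x. x \<in> S \<Longrightarrow> f x \<in> low_order n) \<Longrightarrow> sum f S \<in> low_order n"
  by (induction S rule: infinite_finite_induct) (auto intro: low_order.zero low_order_add)

text \<open>First-order Taylor expansion: conjugation by \<open>x\<^sup>a\<close> replaces \<open>\<partial>\<^sub>p\<close> by \<open>\<partial>\<^sub>p - a\<^sub>p\<close>.\<close>

lemma conjugate_pd_pow:
  assumes "\<nu> \<in> multi_indices l"
  shows "\<exists>R\<in>low_order (mdeg \<nu>). xw a * pd_pow \<nu> * xw (- a) =
    pd_pow \<nu> - (\<Sum>q<l. kst (coef a q * of_nat (coef \<nu> q)) * pd_pow (\<nu> - unit_index q)) + R"
  using assms
proof (induction \<nu> rule: multi_indices_induct)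
  case zero
  show ?case by (intro bexI[of _ 0]) (simp_all add: xw_inverse low_order.zero)
next
  case (add_unit \<nu> p)
  let ?k = "\<lambda>\<nu> q. kst (coef a q * of_nat (coef \<nu> q))"
  obtain R where R: "R \<in> low_order (mdeg \<nu>)" "xw a * pd_pow \<nu> * xw (- a) =
      pd_pow \<nu> - (\<Sum>q<l. ?k \<nu> q * pd_pow (\<nu> - unit_index q)) + R"
    using add_unit.IH by blast
  let ?S = "\<Sum>q<l. ?k \<nu> q * pd_pow (\<nu> - unit_index q)"
  have comm: "xw a * pd p = (pd p - kst (coef a p)) * xw a"
    by (simp add: left_diff_distrib pd_walg_of xderiv_xmono walg_of_mult)
  have "xw a * pd_pow (\<nu> + unit_index p) * xw (- a) = (xw a * pd p) * pd_pow \<nu> * xw (- a)"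
    by (simp add: pd_pow_add pd_pow_commute[of \<nu> "unit_index p", simplified] mult.assoc)
  also have "\<dots> = (pd p - kst (coef a p)) * (xw a * pd_pow \<nu> * xw (- a))"
    unfolding comm by (simp only: mult.assoc)
  also have "\<dots> = pd p * pd_pow \<nu> - (pd p * ?S + kst (coef a p) * pd_pow \<nu>) +
      (kst (coef a p) * ?S + pd p * R - kst (coef a p) * R)"
    unfolding R(2) by (simp add: algebra_simps)
  also have "pd p * pd_pow \<nu> = (pd_pow (\<nu> + unit_index p) :: 'f walg)"
    by (rule pd_mult_pd_pow)
  \<comment> \<open>Product rule: raising the exponent of \<partial>_p multiplies every term by
    \<partial>_p and adds one copy of a_p \<partial>^\<nu> to the term q = p.\<close>
  also have "pd p * ?S + kst (coef a p) * pd_pow \<nu> =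
      (\<Sum>q<l. ?k (\<nu> + unit_index p) q * pd_pow (\<nu> + unit_index p - unit_index q))"
  proof -
    have "?k (\<nu> + unit_index p) q * pd_pow (\<nu> + unit_index p - unit_index q) =
        pd p * (?k \<nu> q * pd_pow (\<nu> - unit_index q)) + (if q = p then kst (coef a p) * pd_pow \<nu> else 0)" for q
    proof (cases "q = p")
      case True
      have "?k \<nu> p * (pd p * pd_pow (\<nu> - unit_index p)) = ?k \<nu> p * pd_pow \<nu>"
      proof (cases "coef \<nu> p = 0")
        case False
        then have "pd p * pd_pow (\<nu> - unit_index p) = (pd_pow \<nu> :: 'f walg)"
          by (simp add: pd_mult_pd_pow diff_unit_index_add)
        then show ?thesis by simp
      qed simp
      with True show ?thesis
        by (simp only: kst_left_commute[of "pd p"])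
          (simp add: lookup_add distrib_left kst_add distrib_right)
    next
      case False
      then have "\<nu> + unit_index p - unit_index q = unit_index p + (\<nu> - unit_index q)" if "coef \<nu> q \<noteq> 0"
        using that by (intro poly_mapping_eqI) (auto simp: lookup_add lookup_minus)
      then show ?thesis
        using False by (cases "coef \<nu> q = 0")
          (simp_all add: lookup_add pd_pow_add kst_left_commute[of "pd p"])
    qed
    then show ?thesis
      using add_unit.hyps by (simp add: sum.distrib sum_distrib_left)
  qed
  finally have "xw a * pd_pow (\<nu> + unit_index p) * xw (- a) = pd_pow (\<nu> + unit_index p) -
      (\<Sum>q<l. ?k (\<nu> + unit_index p) q * pd_pow (\<nu> + unit_index p - unit_index q)) +
      (kst (coef a p) * ?S + pd p * R - kst (coef a p) * R)" .
  \<comment> \<open>The terms of \<open>?S\<close> have order one less than \<nu>, hence two less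
    than \<nu> + 1_p: multiplied by the constant a_p they belong to the new remainder.\<close>
  moreover have "?S \<in> low_order (Suc (mdeg \<nu>))"
  proof (intro low_order_sum)
    fix q assume "q \<in> {..<l}"
    show "?k \<nu> q * pd_pow (\<nu> - unit_index q) \<in> low_order (Suc (mdeg \<nu>))"
    proof (cases "coef \<nu> q = 0")
      case False
      then have "mdeg (\<nu> - unit_index q + unit_index q) = mdeg \<nu>" by (simp add: diff_unit_index_add)
      then have "mdeg (\<nu> - unit_index q) + 2 \<le> Suc (mdeg \<nu>)" by simp
      from low_order.add[OF _ this low_order.zero] show ?thesis
        using add_unit.hyps by (simp del: mdeg_add)
    qed (simp add: low_order.zero)
  qed
  then have "kst (coef a p) * ?S + pd p * R + - (kst (coef a p) * R) \<in> low_order (Suc (mdeg \<nu>))"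
    by (intro low_order_add low_order_kst low_order_uminus[OF low_order_Suc[OF low_order_kst[OF R(1)]]]
        low_order_pd[OF add_unit.hyps(2) R(1)])
  then have "kst (coef a p) * ?S + pd p * R - kst (coef a p) * R \<in> low_order (mdeg (\<nu> + unit_index p))"
    by simp
  ultimately show ?case by blast
qed

end

section \<open>Scalar 1: every element is fixed\<close>

locale unital_normalized_lie_hom = normalized_lie_hom l1 l2 \<Gamma> \<phi> 1
  for l1 l2 and \<Gamma> :: "'f::field_char_0 fvec set" and \<phi>
begin

definition Fix :: "'f walg set" where
  "Fix = {w \<in> Wc. \<phi> w = w}"

lemma Fix_add: "a \<in> Fix \<Longrightarrow> b \<in> Fix \<Longrightarrow> a + b \<in> Fix"
  by (simp add: Fix_def Wc_add phi_lin)

lemma Fix_diff: "a \<in> Fix \<Longrightarrow> b \<in> Fix \<Longrightarrow> a - b \<in> Fix"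
  by (simp add: Fix_def Wc_diff phi_lin)

lemma Fix_zero: "0 \<in> Fix"
  by (simp add: Fix_def phi_lin)

lemma Fix_kst: "a \<in> Fix \<Longrightarrow> kst d * a \<in> Fix"
  by (simp add: Fix_def Wc_kst_mult phi_lin)

lemma Fix_kstD: "d \<noteq> 0 \<Longrightarrow> kst d * a \<in> Fix \<Longrightarrow> a \<in> Fix"
  using Fix_kst[of "kst d * a" "inverse d"] by (simp add: kst_inverse)

lemma Fix_br: "a \<in> Fix \<Longrightarrow> b \<in> Fix \<Longrightarrow> br a b \<in> Fix"
  by (simp add: Fix_def Wc_br phi_br)

lemma Fix_double: "a + a \<in> Fix \<Longrightarrow> a \<in> Fix"
  using Fix_kstD[of 2 a] by (simp add: mult_2)

lemma Fix_walg_of: "u \<in> A \<Longrightarrow> walg_of u \<in> Fix"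
  by (simp add: Fix_def phi_walg_of_eq)

text \<open>For c = 1 the shift (1 - c) / 2 in \<open>phi_xw_Dl_eq\<close> is zero.\<close>

lemma Fix_xw_Dl:
  "\<alpha> \<in> \<Gamma> \<Longrightarrow> (\<Sum>p<l. e p * coef \<alpha> p) = 1 \<Longrightarrow> xw \<alpha> * Dl e \<in> Fix"
  using phi_xw_Dl_eq(1)[of \<alpha> e] by (simp add: Fix_def Wc_mult Dl_in A_xmono)

lemma Dl_single: "p < l \<Longrightarrow> Dl (\<lambda>r. if r = p then d else 0) = kst d * pd p"
  by (simp add: Dl_def if_distrib[of "\<lambda>x. kst x * _"] cong: if_cong)

text \<open>If \<alpha>_p is nonzero, rescale \<partial>_p to eigenvalue 1. If it is zero, add
  \<partial>_p to a rescaled \<partial>_q with \<alpha>_q nonzero, which does not change the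
  eigenvalue, and subtract the fixed \<partial>_q part.\<close>

lemma Fix_xw_pd:
  assumes \<alpha>: "\<alpha> \<in> \<Gamma>" and p: "p < l"
  shows "xw \<alpha> * pd p \<in> Fix"
proof (cases "\<alpha> = 0")
  case True
  then show ?thesis using p by (simp add: Fix_def phi_pd)
next
  case False
  then obtain q where q: "q < l" "coef \<alpha> q \<noteq> 0" using exists_coordinate[OF \<alpha>] by blast
  have single: "(\<Sum>r<l. (if r = s then d else 0) * coef \<alpha> r) = d * coef \<alpha> s" if "s < l" for s d
    using that by (simp add: if_distrib[of "\<lambda>x. x * _"] cong: if_cong)
  have base: "xw \<alpha> * pd s \<in> Fix" if s: "s < l" "coef \<alpha> s \<noteq> 0" for s
  proof -
    have "xw \<alpha> * Dl (\<lambda>r. if r = s then 1 / coef \<alpha> s else 0) \<in> Fix"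
      using s by (intro Fix_xw_Dl \<alpha>) (simp add: single)
    then have "kst (1 / coef \<alpha> s) * (xw \<alpha> * pd s) \<in> Fix"
      using s by (simp add: Dl_single kst_left_commute[of "xw \<alpha>"])
    then show ?thesis by (rule Fix_kstD[rotated]) (use s in simp)
  qed
  show ?thesis
  proof (cases "coef \<alpha> p = 0")
    case True
    let ?e = "\<lambda>r. (if r = q then 1 / coef \<alpha> q else 0) + (if r = p then 1 else 0)"
    have "(\<Sum>r<l. ?e r * coef \<alpha> r) = 1"
      using q p True by (simp add: distrib_right sum.distrib single)
    then have "xw \<alpha> * Dl ?e \<in> Fix" by (intro Fix_xw_Dl \<alpha>)
    moreover have "Dl ?e = Dl (\<lambda>r. if r = q then 1 / coef \<alpha> q else 0) + Dl (\<lambda>r. if r = p then 1 else 0)"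
      by (simp only: Dl_def kst_add distrib_right sum.distrib)
    ultimately have "kst (1 / coef \<alpha> q) * (xw \<alpha> * pd q) + xw \<alpha> * pd p \<in> Fix"
      using p q by (simp add: Dl_single distrib_left kst_left_commute[of "xw \<alpha>"])
    from Fix_diff[OF this Fix_kst[OF base[OF q], of "1 / coef \<alpha> q"]] show ?thesis by simp
  qed (rule base[OF p])
qed

text \<open>The element \<partial>_p \<partial>_q is fixed up to a constant, which brackets do not
  see: its brackets with the x^\<beta> are first-order elements already fixed, so the correction
  lies in \<open>A\<close>, and commuting with all \<partial>_r makes it constant.\<close>

lemma Fix_br_pd_pd:
  assumes p: "p < l" and q: "q < l" and w: "w \<in> Fix"
  shows "br (pd p * pd q) w \<in> Fix"
proof -
  let ?D = "pd p * pd q :: 'f walg"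
  have D: "?D \<in> Wc" using p q by (simp add: Wc_mult)
  have "br (\<phi> ?D) (xw \<beta>) = br ?D (xw \<beta>)" if \<beta>: "\<beta> \<in> \<Gamma>" for \<beta>
  proof -
    have x: "\<phi> (xw \<beta>) = xw \<beta>" using phi_xw[OF \<beta>] by simp
    have "br ?D (xw \<beta>) = kst (coef \<beta> q) * (xw \<beta> * pd p) +
        kst (coef \<beta> q) * (kst (coef \<beta> p) * xw \<beta>) + kst (coef \<beta> p) * (xw \<beta> * pd q)"
      by (simp add: br_mult_left xderiv_xmono walg_of_mult kst_left_commute[of "pd p"] mult.assoc)
        (simp add: pd_walg_of xderiv_xmono walg_of_mult distrib_left)
    moreover have "kst (coef \<beta> q) * (xw \<beta> * pd p) +
        kst (coef \<beta> q) * (kst (coef \<beta> p) * xw \<beta>) + kst (coef \<beta> p) * (xw \<beta> * pd q) \<in> Fix"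
      using \<beta> p q by (intro Fix_add Fix_kst Fix_xw_pd Fix_walg_of) (simp_all add: A_xmono)
    ultimately have "\<phi> (br ?D (xw \<beta>)) = br ?D (xw \<beta>)" by (simp add: Fix_def)
    then show ?thesis using D \<beta> phi_br[of ?D "xw \<beta>"] x by (simp add: A_xmono)
  qed
  then obtain g where g: "g \<in> A" "\<phi> ?D = ?D + walg_of g"
    using centralizer_diff[of "\<phi> ?D" ?D] D phi_lin(1) by blast
  have "xderiv r g = 0" if "r < l" for r
  proof -
    have "br ?D (pd r) = 0" by (simp add: br_mult_left)
    then have "br (?D + walg_of g) (pd r) = 0"
      using phi_br[of ?D "pd r"] D that g(2) phi_pd[OF that] by (simp add: phi_lin(4))
    then show ?thesis using \<open>br ?D (pd r) = 0\<close> by (simp add: br_add_left)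
  qed
  then obtain d where "g = Poly_Mapping.single 0 d" using joint_kernel[OF g(1)] by blast
  then show ?thesis
    using w D phi_br[of ?D w] g(2) by (simp add: Fix_def Wc_br br_add_left)
qed

text \<open>Induction on the order. The bracket of \<partial>_p \<partial>_q with v
  \<partial>^\<mu>, where \<partial>_q v = u, contains the wanted u \<partial>_p \<partial>^\<mu>;
  the other terms are of lower order or carry the extra factor \<partial>_q. Hence the direction
  \<open>q\<close>, with \<alpha>_q nonzero, is settled first.\<close>

lemma Fix_homogeneous:
  assumes \<alpha>: "\<alpha> \<in> \<Gamma>" "\<alpha> \<noteq> 0" and \<mu>: "\<mu> \<in> multi_indices l"
  shows "u \<in> homogeneous \<alpha> \<Longrightarrow> walg_of u * pd_pow \<mu> \<in> Fix"
  using \<mu>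
proof (induction \<mu> arbitrary: u rule: multi_indices_induct)
  case zero
  then show ?case by (simp add: Fix_walg_of homogeneous_A)
next
  case (add_unit \<mu> p)
  obtain q where q: "q < l" "coef \<alpha> q \<noteq> 0" using exists_coordinate[OF \<alpha>] by blast
  note IH = add_unit.IH
  \<comment> \<open>For p = q the wanted term occurs twice, and it is halved in characteristic
    0.\<close>
  have step: "walg_of u * pd_pow (\<mu> + unit_index q) \<in> Fix" if u: "u \<in> homogeneous \<alpha>" for u
  proof -
    obtain v where v: "v \<in> homogeneous \<alpha>" "xderiv q v = u"
      using homogeneous_xderiv_surj[OF q(2) u] by blast
    from Fix_diff[OF Fix_br_pd_pd[OF q(1) q(1) IH[OF v(1)]] IH[OF homogeneous_xderiv[OF u, of q]]]
    have "walg_of u * pd_pow (\<mu> + unit_index q) + walg_of u * pd_pow (\<mu> + unit_index q) \<in> Fix"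
      by (simp add: br_pd_pd_monomial v(2))
    then show ?thesis by (rule Fix_double)
  qed
  obtain v where v: "v \<in> homogeneous \<alpha>" "xderiv q v = u"
    using homogeneous_xderiv_surj[OF q(2) add_unit.prems] by blast
  have "br (pd p * pd q) (walg_of v * pd_pow \<mu>) - walg_of (xderiv p u) * pd_pow \<mu> -
      walg_of (xderiv p v) * pd_pow (\<mu> + unit_index q) \<in> Fix"
    using add_unit.hyps(2) q(1) v(1) add_unit.prems
    by (intro Fix_diff Fix_br_pd_pd IH step homogeneous_xderiv)
  then show ?case by (simp add: br_pd_pd_monomial v(2))
qed

lemma Fix_low_order:
  assumes "\<And>\<kappa>. \<kappa> \<in> multi_indices l \<Longrightarrow> mdeg \<kappa> + 2 \<le> n \<Longrightarrow> walg_of u * pd_pow \<kappa> \<in> Fix"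
  shows "R \<in> low_order n \<Longrightarrow> walg_of u * R \<in> Fix"
proof (induction R rule: low_order.induct)
  case (add \<kappa> w d)
  have "walg_of u * (kst d * pd_pow \<kappa> + w) = kst d * (walg_of u * pd_pow \<kappa>) + walg_of u * w"
    by (simp add: distrib_left kst_left_commute[of "walg_of u"])
  then show ?case using add assms by (simp add: Fix_add Fix_kst)
qed (simp add: Fix_zero)

text \<open>In weight zero no direction has a nonzero eigenvalue. Instead x^a t^i \<partial>^\<nu>,
  fixed for nonzero a in \<Gamma>, is bracketed with x^(-a): in the Taylor expansion the leading
  terms cancel, the remainder is fixed by induction, and the first-order term \<open>G a\<close> is
  left. It is linear in \<open>a\<close>, so it is fixed for every vector \<open>a\<close>.\<close>

lemma Fix_weight_zero:
  assumes i: "i \<in> multi_indices l1"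
  shows "\<mu> \<in> multi_indices l \<Longrightarrow> walg_of (xmono 0 i) * pd_pow \<mu> \<in> Fix"
proof (induction "mdeg \<mu>" arbitrary: \<mu> rule: less_induct)
  case less
  define t where "t = walg_of (xmono (0 :: 'f fvec) i)"
  \<comment> \<open>One order higher in coordinate 0, which exists because
    \<open>0 < l1 + l2\<close>, so that the first-order term at the unit vector is a positive
    multiple of t^i \<partial>^\<mu>.\<close>
  define \<nu> where "\<nu> = \<mu> + unit_index 0"
  have \<nu>: "\<nu> \<in> multi_indices l" "mdeg \<nu> = Suc (mdeg \<mu>)" using less.prems pos by (simp_all add: \<nu>_def)
  define G where "G a = (\<Sum>q<l. kst (coef a q * of_nat (coef \<nu> q)) * (t * pd_pow (\<nu> - unit_index q)))" for a
  have tA: "xmono 0 i \<in> A" using i by (simp add: A_xmono)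
  have G_Gamma: "G a \<in> Fix" if a: "a \<in> \<Gamma>" for a
  proof (cases "a = 0")
    case True
    then show ?thesis by (simp add: G_def Fix_zero)
  next
    case False
    obtain R where R: "R \<in> low_order (mdeg \<nu>)" "xw a * pd_pow \<nu> * xw (- a) =
        pd_pow \<nu> - (\<Sum>q<l. kst (coef a q * of_nat (coef \<nu> q)) * pd_pow (\<nu> - unit_index q)) + R"
      using conjugate_pd_pow[OF \<nu>(1), of a] by blast
    have tR: "t * R \<in> Fix"
      unfolding t_def using less.hyps \<nu>(2) by (intro Fix_low_order[OF _ R(1)]) simp
    have xt: "xw a * t = walg_of (xmono a i)" by (simp add: t_def xmono_add flip: walg_of_mult)
    have "walg_of (xmono a i) * pd_pow \<nu> \<in> Fix"
      using a i False by (intro Fix_homogeneous[OF a _ \<nu>(1)]) (simp_all add: xmono_def homogeneous_single)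
    moreover have "xw (- a) \<in> Fix" using a by (intro Fix_walg_of) (simp add: A_xmono Gamma_uminus)
    ultimately have "br (walg_of (xmono a i) * pd_pow \<nu>) (xw (- a)) \<in> Fix" by (rule Fix_br)
    also have "br (walg_of (xmono a i) * pd_pow \<nu>) (xw (- a)) = t * (xw a * pd_pow \<nu> * xw (- a)) - t * pd_pow \<nu>"
    proof -
      have "xw (- a) * (xw a * t * pd_pow \<nu>) = t * pd_pow \<nu>"
        by (simp add: mult.assoc[symmetric] xw_inverse)
      moreover have "xw a * t = t * xw a" by (simp add: t_def walg_of_commute)
      then have "xw a * t * pd_pow \<nu> * xw (- a) = t * (xw a * pd_pow \<nu> * xw (- a))"
        by (simp only: mult.assoc)
      ultimately show ?thesis unfolding xt[symmetric] br_def by (simp only:)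
    qed
    also have "t * (xw a * pd_pow \<nu> * xw (- a)) - t * pd_pow \<nu> = t * R - G a"
      unfolding R(2) G_def t_def
      by (simp add: distrib_left right_diff_distrib sum_distrib_left kst_left_commute[of "walg_of _"])
    finally have "t * R - G a \<in> Fix" .
    from Fix_diff[OF tR this] show ?thesis by simp
  qed
  have G_in: "G a \<in> Wc" for a
    unfolding G_def t_def using \<nu>(1) tA by (intro Wc_sum Wc_kst_mult Wc_monomial) simp_all
  have G_add: "G (a + b) = G a + G b" for a b
    by (simp add: G_def lookup_add distrib_right kst_add sum.distrib)
  have G_scale: "G (scale d a) = kst d * G a" for d a
    by (simp only: G_def lookup_scale mult.assoc kst_mult sum_distrib_left)
  have "pm.subspace {a. G a \<in> Fix}"
    unfolding pm.subspace_def
    using Fix_add Fix_kst G_add G_scale G_Gamma[OF Gamma_zero] by simp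
  then have "vecs l \<subseteq> {a. G a \<in> Fix}" using G_Gamma by (intro vecs_subset_subspace) auto
  then have "G (Poly_Mapping.single 0 1) \<in> Fix" using single_in_vecs[OF pos] by blast
  moreover have "G (Poly_Mapping.single 0 1) = kst (of_nat (Suc (coef \<mu> 0))) * (t * pd_pow \<mu>)"
  proof -
    have "G (Poly_Mapping.single 0 1) = (\<Sum>q<l. if q = 0 then kst (of_nat (Suc (coef \<mu> 0))) * (t * pd_pow \<mu>) else 0)"
      unfolding G_def
    proof (intro sum.cong refl)
      fix q :: nat
      have "coef (Poly_Mapping.single 0 (1 :: 'f)) q = (if q = 0 then 1 else 0)"
        by (simp only: lookup_single when_def eq_commute)
      moreover have "coef \<nu> 0 = Suc (coef \<mu> 0)" by (simp add: \<nu>_def lookup_add)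
      moreover have "\<nu> - unit_index 0 = \<mu>" by (simp add: \<nu>_def)
      ultimately show "kst (coef (Poly_Mapping.single 0 1) q * of_nat (coef \<nu> q)) *
          (t * pd_pow (\<nu> - unit_index q)) =
          (if q = 0 then kst (of_nat (Suc (coef \<mu> 0))) * (t * pd_pow \<mu>) else 0)"
        by (cases "q = 0") (simp_all del: single_one single_of_nat)
    qed
    then show ?thesis using pos by simp
  qed
  ultimately have "kst (of_nat (Suc (coef \<mu> 0))) * (t * pd_pow \<mu>) \<in> Fix" by (simp only:)
  then show ?case unfolding t_def by (rule Fix_kstD[rotated]) (simp del: of_nat_Suc)
qed

lemma phi_eq_id: "w \<in> Wc \<Longrightarrow> \<phi> w = w"
proof -
  assume "w \<in> Wc"
  then have "w \<in> Fix"
  proof (induction w rule: Wc_monomial_induct)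
    case (monomial \<alpha> i d \<mu>)
    show ?case
    proof (cases "\<alpha> = 0")
      case True
      have "walg_of (Poly_Mapping.single (0, i) d) = kst d * walg_of (xmono (0 :: 'f fvec) i)"
        by (simp add: xmono_def mult_single flip: walg_of_mult)
      then show ?thesis
        using True Fix_kst[OF Fix_weight_zero[OF monomial(2,3)], of d] by (simp add: mult.assoc)
    next
      case False
      then show ?thesis
        using monomial by (intro Fix_homogeneous[of \<alpha>] homogeneous_single) simp_all
    qed
  qed (auto intro: Fix_zero Fix_add)
  then show ?thesis by (simp add: Fix_def)
qed

end


section \<open>Closed families are gradients up to constants\<close>

lemma sum_coef_multi_index:
  assumes "i \<in> multi_indices n"
  shows "(\<Sum>p<n. coef i p) = mdeg i"
  unfolding mdeg_def using assms
  by (intro sum.mono_neutral_right) (auto simp: multi_indices_def in_keys_iff)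

context weyl_type
begin

lemma A_coef_eq_0: "u \<in> A \<Longrightarrow> i \<notin> multi_indices l1 \<Longrightarrow> coef u (\<alpha>, i) = 0"
  by (auto simp: A_iff in_keys_iff)

lemma homogeneous_coef_eq_0: "u \<in> homogeneous \<alpha> \<Longrightarrow> \<beta> \<noteq> \<alpha> \<Longrightarrow> coef u (\<beta>, i) = 0"
  using in_keys_iff[of "(\<beta>, i)" u] by (auto simp: homogeneous_def)

text \<open>Solve the equation in one direction \<open>q\<close> with \<alpha>_q nonzero. By
  closedness the errors in the other directions lie in the kernel of \<partial>_q, which is zero on
  weight \<alpha>.\<close>

lemma closed_weight_nonzero:
  assumes a: "\<And>p. p < l \<Longrightarrow> a p \<in> homogeneous \<alpha>" and \<alpha>: "\<alpha> \<in> \<Gamma>" "\<alpha> \<noteq> 0"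
    and closed: "\<And>p q. p < l \<Longrightarrow> q < l \<Longrightarrow> xderiv p (a q) = xderiv q (a p)"
  obtains u where "u \<in> A" "\<And>p. p < l \<Longrightarrow> a p = xderiv p u"
proof -
  obtain q where q: "q < l" "coef \<alpha> q \<noteq> 0" using exists_coordinate[OF \<alpha>] by blast
  obtain u where u: "u \<in> homogeneous \<alpha>" "xderiv q u = a q"
    using homogeneous_xderiv_surj[OF q(2) a[OF q(1)]] by blast
  have "a p = xderiv p u" if p: "p < l" for p
  proof -
    let ?d = "xderiv p u - a p"
    have "xderiv q ?d = 0"
      using closed[OF p q(1)] by (simp add: xderiv_diff xderiv_commute[of q p] u(2))
    then have "xderiv q ?d = Poly_Mapping.single 0 0 * ?d" by simp
    from eigen_support[OF this] have sub: "\<And>\<beta> i. (\<beta>, i) \<in> supp ?d \<Longrightarrow> coef \<beta> q = 0" by blast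
    have "?d \<in> homogeneous \<alpha>" using u(1) a[OF p] by (intro homogeneous_diff homogeneous_xderiv)
    then have "\<And>\<beta> i. (\<beta>, i) \<in> supp ?d \<Longrightarrow> \<beta> = \<alpha>" by (force simp: homogeneous_def)
    with sub q(2) have "supp ?d = {}" by fast
    then show ?thesis by simp
  qed
  then show ?thesis using that u(1) homogeneous_A by blast
qed

text \<open>Euler's homotopy: the antiderivative of \<open>\<Sum> a\<^sub>p dt\<^sub>p\<close> is \<open>\<Sum> t\<^sub>p a\<^sub>p\<close> with each monomial divided
  by its degree.\<close>

lemma closed_weight_zero:
  assumes a: "\<And>p. p < l \<Longrightarrow> a p \<in> homogeneous 0"
    and closed: "\<And>p q. p < l \<Longrightarrow> q < l \<Longrightarrow> xderiv p (a q) = xderiv q (a p)"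
  obtains u v where "u \<in> A" "\<And>p. p < l1 \<Longrightarrow> v p = 0"
    "\<And>p. p < l \<Longrightarrow> a p = xderiv p u + Poly_Mapping.single 0 (v p)"
proof -
  \<comment> \<open>The divisor \<open>Suc (mdeg (snd k))\<close> is the degree after multiplication
    by t_p. Only \<open>p < l1\<close> has a variable t_p in \<open>A\<close>, which is why
    \<open>u\<close> sums \<open>w p\<close> over these indices alone.\<close>
  define w where "w p = (\<Sum>k\<in>supp (a p). Poly_Mapping.single (0 :: 'f fvec, snd k + unit_index p)
      (coef (a p) k / of_nat (Suc (mdeg (snd k)))))" for p
  define u where "u = (\<Sum>p<l1. w p)"
  have aA: "a p \<in> A" if "p < l" for p using a[OF that] by (rule homogeneous_A)
  have uA: "u \<in> A"
    unfolding u_def w_def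
  proof (intro A_sum)
    fix p k assume p: "p \<in> {..<l1}" and k: "k \<in> supp (a p)"
    obtain \<alpha> i where "k = (\<alpha>, i)" by fastforce
    with aA[of p] p k have "snd k \<in> multi_indices l1" by (auto simp: A_iff)
    with p show "Poly_Mapping.single (0, snd k + unit_index p)
        (coef (a p) k / of_nat (Suc (mdeg (snd k)))) \<in> A"
      by (simp add: A_single)
  qed
  have coef_w_add: "coef (w p) (0, j + unit_index p) = coef (a p) (0, j) / of_nat (Suc (mdeg j))"
    if p: "p < l1" for p j
  proof -
    have "coef (w p) (0, j + unit_index p) = (\<Sum>k\<in>supp (a p). if k = (0, j)
        then coef (a p) (0, j) / of_nat (Suc (mdeg j)) else 0)"
      unfolding w_def lookup_sum
    proof (intro sum.cong refl)
      fix k assume "k \<in> supp (a p)"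
      then have "fst k = 0" using a[of p] p by (simp add: homogeneous_def)
      then show "coef (Poly_Mapping.single (0, snd k + unit_index p)
            (coef (a p) k / of_nat (Suc (mdeg (snd k))))) (0, j + unit_index p) =
          (if k = (0, j) then coef (a p) (0, j) / of_nat (Suc (mdeg j)) else 0)"
        by (cases k) (simp add: lookup_single when_def del: of_nat_Suc)
    qed
    also have "\<dots> = coef (a p) (0, j) / of_nat (Suc (mdeg j))"
      by (simp add: in_keys_iff del: of_nat_Suc)
    finally show ?thesis .
  qed
  have coef_w_zero: "coef (w p) (0, m) = 0" if "coef m p = 0" for p m
    unfolding w_def lookup_sum
  proof (intro sum.neutral ballI)
    fix k :: "'f fvec \<times> mindex"
    have "snd k + unit_index p \<noteq> m"
    proof
      assume "snd k + unit_index p = m"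
      then have "coef m p = coef (snd k) p + 1" by (auto simp: lookup_add)
      with that show False by simp
    qed
    then show "coef (Poly_Mapping.single (0, snd k + unit_index p)
        (coef (a p) k / of_nat (Suc (mdeg (snd k))))) (0, m) = 0"
      by (simp add: lookup_single when_def)
  qed
  have coef_w: "coef (w p) (0, i + unit_index q) * of_nat (Suc (mdeg i)) =
      (if 0 < coef (i + unit_index q) p then coef (a p) (0, i + unit_index q - unit_index p) else 0)"
    if p: "p < l1" for p q i
  proof (cases "0 < coef (i + unit_index q) p")
    case True
    define j where "j = i + unit_index q - unit_index p"
    have ij: "i + unit_index q = j + unit_index p" unfolding j_def by (rule diff_unit_index_add[OF True, symmetric])
    have "mdeg (i + unit_index q) = mdeg (j + unit_index p)" by (rule arg_cong[OF ij])
    then have "mdeg j = mdeg i" by (simp only: mdeg_add mdeg_unit_index add_right_cancel)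
    then have "coef (w p) (0, i + unit_index q) * of_nat (Suc (mdeg i)) = coef (a p) (0, j)"
      unfolding ij coef_w_add[OF p] by (simp del: of_nat_Suc)
    with True show ?thesis by (simp only: if_True j_def)
  next
    case False
    then show ?thesis using coef_w_zero[of "i + unit_index q" p] by (simp only: if_False) simp
  qed
  have closed': "of_nat (Suc (coef j q)) * coef (a p) (0, j + unit_index q) =
      of_nat (Suc (coef j p)) * coef (a q) (0, j + unit_index p)" if "p < l" "q < l" for p q j
    using arg_cong[OF closed[OF that], of "\<lambda>u. coef u (0, j)"] by (simp add: coef_xderiv)
  have grad: "a q = xderiv q u" if q: "q < l1" for q
  proof (rule poly_mapping_eqI)
    fix k :: "'f fvec \<times> mindex"
    obtain \<alpha> i where k: "k = (\<alpha>, i)" by fastforce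
    have u_hom: "coef u (\<alpha>, j) = 0" if "\<alpha> \<noteq> 0" for j
      unfolding u_def w_def using that by (simp add: lookup_sum lookup_single when_def)
    show "coef (a q) k = coef (xderiv q u) k"
    proof (cases "\<alpha> = 0")
      case False
      then show ?thesis
        using homogeneous_coef_eq_0[OF a] q by (simp add: k coef_xderiv u_hom)
    next
      case True
      \<comment> \<open>Closedness replaces the coefficients of a_p by those of a_q, at the price of
        the factor i_p. Summed over \<open>p\<close> these factors give the degree of t^i, and p = q
        contributes the additional 1.\<close>
      have each: "of_nat (Suc (coef i q)) * (coef (w p) (0, i + unit_index q) * of_nat (Suc (mdeg i))) =
          of_nat (coef i p + (if p = q then 1 else 0)) * coef (a q) (0, i)" if p: "p < l1" for p
      proof (cases "p = q")
        case True
        then show ?thesis unfolding coef_w[OF p] by (simp add: lookup_add)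
      next
        case False
        show ?thesis
        proof (cases "coef i p = 0")
          case True
          then show ?thesis unfolding coef_w[OF p] using False by (simp add: lookup_add)
        next
          case nz: False
          define j where "j = i - unit_index p"
          have i: "i = j + unit_index p" using nz by (simp add: j_def diff_unit_index_add)
          have "i + unit_index q - unit_index p = j + unit_index q"
            by (intro poly_mapping_eqI) (simp add: i lookup_add lookup_minus)
          moreover have "coef j q = coef i q" "Suc (coef j p) = coef i p"
            using False by (simp_all add: i lookup_add)
          moreover have "0 < coef (i + unit_index q) p" using nz by (simp add: lookup_add)
          ultimately show ?thesis
            unfolding coef_w[OF p] using False closed'[of p q j] p q
            by (simp only: i[symmetric] if_True if_False trans_less_add1 add_0_right)
        qed
      qed
      have "coef (xderiv q u) (0, i) * of_nat (Suc (mdeg i)) =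
          (\<Sum>p<l1. of_nat (Suc (coef i q)) * (coef (w p) (0, i + unit_index q) * of_nat (Suc (mdeg i))))"
        by (simp add: coef_xderiv u_def lookup_sum sum_distrib_left sum_distrib_right mult.assoc
            del: of_nat_Suc)
      also have "\<dots> = (\<Sum>p<l1. of_nat (coef i p + (if p = q then 1 else 0)) * coef (a q) (0, i))"
        by (intro sum.cong refl each) simp
      also have "\<dots> = of_nat (\<Sum>p<l1. coef i p + (if p = q then 1 else 0)) * coef (a q) (0, i)"
        by (simp only: sum_distrib_right of_nat_sum)
      also have "\<dots> = of_nat (Suc (mdeg i)) * coef (a q) (0, i)"
      proof (cases "i \<in> multi_indices l1")
        case True
        then show ?thesis using q by (simp add: sum.distrib sum_coef_multi_index)
      next
        case False
        then have "coef (a q) (0, i) = 0" using q by (intro A_coef_eq_0 aA) simp_all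
        then show ?thesis by simp
      qed
      finally have "coef (xderiv q u) (0, i) = coef (a q) (0, i)"
        by (simp del: of_nat_Suc)
      then show ?thesis by (simp add: k True)
    qed
  qed
  \<comment> \<open>For \<open>q \<ge> l1\<close> there is no variable t_q, so \<open>u\<close>
    cannot account for \<open>a q\<close>; closedness forces \<open>a q\<close> to be
    constant.\<close>
  define v where "v q = (if q < l1 then 0 else coef (a q) 0)" for q
  have const: "a q = xderiv q u + Poly_Mapping.single 0 (v q)" if q: "l1 \<le> q" "q < l" for q
  proof -
    have "coef (a q) (0, i) = 0" if i: "i \<in> multi_indices l1" "i \<noteq> 0" for i
    proof -
      obtain j p where jp: "i = j + unit_index p" using i(2) by (cases i rule: mindex_cases) auto
      with i have "p < l1" by simp
      \<comment> \<open>The exponent contains t_q with \<open>q \<ge> l1\<close>, which does not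
        occur in \<open>A\<close>.\<close>
      have "coef (a p) (0, j + unit_index q) = 0" using \<open>p < l1\<close> q by (intro A_coef_eq_0 aA) simp_all
      then have "of_nat (Suc (coef j p)) * coef (a q) (0, i) = 0"
        using closed'[of p q j] \<open>p < l1\<close> q jp by simp
      then show ?thesis by (simp only: mult_eq_0_iff of_nat_eq_0_iff nat.simps simp_thms)
    qed
    note vanish = this
    have "supp (a q) \<subseteq> {0}"
    proof
      fix k assume k: "k \<in> supp (a q)"
      obtain \<alpha> i where k_eq: "k = (\<alpha>, i)" by fastforce
      have "fst k = 0" using a[OF q(2)] k by (simp add: homogeneous_def)
      then have "\<alpha> = 0" by (simp add: k_eq)
      have nz: "coef (a q) (0, i) \<noteq> 0" using k \<open>\<alpha> = 0\<close> by (simp add: in_keys_iff k_eq)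
      then have "i \<in> multi_indices l1" using A_coef_eq_0[OF aA[OF q(2)]] by blast
      then have "i = 0" using nz vanish by blast
      then show "k \<in> {0}" using \<open>\<alpha> = 0\<close> by (simp add: k_eq zero_prod_def)
    qed
    then have single: "a q = Poly_Mapping.single 0 (coef (a q) 0)" by (rule supp_subset_singleton)
    have v: "v q = coef (a q) 0" using q by (simp add: v_def)
    have "a q = Poly_Mapping.single 0 (v q)" unfolding v by (rule single)
    moreover have "xderiv q u = 0"
    proof (rule poly_mapping_eqI)
      fix k :: "'f fvec \<times> mindex"
      obtain \<alpha> i where k: "k = (\<alpha>, i)" by fastforce
      have "coef u (\<alpha>, j) = 0" if "\<alpha> \<noteq> 0" for j
        unfolding u_def w_def using that by (simp add: lookup_sum lookup_single when_def)
      moreover have "coef u (\<alpha>, i + unit_index q) = 0" using q by (intro A_coef_eq_0 uA) simp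
      ultimately show "coef (xderiv q u) k = coef 0 k" by (cases "\<alpha> = 0") (simp_all add: k coef_xderiv)
    qed
    ultimately show ?thesis by simp
  qed
  show ?thesis
  proof (rule that[OF uA, of v])
    fix p assume p: "p < l"
    show "a p = xderiv p u + Poly_Mapping.single 0 (v p)"
    proof (cases "p < l1")
      case True
      then have "v p = 0" by (simp add: v_def)
      then show ?thesis using grad[OF True] by simp
    next
      case False
      then show ?thesis using p by (intro const) simp_all
    qed
  qed (simp add: v_def)
qed

definition weight_part :: "'f fvec \<Rightarrow> 'f salg \<Rightarrow> 'f salg" where
  "weight_part \<alpha> u = (\<Sum>k\<in>{k\<in>supp u. fst k = \<alpha>}. Poly_Mapping.single k (coef u k))"

lemma coef_weight_part: "coef (weight_part \<alpha> u) k = (if fst k = \<alpha> then coef u k else 0)"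
  by (auto simp: weight_part_def lookup_sum lookup_single when_def in_keys_iff sum.If_cases
      intro!: sum.neutral)

lemma weight_part_homogeneous:
  assumes "u \<in> A"
  shows "weight_part \<alpha> u \<in> homogeneous \<alpha>"
proof -
  have sub: "k \<in> supp u \<and> fst k = \<alpha>" if "k \<in> supp (weight_part \<alpha> u)" for k
  proof -
    from that have "coef (weight_part \<alpha> u) k \<noteq> 0" by (simp only: in_keys_iff not_False_eq_True)
    then have "fst k = \<alpha> \<and> coef u k \<noteq> 0" by (auto simp: coef_weight_part split: if_splits)
    then show ?thesis by (simp add: in_keys_iff)
  qed
  have "supp u \<subseteq> \<Gamma> \<times> multi_indices l1" using assms by (simp only: salg_carrier_def mem_Collect_eq)
  then have "supp (weight_part \<alpha> u) \<subseteq> \<Gamma> \<times> multi_indices l1" using sub by blast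
  then show ?thesis using sub by (simp only: homogeneous_def salg_carrier_def mem_Collect_eq) blast
qed

lemma weight_part_xderiv: "weight_part \<alpha> (xderiv p u) = xderiv p (weight_part \<alpha> u)"
  by (rule poly_mapping_eqI) (auto simp: coef_weight_part coef_xderiv split_paired_all)

text \<open>The derivations preserve weights, so each of the finitely many weights is treated
  separately; constants arise in weight zero only.\<close>

lemma closed_family:
  assumes a: "\<And>p. p < l \<Longrightarrow> a p \<in> A"
    and closed: "\<And>p q. p < l \<Longrightarrow> q < l \<Longrightarrow> xderiv p (a q) = xderiv q (a p)"
  obtains u v where "u \<in> A" "\<And>p. p < l1 \<Longrightarrow> v p = 0"
    "\<And>p. p < l \<Longrightarrow> a p = xderiv p u + Poly_Mapping.single 0 (v p)"
proof -
  define S where "S = (\<Union>p\<in>{..<l}. fst ` supp (a p))"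
  have S: "finite S" "S \<subseteq> \<Gamma>" using a by (auto simp: S_def A_iff)
  have part: "\<exists>u v. u \<in> A \<and> (\<forall>p<l1. v p = 0) \<and>
      (\<forall>p<l. weight_part \<alpha> (a p) = xderiv p u + Poly_Mapping.single 0 (v p))" if "\<alpha> \<in> S" for \<alpha>
  proof -
    have 1: "weight_part \<alpha> (a p) \<in> homogeneous \<alpha>" if "p < l" for p
      using a[OF that] by (rule weight_part_homogeneous)
    have 2: "xderiv p (weight_part \<alpha> (a q)) = xderiv q (weight_part \<alpha> (a p))" if "p < l" "q < l" for p q
      using closed[OF that] by (simp flip: weight_part_xderiv)
    have \<alpha>\<Gamma>: "\<alpha> \<in> \<Gamma>" using S(2) that by blast
    show ?thesis
    proof (cases "\<alpha> = 0")
      case True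
      obtain u v where "u \<in> A" "\<And>p. p < l1 \<Longrightarrow> v p = 0"
          "\<And>p. p < l \<Longrightarrow> weight_part 0 (a p) = xderiv p u + Poly_Mapping.single 0 (v p)"
        using closed_weight_zero[where a = "\<lambda>p. weight_part 0 (a p)", OF 1[unfolded True] 2[unfolded True]]
        by blast
      then show ?thesis unfolding True by blast
    next
      case False
      then obtain u where "u \<in> A" "\<And>p. p < l \<Longrightarrow> weight_part \<alpha> (a p) = xderiv p u"
        using closed_weight_nonzero[where a = "\<lambda>p. weight_part \<alpha> (a p)" and \<alpha> = \<alpha>,
              OF 1 \<alpha>\<Gamma> False 2] by blast
      then show ?thesis by (intro exI[of _ u] exI[of _ "\<lambda>_. 0"]) simp
    qed
  qed
  then obtain U V where UV: "\<And>\<alpha>. \<alpha> \<in> S \<Longrightarrow> U \<alpha> \<in> A" "\<And>\<alpha> p. \<alpha> \<in> S \<Longrightarrow> p < l1 \<Longrightarrow> V \<alpha> p = (0::'f)"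
    "\<And>\<alpha> p. \<alpha> \<in> S \<Longrightarrow> p < l \<Longrightarrow>
      weight_part \<alpha> (a p) = xderiv p (U \<alpha>) + Poly_Mapping.single 0 (V \<alpha> p)"
    by metis
  have "a p = xderiv p (\<Sum>\<alpha>\<in>S. U \<alpha>) + Poly_Mapping.single 0 (\<Sum>\<alpha>\<in>S. V \<alpha> p)" if p: "p < l" for p
  proof -
    have "a p = (\<Sum>\<alpha>\<in>S. weight_part \<alpha> (a p))"
    proof (rule poly_mapping_eqI)
      fix k
      have "coef (a p) k = 0" if "fst k \<notin> S"
        using that p by (force simp: S_def in_keys_iff)
      then show "coef (a p) k = coef (\<Sum>\<alpha>\<in>S. weight_part \<alpha> (a p)) k"
        using S(1) by (simp add: lookup_sum coef_weight_part)
    qed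
    also have "\<dots> = (\<Sum>\<alpha>\<in>S. xderiv p (U \<alpha>) + Poly_Mapping.single 0 (V \<alpha> p))"
      using UV(3)[OF _ p] by (intro sum.cong refl)
    also have "\<dots> = xderiv p (\<Sum>\<alpha>\<in>S. U \<alpha>) + (\<Sum>\<alpha>\<in>S. Poly_Mapping.single 0 (V \<alpha> p))"
      by (simp add: sum.distrib xderiv_sum)
    also have "(\<Sum>\<alpha>\<in>S. Poly_Mapping.single 0 (V \<alpha> p)) = Poly_Mapping.single 0 (\<Sum>\<alpha>\<in>S. V \<alpha> p)"
      using S(1) by induction (simp_all add: single_add)
    finally show ?thesis .
  qed
  then show ?thesis
    using that[of "\<Sum>\<alpha>\<in>S. U \<alpha>" "\<lambda>p. \<Sum>\<alpha>\<in>S. V \<alpha> p"] UV(1,2) by (simp add: A_sum)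
qed

end

section \<open>Lie automorphisms\<close>

text \<open>Carrying the inverse along makes the hypotheses symmetric, so that everything proved for
  \<phi> is available for \<psi>.\<close>

locale lie_automorphism = weyl_type l1 l2 \<Gamma> for l1 l2 and \<Gamma> :: "'f::field_char_0 fvec set" +
  fixes \<phi> \<psi> :: "'f walg \<Rightarrow> 'f walg"
  assumes phi: "lie_hom \<phi>" and psi: "lie_hom \<psi>"
    and psi_phi: "w \<in> Wc \<Longrightarrow> \<psi> (\<phi> w) = w" and phi_psi: "w \<in> Wc \<Longrightarrow> \<phi> (\<psi> w) = w"
begin

lemma inverse: "lie_automorphism l1 l2 \<Gamma> \<psi> \<phi>"
  by unfold_locales (simp_all add: phi psi phi_psi psi_phi)

lemma lin: "linear_map \<phi>" "linear_map \<psi>"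
  using phi psi by (simp_all add: lie_hom_def)

lemmas phi_lin = linear_mapD[OF lin(1)]
lemmas psi_lin = linear_mapD[OF lin(2)]

lemma phi_br: "a \<in> Wc \<Longrightarrow> b \<in> Wc \<Longrightarrow> \<phi> (br a b) = br (\<phi> a) (\<phi> b)"
  using phi by (simp add: lie_hom_def)

lemma phi_br_psi: "a \<in> Wc \<Longrightarrow> b \<in> Wc \<Longrightarrow> br (\<phi> a) b = \<phi> (br a (\<psi> b))"
  by (simp add: phi_br psi_lin(1) phi_psi)

lemma phi_eq_0: "w \<in> Wc \<Longrightarrow> \<phi> w = 0 \<Longrightarrow> w = 0"
  using psi_phi[of w] by (simp add: psi_lin(4))

text \<open>\<open>A\<close> consists of the locally ad-nilpotent elements: a locally nilpotent derivation of a domain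
  annihilates the units \<open>x\<^sup>\<alpha>\<close>.\<close>

lemma phi_A:
  assumes u: "u \<in> A"
  shows "\<exists>v\<in>A. \<phi> (walg_of u) = walg_of v"
proof -
  let ?w = "\<phi> (walg_of u)"
  have w: "?w \<in> Wc" using u by (simp add: phi_lin(1))
  have nil: "\<exists>n. (br ?w ^^ n) z = 0" if z: "z \<in> Wc" for z
  proof -
    have eq: "(br ?w ^^ n) z = \<phi> ((br (walg_of u) ^^ n) (\<psi> z))" for n
    proof (induction n)
      case (Suc n)
      then show ?case using u z by (simp add: phi_br br_pow_in psi_lin(1))
    qed (simp add: phi_psi z)
    obtain n where "(br (walg_of u) ^^ n) (\<psi> z) = 0" using br_walg_of_nilpotent by blast
    with eq[of n] have "(br ?w ^^ n) z = 0" by (simp only: phi_lin(4))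
    then show ?thesis by blast
  qed
  have "br ?w (xw \<beta>) = 0" if "\<beta> \<in> \<Gamma>" for \<beta>
  proof -
    have "xw \<beta> \<in> Wc" "xw (- \<beta>) \<in> Wc" using that Gamma_uminus[OF that] by (simp_all add: A_xmono)
    then obtain M N where MN: "(br ?w ^^ M) (xw \<beta>) = 0" "(br ?w ^^ N) (xw (- \<beta>)) = 0"
      using nil[of "xw \<beta>"] nil[of "xw (- \<beta>)"] by blast
    show ?thesis by (rule locally_nilpotent_kills_units[OF xw_inverse(1) MN])
  qed
  then have "ord_le 0 ?w" by (rule centralizer_xw[OF w])
  then have "?w = walg_of (cf ?w 0)" by (simp only: ord_le_0)
  then show ?thesis using Wc_cf[OF w] by blast
qed

lemma psi_A: "u \<in> A \<Longrightarrow> \<exists>v\<in>A. \<psi> (walg_of u) = walg_of v"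
  using inverse by (rule lie_automorphism.phi_A)

text \<open>The element 1 is central, so by surjectivity its image commutes with every \<partial>_p;
  being in \<open>A\<close>, it is constant.\<close>

lemma phi_one: obtains c where "c \<noteq> 0" "\<phi> 1 = kst c"
proof -
  obtain v where v: "v \<in> A" "\<phi> 1 = walg_of v" using phi_A[OF A_one] by auto
  have "xderiv p v = 0" if "p < l" for p
  proof -
    have "br (walg_of v) (pd p) = 0"
      using phi_br_psi[of 1 "pd p"] that by (simp add: v(2) phi_lin(4))
    then show ?thesis by simp
  qed
  then obtain c where c: "v = Poly_Mapping.single 0 c" using joint_kernel[OF v(1)] by blast
  moreover have "c \<noteq> 0" using phi_eq_0[of 1] v(2) c by auto
  ultimately show ?thesis using that v(2) by blast
qed

text \<open>The product y z is formed in \<open>A\<close> and need not be the image of a product. It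
  is an eigenvector of the derivation ad \<phi>(\<partial>_p) with eigenvalue a_p + b_p, so its
  preimage is an eigenvector of \<partial>_p of weight a + b, that is a multiple of x^(a+b). The
  multiple is nonzero because \<open>A\<close> is a domain.\<close>

lemma eigenvector_product:
  assumes a: "a \<in> \<Gamma>" "b \<in> \<Gamma>" and y: "y \<in> A" "z \<in> A" "\<phi> (xw a) = walg_of y" "\<phi> (xw b) = walg_of z"
  obtains k where "k \<noteq> 0" "walg_of (y * z) = kst k * \<phi> (xw (a + b))"
proof -
  have yz: "y * z \<in> A" using y by (simp add: A_mult)
  obtain v where v: "v \<in> A" "\<psi> (walg_of (y * z)) = walg_of v" using psi_A[OF yz] by blast
  have eig: "br (\<phi> (pd p)) (\<phi> (xw d)) = kst (coef d p) * \<phi> (xw d)" if "d \<in> \<Gamma>" "p < l" for d p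
  proof -
    have "br (\<phi> (pd p)) (\<phi> (xw d)) = \<phi> (kst (coef d p) * xw d)"
      using that by (simp add: A_xmono xderiv_xmono walg_of_mult flip: phi_br)
    then show ?thesis using that by (simp add: phi_lin(3) A_xmono)
  qed
  have "xderiv p v = Poly_Mapping.single 0 (coef (a + b) p) * v" if p: "p < l" for p
  proof -
    have "br (\<phi> (pd p)) (walg_of (y * z)) =
        kst (coef a p) * walg_of y * walg_of z + walg_of y * (kst (coef b p) * walg_of z)"
      using eig[OF a(1) p] eig[OF a(2) p] by (simp add: walg_of_mult br_mult_right y)
    also have "\<dots> = kst (coef (a + b) p) * walg_of (y * z)"
      by (simp add: walg_of_mult kst_left_commute[of "walg_of y"] mult.assoc lookup_add kst_add distrib_right)
    finally have "\<psi> (br (\<phi> (pd p)) (walg_of (y * z))) = kst (coef (a + b) p) * walg_of v"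
      using yz v by (simp add: psi_lin(3))
    moreover have "\<psi> (br (\<phi> (pd p)) (walg_of (y * z))) = walg_of (xderiv p v)"
      using p yz v by (simp add: phi_br_psi psi_phi A_xderiv)
    ultimately show ?thesis by (simp flip: walg_of_mult)
  qed
  moreover have "a + b \<in> vecs l" using Gamma_add[OF a] Gamma_vecs by blast
  ultimately have v_eq: "v = Poly_Mapping.single 0 (coef v (a + b, 0)) * xmono (a + b) 0"
    using joint_eigenvector[OF v(1)] by blast
  define k where "k = coef v (a + b, 0)"
  have "walg_of (y * z) = \<phi> (walg_of v)" using phi_psi[of "walg_of (y * z)"] yz v(2) by simp
  also have "\<dots> = \<phi> (kst k * xw (a + b))"
    using v_eq unfolding k_def[symmetric] by (simp add: walg_of_mult)
  also have "\<dots> = kst k * \<phi> (xw (a + b))"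
    using Gamma_add[OF a] by (simp add: phi_lin(3) A_xmono)
  finally have eq: "walg_of (y * z) = kst k * \<phi> (xw (a + b))" .
  have nz: "xw d \<noteq> 0" for d :: "'f fvec" using xw_inverse(1)[of d] by auto
  have "y \<noteq> 0" "z \<noteq> 0"
    using y a phi_eq_0[of "xw a"] phi_eq_0[of "xw b"] nz by (auto simp: A_xmono)
  then have "walg_of (y * z) \<noteq> 0" using salg_mult_neq_0 by simp
  then have "k \<noteq> 0" using eq by auto
  then show ?thesis using that eq by blast
qed

text \<open>By \<open>eigenvector_product\<close> the images of x^a and x^(-a) multiply to a nonzero
  constant, so they are units and hence monomials.\<close>

lemma phi_xw_monomial:
  assumes a: "a \<in> \<Gamma>"
  shows "\<exists>f b. f \<noteq> 0 \<and> b \<in> \<Gamma> \<and> \<phi> (xw a) = kst f * xw b"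
proof -
  have a': "- a \<in> \<Gamma>" using a by (rule Gamma_uminus)
  obtain y where y: "y \<in> A" "\<phi> (xw a) = walg_of y" using phi_A[of "xmono a 0"] a by (auto simp: A_xmono)
  obtain z where z: "z \<in> A" "\<phi> (xw (- a)) = walg_of z" using phi_A[of "xmono (- a) 0"] a' by (auto simp: A_xmono)
  obtain k where k: "k \<noteq> 0" "walg_of (y * z) = kst k * \<phi> (xw (a + - a))"
    using eigenvector_product[OF a a' y(1) z(1) y(2) z(2)] by blast
  obtain c where c: "c \<noteq> 0" "\<phi> 1 = kst c" by (rule phi_one)
  have "walg_of (y * z) = kst (k * c)" using k(2) c(2) by (simp add: kst_mult)
  then have yz: "y * z = Poly_Mapping.single 0 (k * c)" by simp
  have kc: "k * c \<noteq> 0" using k c by simp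
  obtain k1 where k1: "supp y = {k1}" using salg_unit_monomial[OF yz kc] by blast
  have "z * y = Poly_Mapping.single 0 (k * c)" using yz by (simp add: mult.commute)
  then obtain k2 where k2: "supp z = {k2}" using salg_unit_monomial kc by blast
  have ye: "y = Poly_Mapping.single k1 (coef y k1)" and ze: "z = Poly_Mapping.single k2 (coef z k2)"
    using k1 k2 by (auto intro: supp_subset_singleton)
  have nz: "coef y k1 \<noteq> 0" "coef z k2 \<noteq> 0" using k1 k2 in_keys_iff[of k1 y] in_keys_iff[of k2 z] by auto
  have "Poly_Mapping.single (k1 + k2) (coef y k1 * coef z k2) = Poly_Mapping.single 0 (k * c)"
    using yz ye ze by (metis mult_single)
  then have "coef (Poly_Mapping.single 0 (k * c)) (k1 + k2) \<noteq> 0"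
    using nz by (metis lookup_single_eq mult_eq_0_iff)
  then have "k1 + k2 = 0" by (auto simp: lookup_single when_def split: if_splits)
  \<comment> \<open>Exponents of t are natural numbers, so a vanishing sum leaves no power of t in
    the image.\<close>
  then have "snd k1 + snd k2 = 0" by (metis snd_add snd_zero)
  then have "coef (snd k1) p + coef (snd k2) p = 0" for p by (metis lookup_add lookup_zero)
  then have "snd k1 = 0" by (intro poly_mapping_eqI) simp
  then have k1_eq: "k1 = (fst k1, 0)" by (metis prod.collapse)
  moreover have "k1 \<in> supp y" using k1 by simp
  ultimately have "fst k1 \<in> \<Gamma>" using y(1) A_iff by metis
  moreover have "Poly_Mapping.single k1 (coef y k1) = Poly_Mapping.single 0 (coef y k1) * xmono (fst k1) 0"
    using k1_eq by (simp add: xmono_def mult_single)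
  then have "\<phi> (xw a) = kst (coef y k1) * xw (fst k1)" using y(2) ye by (metis walg_of_mult)
  ultimately show ?thesis using nz(1) by blast
qed

definition phi_data :: "'f fvec \<Rightarrow> 'f \<times> 'f fvec" where
  "phi_data a = (SOME d. fst d \<noteq> 0 \<and> snd d \<in> \<Gamma> \<and> \<phi> (xw a) = kst (fst d) * xw (snd d))"

definition \<pi> :: "'f fvec \<Rightarrow> 'f fvec" where "\<pi> a = snd (phi_data a)"
definition f :: "'f fvec \<Rightarrow> 'f" where "f a = fst (phi_data a)"

lemma phi_xw:
  assumes "a \<in> \<Gamma>"
  shows "f a \<noteq> 0" "\<pi> a \<in> \<Gamma>" "\<phi> (xw a) = kst (f a) * xw (\<pi> a)"
proof -
  have "\<exists>d. fst d \<noteq> 0 \<and> snd d \<in> \<Gamma> \<and> \<phi> (xw a) = kst (fst d) * xw (snd d)"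
    using phi_xw_monomial[OF assms] by auto
  from someI_ex[OF this] show "f a \<noteq> 0" "\<pi> a \<in> \<Gamma>" "\<phi> (xw a) = kst (f a) * xw (\<pi> a)"
    by (simp_all add: phi_data_def \<pi>_def f_def)
qed

lemma kst_xw_eq:
  assumes "kst d * xw a = kst e * xw (b :: 'f fvec)" "d \<noteq> 0"
  shows "a = b \<and> d = e"
proof -
  have "Poly_Mapping.single (a, 0) d = (Poly_Mapping.single (b, 0) e :: 'f salg)"
    using assms(1) by (simp add: xmono_def mult_single flip: walg_of_mult)
  from arg_cong[OF this, of "\<lambda>u. coef u (a, 0)"] show ?thesis using assms(2) by (auto simp: lookup_single when_def split: if_splits)
qed

text \<open>The product of the two images is a multiple of the image of x^(a+b); compare
  exponents.\<close>

lemma pi_add: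
  assumes "a \<in> \<Gamma>" "b \<in> \<Gamma>"
  shows "\<pi> (a + b) = \<pi> a + \<pi> b"
proof -
  have x: "\<phi> (xw d) = walg_of (Poly_Mapping.single 0 (f d) * xmono (\<pi> d) 0)"
    "Poly_Mapping.single 0 (f d) * xmono (\<pi> d) 0 \<in> A" if "d \<in> \<Gamma>" for d
    using phi_xw[OF that] by (simp_all add: walg_of_mult A_mult A_xmono)
  obtain k where "k \<noteq> 0" and k: "walg_of ((Poly_Mapping.single 0 (f a) * xmono (\<pi> a) 0) *
      (Poly_Mapping.single 0 (f b) * xmono (\<pi> b) 0)) = kst k * \<phi> (xw (a + b))"
    using eigenvector_product[OF assms x(2)[OF assms(1)] x(2)[OF assms(2)] x(1)[OF assms(1)] x(1)[OF assms(2)]]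
    by blast
  have "kst (f a * f b) * xw (\<pi> a + \<pi> b) = kst (k * f (a + b)) * xw (\<pi> (a + b))"
    using k phi_xw(3)[OF Gamma_add[OF assms]]
    by (simp add: walg_of_mult kst_mult xw_add mult.assoc kst_left_commute[of "xw _"])
  then show ?thesis using kst_xw_eq phi_xw(1) assms by (metis mult_eq_0_iff)
qed

text \<open>Each x^\<beta> is the image of an element of \<open>A\<close>, so its bracket with
  \<phi>(w) is again the image of an element of \<open>A\<close>.\<close>

lemma order_1_phi:
  assumes w: "w \<in> Wc" "\<And>u. u \<in> A \<Longrightarrow> \<exists>v\<in>A. br w (walg_of u) = walg_of v"
  shows "ord_le 1 (\<phi> w)"
proof (rule order_1_if_br_xw)
  show "\<phi> w \<in> Wc" using w(1) by (rule phi_lin(1))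
  fix \<beta> assume \<beta>: "\<beta> \<in> \<Gamma>"
  obtain u where u: "u \<in> A" "\<psi> (xw \<beta>) = walg_of u" using psi_A[of "xmono \<beta> 0"] \<beta> by (auto simp: A_xmono)
  obtain v where v: "v \<in> A" "br w (walg_of u) = walg_of v" using w(2)[OF u(1)] by blast
  have "br (\<phi> w) (xw \<beta>) = \<phi> (walg_of v)"
    using phi_br_psi[OF w(1), of "xw \<beta>"] \<beta> u v by (simp add: A_xmono)
  then show "\<exists>u. br (\<phi> w) (xw \<beta>) = walg_of u" using phi_A[OF v(1)] by auto
qed

text \<open>The constant term of the coefficient of \<partial>_q in \<phi>(\<partial>_p); by
  \<open>phi_pd\<close> that coefficient has no other terms. Later \<open>g\<close> becomes the
  matrix G.\<close>

definition g :: "nat \<Rightarrow> nat \<Rightarrow> 'f" where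
  "g q p = coef (cf (\<phi> (pd p)) (unit_index q)) 0"

end

text \<open>Under the prefix \<open>inv\<close> the data \<open>\<pi>\<close>, \<open>f\<close> and
  \<open>g\<close> of the inverse automorphism become available.\<close>

sublocale lie_automorphism \<subseteq> inv: lie_automorphism l1 l2 \<Gamma> \<psi> \<phi>
  by (rule inverse)

context lie_automorphism
begin

lemma pi_inverse:
  assumes "a \<in> \<Gamma>"
  shows "inv.\<pi> (\<pi> a) = a" "inv.f (\<pi> a) * f a = 1"
proof -
  have "kst 1 * xw a = \<psi> (kst (f a) * xw (\<pi> a))"
    using psi_phi[of "xw a"] assms phi_xw[OF assms] by (simp add: A_xmono)
  also have "\<dots> = kst (f a * inv.f (\<pi> a)) * xw (inv.\<pi> (\<pi> a))"
    using phi_xw[OF assms] inv.phi_xw[of "\<pi> a"] by (simp add: psi_lin(3) A_xmono kst_mult mult.assoc)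
  finally have "a = inv.\<pi> (\<pi> a) \<and> 1 = f a * inv.f (\<pi> a)" by (rule kst_xw_eq) simp
  then show "inv.\<pi> (\<pi> a) = a" "inv.f (\<pi> a) * f a = 1" by (simp_all add: mult.commute)
qed

end

context lie_automorphism
begin

text \<open>For every \<open>a\<close> the combination of the first-order coefficients with weights
  (\<pi> a)_q is the constant a_p. As \<pi> maps onto \<Gamma> and \<Gamma> spans, the nonconstant
  part of each coefficient vanishes.\<close>

lemma phi_pd:
  assumes p: "p < l"
  shows "\<phi> (pd p) = walg_of (cf (\<phi> (pd p)) 0) + (\<Sum>q<l. kst (g q p) * pd q)"
    and "a \<in> \<Gamma> \<Longrightarrow> (\<Sum>q<l. g q p * coef (\<pi> a) q) = coef a p"
proof -
  have w: "\<phi> (pd p) \<in> Wc" using p by (simp add: phi_lin(1))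
  have o1: "ord_le 1 (\<phi> (pd p))"
    using p by (intro order_1_phi) (auto simp: A_xderiv)
  have eq: "(\<Sum>q<l. Poly_Mapping.single 0 (coef (\<pi> a) q) * cf (\<phi> (pd p)) (unit_index q)) =
      Poly_Mapping.single 0 (coef a p)" if a: "a \<in> \<Gamma>" for a
  proof -
    have "br (\<phi> (pd p)) (kst (f a) * xw (\<pi> a)) = \<phi> (kst (coef a p) * xw a)"
      using phi_br[of "pd p" "xw a"] p a phi_xw(3)[OF a] by (simp add: A_xmono xderiv_xmono walg_of_mult)
    also have "\<dots> = kst (f a) * (kst (coef a p) * xw (\<pi> a))"
      using a by (simp add: phi_lin(3) A_xmono phi_xw(3) kst_left_commute[of "kst (coef a p)"])
    finally have "br (\<phi> (pd p)) (xw (\<pi> a)) = kst (coef a p) * xw (\<pi> a)"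
      by (simp only: br_kst_right kst_cancel[OF phi_xw(1)[OF a]])
    then show ?thesis
      unfolding br_order_1_xw[OF o1 w] by (simp add: xmono_cancel flip: walg_of_mult)
  qed
  have const: "cf (\<phi> (pd p)) (unit_index q) = Poly_Mapping.single 0 (g q p)" if q: "q < l" for q
  proof -
    have "coef (cf (\<phi> (pd p)) (unit_index q)) k = 0" if "k \<noteq> 0" for k
    proof (rule coefficients_orthogonal[OF _ q])
      fix \<beta> assume "\<beta> \<in> \<Gamma>"
      then have "\<pi> (inv.\<pi> \<beta>) = \<beta>" "inv.\<pi> \<beta> \<in> \<Gamma>" using inv.pi_inverse inv.phi_xw by auto
      then show "coef (\<Sum>q<l. Poly_Mapping.single 0 (coef \<beta> q) * cf (\<phi> (pd p)) (unit_index q)) k = 0"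
        using eq[of "inv.\<pi> \<beta>"] that by (simp add: lookup_single when_def)
    qed
    then show ?thesis
      by (intro poly_mapping_eqI) (auto simp: lookup_single when_def g_def)
  qed
  show "\<phi> (pd p) = walg_of (cf (\<phi> (pd p)) 0) + (\<Sum>q<l. kst (g q p) * pd q)"
  proof -
    have sum: "(\<Sum>q<l. walg_of (cf (\<phi> (pd p)) (unit_index q)) * pd q) = (\<Sum>q<l. kst (g q p) * pd q)"
      by (intro sum.cong refl) (simp add: const)
    show ?thesis unfolding sum[symmetric] by (rule order_1_expand[OF o1 w])
  qed
  assume "a \<in> \<Gamma>"
  have "(\<Sum>q<l. Poly_Mapping.single 0 (coef (\<pi> a) q * g q p)) =
      (\<Sum>q<l. Poly_Mapping.single 0 (coef (\<pi> a) q) * cf (\<phi> (pd p)) (unit_index q))"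
    by (intro sum.cong refl) (simp add: const mult_single)
  also have "\<dots> = Poly_Mapping.single 0 (coef a p)" by (rule eq[OF \<open>a \<in> \<Gamma>\<close>])
  finally have "(\<Sum>q<l. Poly_Mapping.single 0 (coef (\<pi> a) q * g q p)) =
      (Poly_Mapping.single 0 (coef a p) :: 'f salg)" .
  from arg_cong[OF this, of "\<lambda>u. coef u 0"] show "(\<Sum>q<l. g q p * coef (\<pi> a) q) = coef a p"
    by (simp add: lookup_sum mult.commute)
qed

end


context weyl_type
begin

section \<open>Affine automorphisms and linear data\<close>

definition affine_hom where
  "affine_hom f \<pi> n \<tau> g v = weyl_relations.gen_hom (\<lambda>\<alpha>. kst (f \<alpha>) * xw (\<pi> \<alpha>))
    (\<lambda>r. (\<Sum>s<l1. kst (n s r) * tw s) + kst (\<tau> r)) (\<lambda>p. (\<Sum>q<l. kst (g q p) * pd q) + kst (v p))"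

lemma affine_hom:
  assumes f: "f 0 = 1" "\<And>\<alpha> \<beta>. \<alpha> \<in> \<Gamma> \<Longrightarrow> \<beta> \<in> \<Gamma> \<Longrightarrow> f (\<alpha> + \<beta>) = f \<alpha> * (f \<beta> :: 'f)"
    and \<pi>: "\<pi> 0 = 0" "\<And>\<alpha> \<beta>. \<alpha> \<in> \<Gamma> \<Longrightarrow> \<beta> \<in> \<Gamma> \<Longrightarrow> \<pi> (\<alpha> + \<beta>) = \<pi> \<alpha> + \<pi> \<beta>"
      "\<And>\<alpha>. \<alpha> \<in> \<Gamma> \<Longrightarrow> \<pi> \<alpha> \<in> \<Gamma>"
    and g: "\<And>\<alpha> p. \<alpha> \<in> \<Gamma> \<Longrightarrow> p < l \<Longrightarrow> (\<Sum>q<l. g q p * coef (\<pi> \<alpha>) q) = coef \<alpha> p"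
    and n: "\<And>p r. p < l \<Longrightarrow> r < l1 \<Longrightarrow> (\<Sum>s<l1. g s p * n s r) = (if p = r then 1 else 0)"
  shows "assoc_hom (affine_hom f \<pi> n \<tau> g v)"
    and "\<alpha> \<in> \<Gamma> \<Longrightarrow> affine_hom f \<pi> n \<tau> g v (xw \<alpha>) = kst (f \<alpha>) * xw (\<pi> \<alpha>)"
    and "r < l1 \<Longrightarrow> affine_hom f \<pi> n \<tau> g v (tw r) = (\<Sum>s<l1. kst (n s r) * tw s) + kst (\<tau> r)"
    and "p < l \<Longrightarrow> affine_hom f \<pi> n \<tau> g v (pd p) = (\<Sum>q<l. kst (g q p) * pd q) + kst (v p)"
proof -
  interpret R: weyl_relations l1 l2 \<Gamma> "\<lambda>\<alpha>. kst (f \<alpha>) * xw (\<pi> \<alpha>)"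
    "\<lambda>r. (\<Sum>s<l1. kst (n s r) * tw s) + kst (\<tau> r)" "\<lambda>p. (\<Sum>q<l. kst (g q p) * pd q) + kst (v p)"
    by (rule weyl_relations_affine[OF f \<pi> g n])
  show "assoc_hom (affine_hom f \<pi> n \<tau> g v)" unfolding affine_hom_def by (rule R.assoc_hom_gen_hom)
  show "\<alpha> \<in> \<Gamma> \<Longrightarrow> affine_hom f \<pi> n \<tau> g v (xw \<alpha>) = kst (f \<alpha>) * xw (\<pi> \<alpha>)"
    unfolding affine_hom_def by (rule R.gen_hom_generators)
  show "r < l1 \<Longrightarrow> affine_hom f \<pi> n \<tau> g v (tw r) = (\<Sum>s<l1. kst (n s r) * tw s) + kst (\<tau> r)"
    unfolding affine_hom_def by (rule R.gen_hom_generators)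
  show "p < l \<Longrightarrow> affine_hom f \<pi> n \<tau> g v (pd p) = (\<Sum>q<l. kst (g q p) * pd q) + kst (v p)"
    unfolding affine_hom_def by (rule R.gen_hom_generators)
qed

definition vec_hom :: "(nat \<Rightarrow> 'f) \<Rightarrow> 'f walg \<Rightarrow> 'f walg" where
  "vec_hom v = affine_hom (\<lambda>_. 1) (\<lambda>\<alpha>. \<alpha>) (\<lambda>s r. if s = r then 1 else 0) v
     (\<lambda>q p. if q = p then 1 else 0) (\<lambda>p. if p < l1 then 0 else v p)"

lemma vec_hom:
  shows "assoc_hom (vec_hom v)"
    and "\<alpha> \<in> \<Gamma> \<Longrightarrow> vec_hom v (xw \<alpha>) = xw \<alpha>"
    and "r < l1 \<Longrightarrow> vec_hom v (tw r) = tw r + kst (v r)"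
    and "p < l \<Longrightarrow> vec_hom v (pd p) = pd p + (if p < l1 then 0 else kst (v p))"
proof -
  have delta: "(\<Sum>q<n. (if q = p then 1 else 0) * c q) = c p" if "p < n"
    for n p and c :: "nat \<Rightarrow> 'f"
    using that by (simp add: if_distrib[of "\<lambda>x. x * _"] cong: if_cong)
  have n: "(\<Sum>s<l1. (if s = p then 1 else 0) * (if s = r then 1 else 0)) = (if p = r then 1 else (0 :: 'f))"
    if "p < l" "r < l1" for p r
    using that by (simp add: if_distrib[of "\<lambda>x. _ * x"] cong: if_cong)
  have delta_w: "(\<Sum>q<n. kst (if q = p then 1 else 0) * c q) = c p" if "p < n" for n p and c :: "nat \<Rightarrow> 'f walg"
    using that by (simp add: if_distrib[of "\<lambda>x. kst x * _"] cong: if_cong)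
  note R = affine_hom[of "\<lambda>_. 1" "\<lambda>\<alpha>. \<alpha>" "\<lambda>q p. if q = p then 1 else 0" "\<lambda>s r. if s = r then 1 else 0"]
  show "assoc_hom (vec_hom v)"
    unfolding vec_hom_def by (rule R(1)) (simp_all add: delta n)
  show "\<alpha> \<in> \<Gamma> \<Longrightarrow> vec_hom v (xw \<alpha>) = xw \<alpha>"
    unfolding vec_hom_def by (subst R(2)) (simp_all add: delta n)
  show "r < l1 \<Longrightarrow> vec_hom v (tw r) = tw r + kst (v r)"
    unfolding vec_hom_def by (subst R(3)) (simp_all only: delta_w, simp_all add: delta n)
  show "p < l \<Longrightarrow> vec_hom v (pd p) = pd p + (if p < l1 then 0 else kst (v p))"
    unfolding vec_hom_def by (subst R(4)) (simp_all only: delta_w, simp_all add: delta n)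
qed

lemma vec_hom_inverse:
  assumes "w \<in> Wc"
  shows "vec_hom (\<lambda>p. - v p) (vec_hom v w) = w"
proof (rule assoc_hom_eqI[OF assoc_hom_comp[OF vec_hom(1) vec_hom(1)] assoc_hom_id])
  let ?S = "vec_hom (\<lambda>p. - v p)"
  note S = linear_mapD[OF assoc_homD(1)[OF vec_hom(1)]] assoc_homD(2)[OF vec_hom(1)]
  show "?S (vec_hom v (tw p)) = tw p" if "p < l1" for p
    using that by (simp add: vec_hom(3) S(2) A_xmono) (simp add: S(7) S(8) kst_uminus)
  show "?S (vec_hom v (pd p)) = pd p" if "p < l" for p
    using that by (cases "p < l1") (simp_all add: vec_hom(4) S(2) S(7) S(8) kst_uminus)
qed (use assms in \<open>simp_all add: vec_hom(2)\<close>)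

text \<open>A pair (G, f) of \<open>Aut2_A1\<close> without matrices: \<open>g\<close> and
  \<open>g'\<close> are the entries of G and of its inverse, \<open>\<pi>\<close> and
  \<open>\<pi>'\<close> the actions of the inverse and of G on \<Gamma>, and the last clause is the
  zero block. The description is symmetric under inversion.\<close>

definition linear_data where
  "linear_data f \<pi> \<pi>' g g' \<longleftrightarrow>
     (\<forall>a\<in>\<Gamma>. f a \<noteq> (0::'f)) \<and> (\<forall>a\<in>\<Gamma>. \<forall>b\<in>\<Gamma>. f (a + b) = f a * f b) \<and>
     (\<forall>a\<in>\<Gamma>. \<pi> a \<in> \<Gamma> \<and> \<pi>' a \<in> \<Gamma> \<and> \<pi>' (\<pi> a) = a \<and> \<pi> (\<pi>' a) = a) \<and>
     (\<forall>a\<in>\<Gamma>. \<forall>b\<in>\<Gamma>. \<pi> (a + b) = \<pi> a + \<pi> b \<and> \<pi>' (a + b) = \<pi>' a + \<pi>' b) \<and>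
     (\<forall>a\<in>\<Gamma>. \<forall>p<l. (\<Sum>q<l. g q p * coef (\<pi> a) q) = coef a p \<and>
        (\<Sum>q<l. g' q p * coef (\<pi>' a) q) = coef a p) \<and>
     (\<forall>r<l. \<forall>p<l. (\<Sum>q<l. g' r q * g q p) = (if r = p then 1 else 0) \<and>
        (\<Sum>q<l. g r q * g' q p) = (if r = p then 1 else 0)) \<and>
     (\<forall>r<l1. \<forall>m. l1 \<le> m \<and> m < l \<longrightarrow> g r m = 0 \<and> g' r m = 0)"

text \<open>The index order in \<open>g' r s\<close> is that of the transposed inverse acting on the
  t_r; the upper left block of the inverse of G is the inverse of M because of the zero
  block.\<close>

definition tau_hom where
  "tau_hom f \<pi> g g' = affine_hom f \<pi> (\<lambda>s r. g' r s) (\<lambda>_. 0) g (\<lambda>_. 0)"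

lemma linear_data_inverse:
  assumes "linear_data f \<pi> \<pi>' g g'"
  shows "linear_data (\<lambda>a. 1 / f (\<pi>' a)) \<pi>' \<pi> g' g"
  using assms unfolding linear_data_def by (intro conjI ballI allI impI) simp_all

lemma linear_data_block:
  assumes "linear_data f \<pi> \<pi>' g g'" "p < l" "r < l1"
  shows "(\<Sum>s<l1. g' r s * g s p) = (if p = r then 1 else 0)"
proof -
  have "(\<Sum>s<l1. g' r s * g s p) = (\<Sum>s<l. g' r s * g s p)"
  proof (rule sum.mono_neutral_left)
    show "\<forall>s\<in>{..<l} - {..<l1}. g' r s * g s p = 0"
      using assms by (auto simp: linear_data_def)
  qed auto
  also have "\<dots> = (if r = p then 1 else 0)"
    using assms by (simp add: linear_data_def)
  finally show ?thesis by auto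
qed

lemma tau_hom:
  assumes d: "linear_data f \<pi> \<pi>' g g'"
  shows "assoc_hom (tau_hom f \<pi> g g')"
    and "\<alpha> \<in> \<Gamma> \<Longrightarrow> tau_hom f \<pi> g g' (xw \<alpha>) = kst (f \<alpha>) * xw (\<pi> \<alpha>)"
    and "r < l1 \<Longrightarrow> tau_hom f \<pi> g g' (tw r) = (\<Sum>s<l1. kst (g' r s) * tw s)"
    and "p < l \<Longrightarrow> tau_hom f \<pi> g g' (pd p) = (\<Sum>q<l. kst (g q p) * pd q)"
proof -
  have "f (0 + 0) = f 0 * f 0" "f 0 \<noteq> 0" using d Gamma_zero unfolding linear_data_def by blast+
  then have f0: "f 0 = 1" by simp
  have "\<pi> (0 + 0) = \<pi> 0 + \<pi> 0" using d Gamma_zero unfolding linear_data_def by blast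
  then have \<pi>0: "\<pi> 0 = 0" by simp
  have f: "f (a + b) = f a * f b" if "a \<in> \<Gamma>" "b \<in> \<Gamma>" for a b
    using d that by (simp add: linear_data_def)
  have \<pi>: "\<pi> (a + b) = \<pi> a + \<pi> b" if "a \<in> \<Gamma>" "b \<in> \<Gamma>" for a b
    using d that by (simp add: linear_data_def)
  have \<pi>': "\<pi> a \<in> \<Gamma>" if "a \<in> \<Gamma>" for a
    using d that by (simp add: linear_data_def)
  have g: "(\<Sum>q<l. g q p * coef (\<pi> \<alpha>) q) = coef \<alpha> p" if "\<alpha> \<in> \<Gamma>" "p < l" for \<alpha> p
    using d that by (simp add: linear_data_def)
  have n: "(\<Sum>s<l1. g s p * g' r s) = (if p = r then 1 else 0)" if "p < l" "r < l1" for p r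
    using linear_data_block[OF d that] by (simp add: mult.commute)
  note R = affine_hom[where f = f and \<pi> = \<pi> and g = g and n = "\<lambda>s r. g' r s" and \<tau> = "\<lambda>_. 0" and v = "\<lambda>_. 0", OF f0 f \<pi>0 \<pi> \<pi>' g n]
  show "assoc_hom (tau_hom f \<pi> g g')"
    "\<alpha> \<in> \<Gamma> \<Longrightarrow> tau_hom f \<pi> g g' (xw \<alpha>) = kst (f \<alpha>) * xw (\<pi> \<alpha>)"
    "r < l1 \<Longrightarrow> tau_hom f \<pi> g g' (tw r) = (\<Sum>s<l1. kst (g' r s) * tw s)"
    "p < l \<Longrightarrow> tau_hom f \<pi> g g' (pd p) = (\<Sum>q<l. kst (g q p) * pd q)"
    unfolding tau_hom_def using R by simp_all
qed

lemma sum_kst_compose: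
  fixes n :: nat
  assumes "\<And>m. m < n \<Longrightarrow> (\<Sum>q<n. b m q * a q) = (if m = p then 1 else (0::'f))" "p < n"
  shows "(\<Sum>q<n. kst (a q) * (\<Sum>m<n. kst (b m q) * w m)) = w p"
proof -
  have "(\<Sum>q<n. kst (a q) * (\<Sum>m<n. kst (b m q) * w m)) =
      (\<Sum>m<n. kst (\<Sum>q<n. b m q * a q) * w m)"
    unfolding sum_distrib_left kst_sum[symmetric] sum_distrib_right
    by (subst sum.swap) (simp add: kst_mult mult.assoc kst_left_commute[of "kst (a _)"])
  also have "\<dots> = (\<Sum>m<n. if m = p then w p else 0)"
    using assms(1) by (intro sum.cong refl) auto
  also have "\<dots> = w p" using assms(2) by (simp only: sum.delta finite_lessThan lessThan_iff if_True)
  finally show ?thesis .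
qed

lemma tau_hom_inverse:
  assumes d: "linear_data f \<pi> \<pi>' g g'" and "w \<in> Wc"
  shows "tau_hom (\<lambda>a. 1 / f (\<pi>' a)) \<pi>' g' g (tau_hom f \<pi> g g' w) = w"
proof -
  note d' = linear_data_inverse[OF d]
  note S = tau_hom[OF d] and S' = tau_hom[OF d']
  note L = assoc_homD(1)[OF S'(1)]
  show ?thesis
  proof (rule assoc_hom_eqI[OF assoc_hom_comp[OF S'(1) S(1)] assoc_hom_id])
    fix \<alpha> assume a: "\<alpha> \<in> \<Gamma>"
    then have *: "\<pi> \<alpha> \<in> \<Gamma>" "\<pi>' (\<pi> \<alpha>) = \<alpha>" "f \<alpha> \<noteq> 0" using d by (auto simp: linear_data_def)
    have "kst (f \<alpha>) * (kst (1 / f \<alpha>) * xw \<alpha>) = xw \<alpha>"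
      using * by (simp add: mult.assoc[symmetric] kst_mult[symmetric])
    then show "tau_hom (\<lambda>a. 1 / f (\<pi>' a)) \<pi>' g' g (tau_hom f \<pi> g g' (xw \<alpha>)) = xw \<alpha>"
      using a * by (simp add: S(2) linear_mapD(3)[OF L] S'(2) A_xmono)
  next
    fix p assume p: "p < l1"
    have "(\<Sum>q<l1. g q m * g' p q) = (if m = p then 1 else 0)" if "m < l1" for m
      using linear_data_block[OF d, of m p] that p by (simp add: mult.commute)
    from sum_kst_compose[OF this p]
    have "(\<Sum>q<l1. kst (g' p q) * (\<Sum>m<l1. kst (g q m) * tw m)) = tw p" by simp
    then show "tau_hom (\<lambda>a. 1 / f (\<pi>' a)) \<pi>' g' g (tau_hom f \<pi> g g' (tw p)) = tw p"
      unfolding S(3)[OF p] using p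
      by (subst linear_map_sum[OF L]) (simp_all add: Wc_kst_mult linear_mapD(3)[OF L] S'(3) A_xmono)
  next
    fix p assume p: "p < l"
    have "(\<Sum>q<l. g' m q * g q p) = (if m = p then 1 else 0)" if "m < l" for m
      using d that p by (simp add: linear_data_def)
    from sum_kst_compose[OF this p]
    have "(\<Sum>q<l. kst (g q p) * (\<Sum>m<l. kst (g' m q) * pd m)) = pd p" by simp
    then show "tau_hom (\<lambda>a. 1 / f (\<pi>' a)) \<pi>' g' g (tau_hom f \<pi> g g' (pd p)) = pd p"
      unfolding S(4)[OF p] using p
      by (subst linear_map_sum[OF L]) (simp_all add: Wc_kst_mult linear_mapD(3)[OF L] S'(4))
  qed (rule assms(2))
qed

text \<open>Every b in \<Gamma> is an eigenvector of the matrix \<open>N\<close>. For two of them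
  additivity compares the eigenvalues at b, b' and b + b'; either this gives equality at once, or b
  and b' are proportional and share their eigenvalue.\<close>

lemma scalar_on_Gamma:
  assumes L: "\<And>b p. b \<in> \<Gamma> \<Longrightarrow> p < l \<Longrightarrow> (\<Sum>r<l. coef b r * N r p) = \<kappa> b * coef b p"
    and b: "b \<in> \<Gamma>" "b \<noteq> 0" and b': "b' \<in> \<Gamma>" "b' \<noteq> 0"
  shows "\<kappa> b = (\<kappa> b' :: 'f)"
proof -
  have add: "(\<kappa> (b + b') - \<kappa> b) * coef b p = (\<kappa> b' - \<kappa> (b + b')) * coef b' p" if p: "p < l" for p
  proof -
    have "(\<Sum>r<l. coef (b + b') r * N r p) = (\<Sum>r<l. coef b r * N r p) + (\<Sum>r<l. coef b' r * N r p)"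
      by (simp add: lookup_add distrib_right sum.distrib)
    then have "\<kappa> (b + b') * (coef b p + coef b' p) = \<kappa> b * coef b p + \<kappa> b' * coef b' p"
      unfolding L[OF Gamma_add[OF b(1) b'(1)] p] L[OF b(1) p] L[OF b'(1) p] by (simp only: lookup_add)
    then show ?thesis by (simp add: algebra_simps)
  qed
  obtain q where q: "q < l" "coef b' q \<noteq> 0" using exists_coordinate[OF b'] by blast
  obtain q' where q': "q' < l" "coef b q' \<noteq> 0" using exists_coordinate[OF b] by blast
  show ?thesis
  proof (cases "\<kappa> (b + b') = \<kappa> b")
    case True
    then show ?thesis using add[OF q(1)] q(2) by simp
  next
    case False
    define k where "k = (\<kappa> b' - \<kappa> (b + b')) / (\<kappa> (b + b') - \<kappa> b)"
    have k: "coef b p = k * coef b' p" if "p < l" for p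
      using add[OF that] False by (simp add: k_def field_simps)
    have "\<kappa> b * coef b q' = (\<Sum>r<l. coef b r * N r q')" using L[OF b(1) q'(1)] by simp
    also have "\<dots> = k * (\<Sum>r<l. coef b' r * N r q')"
      unfolding sum_distrib_left by (intro sum.cong refl) (simp add: k)
    also have "\<dots> = \<kappa> b' * coef b q'" using L[OF b'(1) q'(1)] k[OF q'(1)] by simp
    finally show ?thesis using q'(2) by simp
  qed
qed

end

context lie_automorphism
begin

lemma kst_eq_iff: "kst c = kst d \<longleftrightarrow> c = (d :: 'f)"
  using kst_eq_0_iff[of "c - d"] by (simp only: kst_diff right_minus_eq)

lemma pi_coef: "a \<in> \<Gamma> \<Longrightarrow> p < l \<Longrightarrow> coef (\<pi> a) p = (\<Sum>q<l. coef a q * inv.g q p)"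
  using inv.phi_pd(2)[of p "\<pi> a"] phi_xw(2) pi_inverse(1) by (simp add: mult.commute)

text \<open>The two matrices describe mutually inverse maps on \<Gamma>, and a matrix identity that
  holds on \<Gamma> holds everywhere.\<close>

lemma g_inverse:
  assumes "r < l" "p < l"
  shows "(\<Sum>q<l. inv.g r q * g q p) = (if r = p then 1 else 0)"
proof -
  have "(\<Sum>q<l. inv.g r q * g q p) - (if r = p then 1 else 0) = 0"
  proof (rule orthogonal_Gamma[OF _ assms(1)])
    fix a assume a: "a \<in> \<Gamma>"
    have "coef a p = (\<Sum>q<l. \<Sum>r<l. coef a r * (inv.g r q * g q p))"
      using phi_pd(2)[OF assms(2) a] pi_coef[OF a] by (simp add: sum_distrib_left sum_distrib_right mult_ac)
    also have "\<dots> = (\<Sum>r<l. coef a r * (\<Sum>q<l. inv.g r q * g q p))"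
      by (subst sum.swap) (simp add: sum_distrib_left)
    finally show "(\<Sum>r<l. coef a r * ((\<Sum>q<l. inv.g r q * g q p) - (if r = p then 1 else 0))) = 0"
      using assms(2) by (simp add: right_diff_distrib sum_subtractf if_distrib[of "\<lambda>x. _ * x"] cong: if_cong)
  qed
  then show ?thesis by simp
qed

end

context lie_automorphism
begin

text \<open>Let s be the image of t_r. Bracketing it with the images of the \<partial>_p shows that
  the vector of constant terms x_q of \<partial>_q s is \<open>c\<close> times row \<open>r\<close>
  of the inverse matrix. For \<open>m \<ge> l1\<close> there is no t_m in \<open>A\<close>, so x_m =
  0.\<close>

lemma inv_g_zero:
  assumes r: "r < l1" and m: "l1 \<le> m" "m < l"
  shows "inv.g r m = 0"
proof -
  obtain c where c: "c \<noteq> 0" "\<phi> 1 = kst c" by (rule phi_one)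
  obtain s where s: "s \<in> A" "\<phi> (tw r) = walg_of s"
    using phi_A[of "xmono 0 (unit_index r)"] r by (auto simp: A_xmono)
  define x where "x q = coef (xderiv q s) 0" for q
  have eq: "(\<Sum>q<l. g q p * x q) = (if p = r then c else 0)" if p: "p < l" for p
  proof -
    have "br (\<phi> (pd p)) (walg_of s) = \<phi> (walg_of (if p = r then 1 else 0))"
      using phi_br[of "pd p" "tw r"] p r s by (simp add: A_xmono xderiv_t)
    also have "\<dots> = walg_of (Poly_Mapping.single 0 (if p = r then c else 0))"
      using c(2) by (simp add: phi_lin(4))
    also have "br (\<phi> (pd p)) (walg_of s) = walg_of (\<Sum>q<l. Poly_Mapping.single 0 (g q p) * xderiv q s)"
      by (subst phi_pd(1)[OF p])
        (simp add: br_add_left br_sum_left br_kst_left walg_of_sum walg_of_mult)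
    finally have "(\<Sum>q<l. Poly_Mapping.single 0 (g q p) * xderiv q s) =
        Poly_Mapping.single 0 (if p = r then c else 0)" by (simp only: walg_of_eq_iff)
    from arg_cong[OF this, of "\<lambda>u. coef u 0"] show ?thesis
      by (simp add: lookup_sum coef_const_mult x_def)
  qed
  have "x m = (\<Sum>q<l. x q * (if q = m then 1 else 0))"
    using m(2) by (simp add: if_distrib[of "\<lambda>x. _ * x"] cong: if_cong)
  also have "\<dots> = (\<Sum>q<l. x q * (\<Sum>p<l. g q p * inv.g p m))"
    using m(2) inv.g_inverse by (intro sum.cong refl) simp
  also have "\<dots> = (\<Sum>p<l. (\<Sum>q<l. g q p * x q) * inv.g p m)"
    unfolding sum_distrib_left sum_distrib_right by (subst sum.swap) (simp add: mult_ac)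
  also have "\<dots> = c * inv.g r m"
    using r by (simp add: eq if_distrib[of "\<lambda>x. x * _"] cong: if_cong)
  finally have "x m = c * inv.g r m" .
  moreover have "x m = 0"
  proof -
    have "coef s (0, unit_index m) = 0" using m by (intro A_coef_eq_0 s) simp
    then show ?thesis by (simp add: x_def zero_prod_def coef_xderiv)
  qed
  ultimately show ?thesis using c(1) by simp
qed

text \<open>The image of x^a \<partial>_p is of first order. Its bracket with the image of x^d, read
  at the exponent \<pi> a, shows that \<open>d\<close> is an eigenvector of a matrix depending only
  on \<open>a\<close>, with eigenvalue f(a + d) / f(d); by \<open>scalar_on_Gamma\<close> this ratio
  does not depend on \<open>d \<noteq> 0\<close>.\<close>

lemma f_mult:
  assumes c: "\<phi> 1 = kst c" "c \<noteq> 0" and ab: "a \<in> \<Gamma>" "b \<in> \<Gamma>"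
  shows "f (a + b) * c = f a * f b"
proof -
  have pi0: "\<pi> 0 = 0" using pi_add[of 0 0] by simp
  have f0: "f 0 = c"
    using phi_xw(3)[of 0] c(1) kst_eq_iff[of "f 0" c] by (simp add: pi0)
  have step: "f (a + b) * f b' = f (a + b') * f b"
    if a: "a \<in> \<Gamma>" and b: "b \<in> \<Gamma>" "b \<noteq> 0" and b': "b' \<in> \<Gamma>" "b' \<noteq> 0" for a b b'
  proof -
    define m where "m q p = coef (cf (\<phi> (xw a * pd p)) (unit_index q)) (\<pi> a, 0)" for q p
    have L: "f d * (\<Sum>q<l. coef (\<pi> d) q * m q p) = coef d p * f (a + d)"
      if d: "d \<in> \<Gamma>" and p: "p < l" for d p
    proof -
      let ?w = "xw a * pd p"
      have w: "?w \<in> Wc" using a p by (simp add: Wc_mult A_xmono)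
      have w': "\<phi> ?w \<in> Wc" using w by (rule phi_lin(1))
      have o1: "ord_le 1 (\<phi> ?w)"
        using a p by (intro order_1_phi w)
          (auto simp: br_mult_left walg_of_mult[symmetric] A_mult A_xderiv A_xmono)
      have "br (\<phi> ?w) (\<phi> (xw d)) = \<phi> (kst (coef d p) * xw (a + d))"
        using phi_br[OF w, of "xw d"] d
        by (simp add: A_xmono br_mult_left xderiv_xmono walg_of_mult xw_add kst_left_commute[of "xw a"])
      also have "\<dots> = kst (coef d p * f (a + d)) * (xw (\<pi> a) * xw (\<pi> d))"
        using phi_xw(3)[OF Gamma_add[OF a d]] pi_add[OF a d] Gamma_add[OF a d]
        by (simp add: phi_lin(3) Wc_mult a d A_xmono kst_mult mult.assoc xw_add)
      also have "br (\<phi> ?w) (\<phi> (xw d)) = kst (f d) * walg_of ((\<Sum>q<l. Poly_Mapping.single 0 (coef (\<pi> d) q) *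
          cf (\<phi> ?w) (unit_index q)) * xmono (\<pi> d) 0)"
        unfolding phi_xw(3)[OF d] br_kst_right br_order_1_xw[OF o1 w'] ..
      finally have "walg_of ((Poly_Mapping.single 0 (f d) * (\<Sum>q<l. Poly_Mapping.single 0 (coef (\<pi> d) q) *
          cf (\<phi> ?w) (unit_index q))) * xmono (\<pi> d) 0) =
          walg_of ((Poly_Mapping.single 0 (coef d p * f (a + d)) * xmono (\<pi> a) 0) * xmono (\<pi> d) 0)"
        by (simp only: walg_of_mult mult.assoc)
      then have "Poly_Mapping.single 0 (f d) * (\<Sum>q<l. Poly_Mapping.single 0 (coef (\<pi> d) q) *
          cf (\<phi> ?w) (unit_index q)) = Poly_Mapping.single 0 (coef d p * f (a + d)) * xmono (\<pi> a) 0"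
        by (simp only: walg_of_eq_iff xmono_cancel)
      from arg_cong[OF this, of "\<lambda>u. coef u (\<pi> a, 0)"] show ?thesis
        by (simp add: coef_const_mult lookup_sum m_def xmono_def)
    qed
    have "(\<Sum>r<l. coef d r * (\<Sum>q<l. inv.g r q * m q p)) = f (a + d) / f d * coef d p"
      if d: "d \<in> \<Gamma>" and p: "p < l" for d p
    proof -
      have "(\<Sum>r<l. coef d r * (\<Sum>q<l. inv.g r q * m q p)) = (\<Sum>q<l. coef (\<pi> d) q * m q p)"
        unfolding sum_distrib_left
        by (subst sum.swap, intro sum.cong refl) (simp add: pi_coef[OF d] sum_distrib_right sum_distrib_left mult_ac)
      then show ?thesis using L[OF d p] phi_xw(1)[OF d] by (simp add: field_simps)
    qed
    from scalar_on_Gamma[of _ "\<lambda>d. f (a + d) / f d", OF this b b'] show ?thesis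
      using phi_xw(1)[OF b(1)] phi_xw(1)[OF b'(1)] by (simp add: field_simps)
  qed
  show ?thesis
  proof (cases "a = 0 \<or> b = 0")
    case True
    then show ?thesis by (auto simp: f0 mult.commute)
  next
    case False
    then have ab0: "a \<noteq> 0" "b \<noteq> 0" by simp_all
    have na: "- a \<in> \<Gamma>" "- a \<noteq> 0" using ab(1) ab0 by (simp_all add: Gamma_uminus)
    have aa: "a + a \<in> \<Gamma>" using ab(1) by (rule Gamma_add[OF ab(1)])
    have e: "- a + (a + a) = a" by (simp only: add.assoc[symmetric] left_minus add_0)
    have a2: "a + a \<noteq> 0"
    proof
      assume "a + a = 0"
      then have "coef a p + coef a p = 0" for p by (metis lookup_add lookup_zero)
      then have "2 * coef a p = 0" for p by (simp only: mult_2)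
      then have "a = 0" by (intro poly_mapping_eqI) simp
      then show False using False by simp
    qed
    \<comment> \<open>Three instances of \<open>step\<close>, at the base points a, -a and a,
      eliminate f(-a) and f(a + a); \<open>a + a \<noteq> 0\<close> holds in characteristic
      0.\<close>
    have 1: "f (a + b) * f (- a) = c * f b"
      using step[OF ab(1) ab(2) ab0(2) na] unfolding right_minus f0 .
    have 2: "f a * f a = c * f (a + a)"
      using step[OF na(1) aa a2 ab(1) ab0(1)] unfolding e left_minus f0 .
    have 3: "f (a + a) * f (- a) = c * f a"
      using step[OF ab(1) ab(1) ab0(1) na] unfolding right_minus f0 .
    have nz: "f a \<noteq> 0" "f (- a) \<noteq> 0" using phi_xw(1) ab na by auto
    have "f a * f a * f (- a) = c * (c * f a)" unfolding 2 using 3 by (simp add: mult.assoc)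
    then have "f a * f (- a) = c * c" using nz by simp
    then have "f (a + b) * c * (f a * f (- a)) = f a * f b * (c * c) \<longleftrightarrow> f (a + b) * c = f a * f b"
      using c(2) by simp
    moreover have "f (a + b) * c * (f a * f (- a)) = f a * c * (f (a + b) * f (- a))" by (simp add: mult_ac)
    ultimately show ?thesis unfolding 1 by (simp add: mult_ac)
  qed
qed

end

context lie_automorphism
begin

definition scalar :: 'f where
  "scalar = (SOME c. c \<noteq> 0 \<and> \<phi> 1 = kst c)"

lemma scalar: "scalar \<noteq> 0" "\<phi> 1 = kst scalar"
proof -
  have "\<exists>c. c \<noteq> 0 \<and> \<phi> 1 = kst c" using phi_one by metis
  from someI_ex[OF this] show "scalar \<noteq> 0" "\<phi> 1 = kst scalar" by (simp_all add: scalar_def)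
qed

text \<open>Since f(a + b) c = f(a) f(b), dividing by \<open>c\<close> yields a character.\<close>

lemma linear_data: "linear_data (\<lambda>a. f a / scalar) \<pi> inv.\<pi> g inv.g"
  unfolding linear_data_def
proof (intro conjI ballI allI impI)
  fix a assume a: "a \<in> \<Gamma>"
  show "f a / scalar \<noteq> 0" using phi_xw(1)[OF a] scalar(1) by simp
  show "\<pi> a \<in> \<Gamma>" "inv.\<pi> a \<in> \<Gamma>" using a phi_xw(2) inv.phi_xw(2) by auto
  show "inv.\<pi> (\<pi> a) = a" "\<pi> (inv.\<pi> a) = a" using a pi_inverse(1) inv.pi_inverse(1) by auto
  show "(\<Sum>q<l. g q p * coef (\<pi> a) q) = coef a p" "(\<Sum>q<l. inv.g q p * coef (inv.\<pi> a) q) = coef a p"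
    if "p < l" for p using phi_pd(2)[OF that a] inv.phi_pd(2)[OF that a] by auto
  fix b assume b: "b \<in> \<Gamma>"
  show "f (a + b) / scalar = f a / scalar * (f b / scalar)"
    using f_mult[OF scalar(2,1) a b] scalar(1) by (simp add: field_simps)
  show "\<pi> (a + b) = \<pi> a + \<pi> b" "inv.\<pi> (a + b) = inv.\<pi> a + inv.\<pi> b"
    using pi_add[OF a b] inv.pi_add[OF a b] by auto
next
  fix r p assume "r < l" "p < l"
  then show "(\<Sum>q<l. inv.g r q * g q p) = (if r = p then 1 else 0)"
    "(\<Sum>q<l. g r q * inv.g q p) = (if r = p then 1 else 0)"
    using g_inverse inv.g_inverse by auto
next
  fix r m assume "r < l1" "l1 \<le> m \<and> m < l"
  then show "g r m = 0" "inv.g r m = 0" using inv_g_zero inv.inv_g_zero by auto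
qed

end

context lie_automorphism
begin

lemma decomposition:
  obtains f \<pi> \<pi>' g g' u v
  where "linear_data f \<pi> \<pi>' g g'" "u \<in> A" "scalar = 1 \<or> scalar = - 1"
    "scalar = 1 \<Longrightarrow> \<forall>w\<in>Wc. \<phi> w = tau_hom f \<pi> g g' (exp_ad u (vec_hom v w))"
proof -
  note d = linear_data and d' = linear_data_inverse[OF linear_data]
  define S where "S = tau_hom (\<lambda>a. f a / scalar) \<pi> g inv.g"
  define S' where "S' = tau_hom (\<lambda>a. 1 / (f (inv.\<pi> a) / scalar)) inv.\<pi> inv.g g"
  note S = tau_hom[OF d, folded S_def] and S' = tau_hom[OF d', folded S'_def]
  have S'S: "S' (S w) = w" if "w \<in> Wc" for w
    using tau_hom_inverse[OF d that] by (simp add: S_def S'_def)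
  note T = tau_hom_inverse[OF d', folded S'_def]
  have SS': "S (S' w) = w" if w: "w \<in> Wc" for w
  proof -
    have S'w: "S' w \<in> Wc" by (rule linear_mapD(1)[OF assoc_homD(1)[OF S'(1)] w])
    have SS'w: "S (S' w) \<in> Wc" by (rule linear_mapD(1)[OF assoc_homD(1)[OF S(1)] S'w])
    show ?thesis using T[OF SS'w] unfolding S'S[OF S'w] T[OF w] by (rule sym)
  qed
  have lieS': "lie_hom S'" and lieS: "lie_hom S" using S(1) S'(1) by (auto intro: assoc_hom_lie_hom)
  note LS = linear_mapD[OF assoc_homD(1)[OF S(1)]] and LS' = linear_mapD[OF assoc_homD(1)[OF S'(1)]]
  define \<phi>1 where "\<phi>1 = (\<lambda>w. S' (\<phi> w))"
  interpret S: lie_automorphism l1 l2 \<Gamma> S' S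
    by unfold_locales (simp_all add: lieS lieS' S'S SS')
  have lie1: "lie_hom \<phi>1" unfolding \<phi>1_def by (rule lie_hom_comp[OF lieS' phi])
  have br1: "\<phi>1 (br a b) = br (\<phi>1 a) (\<phi>1 b)" if "a \<in> Wc" "b \<in> Wc" for a b
    using lie1 that by (simp add: lie_hom_def)
  have zero1: "\<phi>1 0 = 0" using lie1 by (simp add: lie_hom_def linear_mapD(4))
  have A1: "\<exists>v\<in>A. \<phi>1 (walg_of u) = walg_of v" if "u \<in> A" for u
    using phi_A[OF that] S.phi_A by (auto simp: \<phi>1_def)
  have xw1: "\<phi>1 (xw a) = kst scalar * xw a" if a: "a \<in> \<Gamma>" for a
  proof -
    have "\<phi> (xw a) = kst scalar * S (xw a)"
      using a phi_xw(3)[OF a] scalar(1) by (simp add: S(2) mult.assoc[symmetric] kst_mult[symmetric])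
    then show ?thesis
      using a by (simp add: \<phi>1_def LS(1) LS'(3) S'S A_xmono)
  qed
  define b where "b p = cf (\<phi>1 (pd p)) 0" for p
  have pd1: "\<phi>1 (pd p) = pd p + walg_of (b p) \<and> b p \<in> A" if p: "p < l" for p
  proof -
    have in_A: "cf (\<phi> (pd p)) 0 \<in> A" using p by (intro Wc_cf phi_lin(1)) simp
    then obtain z where z: "z \<in> A" "S' (walg_of (cf (\<phi> (pd p)) 0)) = walg_of z" using S.phi_A by blast
    have "\<phi>1 (pd p) = S' (walg_of (cf (\<phi> (pd p)) 0) + S (pd p))"
      unfolding \<phi>1_def by (subst phi_pd(1)[OF p]) (simp add: S(4) p)
    also have "\<dots> = pd p + walg_of z"
      using p in_A z by (simp add: LS'(2) LS(1) S'S add.commute)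
    finally have eq: "\<phi>1 (pd p) = pd p + walg_of z" .
    have "cf (pd p :: 'f walg) 0 = 0"
      using cf_monomial[of 1 "unit_index p" 0] by (simp add: unit_index_neq_0[THEN not_sym])
    then have "b p = z" unfolding b_def eq by simp
    with eq z(1) show ?thesis by simp
  qed
  \<comment> \<open>The family -b has to be integrated, because \<open>exp_ad u\<close> sends
    \<partial>_p to \<partial>_p - \<partial>_p(u).\<close>
  have "xderiv p (- b q) = xderiv q (- b p)" if pq: "p < l" "q < l" for p q
  proof -
    have "br (\<phi>1 (pd p)) (\<phi>1 (pd q)) = \<phi>1 (br (pd p) (pd q))"
      by (rule br1[symmetric]) (simp_all add: pq)
    also have "\<dots> = 0" by (simp add: zero1)
    finally have "walg_of (xderiv p (b q)) - walg_of (xderiv q (b p)) = 0"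
      using pd1[OF pq(1)] pd1[OF pq(2)] by (simp add: br_add_left br_add_right)
    then have "xderiv p (b q) = xderiv q (b p)" by (simp flip: walg_of_diff)
    then show ?thesis by (simp add: xderiv_uminus)
  qed
  then obtain u v0 where u: "u \<in> A" and v0: "\<And>p. p < l1 \<Longrightarrow> v0 p = (0 :: 'f)"
    and uv: "\<And>p. p < l \<Longrightarrow> - b p = xderiv p u + Poly_Mapping.single 0 (v0 p)"
    using closed_family[of "\<lambda>p. - b p"] pd1 A_uminus by blast
  \<comment> \<open>The image of t_r has the same derivatives as c t_r, so the two differ by a
    constant.\<close>
  have tw1: "\<exists>e. \<phi>1 (tw r) = kst scalar * tw r + kst e" if r: "r < l1" for r
  proof -
    obtain s where s: "s \<in> A" "\<phi>1 (tw r) = walg_of s"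
      using A1[of "xmono 0 (unit_index r)"] r by (auto simp: A_xmono)
    have "xderiv p (s - Poly_Mapping.single 0 scalar * xmono 0 (unit_index r)) = 0" if p: "p < l" for p
    proof -
      have "\<phi>1 (br (pd p) (tw r)) = br (\<phi>1 (pd p)) (\<phi>1 (tw r))"
        by (rule br1) (simp_all add: p r A_xmono)
      also have "\<dots> = walg_of (xderiv p s)" using pd1[OF p] s(2) by (simp add: br_add_left)
      also have "\<phi>1 (br (pd p) (tw r)) = (if p = r then kst scalar else 0)"
        using xw1[of 0] by (simp add: xderiv_t zero1)
      finally have "walg_of (xderiv p s) = walg_of (if p = r then Poly_Mapping.single 0 scalar else 0)"
        by (simp split: if_splits)
      then have "xderiv p s = (if p = r then Poly_Mapping.single 0 scalar else 0)"
        by (simp only: walg_of_eq_iff)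
      then show ?thesis by (simp add: xderiv_diff xderiv_const_mult xderiv_t)
    qed
    moreover have "s - Poly_Mapping.single 0 scalar * xmono 0 (unit_index r) \<in> A"
      using s(1) r by (intro A_diff A_mult) (simp_all add: A_xmono)
    ultimately obtain e where "s - Poly_Mapping.single 0 scalar * xmono 0 (unit_index r) = Poly_Mapping.single 0 e"
      using joint_kernel by blast
    then have "s = Poly_Mapping.single 0 scalar * xmono 0 (unit_index r) + Poly_Mapping.single 0 e"
      by (simp add: algebra_simps)
    then have "\<phi>1 (tw r) = kst scalar * tw r + kst e"
      unfolding s(2) by (simp only: walg_of_add walg_of_mult)
    then show ?thesis by blast
  qed
  then obtain e where e: "\<And>r. r < l1 \<Longrightarrow> \<phi>1 (tw r) = kst scalar * tw r + kst (e r)" by metis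
  \<comment> \<open>For \<open>p < l1\<close> the value is dictated by c (t_p + v_p) = c t_p + e_p;
    for the other indices it absorbs the constants \<open>v0\<close> left over by the
    integration.\<close>
  define v where "v p = (if p < l1 then e p / scalar else - v0 p)" for p
  define V' where "V' = vec_hom (\<lambda>p. - v p)"
  have V'V: "V' (vec_hom v w) = w" if "w \<in> Wc" for w using vec_hom_inverse[OF that] by (simp add: V'_def)
  have VV': "vec_hom v (V' w) = w" if "w \<in> Wc" for w
    using vec_hom_inverse[OF that, of "\<lambda>p. - v p"] by (simp add: V'_def)
  have homV': "assoc_hom V'" unfolding V'_def by (rule vec_hom(1))
  have homE: "assoc_hom (exp_ad (- u))" using u by (intro assoc_hom_exp_ad A_uminus)
  define \<phi>2 where "\<phi>2 = (\<lambda>w. V' (exp_ad (- u) (\<phi>1 w)))"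
  note LV = linear_mapD[OF assoc_homD(1)[OF vec_hom(1)]] and LV' = linear_mapD[OF assoc_homD(1)[OF homV']]
    and LE = linear_mapD[OF assoc_homD(1)[OF homE]]
  interpret V: lie_automorphism l1 l2 \<Gamma> V' "vec_hom v"
    by unfold_locales (simp_all add: assoc_hom_lie_hom homV' vec_hom(1) V'V VV')
  interpret N: normalized_lie_hom l1 l2 \<Gamma> \<phi>2 scalar
  proof unfold_locales
    show "lie_hom \<phi>2"
      unfolding \<phi>2_def by (rule lie_hom_comp[OF assoc_hom_lie_hom[OF homV'] lie_hom_comp[OF assoc_hom_lie_hom[OF homE] lie1]])
    show "scalar \<noteq> 0" by (rule scalar)
    show "\<exists>v\<in>A. \<phi>2 (walg_of u) = walg_of v" if "u \<in> A" for u
      using A1[OF that] V.phi_A by (auto simp: \<phi>2_def exp_ad_walg_of)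
    show "\<phi>2 (xw a) = kst scalar * xw a" if a: "a \<in> \<Gamma>" for a
      using V'V[of "xw a"] a
      by (simp add: \<phi>2_def xw1 LE(3) LV'(3) A_xmono exp_ad_walg_of vec_hom(2))
    show "\<phi>2 (pd p) = pd p" if p: "p < l" for p
    proof -
      have b: "b p = - (xderiv p u + Poly_Mapping.single 0 (v0 p))"
        using arg_cong[OF uv[OF p], of uminus] by simp
      have "exp_ad (- u) (\<phi>1 (pd p)) = exp_ad (- u) (pd p + walg_of (b p))" using pd1[OF p] by simp
      also have "\<dots> = exp_ad (- u) (pd p) + exp_ad (- u) (walg_of (b p))"
        by (rule LE(2)) (use p pd1[OF p] in simp_all)
      also have "\<dots> = pd p + walg_of (xderiv p u) + walg_of (b p)"
        by (simp add: exp_ad_pd exp_ad_walg_of xderiv_uminus walg_of_uminus)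
      also have "\<dots> = pd p - kst (v0 p)"
        unfolding b by (simp add: walg_of_uminus walg_of_add walg_of_diff)
      also have "\<dots> = vec_hom v (pd p)"
        using p v0[of p] by (cases "p < l1") (simp_all add: vec_hom(4) v_def kst_uminus)
      finally show ?thesis using p by (simp add: \<phi>2_def V'V)
    qed
    show "\<phi>2 (tw r) = kst scalar * tw r" if r: "r < l1" for r
    proof -
      have "exp_ad (- u) (\<phi>1 (tw r)) = kst scalar * vec_hom v (tw r)"
        using r scalar(1)
        by (simp add: e LE(2) LE(3) A_xmono Wc_kst_mult exp_ad_walg_of vec_hom(3) v_def distrib_left
            kst_mult[symmetric])
      then show ?thesis using r by (simp add: \<phi>2_def LV'(3) LV(1) V'V A_xmono)
    qed
  qed
  show ?thesis
  proof (rule that[OF d u N.c_cases])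
    assume 1: "scalar = 1"
    interpret U: unital_normalized_lie_hom l1 l2 \<Gamma> \<phi>2
      by (intro unital_normalized_lie_hom.intro) (use N.normalized_lie_hom_axioms 1 in simp)
    show "\<forall>w\<in>Wc. \<phi> w = tau_hom (\<lambda>a. f a / scalar) \<pi> g inv.g (exp_ad u (vec_hom v w))"
    proof
      fix w assume w: "w \<in> Wc"
      have w1: "\<phi>1 w \<in> Wc" using lie1 w by (simp add: lie_hom_def linear_mapD(1))
      have "vec_hom v w = vec_hom v (\<phi>2 w)" by (simp only: U.phi_eq_id[OF w])
      also have "\<dots> = exp_ad (- u) (\<phi>1 w)" using w1 by (simp add: \<phi>2_def VV' LE(1))
      finally have "exp_ad u (vec_hom v w) = \<phi>1 w"
        using exp_ad_inverse[OF A_uminus[OF u] w1] by simp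
      then have "S (exp_ad u (vec_hom v w)) = S (S' (\<phi> w))" by (simp only: \<phi>1_def)
      also have "\<dots> = \<phi> w" by (rule SS'[OF phi_lin(1)[OF w]])
      finally show "\<phi> w = tau_hom (\<lambda>a. f a / scalar) \<pi> g inv.g (exp_ad u (vec_hom v w))"
        unfolding S_def by (rule sym)
    qed
  qed
qed

end


section \<open>Matrices\<close>

lemma GL_D:
  fixes G :: "'f::field mat"
  assumes "G \<in> GL n"
  shows "G \<in> carrier_mat n n" "GL_inv n G \<in> carrier_mat n n"
    "G * GL_inv n G = 1\<^sub>m n" "GL_inv n G * G = 1\<^sub>m n"
proof -
  interpret R: ring "ring_mat TYPE('f) n ()" by (rule ring_mat)
  have G: "G \<in> Units (ring_mat TYPE('f) n ())" using assms by (simp add: GL_def)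
  show "G \<in> carrier_mat n n" "GL_inv n G \<in> carrier_mat n n"
    "G * GL_inv n G = 1\<^sub>m n" "GL_inv n G * G = 1\<^sub>m n"
    using R.Units_closed[OF G] R.Units_inv_closed[OF G] R.Units_r_inv[OF G] R.Units_l_inv[OF G]
    by (simp_all add: GL_inv_def ring_mat_simps)
qed

lemma mat_mult_entry:
  assumes "B \<in> carrier_mat n n" "C \<in> carrier_mat n n" "i < n" "j < n"
  shows "(B * C) $$ (i, j) = (\<Sum>k<n. B $$ (i, k) * C $$ (k, j))"
  using assms by (simp add: scalar_prod_def atLeast0LessThan)

lemma GL_mat:
  fixes a b :: "nat \<Rightarrow> nat \<Rightarrow> 'f::field"
  assumes ab: "\<And>i j. i < n \<Longrightarrow> j < n \<Longrightarrow> (\<Sum>k<n. a i k * b k j) = (if i = j then 1 else 0)"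
    and ba: "\<And>i j. i < n \<Longrightarrow> j < n \<Longrightarrow> (\<Sum>k<n. b i k * a k j) = (if i = j then 1 else 0)"
  shows "mat n n (\<lambda>(i, j). a i j) \<in> GL n"
    and "GL_inv n (mat n n (\<lambda>(i, j). a i j)) = mat n n (\<lambda>(i, j). b i j)"
proof -
  interpret R: ring "ring_mat TYPE('f) n ()" by (rule ring_mat)
  let ?a = "mat n n (\<lambda>(i, j). a i j)" and ?b = "mat n n (\<lambda>(i, j). b i j)"
  have 1: "?a * ?b = 1\<^sub>m n" "?b * ?a = 1\<^sub>m n"
    by (rule eq_matI; simp add: mat_mult_entry[where n = n] ab ba del: index_mult_mat(1))+
  then show "?a \<in> GL n" unfolding GL_def Units_def
    by (auto simp: ring_mat_simps intro!: bexI[of _ ?b])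
  show "GL_inv n ?a = ?b" unfolding GL_inv_def
    by (rule R.inv_unique'[symmetric]) (simp_all add: ring_mat_simps 1)
qed

lemma coef_row_mult:
  "coef (row_mult n \<alpha> G) q = (if q < n then \<Sum>p<n. coef \<alpha> p * G $$ (p, q) else 0)"
  by (simp add: row_mult_def lookup_sum lookup_single when_def)

lemma row_mult_vecs: "row_mult n \<alpha> G \<in> vecs n"
  by (auto simp: vecs_def in_keys_iff coef_row_mult split: if_splits)

lemma row_mult_add: "row_mult n (\<alpha> + \<beta>) G = row_mult n \<alpha> G + row_mult n \<beta> G"
  by (rule poly_mapping_eqI) (simp add: coef_row_mult lookup_add distrib_right sum.distrib)

lemma sum_sum_inverse:
  fixes a :: "nat \<Rightarrow> 'f::field"
  assumes "\<And>p. p < n \<Longrightarrow> (\<Sum>q<n. g p q * h q r) = (if p = r then 1 else 0)" "r < n"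
  shows "(\<Sum>q<n. (\<Sum>p<n. a p * g p q) * h q r) = a r"
proof -
  have "(\<Sum>q<n. (\<Sum>p<n. a p * g p q) * h q r) = (\<Sum>p<n. a p * (\<Sum>q<n. g p q * h q r))"
    unfolding sum_distrib_right sum_distrib_left by (subst sum.swap) (simp add: mult.assoc)
  also have "\<dots> = (\<Sum>p<n. a p * (if p = r then 1 else 0))" using assms(1) by simp
  also have "\<dots> = a r" using assms(2) by (simp add: if_distrib[of "\<lambda>x. _ * x"] cong: if_cong)
  finally show ?thesis .
qed

lemma row_mult_inverse:
  assumes "B \<in> carrier_mat n n" "C \<in> carrier_mat n n" "B * C = 1\<^sub>m n" "\<alpha> \<in> vecs n"
  shows "row_mult n (row_mult n \<alpha> B) C = \<alpha>"
proof (rule poly_mapping_eqI)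
  fix r
  show "coef (row_mult n (row_mult n \<alpha> B) C) r = coef \<alpha> r"
  proof (cases "r < n")
    case True
    have "(\<Sum>q<n. B $$ (p, q) * C $$ (q, r)) = (if p = r then 1 else 0)" if "p < n" for p
      using mat_mult_entry[OF assms(1,2) that True] True that by (simp add: assms(3))
    from sum_sum_inverse[where g = "\<lambda>p q. B $$ (p, q)" and h = "\<lambda>q r. C $$ (q, r)" and a = "coef \<alpha>", OF this True]
    show ?thesis using True
      by (simp add: coef_row_mult)
  next
    case False
    then have "r \<notin> supp \<alpha>" using assms(4) by (auto simp: vecs_def)
    with False show ?thesis by (simp add: coef_row_mult in_keys_iff)
  qed
qed

lemma sum_lessThan_add_split:
  "(\<Sum>q<n + m. f q) = (\<Sum>q<n. f q) + (\<Sum>k<m. f (n + k) :: 'a::comm_monoid_add)" for n m :: nat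
  by (induction m) (simp_all add: add.assoc)

section \<open>Splitting off an involution\<close>

text \<open>The subgroup \<open>E\<close> has index 2 and the involution gives a complement. Because
  \<open>generate G {s}\<close> has only the elements 1 and s, all conditions on the action reduce
  to these two cases.\<close>

lemma (in group) semidirect_involution:
  assumes E: "subgroup E G" and s: "s \<in> carrier G" "s \<otimes> s = \<one>" "s \<notin> E"
    and cosets: "\<And>x. x \<in> carrier G \<Longrightarrow> x \<in> E \<or> x \<otimes> s \<in> E"
    and norm: "\<And>e. e \<in> E \<Longrightarrow> s \<otimes> e \<otimes> s \<in> E"
  shows "ord s = 2"
    and "conj_action G E \<in> hom (G\<lparr>carrier := generate G {s}\<rparr>) (AutoGroup (G\<lparr>carrier := E\<rparr>))"
    and "(\<lambda>(e, t). e \<otimes> t)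
      \<in> iso (semidirect (G\<lparr>carrier := E\<rparr>) (G\<lparr>carrier := generate G {s}\<rparr>) (conj_action G E)) G"
proof -
  have inv_s: "inv s = s" using s by (intro inv_equality) auto
  have EG: "e \<in> carrier G" if "e \<in> E" for e using subgroup.mem_carrier[OF E that] .
  have E1: "\<one> \<in> E" by (rule subgroup.one_closed[OF E])
  have s1: "s \<noteq> \<one>" using s(3) E1 by blast
  have ss: "s \<otimes> (s \<otimes> x) = x" if "x \<in> carrier G" for x
    using that s by (simp add: m_assoc[symmetric])
  have pow: "s [^] n = (if even n then \<one> else s)" for n :: nat
    using s by (induction n) auto
  show "ord s = 2"
    using s(1) s1 by (subst ord_unique) (auto simp: pow)
  have "subgroup {\<one>, s} G"
    using s inv_s by (intro subgroupI) auto
  then have S: "generate G {s} = {\<one>, s}"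
  proof (rule generateI[symmetric])
    fix K assume "subgroup K G" "{s} \<subseteq> K"
    then show "{\<one>, s} \<subseteq> K" by (auto intro: subgroup.one_closed)
  qed auto
  have t: "t \<in> carrier G" "t \<otimes> t = \<one>" "inv t = t" if "t \<in> {\<one>, s}" for t
    using that s inv_s by auto
  have tt: "t \<otimes> (t \<otimes> x) = x" if "t \<in> {\<one>, s}" "x \<in> carrier G" for t x
    using that ss by auto
  have c: "conj_action G E t e = t \<otimes> (e \<otimes> t)" if "t \<in> {\<one>, s}" "e \<in> E" for t e
    using that t[OF that(1)] EG by (simp add: conj_action_def m_assoc)
  have cE: "t \<otimes> (e \<otimes> t) \<in> E" if "t \<in> {\<one>, s}" "e \<in> E" for t e
    using that norm[of e] EG[of e] s(1) by (auto simp: m_assoc)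
  have cBij: "conj_action G E t \<in> Bij E" if "t \<in> {\<one>, s}" for t
  proof -
    have "conj_action G E t (conj_action G E t e) = e" if "e \<in> E" for e
      using that \<open>t \<in> {\<one>, s}\<close> t[OF \<open>t \<in> {\<one>, s}\<close>] EG[OF that]
      by (simp add: c cE m_assoc tt del: insert_iff)
    then have "bij_betw (conj_action G E t) E E"
      by (intro bij_betw_byWitness[where f' = "conj_action G E t"]) (use c cE that in auto)
    then show ?thesis by (simp add: Bij_def conj_action_def)
  qed
  have cauto: "conj_action G E t \<in> auto (G\<lparr>carrier := E\<rparr>)" if "t \<in> {\<one>, s}" for t
  proof -
    have "conj_action G E t (a \<otimes> b) = conj_action G E t a \<otimes> conj_action G E t b" if "a \<in> E" "b \<in> E" for a b
      using that \<open>t \<in> {\<one>, s}\<close> t[OF \<open>t \<in> {\<one>, s}\<close>] EG[OF that(1)] EG[OF that(2)] subgroup.m_closed[OF E that]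
      by (simp add: c m_assoc tt del: insert_iff)
    then show ?thesis
      using cBij[OF that] c[OF that] cE[OF that] by (auto simp: auto_def hom_def)
  qed
  have closed: "t \<otimes> t' \<in> {\<one>, s}" if "t \<in> {\<one>, s}" "t' \<in> {\<one>, s}" for t t' using that s by auto
  show "conj_action G E \<in> hom (G\<lparr>carrier := generate G {s}\<rparr>) (AutoGroup (G\<lparr>carrier := E\<rparr>))"
  proof (rule homI)
    fix t assume "t \<in> carrier (G\<lparr>carrier := generate G {s}\<rparr>)"
    then show "conj_action G E t \<in> carrier (AutoGroup (G\<lparr>carrier := E\<rparr>))"
      using cauto by (simp add: S AutoGroup_def)
  next
    fix t t' assume "t \<in> carrier (G\<lparr>carrier := generate G {s}\<rparr>)" "t' \<in> carrier (G\<lparr>carrier := generate G {s}\<rparr>)"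
    then have tS: "t \<in> {\<one>, s}" "t' \<in> {\<one>, s}" by (simp_all add: S)
    have "conj_action G E (t \<otimes> t') = compose E (conj_action G E t) (conj_action G E t')"
    proof
      fix e
      show "conj_action G E (t \<otimes> t') e = compose E (conj_action G E t) (conj_action G E t') e"
      proof (cases "e \<in> E")
        case True
        have "inv (t \<otimes> t') = t' \<otimes> t" using tS t by (simp add: inv_mult_group del: insert_iff)
        then have "conj_action G E (t \<otimes> t') e = t \<otimes> t' \<otimes> e \<otimes> (t' \<otimes> t)"
          using True by (simp add: conj_action_def)
        then show ?thesis
          using True tS t(1)[OF tS(1)] t(1)[OF tS(2)] EG[OF True]
          by (simp add: compose_def c cE m_assoc del: insert_iff)
      qed (simp add: conj_action_def compose_def)
    qed
    then show "conj_action G E (t \<otimes>\<^bsub>G\<lparr>carrier := generate G {s}\<rparr>\<^esub> t') =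
        conj_action G E t \<otimes>\<^bsub>AutoGroup (G\<lparr>carrier := E\<rparr>)\<^esub> conj_action G E t'"
      using cBij[OF tS(1)] cBij[OF tS(2)] by (simp add: AutoGroup_def BijGroup_def)
  qed
  let ?m = "\<lambda>(e, t). e \<otimes> t"
  have "?m \<in> hom (semidirect (G\<lparr>carrier := E\<rparr>) (G\<lparr>carrier := generate G {s}\<rparr>) (conj_action G E)) G"
  proof (rule homI)
    fix x assume "x \<in> carrier (semidirect (G\<lparr>carrier := E\<rparr>) (G\<lparr>carrier := generate G {s}\<rparr>) (conj_action G E))"
    then show "?m x \<in> carrier G" using EG t(1) by (auto simp: semidirect_def S)
  next
    fix x y
    assume "x \<in> carrier (semidirect (G\<lparr>carrier := E\<rparr>) (G\<lparr>carrier := generate G {s}\<rparr>) (conj_action G E))"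
      and "y \<in> carrier (semidirect (G\<lparr>carrier := E\<rparr>) (G\<lparr>carrier := generate G {s}\<rparr>) (conj_action G E))"
    then obtain e t e' t' where xy: "x = (e, t)" "y = (e', t')"
      and et: "e \<in> E" "t \<in> {\<one>, s}" "e' \<in> E" "t' \<in> {\<one>, s}"
      by (auto simp: semidirect_def S simp del: insert_iff)
    show "?m (x \<otimes>\<^bsub>semidirect (G\<lparr>carrier := E\<rparr>) (G\<lparr>carrier := generate G {s}\<rparr>) (conj_action G E)\<^esub> y) =
        ?m x \<otimes> ?m y"
      using et t(1)[OF et(2)] t(1)[OF et(4)] EG[OF et(1)] EG[OF et(3)]
      by (simp add: xy semidirect_def c m_assoc tt del: insert_iff)
  qed
  moreover have "bij_betw ?m (E \<times> {\<one>, s}) (carrier G)"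
  proof (rule bij_betw_imageI)
    show "inj_on ?m (E \<times> {\<one>, s})"
    proof (rule inj_onI, clarsimp simp del: insert_iff)
      fix e t e' t'
      assume et: "e \<in> E" "t \<in> {\<one>, s}" "e' \<in> E" "t' \<in> {\<one>, s}" and eq: "e \<otimes> t = e' \<otimes> t'"
      \<comment> \<open>If \<open>a\<close> and \<open>a \<otimes> s\<close> were both in
        \<open>E\<close>, so would be \<open>s\<close>; this keeps the two cosets apart.\<close>
      have no: False if "a \<in> E" "b \<in> E" "a \<otimes> s = b" for a b
      proof -
        have "inv a \<otimes> (a \<otimes> s) \<in> E"
          using that E by (simp add: subgroup.m_closed subgroup.m_inv_closed)
        then show False using s EG[OF that(1)] by (simp add: m_assoc[symmetric])
      qed
      have "t = t'" using et eq no[of e e'] no[of e' e] EG by auto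
      with eq et show "e = e' \<and> t = t'" using EG t(1) by (auto simp del: insert_iff)
    qed
    show "?m ` (E \<times> {\<one>, s}) = carrier G"
    proof (intro equalityI subsetI)
      fix x assume x: "x \<in> carrier G"
      show "x \<in> ?m ` (E \<times> {\<one>, s})"
        using cosets[OF x]
      proof
        assume "x \<in> E"
        then show ?thesis using x by (intro image_eqI[of _ _ "(x, \<one>)"]) auto
      next
        assume "x \<otimes> s \<in> E"
        then show ?thesis using x s by (intro image_eqI[of _ _ "(x \<otimes> s, s)"]) (auto simp: m_assoc)
      qed
    qed (use EG t(1) in auto)
  qed
  ultimately show "?m \<in> iso (semidirect (G\<lparr>carrier := E\<rparr>) (G\<lparr>carrier := generate G {s}\<rparr>) (conj_action G E)) G"
    by (simp add: iso_def semidirect_def S)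
qed

section \<open>Transport to the carrier\<close>

lemma rep_sum: "rep_walg (sum f X) = (\<Sum>x\<in>X. rep_walg (f x))"
  by (induction X rule: infinite_finite_induct) (simp_all add: rep_walg_simps)

lemma rep_generators [simp]: "rep_walg (walg_of u) = emb u" "rep_walg (pd p) = wd p"
  by (simp_all add: walg_of_def pd_def)

lemma emb_single_0 [simp]: "emb (Poly_Mapping.single 0 c) = wscale c wone" for c :: "'f::field_char_0"
  using rep_kst_mult[of c 1] by (simp add: rep_walg_simps)

lemma rep_br: "rep_walg (br a b) = weyl_bracket (rep_walg a) (rep_walg b)"
  by (simp add: br_def weyl_bracket_def rep_walg_simps)

lemma rep_bracket_pow: "rep_walg ((br (walg_of u) ^^ k) a) = (weyl_bracket (emb u) ^^ k) (rep_walg a)"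
  by (induction k) (simp_all add: rep_br)

lemma walg_eq_iff: "a = b \<longleftrightarrow> rep_walg a = rep_walg b"
  by (rule rep_walg_inject[symmetric])

lemma abs_walg_simps:
  "abs_walg (a + b) = abs_walg a + abs_walg b" "abs_walg (wscale c a) = kst c * abs_walg a"
  by (simp_all add: walg_eq_iff rep_walg_simps(1-5) rep_kst_mult)

definition up :: "('f weyl \<Rightarrow> 'f weyl) \<Rightarrow> 'f::field_char_0 walg \<Rightarrow> 'f walg" where
  "up h w = abs_walg (h (rep_walg w))"

context weyl_type
begin

abbreviation W :: "'f weyl set" where "W \<equiv> weyl_carrier l1 l2 \<Gamma>"

text \<open>Transport back to the carrier type. The restriction to \<open>W\<close> makes the map
  extensional, as \<open>Bij\<close> demands, so \<open>low S\<close> records exactly the values of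
  \<open>S\<close> on \<open>Wc\<close>.\<close>

definition low :: "('f walg \<Rightarrow> 'f walg) \<Rightarrow> 'f weyl \<Rightarrow> 'f weyl" where
  "low S = (\<lambda>a\<in>W. rep_walg (S (abs_walg a)))"

lemma abs_in_Wc [simp]: "abs_walg a \<in> Wc \<longleftrightarrow> a \<in> W"
  by (simp add: Wc_iff)

lemma low_rep: "w \<in> Wc \<Longrightarrow> low S (rep_walg w) = rep_walg (S w)"
  by (simp add: low_def Wc_iff rep_walg_inverse)

lemma low_generators:
  "\<alpha> \<in> \<Gamma> \<Longrightarrow> low S (wx \<alpha>) = rep_walg (S (xw \<alpha>))"
  "r < l1 \<Longrightarrow> low S (wt r) = rep_walg (S (tw r))"
  "p < l \<Longrightarrow> low S (wd p) = rep_walg (S (pd p))"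
  using low_rep[of "xw \<alpha>" S] low_rep[of "tw r" S] low_rep[of "pd p" S]
  by (simp_all add: wx_def wt_def A_xmono)

lemma low_eq_iff: "low S = low T \<longleftrightarrow> (\<forall>w\<in>Wc. S w = T w)"
proof
  assume eq: "low S = low T"
  show "\<forall>w\<in>Wc. S w = T w"
    using low_rep[of _ S] low_rep[of _ T] unfolding eq by (simp add: walg_eq_iff)
next
  assume "\<forall>w\<in>Wc. S w = T w"
  then show "low S = low T" by (auto simp: low_def intro!: restrict_ext)
qed

lemma compose_low:
  assumes "linear_map T"
  shows "compose W (low S) (low T) = low (\<lambda>w. S (T w))"
proof
  fix a
  show "compose W (low S) (low T) a = low (\<lambda>w. S (T w)) a"
    using linear_mapD(1)[OF assms, of "abs_walg a"]
    by (simp add: compose_def low_def Wc_iff rep_walg_inverse)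
qed

lemma low_id: "low (\<lambda>w. w) = (\<lambda>a\<in>W. a)"
  by (simp add: low_def)

lemma low_Bij:
  assumes "linear_map S" "linear_map S'" "\<forall>w\<in>Wc. S' (S w) = w \<and> S (S' w) = w"
  shows "low S \<in> Bij W"
proof -
  have WW: "low T a \<in> W" if "linear_map T" "a \<in> W" for T a
    using linear_mapD(1)[OF that(1), of "abs_walg a"] that(2) by (simp add: low_def Wc_iff)
  have inv: "low U (low T a) = a" if "linear_map T" "\<forall>w\<in>Wc. U (T w) = w" "a \<in> W" for T U a
  proof -
    have "low U (low T a) = compose W (low U) (low T) a" using that by (simp add: compose_def)
    also have "\<dots> = low (\<lambda>w. w) a"
      unfolding compose_low[OF that(1)] using that(2) by (subst low_eq_iff[THEN iffD2]) auto
    finally show ?thesis using that(3) by (simp add: low_id)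
  qed
  have "bij_betw (low S) W W"
    by (rule bij_betw_byWitness[where f' = "low S'"]) (use assms in \<open>auto simp: inv WW\<close>)
  then show ?thesis by (simp add: Bij_def low_def)
qed

text \<open>The operation \<open>star\<close> stands for the product or the bracket, so both
  automorphism groups are treated together. The inverse is exhibited with its properties, in the
  form the locale \<open>lie_automorphism\<close> asks for.\<close>

lemma aut_group_iff:
  assumes star: "\<And>a b. rep_walg (star a b) = m (rep_walg a) (rep_walg b)"
    and closed: "\<And>a b. a \<in> Wc \<Longrightarrow> b \<in> Wc \<Longrightarrow> star a b \<in> Wc"
  shows "h \<in> carrier (aut_group m W) \<longleftrightarrow>
    (\<exists>S S'. h = low S \<and> linear_map S \<and> linear_map S' \<and> (\<forall>w\<in>Wc. S' (S w) = w \<and> S (S' w) = w) \<and>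
      (\<forall>a\<in>Wc. \<forall>b\<in>Wc. S (star a b) = star (S a) (S b) \<and> S' (star a b) = star (S' a) (S' b)))"
proof
  have abs_star: "abs_walg (m a b) = star (abs_walg a) (abs_walg b)" for a b
    by (simp add: walg_eq_iff star)
  have add: "a + b \<in> W" and m: "m a b \<in> W" if "a \<in> W" "b \<in> W" for a b
    using that Wc_add[of "abs_walg a" "abs_walg b"] closed[of "abs_walg a" "abs_walg b"]
    by (simp_all add: abs_walg_simps[symmetric] abs_star[symmetric])
  have scl: "wscale c a \<in> W" if "a \<in> W" for a c
    using that Wc_kst_mult[of "abs_walg a" c] by (simp add: abs_walg_simps[symmetric])
  {
    assume "h \<in> carrier (aut_group m W)"
    then have h: "h \<in> Bij W"
      and h_add: "\<And>a b. a \<in> W \<Longrightarrow> b \<in> W \<Longrightarrow> h (a + b) = h a + h b"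
      and h_scl: "\<And>c a. a \<in> W \<Longrightarrow> h (wscale c a) = wscale c (h a)"
      and h_m: "\<And>a b. a \<in> W \<Longrightarrow> b \<in> W \<Longrightarrow> h (m a b) = m (h a) (h b)"
      by (simp_all add: aut_group_def)
    define k where "k = inv_into W h"
    have bij: "bij_betw h W W" using h by (simp add: Bij_def)
    have hW: "h a \<in> W" and kW: "k a \<in> W" and kh: "k (h a) = a" and hk: "h (k a) = a" if "a \<in> W" for a
      using that bij unfolding k_def bij_betw_def
      by (auto simp: inv_into_f_f f_inv_into_f intro: inv_into_into)
    have eqI: "a = b" if "h a = h b" "a \<in> W" "b \<in> W" for a b using kh that by metis
    have k_add: "k (a + b) = k a + k b" and k_scl: "k (wscale c a) = wscale c (k a)"
      and k_m: "k (m a b) = m (k a) (k b)" if "a \<in> W" "b \<in> W" for a b c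
      by (rule eqI; simp add: that h_add h_scl h_m hk kW add scl m)+
    have mem: "rep_walg w \<in> W" if "w \<in> Wc" for w using that by (simp add: Wc_iff)
    have lin: "linear_map (up f)"
      if "\<And>a. a \<in> W \<Longrightarrow> f a \<in> W" "\<And>a b. a \<in> W \<Longrightarrow> b \<in> W \<Longrightarrow> f (a + b) = f a + f b"
        "\<And>c a. a \<in> W \<Longrightarrow> f (wscale c a) = wscale c (f a)" for f
      using that by (simp add: linear_map_def up_def mem rep_walg_simps(1-5) rep_kst_mult abs_walg_simps)
    have "h = low (up h)"
    proof
      fix a
      show "h a = low (up h) a"
        using h by (cases "a \<in> W") (auto simp: low_def up_def Bij_def extensional_def)
    qed
    moreover have "linear_map (up h)" "linear_map (up k)"
      by (rule lin; simp add: hW h_add h_scl kW k_add k_scl)+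
    moreover have "\<forall>w\<in>Wc. up k (up h w) = w \<and> up h (up k w) = w"
      by (simp add: up_def mem kh hk rep_walg_inverse)
    moreover have "\<forall>a\<in>Wc. \<forall>b\<in>Wc. up h (star a b) = star (up h a) (up h b) \<and>
        up k (star a b) = star (up k a) (up k b)"
      by (simp add: up_def mem star h_m k_m abs_star)
    ultimately show "\<exists>S S'. h = low S \<and> linear_map S \<and> linear_map S' \<and>
      (\<forall>w\<in>Wc. S' (S w) = w \<and> S (S' w) = w) \<and>
      (\<forall>a\<in>Wc. \<forall>b\<in>Wc. S (star a b) = star (S a) (S b) \<and> S' (star a b) = star (S' a) (S' b))"
      by blast
  next
    assume "\<exists>S S'. h = low S \<and> linear_map S \<and> linear_map S' \<and>
      (\<forall>w\<in>Wc. S' (S w) = w \<and> S (S' w) = w) \<and>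
      (\<forall>a\<in>Wc. \<forall>b\<in>Wc. S (star a b) = star (S a) (S b) \<and> S' (star a b) = star (S' a) (S' b))"
    then obtain S S' where S: "h = low S" "linear_map S" "linear_map S'"
      "\<forall>w\<in>Wc. S' (S w) = w \<and> S (S' w) = w" "\<forall>a\<in>Wc. \<forall>b\<in>Wc. S (star a b) = star (S a) (S b)"
      by blast
    then show "h \<in> carrier (aut_group m W)"
      using low_Bij[OF S(2-4)] linear_mapD(2,3)[OF S(2)]
      by (simp add: aut_group_def low_def add scl m abs_walg_simps abs_star rep_walg_simps(1-5) rep_kst_mult star)
  }
qed

lemma
  assumes "h \<in> carrier (aut_group m W)" "k \<in> carrier (aut_group m W)"
  shows aut_group_mult: "h \<otimes>\<^bsub>aut_group m W\<^esub> k = compose W h k"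
  using assms by (simp add: aut_group_def BijGroup_def)

lemma aut_group_one: "\<one>\<^bsub>aut_group m W\<^esub> = low (\<lambda>w. w)"
  by (simp add: aut_group_def BijGroup_def low_id)

lemma group_aut_group:
  assumes star: "\<And>a b. rep_walg (star a b) = m (rep_walg a) (rep_walg b)"
    and closed: "\<And>a b. a \<in> Wc \<Longrightarrow> b \<in> Wc \<Longrightarrow> star a b \<in> Wc"
  shows "group (aut_group m W)"
proof -
  let ?G = "aut_group m W"
  have iff: "h \<in> carrier ?G \<longleftrightarrow>
    (\<exists>S S'. h = low S \<and> linear_map S \<and> linear_map S' \<and> (\<forall>w\<in>Wc. S' (S w) = w \<and> S (S' w) = w) \<and>
      (\<forall>a\<in>Wc. \<forall>b\<in>Wc. S (star a b) = star (S a) (S b) \<and> S' (star a b) = star (S' a) (S' b)))" for h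
    by (rule aut_group_iff) (use star closed in auto)
  have obt: "\<exists>S S'. h = low S \<and> linear_map S \<and> linear_map S' \<and> low S' \<in> carrier ?G \<and>
      (\<forall>w\<in>Wc. S' (S w) = w \<and> S (S' w) = w) \<and>
      (\<forall>a\<in>Wc. \<forall>b\<in>Wc. S (star a b) = star (S a) (S b) \<and> S' (star a b) = star (S' a) (S' b))"
    if h: "h \<in> carrier ?G" for h
  proof -
    obtain S S' where S: "h = low S" "linear_map S" "linear_map S'"
      "\<forall>w\<in>Wc. S' (S w) = w \<and> S (S' w) = w"
      "\<forall>a\<in>Wc. \<forall>b\<in>Wc. S (star a b) = star (S a) (S b) \<and> S' (star a b) = star (S' a) (S' b)"
      using iffD1[OF iff h] by blast
    have "low S' \<in> carrier ?G" by (rule iffD2[OF iff]) (use S in blast)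
    with S show ?thesis by blast
  qed
  have mult: "low (\<lambda>w. S (T w)) = low S \<otimes>\<^bsub>?G\<^esub> low T"
    if "low S \<in> carrier ?G" "low T \<in> carrier ?G" "linear_map T" for S T
    by (simp only: aut_group_mult[OF that(1,2)] compose_low[OF that(3)])
  have clos: "h \<otimes>\<^bsub>?G\<^esub> k \<in> carrier ?G" if hk: "h \<in> carrier ?G" "k \<in> carrier ?G" for h k
  proof -
    obtain S S' where S: "h = low S" "linear_map S" "linear_map S'"
      "\<forall>w\<in>Wc. S' (S w) = w \<and> S (S' w) = w"
      "\<forall>a\<in>Wc. \<forall>b\<in>Wc. S (star a b) = star (S a) (S b) \<and> S' (star a b) = star (S' a) (S' b)"
      using obt[OF hk(1)] by blast
    obtain T T' where T: "k = low T" "linear_map T" "linear_map T'"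
      "\<forall>w\<in>Wc. T' (T w) = w \<and> T (T' w) = w"
      "\<forall>a\<in>Wc. \<forall>b\<in>Wc. T (star a b) = star (T a) (T b) \<and> T' (star a b) = star (T' a) (T' b)"
      using obt[OF hk(2)] by blast
    have "low (\<lambda>w. S (T w)) \<in> carrier ?G"
      by (rule iffD2[OF iff], rule exI[of _ "\<lambda>w. S (T w)"], rule exI[of _ "\<lambda>w. T' (S' w)"])
        (use S T in \<open>simp add: linear_map_comp linear_mapD(1)[OF S(3)] linear_mapD(1)[OF T(2)]\<close>)
    then show ?thesis using mult[of S T] hk S(1) T(1,2) by simp
  qed
  have one: "\<one>\<^bsub>?G\<^esub> \<in> carrier ?G"
    unfolding aut_group_one
    by (rule iffD2[OF iff], rule exI[of _ "\<lambda>w. w"], rule exI[of _ "\<lambda>w. w"]) (simp add: linear_map_def)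
  show ?thesis
  proof (rule groupI)
    fix h k j assume hk: "h \<in> carrier ?G" "k \<in> carrier ?G" "j \<in> carrier ?G"
    have "j \<in> W \<rightarrow> W" using hk(3) by (auto simp: aut_group_def dest: Bij_imp_funcset)
    then show "h \<otimes>\<^bsub>?G\<^esub> k \<otimes>\<^bsub>?G\<^esub> j = h \<otimes>\<^bsub>?G\<^esub> (k \<otimes>\<^bsub>?G\<^esub> j)"
      using hk clos by (simp add: aut_group_mult compose_assoc[symmetric])
  next
    fix h assume h: "h \<in> carrier ?G"
    obtain S S' where S: "h = low S" "linear_map S" "low S' \<in> carrier ?G" "\<forall>w\<in>Wc. S' (S w) = w"
      using obt[OF h] by blast
    show "\<one>\<^bsub>?G\<^esub> \<otimes>\<^bsub>?G\<^esub> h = h"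
      using mult[of "\<lambda>w. w" S] S(1,2) h one by (simp add: aut_group_one)
    have "low S' \<otimes>\<^bsub>?G\<^esub> h = low (\<lambda>w. S' (S w))"
      unfolding S(1) by (rule mult[symmetric, OF S(3) h[unfolded S(1)] S(2)])
    also have "\<dots> = \<one>\<^bsub>?G\<^esub>" unfolding aut_group_one low_eq_iff by (rule S(4))
    finally have "low S' \<otimes>\<^bsub>?G\<^esub> h = \<one>\<^bsub>?G\<^esub>" .
    then show "\<exists>k\<in>carrier ?G. k \<otimes>\<^bsub>?G\<^esub> h = \<one>\<^bsub>?G\<^esub>" using S(3) by blast
  qed (use clos one in auto)
qed

abbreviation "AutL \<equiv> Aut_Lie l1 l2 \<Gamma>"
abbreviation "AutW \<equiv> Aut_assoc l1 l2 \<Gamma>"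

lemma Aut_Lie_iff: "h \<in> carrier AutL \<longleftrightarrow> (\<exists>S S'. h = low S \<and> lie_automorphism l1 l2 \<Gamma> S S')"
  unfolding Aut_Lie_def
  by (subst aut_group_iff[where star = br, OF rep_br Wc_br])
    (assumption, assumption, rule iff_exI, rule iff_exI,
      auto simp: lie_automorphism_def lie_automorphism_axioms_def lie_hom_def weyl_type_axioms)

lemma Aut_assoc_iff: "h \<in> carrier AutW \<longleftrightarrow>
  (\<exists>S S'. h = low S \<and> assoc_hom S \<and> assoc_hom S' \<and> (\<forall>w\<in>Wc. S' (S w) = w \<and> S (S' w) = w))"
proof -
  \<comment> \<open>Surjectivity makes S 1 the unit element: apply \<open>S\<close> to 1 times a
    preimage of 1.\<close>
  have one: "S 1 = 1"
    if "linear_map S'" "\<forall>w\<in>Wc. S (S' w) = w" "\<forall>a\<in>Wc. \<forall>b\<in>Wc. S (a * b) = S a * S b" for S S'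
  proof -
    have "S' 1 \<in> Wc" by (rule linear_mapD(1)[OF that(1)]) simp
    then have "S (1 * S' 1) = S 1 * S (S' 1)" using that(3) Wc_one by blast
    then show ?thesis using that(2) by simp
  qed
  show ?thesis
    unfolding Aut_assoc_def
    by (subst aut_group_iff[where star = "(*)", OF rep_walg_simps(6) Wc_mult])
      (assumption, assumption, rule iff_exI, rule iff_exI, auto simp: assoc_hom_def intro: one)
qed

lemma group_Aut: "group AutL" "group AutW"
  unfolding Aut_Lie_def Aut_assoc_def
  by (rule group_aut_group[where star = br, OF rep_br Wc_br]
      group_aut_group[where star = "(*)", OF rep_walg_simps(6) Wc_mult]; assumption)+

lemma Aut_low_mult:
  assumes "linear_map T"
  shows "low S \<in> carrier AutL \<Longrightarrow> low T \<in> carrier AutL \<Longrightarrow> low S \<otimes>\<^bsub>AutL\<^esub> low T = low (\<lambda>w. S (T w))"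
    and "low S \<in> carrier AutW \<Longrightarrow> low T \<in> carrier AutW \<Longrightarrow> low S \<otimes>\<^bsub>AutW\<^esub> low T = low (\<lambda>w. S (T w))"
  using compose_low[OF assms] unfolding Aut_Lie_def Aut_assoc_def by (simp_all add: aut_group_mult)

lemma Aut_one: "\<one>\<^bsub>AutL\<^esub> = low (\<lambda>w. w)" "\<one>\<^bsub>AutW\<^esub> = low (\<lambda>w. w)"
  unfolding Aut_Lie_def Aut_assoc_def by (rule aut_group_one)+

lemma Aut_assoc_subset: "carrier AutW \<subseteq> carrier AutL"
proof
  fix h assume "h \<in> carrier AutW"
  then obtain S S' where S: "h = low S" "assoc_hom S" "assoc_hom S'" "\<forall>w\<in>Wc. S' (S w) = w \<and> S (S' w) = w"
    unfolding Aut_assoc_iff by blast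
  have "lie_automorphism l1 l2 \<Gamma> S S'"
    by unfold_locales (use S in \<open>simp_all add: assoc_hom_lie_hom\<close>)
  with S(1) show "h \<in> carrier AutL" unfolding Aut_Lie_iff by blast
qed

end

section \<open>The special automorphisms\<close>

lemma wscale_zero [simp]: "wscale c 0 = 0" for c :: "'f::field_char_0"
  using rep_kst_mult[of c 0] by (simp add: rep_walg_simps)

lemma wscale_uminus: "wscale c (- a) = - wscale c a" for c :: "'f::field_char_0"
  using rep_kst_mult[of c "- abs_walg a"] rep_kst_mult[of c "abs_walg a"]
  by (simp add: rep_walg_simps(1-5))

lemma neg_dpow_eq: "neg_dpow \<mu> = Poly_Mapping.single \<mu> ((- 1) ^ mdeg \<mu>)" for \<mu> :: mindex
proof -
  have pow: "(- wd p :: 'a weyl) ^ n = Poly_Mapping.single (Poly_Mapping.single p n) ((- 1) ^ n)" for p n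
  proof (induction n)
    case (Suc n)
    have "- wd p = (Poly_Mapping.single (Poly_Mapping.single p 1) (- 1) :: 'a weyl)"
      by (simp add: wd_def unit_index_def single_uminus)
    with Suc show ?case by (simp add: mult_single flip: single_add)
  qed simp
  have prod: "(\<Prod>p\<in>X. Poly_Mapping.single (k p) (c p)) = Poly_Mapping.single (sum k X) (prod c X)"
    for X and k :: "nat \<Rightarrow> mindex" and c :: "nat \<Rightarrow> 'a salg"
    by (induction X rule: infinite_finite_induct) (simp_all add: mult_single)
  have "\<mu> = (\<Sum>p\<in>supp \<mu>. Poly_Mapping.single p (coef \<mu> p))"
    by (rule poly_mapping_eqI)
      (auto simp: lookup_sum lookup_single when_def in_keys_iff sum.delta[OF finite_keys] cong: if_cong)
  then have \<mu>: "(\<Sum>p\<in>supp \<mu>. Poly_Mapping.single p (coef \<mu> p)) = \<mu>" by (rule sym)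
  have "(\<Prod>p\<in>supp \<mu>. (- 1 :: 'a salg) ^ coef \<mu> p) = (- 1) ^ mdeg \<mu>"
    by (simp add: mdeg_def power_sum)
  then show ?thesis unfolding neg_dpow_def pow prod \<mu> by (rule arg_cong)
qed

lemma rep_signed_pd_pow: "rep_walg (kst ((- 1) ^ mdeg \<mu>) * pd_pow \<mu>) = neg_dpow \<mu>"
proof -
  have "Poly_Mapping.single 0 ((- 1) ^ n) = ((- 1) ^ n :: 'a salg)" for n
    by (induction n) (simp_all add: single_uminus)
  then show ?thesis
    unfolding rep_kst_mult by (simp add: pd_pow_def neg_dpow_eq scale_eq_mult wscale_def map_single)
qed

lemma sum_row_mult: "p < n \<Longrightarrow> (\<Sum>q<n. G $$ (q, p) * coef \<alpha> q) = coef (row_mult n \<alpha> G) p"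
  by (simp add: coef_row_mult mult.commute)

context weyl_type
begin

lemma low_in_Aut_assoc:
  assumes "assoc_hom S" "assoc_hom S'" "\<And>w. w \<in> Wc \<Longrightarrow> S' (S w) = w" "\<And>w. w \<in> Wc \<Longrightarrow> S (S' w) = w"
  shows "low S \<in> carrier AutW"
  unfolding Aut_assoc_iff using assms by blast

text \<open>This is the uniqueness behind the definite descriptions in \<open>sigma_vec\<close> and
  \<open>sigma_tau\<close>.\<close>

lemma Aut_assoc_eqI:
  assumes "h \<in> carrier AutW" "assoc_hom S" "\<And>\<alpha>. \<alpha> \<in> \<Gamma> \<Longrightarrow> h (wx \<alpha>) = low S (wx \<alpha>)"
    "\<And>p. p < l1 \<Longrightarrow> h (wt p) = low S (wt p)" "\<And>p. p < l \<Longrightarrow> h (wd p) = low S (wd p)"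
  shows "h = low S"
proof -
  obtain T where T: "h = low T" "assoc_hom T" using assms(1) unfolding Aut_assoc_iff by blast
  have "T w = S w" if "w \<in> Wc" for w
  proof (rule assoc_hom_eqI[OF T(2) assms(2) _ _ _ that])
    show "T (xw \<alpha>) = S (xw \<alpha>)" if "\<alpha> \<in> \<Gamma>" for \<alpha>
      using assms(3)[OF that] that by (simp add: T(1) low_generators walg_eq_iff)
    show "T (tw p) = S (tw p)" if "p < l1" for p
      using assms(4)[OF that] that by (simp add: T(1) low_generators walg_eq_iff)
    show "T (pd p) = S (pd p)" if "p < l" for p
      using assms(5)[OF that] that by (simp add: T(1) low_generators walg_eq_iff)
  qed
  then show ?thesis unfolding T(1) low_eq_iff by blast
qed

lemma vec_hom_inverse': "w \<in> Wc \<Longrightarrow> vec_hom v (vec_hom (\<lambda>p. - v p) w) = w"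
  using vec_hom_inverse[of w "\<lambda>p. - v p"] by simp

lemma sigma_vec_eq: "sigma_vec l1 l2 \<Gamma> v = low (vec_hom (coef v))"
  unfolding sigma_vec_def
proof (rule the_equality)
  let ?S = "vec_hom (coef v)"
  have x: "low ?S (wx \<alpha>) = wx \<alpha>" if "\<alpha> \<in> \<Gamma>" for \<alpha>
    using that by (simp add: low_generators vec_hom(2) wx_def[symmetric])
  have t: "low ?S (wt p) = wt p + wscale (coef v p) wone" if "p < l1" for p
    using that by (simp add: low_generators vec_hom(3) rep_walg_simps wt_def[symmetric])
  have d: "low ?S (wd p) = wd p + (if p < l1 then 0 else wscale (coef v p) wone)" if "p < l" for p
    using that by (simp add: low_generators vec_hom(4) rep_walg_simps)
  have "low ?S \<in> carrier AutW"
    by (rule low_in_Aut_assoc[OF vec_hom(1) vec_hom(1) vec_hom_inverse vec_hom_inverse'])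
  then show "low ?S \<in> carrier AutW \<and> (\<forall>\<alpha>\<in>\<Gamma>. low ?S (wx \<alpha>) = wx \<alpha>) \<and>
     (\<forall>p<l1. low ?S (wd p) = wd p \<and> low ?S (wt p) = wt p + wscale (coef v p) wone) \<and>
     (\<forall>q. l1 \<le> q \<and> q < l1 + l2 \<longrightarrow> low ?S (wd q) = wd q + wscale (coef v q) wone)"
    by (simp add: x t d)
  fix h assume h: "h \<in> carrier AutW \<and> (\<forall>\<alpha>\<in>\<Gamma>. h (wx \<alpha>) = wx \<alpha>) \<and>
     (\<forall>p<l1. h (wd p) = wd p \<and> h (wt p) = wt p + wscale (coef v p) wone) \<and>
     (\<forall>q. l1 \<le> q \<and> q < l1 + l2 \<longrightarrow> h (wd q) = wd q + wscale (coef v q) wone)"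
  show "h = low ?S"
  proof (rule Aut_assoc_eqI[OF _ vec_hom(1)])
    show "h (wd p) = low ?S (wd p)" if "p < l" for p
      using h that d[OF that] by (cases "p < l1") auto
  qed (use h in \<open>simp_all add: x t\<close>)
qed

lemma sigma_exp_eq:
  assumes u: "u \<in> A"
  shows "sigma_exp l1 l2 \<Gamma> u = low (exp_ad u)"
proof -
  have "Sum_any (\<lambda>k::nat. wscale (1 / fact k) ((weyl_bracket (emb u) ^^ k) w)) = rep_walg (exp_ad u (abs_walg w))"
    if "w \<in> W" for w
  proof -
    let ?B = "br (walg_of u)" and ?a = "abs_walg w"
    \<comment> \<open>Nilpotency bounds the set of nonzero terms, so that \<open>Sum_any\<close>
      becomes the finite sum of \<open>exp_ad\<close>.\<close>
    obtain n where n: "(?B ^^ n) ?a = 0" using br_walg_of_nilpotent[of u ?a] u that by auto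
    have zero: "(?B ^^ m) 0 = 0" for m by (induction m) (simp_all add: br_def)
    have "(?B ^^ k) ?a = 0" if "n \<le> k" for k
    proof -
      have "(?B ^^ ((k - n) + n)) ?a = 0" unfolding funpow_add comp_def n zero ..
      then show ?thesis using that by simp
    qed
    then have tail: "(weyl_bracket (emb u) ^^ k) w = 0" if "n \<le> k" for k
      using that rep_bracket_pow[of k u ?a] by (simp add: rep_walg_simps)
    have "Sum_any (\<lambda>k::nat. wscale (1 / fact k) ((weyl_bracket (emb u) ^^ k) w)) =
        (\<Sum>k<n. wscale (1 / fact k) ((weyl_bracket (emb u) ^^ k) w))"
    proof (rule Sum_any.expand_superset)
      show "{k. wscale (1 / fact k) ((weyl_bracket (emb u) ^^ k) w) \<noteq> 0} \<subseteq> {..<n}"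
        using tail by (auto simp: not_le[symmetric])
    qed simp
    also have "\<dots> = rep_walg (exp_ad u ?a)"
      unfolding exp_ad_eq[OF n] by (simp only: rep_sum rep_kst_mult rep_bracket_pow abs_walg_inverse')
    finally show ?thesis .
  qed
  then show ?thesis unfolding sigma_exp_def low_def by (intro restrict_ext)
qed

lemma sigma1_eq: "sigma1 l1 l2 \<Gamma> = low (\<lambda>w. - adjoint w)"
proof -
  have "(\<Sum>\<mu>\<in>supp w. \<Sum>(\<alpha>, i)\<in>supp (coef w \<mu>).
      wscale (coef (coef w \<mu>) (\<alpha>, i)) (- weyl_mult (neg_dpow \<mu>) (emb (xmono \<alpha> i)))) =
    rep_walg (- adjoint (abs_walg w))" for w :: "'f weyl"
  proof -
    have F: "rep_walg (kst ((- 1) ^ mdeg \<mu>) * (pd_pow \<mu> * walg_of u)) = weyl_mult (neg_dpow \<mu>) (emb u)"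
      for \<mu> and u :: "'f salg"
      unfolding mult.assoc[symmetric] rep_walg_simps(6)[of _ "walg_of u"] by (simp add: rep_signed_pd_pow)
    show ?thesis
      unfolding adjoint_def linear_extension_def rep_walg_simps(5) rep_sum rep_kst_mult abs_walg_inverse'
      unfolding sum_negf[symmetric]
      by (intro sum.cong refl) (simp_all only: split_paired_all prod.case F wscale_uminus)
  qed
  then show ?thesis unfolding sigma1_def low_def by (simp cong: restrict_cong)
qed

lemma linear_data_of_matrix:
  assumes "(G, f) \<in> Aut2_A1 l1 l2 \<Gamma>"
  shows "linear_data f (\<lambda>\<alpha>. row_mult l \<alpha> (GL_inv l G)) (\<lambda>\<alpha>. row_mult l \<alpha> G)
    (\<lambda>q p. G $$ (q, p)) (\<lambda>q p. GL_inv l G $$ (q, p))"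
proof -
  let ?H = "GL_inv l G"
  obtain M P Q where G: "G \<in> GL l" and M: "M \<in> GL l1" "Q \<in> GL l2" "G = four_block_mat M (0\<^sub>m l1 l2) P Q"
    and img: "(\<lambda>\<alpha>. row_mult l \<alpha> G) ` \<Gamma> = \<Gamma>" and f: "f \<in> characters \<Gamma>"
    using assms by (auto simp: Aut2_A1_def Aut2_grp_def)
  note GD = GL_D[OF G] and MD = GL_D[OF M(1)]
  have v: "a \<in> vecs l" if "a \<in> \<Gamma>" for a using that Gamma_vecs by blast
  have HG: "row_mult l (row_mult l a ?H) G = a" and GH: "row_mult l (row_mult l a G) ?H = a" if "a \<in> \<Gamma>" for a
    using row_mult_inverse[OF GD(2,1,4) v[OF that]] row_mult_inverse[OF GD(1,2,3) v[OF that]] by auto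
  have G_in: "row_mult l a G \<in> \<Gamma>" if "a \<in> \<Gamma>" for a using img that by blast
  have H_in: "row_mult l a ?H \<in> \<Gamma>" if a: "a \<in> \<Gamma>" for a
  proof -
    obtain b where b: "b \<in> \<Gamma>" "a = row_mult l b G" using img a by blast
    show ?thesis unfolding b(2) GH[OF b(1)] by (rule b(1))
  qed
  have prods: "(\<Sum>q<l. ?H $$ (r, q) * G $$ (q, p)) = (if r = p then 1 else 0)"
    "(\<Sum>q<l. G $$ (r, q) * ?H $$ (q, p)) = (if r = p then 1 else 0)" if "r < l" "p < l" for r p
    using mat_mult_entry[OF GD(2,1) that] mat_mult_entry[OF GD(1,2) that] that
    unfolding GD(3,4) by simp_all
  have dims: "dim_row M = l1" "dim_col M = l1" "dim_row Q = l2" "dim_col Q = l2"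
    using GL_D(1)[OF M(1)] GL_D(1)[OF M(2)] by auto
  have zero: "G $$ (r, m) = 0" if "r < l1" "l1 \<le> m" "m < l" for r m
    using that dims unfolding M(3) by simp
  have block: "G $$ (r, q) = M $$ (r, q)" if "r < l1" "q < l1" for r q
    using that dims unfolding M(3) by simp
  \<comment> \<open>The zero block passes to the inverse H: from G H = 1 its upper right block X
    satisfies M X = 0, and M is invertible.\<close>
  have zero': "?H $$ (r, m) = 0" if rm: "r < l1" "l1 \<le> m" "m < l" for r m
  proof -
    have mz: "(\<Sum>q<l1. ?H $$ (q, m) * M $$ (s, q)) = 0" if s: "s < l1" for s
    proof -
      have "(\<Sum>q<l. G $$ (s, q) * ?H $$ (q, m)) = 0"
        using prods(2)[of s m] s rm by simp
      then show ?thesis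
        unfolding sum_lessThan_add_split using s by (simp add: zero block mult.commute)
    qed
    have "(\<Sum>q<l1. (\<Sum>p<l1. ?H $$ (p, m) * M $$ (q, p)) * GL_inv l1 M $$ (r, q)) = ?H $$ (r, m)"
    proof (rule sum_sum_inverse[where g = "\<lambda>p q. M $$ (q, p)" and h = "\<lambda>q s. GL_inv l1 M $$ (s, q)"
          and a = "\<lambda>p. ?H $$ (p, m)"])
      show "(\<Sum>q<l1. M $$ (q, p) * GL_inv l1 M $$ (r, q)) = (if p = r then 1 else 0)" if "p < l1" for p
        using mat_mult_entry[OF MD(2,1) rm(1) that] that rm(1) unfolding MD(4)
        by (simp add: mult.commute split: if_splits)
    qed (rule rm(1))
    then show ?thesis by (simp add: mz)
  qed
  show ?thesis
    unfolding linear_data_def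
    by (intro conjI ballI allI impI)
      (use f in \<open>simp_all add: characters_def G_in H_in HG GH row_mult_add sum_row_mult prods zero zero'\<close>)
qed

lemma tau_hom_inverse': "linear_data f \<pi> \<pi>' g g' \<Longrightarrow> w \<in> Wc \<Longrightarrow>
  tau_hom f \<pi> g g' (tau_hom (\<lambda>a. 1 / f (\<pi>' a)) \<pi>' g' g w) = w"
proof -
  assume d: "linear_data f \<pi> \<pi>' g g'" and w: "w \<in> Wc"
  note d' = linear_data_inverse[OF d]
  let ?S = "tau_hom f \<pi> g g'" and ?S' = "tau_hom (\<lambda>a. 1 / f (\<pi>' a)) \<pi>' g' g"
  note T = tau_hom_inverse[OF d'] and L = linear_mapD(1)[OF assoc_homD(1)[OF tau_hom(1)[OF d]]]
    and L' = linear_mapD(1)[OF assoc_homD(1)[OF tau_hom(1)[OF d']]]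
  show "?S (?S' w) = w"
    using T[OF L[OF L'[OF w]]] unfolding tau_hom_inverse[OF d L'[OF w]] T[OF w] by (rule sym)
qed

lemma sigma_tau_eq:
  assumes \<tau>: "(G, f) \<in> Aut2_A1 l1 l2 \<Gamma>"
  shows "sigma_tau l1 l2 \<Gamma> (G, f) = low (tau_hom f (\<lambda>\<alpha>. row_mult l \<alpha> (GL_inv l G))
    (\<lambda>q p. G $$ (q, p)) (\<lambda>q p. GL_inv l G $$ (q, p)))" (is "_ = low ?S")
proof -
  note d = linear_data_of_matrix[OF \<tau>]
  note d' = linear_data_inverse[OF d]
  \<comment> \<open>Inverting the transposed block gives the transposed entries of the inverse of G,
    which is the index order used in \<open>tau_hom\<close>.\<close>
  have tr: "transpose_mat (upper_left l1 G) = mat l1 l1 (\<lambda>(i, j). G $$ (j, i))"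
    by (rule eq_matI) (auto simp: upper_left_def)
  have "GL_inv l1 (transpose_mat (upper_left l1 G)) = mat l1 l1 (\<lambda>(i, j). GL_inv l G $$ (j, i))"
    unfolding tr
  proof (rule GL_mat(2))
    fix i j assume "i < l1" "j < l1"
    then show "(\<Sum>k<l1. G $$ (k, i) * GL_inv l G $$ (j, k)) = (if i = j then 1 else 0)"
      "(\<Sum>k<l1. GL_inv l G $$ (k, i) * G $$ (j, k)) = (if i = j then 1 else 0)"
      using linear_data_block[OF d, of i j] linear_data_block[OF d', of i j] by (simp_all add: mult.commute)
  qed
  then have inv: "GL_inv l1 (transpose_mat (upper_left l1 G)) $$ (s, p) = GL_inv l G $$ (p, s)"
    if "s < l1" "p < l1" for s p using that by simp
  have x: "low ?S (wx \<alpha>) = wscale (f \<alpha>) (wx (row_mult l \<alpha> (GL_inv l G)))" if "\<alpha> \<in> \<Gamma>" for \<alpha>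
    using that by (simp add: low_generators tau_hom[OF d] rep_kst_mult wx_def[symmetric])
  have dd: "low ?S (wd p) = (\<Sum>q<l. wscale (G $$ (q, p)) (wd q))" if "p < l" for p
    using that by (simp add: low_generators tau_hom[OF d] rep_sum rep_kst_mult)
  have t: "low ?S (wt p) = (\<Sum>s<l1. wscale (GL_inv l1 (transpose_mat (upper_left l1 G)) $$ (s, p)) (wt s))"
    if "p < l1" for p
    using that by (simp add: low_generators tau_hom[OF d] rep_sum rep_kst_mult inv wt_def[symmetric])
  have in_Aut: "low ?S \<in> carrier AutW"
    by (rule low_in_Aut_assoc[OF tau_hom(1)[OF d] tau_hom(1)[OF d'] tau_hom_inverse[OF d] tau_hom_inverse'[OF d]])
  show ?thesis
    unfolding sigma_tau_def prod.case
  proof (rule the_equality)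
    fix h assume h: "h \<in> carrier AutW \<and>
     (\<forall>\<alpha>\<in>\<Gamma>. h (wx \<alpha>) = wscale (f \<alpha>) (wx (row_mult l \<alpha> (GL_inv l G)))) \<and>
     (\<forall>p<l. h (wd p) = (\<Sum>q<l. wscale (G $$ (q, p)) (wd q))) \<and>
     (\<forall>p<l1. h (wt p) = (\<Sum>s<l1. wscale (GL_inv l1 (transpose_mat (upper_left l1 G)) $$ (s, p)) (wt s)))"
    show "h = low ?S"
      by (rule Aut_assoc_eqI[OF _ tau_hom(1)[OF d]]) (use h in \<open>simp_all add: x t dd\<close>)
  qed (use in_Aut x t dd in blast)
qed

lemma matrix_of_linear_data:
  assumes d: "linear_data f \<pi> \<pi>' g g'"
  shows "(mat l l (\<lambda>(i, j). g i j), f) \<in> Aut2_A1 l1 l2 \<Gamma>"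
    and "sigma_tau l1 l2 \<Gamma> (mat l l (\<lambda>(i, j). g i j), f) = low (tau_hom f \<pi> g g')"
proof -
  let ?G = "mat l l (\<lambda>(i, j). g i j)" and ?H = "mat l l (\<lambda>(i, j). g' i j)"
  note d' = linear_data_inverse[OF d]
  have prods: "(\<Sum>q<l. g' r q * g q p) = (if r = p then 1 else 0)"
    "(\<Sum>q<l. g r q * g' q p) = (if r = p then 1 else 0)" if "r < l" "p < l" for r p
    using d that unfolding linear_data_def by blast+
  have zero: "g r m = 0" "g' r m = 0" if "r < l1" "l1 \<le> m" "m < l" for r m
    using d that unfolding linear_data_def by blast+
  have G: "?G \<in> GL l" and H: "GL_inv l ?G = ?H"
    by (rule GL_mat[where b = g']; simp add: prods)+
  have M: "mat l1 l1 (\<lambda>(i, j). g i j) \<in> GL l1"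
    by (rule GL_mat(1)[where b = g'])
      (use linear_data_block[OF d] linear_data_block[OF d'] in \<open>simp_all add: eq_commute[of _ "_ :: nat"]\<close>)
  \<comment> \<open>The lower right blocks of two inverse matrices are inverse to each other, since
    the upper right block of the second factor is zero.\<close>
  have lower: "(\<Sum>k<l2. a (l1 + i) (l1 + k) * b (l1 + k) (l1 + j)) = (if i = j then 1 else (0 :: 'f))"
    if "\<And>r p. r < l \<Longrightarrow> p < l \<Longrightarrow> (\<Sum>q<l. a r q * b q p) = (if r = p then 1 else 0)"
      "\<And>r m. r < l1 \<Longrightarrow> l1 \<le> m \<Longrightarrow> m < l \<Longrightarrow> b r m = 0" "i < l2" "j < l2" for a b i j
    using that(1)[of "l1 + i" "l1 + j"] that(2-4) unfolding sum_lessThan_add_split by simp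
  have Q: "mat l2 l2 (\<lambda>(i, j). g (l1 + i) (l1 + j)) \<in> GL l2"
    by (rule GL_mat(1)[where a = "\<lambda>i j. g (l1 + i) (l1 + j)" and b = "\<lambda>i j. g' (l1 + i) (l1 + j)"];
        rule lower) (simp_all add: prods zero)
  have "?G = four_block_mat (mat l1 l1 (\<lambda>(i, j). g i j)) (0\<^sub>m l1 l2) (mat l2 l1 (\<lambda>(i, j). g (l1 + i) j))
      (mat l2 l2 (\<lambda>(i, j). g (l1 + i) (l1 + j)))"
    by (rule eq_matI) (auto simp: zero)
  with M Q have blocks: "\<exists>M\<in>GL l1. \<exists>P\<in>carrier_mat l2 l1. \<exists>Q\<in>GL l2. ?G = four_block_mat M (0\<^sub>m l1 l2) P Q"
    using mat_carrier by blast
  have \<pi>: "\<pi> a \<in> \<Gamma>" "\<pi>' a \<in> \<Gamma>" "\<pi> (\<pi>' a) = a"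
    "\<And>p. p < l \<Longrightarrow> (\<Sum>q<l. g q p * coef (\<pi> a) q) = coef a p" if "a \<in> \<Gamma>" for a
    using d that unfolding linear_data_def by blast+
  have \<pi>G: "row_mult l (\<pi> a) ?G = a" if a: "a \<in> \<Gamma>" for a
  proof (rule vecs_eqI[where n = l])
    show "coef (row_mult l (\<pi> a) ?G) p = coef a p" if "p < l" for p
      using \<pi>(4)[OF a that] that by (simp add: coef_row_mult mult.commute)
  qed (use a Gamma_vecs row_mult_vecs in blast)+
  have "(\<lambda>\<alpha>. row_mult l \<alpha> ?G) ` \<Gamma> = \<Gamma>"
  proof (intro equalityI subsetI)
    fix a assume "a \<in> (\<lambda>\<alpha>. row_mult l \<alpha> ?G) ` \<Gamma>"
    then obtain b where b: "b \<in> \<Gamma>" "a = row_mult l b ?G" by blast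
    then show "a \<in> \<Gamma>" using \<pi>G[OF \<pi>(2)[OF b(1)]] \<pi>(2,3)[OF b(1)] by simp
  next
    fix a assume "a \<in> \<Gamma>"
    then show "a \<in> (\<lambda>\<alpha>. row_mult l \<alpha> ?G) ` \<Gamma>" using \<pi>G \<pi>(1) by (intro image_eqI[of _ _ "\<pi> a"]) simp_all
  qed
  moreover have "f \<in> characters \<Gamma>" using d unfolding linear_data_def characters_def by blast
  ultimately show \<tau>: "(?G, f) \<in> Aut2_A1 l1 l2 \<Gamma>"
    using G blocks by (simp add: Aut2_A1_def Aut2_grp_def)
  note D = linear_data_of_matrix[OF \<tau>, unfolded H]
  have \<pi>H: "row_mult l a ?H = \<pi> a" if a: "a \<in> \<Gamma>" for a
    using row_mult_inverse[OF GL_D(1-3)[OF G, unfolded H], of "\<pi> a"] \<pi>G[OF a] \<pi>(1)[OF a] Gamma_vecs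
    by auto
  have "tau_hom f (\<lambda>\<alpha>. row_mult l \<alpha> ?H) (\<lambda>q p. ?G $$ (q, p)) (\<lambda>q p. ?H $$ (q, p)) w = tau_hom f \<pi> g g' w"
    if "w \<in> Wc" for w
    by (rule assoc_hom_eqI[OF tau_hom(1)[OF D] tau_hom(1)[OF d] _ _ _ that])
      (simp_all add: tau_hom[OF D] tau_hom[OF d] \<pi>H)
  then show "sigma_tau l1 l2 \<Gamma> (?G, f) = low (tau_hom f \<pi> g g')"
    unfolding sigma_tau_eq[OF \<tau>] H low_eq_iff by blast
qed

section \<open>The group E and the involution\<close>

lemma E_set_subset: "E_set l1 l2 \<Gamma> \<subseteq> carrier AutW"
proof
  fix e assume "e \<in> E_set l1 l2 \<Gamma>"
  then obtain G f u v where \<tau>: "(G, f) \<in> Aut2_A1 l1 l2 \<Gamma>" and u: "u \<in> A" and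
    e: "e = compose W (sigma_tau l1 l2 \<Gamma> (G, f)) (compose W (sigma_exp l1 l2 \<Gamma> u) (sigma_vec l1 l2 \<Gamma> v))"
    unfolding E_set_def by force
  note d = linear_data_of_matrix[OF \<tau>]
  note d' = linear_data_inverse[OF d]
  let ?T = "tau_hom f (\<lambda>\<alpha>. row_mult l \<alpha> (GL_inv l G)) (\<lambda>q p. G $$ (q, p)) (\<lambda>q p. GL_inv l G $$ (q, p))"
  let ?T' = "tau_hom (\<lambda>a. 1 / f (row_mult l a G)) (\<lambda>\<alpha>. row_mult l \<alpha> G) (\<lambda>q p. GL_inv l G $$ (q, p)) (\<lambda>q p. G $$ (q, p))"
  let ?V = "vec_hom (coef v)" and ?V' = "vec_hom (\<lambda>p. - coef v p)"
  have X: "assoc_hom (exp_ad u)" and X': "assoc_hom (exp_ad (- u))"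
    using u by (simp_all add: assoc_hom_exp_ad A_uminus)
  note lin = linear_mapD(1)[OF assoc_homD(1)]
  have Tw: "exp_ad u (exp_ad (- u) w) = w" if "w \<in> Wc" for w
    using exp_ad_inverse[OF A_uminus[OF u] that] by simp
  have "e = low (\<lambda>w. ?T (exp_ad u (?V w)))"
    unfolding e sigma_tau_eq[OF \<tau>] sigma_exp_eq[OF u] sigma_vec_eq
    by (simp only: compose_low[OF assoc_homD(1)[OF vec_hom(1)]]
        compose_low[OF assoc_homD(1)[OF assoc_hom_comp[OF X vec_hom(1)]]])
  moreover have "low (\<lambda>w. ?T (exp_ad u (?V w))) \<in> carrier AutW"
  proof (rule low_in_Aut_assoc[where S' = "\<lambda>w. ?V' (exp_ad (- u) (?T' w))"])
    show "assoc_hom (\<lambda>w. ?T (exp_ad u (?V w)))"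
      by (rule assoc_hom_comp[OF tau_hom(1)[OF d] assoc_hom_comp[OF X vec_hom(1)]])
    show "assoc_hom (\<lambda>w. ?V' (exp_ad (- u) (?T' w)))"
      by (rule assoc_hom_comp[OF vec_hom(1) assoc_hom_comp[OF X' tau_hom(1)[OF d']]])
    fix w assume w: "w \<in> Wc"
    have V: "?V w \<in> Wc" by (rule lin[OF vec_hom(1) w])
    have XV: "exp_ad u (?V w) \<in> Wc" by (rule lin[OF X V])
    show "?V' (exp_ad (- u) (?T' (?T (exp_ad u (?V w))))) = w"
      unfolding tau_hom_inverse[OF d XV] exp_ad_inverse[OF u V] vec_hom_inverse[OF w] ..
    have T': "?T' w \<in> Wc" by (rule lin[OF tau_hom(1)[OF d'] w])
    have XT': "exp_ad (- u) (?T' w) \<in> Wc" by (rule lin[OF X' T'])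
    show "?T (exp_ad u (?V (?V' (exp_ad (- u) (?T' w))))) = w"
      unfolding vec_hom_inverse'[OF XT'] Tw[OF T'] tau_hom_inverse'[OF d w] ..
  qed
  ultimately show "e \<in> carrier AutW" by simp
qed

lemma kst_eq_iff: "kst c = kst d \<longleftrightarrow> c = (d :: 'f)"
  by (metis lookup_single_eq walg_of_eq_iff)

text \<open>An automorphism fixing 1 has scalar 1, so the factorization in
  \<open>decomposition\<close> applies.\<close>

lemma E_setI:
  assumes S: "lie_automorphism l1 l2 \<Gamma> S S'" and one: "S 1 = 1"
  shows "low S \<in> E_set l1 l2 \<Gamma>"
proof -
  interpret S: lie_automorphism l1 l2 \<Gamma> S S' by (rule S)
  have "kst S.scalar = kst 1" using S.scalar(2) one by simp
  then have scalar: "S.scalar = 1" unfolding kst_eq_iff .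
  obtain f \<pi> \<pi>' g g' u v where d: "linear_data f \<pi> \<pi>' g g'" and u: "u \<in> A"
    and "S.scalar = 1 \<Longrightarrow> \<forall>w\<in>Wc. S w = tau_hom f \<pi> g g' (exp_ad u (vec_hom v w))"
    using S.decomposition by metis
  with scalar have eq: "\<And>w. w \<in> Wc \<Longrightarrow> S w = tau_hom f \<pi> g g' (exp_ad u (vec_hom v w))" by blast
  \<comment> \<open>The decomposition yields \<open>v\<close> as a function on all indices; it is
    cut off at \<open>l\<close> to become a vector, which does not change \<open>vec_hom\<close> on
    the generators.\<close>
  define v' where "v' = (\<Sum>p<l. Poly_Mapping.single p (v p))"
  have v': "coef v' p = (if p < l then v p else 0)" for p
    by (simp add: v'_def lookup_sum lookup_single when_def)
  have "v' \<in> vecs l" by (auto simp: vecs_def in_keys_iff v' split: if_splits)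
  have vv: "vec_hom v w = vec_hom (coef v') w" if "w \<in> Wc" for w
    by (rule assoc_hom_eqI[OF vec_hom(1) vec_hom(1) _ _ _ that]) (simp_all add: vec_hom(2-4) v')
  have X: "assoc_hom (exp_ad u)" using u by (rule assoc_hom_exp_ad)
  have "low S = low (\<lambda>w. tau_hom f \<pi> g g' (exp_ad u (vec_hom (coef v') w)))"
    unfolding low_eq_iff using eq vv by simp
  also have "\<dots> = compose W (sigma_tau l1 l2 \<Gamma> (mat l l (\<lambda>(i, j). g i j), f))
      (compose W (sigma_exp l1 l2 \<Gamma> u) (sigma_vec l1 l2 \<Gamma> v'))"
    unfolding matrix_of_linear_data(2)[OF d] sigma_exp_eq[OF u] sigma_vec_eq
    by (simp only: compose_low[OF assoc_homD(1)[OF vec_hom(1)]]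
        compose_low[OF assoc_homD(1)[OF assoc_hom_comp[OF X vec_hom(1)]]])
  finally show ?thesis
    unfolding E_set_def using matrix_of_linear_data(1)[OF d] u \<open>v' \<in> vecs l\<close> by blast
qed

lemma E_set_eq: "E_set l1 l2 \<Gamma> = carrier AutW"
proof (intro equalityI subsetI)
  fix h assume "h \<in> carrier AutW"
  then obtain S S' where S: "h = low S" "assoc_hom S" "assoc_hom S'" "\<forall>w\<in>Wc. S' (S w) = w \<and> S (S' w) = w"
    unfolding Aut_assoc_iff by blast
  have "lie_automorphism l1 l2 \<Gamma> S S'"
    by unfold_locales (use S in \<open>simp_all add: assoc_hom_lie_hom\<close>)
  then show "h \<in> E_set l1 l2 \<Gamma>" unfolding S(1) by (rule E_setI) (rule assoc_homD(2)[OF S(2)])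
qed (use E_set_subset in blast)

lemma E_setD:
  assumes "e \<in> E_set l1 l2 \<Gamma>"
  obtains S S' where "e = low S" "S 1 = 1" "assoc_hom S" "assoc_hom S'" "low S' \<in> E_set l1 l2 \<Gamma>"
    "\<And>w. w \<in> Wc \<Longrightarrow> S' (S w) = w" "\<And>w. w \<in> Wc \<Longrightarrow> S (S' w) = w"
proof -
  obtain S S' where S: "e = low S" "assoc_hom S" "assoc_hom S'" "\<forall>w\<in>Wc. S' (S w) = w \<and> S (S' w) = w"
    using assms unfolding E_set_eq Aut_assoc_iff by blast
  then have "low S' \<in> E_set l1 l2 \<Gamma>" unfolding E_set_eq by (intro low_in_Aut_assoc) auto
  with S assoc_homD(2)[OF S(2)] show ?thesis by (intro that[of S S']) auto
qed

text \<open>Being all of \<open>AutW\<close>, the set inherits closure from that group, and both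
  groups multiply by composition.\<close>

lemma subgroup_E_set: "subgroup (E_set l1 l2 \<Gamma>) AutL"
proof (rule group.subgroupI[OF group_Aut(1)])
  note sub = subsetD[OF Aut_assoc_subset, folded E_set_eq]
  show "E_set l1 l2 \<Gamma> \<subseteq> carrier AutL" using sub by blast
  show "E_set l1 l2 \<Gamma> \<noteq> {}"
    using monoid.one_closed[OF group.is_monoid[OF group_Aut(2)]] unfolding E_set_eq by blast
  fix a assume a: "a \<in> E_set l1 l2 \<Gamma>"
  obtain S S' where S: "a = low S" "assoc_hom S" "low S' \<in> E_set l1 l2 \<Gamma>" "\<And>w. w \<in> Wc \<Longrightarrow> S' (S w) = w"
    using E_setD[OF a] by metis
  have "low S' \<otimes>\<^bsub>AutL\<^esub> a = low (\<lambda>w. S' (S w))"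
    unfolding S(1) by (rule Aut_low_mult(1)[OF assoc_homD(1)[OF S(2)] sub[OF S(3)] sub[OF a[unfolded S(1)]]])
  also have "\<dots> = \<one>\<^bsub>AutL\<^esub>" unfolding Aut_one low_eq_iff using S(4) by blast
  finally have "inv\<^bsub>AutL\<^esub> a = low S'"
    using group.inv_equality[OF group_Aut(1)] sub[OF a] sub[OF S(3)] by blast
  then show "inv\<^bsub>AutL\<^esub> a \<in> E_set l1 l2 \<Gamma>" using S(3) by simp
  fix b assume b: "b \<in> E_set l1 l2 \<Gamma>"
  obtain T where T: "b = low T" "linear_map T" using E_setD[OF b] assoc_homD(1) by metis
  have "a \<otimes>\<^bsub>AutL\<^esub> b = a \<otimes>\<^bsub>AutW\<^esub> b"
    using Aut_low_mult[OF T(2), of S] sub[OF a] sub[OF b] a b unfolding E_set_eq S(1) T(1) by simp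
  then show "a \<otimes>\<^bsub>AutL\<^esub> b \<in> E_set l1 l2 \<Gamma>"
    using monoid.m_closed[OF group.is_monoid[OF group_Aut(2)]] a b unfolding E_set_eq by simp
qed

lemma neg_adjoint_automorphism: "lie_automorphism l1 l2 \<Gamma> (\<lambda>w. - adjoint w) (\<lambda>w. - adjoint w)"
  by unfold_locales (simp_all add: lie_hom_neg_adjoint adjoint_uminus adjoint_adjoint)

lemma lie_automorphism_comp:
  assumes "lie_automorphism l1 l2 \<Gamma> S S'" "lie_automorphism l1 l2 \<Gamma> T T'"
  shows "lie_automorphism l1 l2 \<Gamma> (\<lambda>w. S (T w)) (\<lambda>w. T' (S' w))"
proof -
  interpret S: lie_automorphism l1 l2 \<Gamma> S S' by (rule assms(1))
  interpret T: lie_automorphism l1 l2 \<Gamma> T T' by (rule assms(2))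
  show ?thesis
    by unfold_locales (simp_all add: lie_hom_comp S.phi S.psi T.phi T.psi S.psi_phi S.phi_psi T.psi_phi T.phi_psi
        S.psi_lin(1) T.phi_lin(1))
qed

text \<open>Membership in \<open>E\<close> is decided by the value at 1: \<open>sigma1\<close> sends
  1 to -1, elements of \<open>E\<close> fix 1, and a Lie automorphism sends 1 to
  \<open>scalar\<close>, which is 1 or -1. Conjugating by \<open>sigma1\<close> changes the sign
  twice.\<close>

lemma sigma1_facts:
  defines "s \<equiv> sigma1 l1 l2 \<Gamma>" and "E \<equiv> E_set l1 l2 \<Gamma>"
  shows "s \<in> carrier AutL" "s \<otimes>\<^bsub>AutL\<^esub> s = \<one>\<^bsub>AutL\<^esub>" "s \<notin> E"
    and "x \<in> carrier AutL \<Longrightarrow> x \<in> E \<or> x \<otimes>\<^bsub>AutL\<^esub> s \<in> E"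
    and "e \<in> E \<Longrightarrow> s \<otimes>\<^bsub>AutL\<^esub> e \<otimes>\<^bsub>AutL\<^esub> s \<in> E"
proof -
  let ?n = "\<lambda>w. - adjoint w :: 'f walg"
  note n = neg_adjoint_automorphism
  have s: "s = low ?n" by (simp add: s_def sigma1_eq)
  have lin: "linear_map ?n" using lie_hom_neg_adjoint by (simp add: lie_hom_def)
  have in_L: "low S \<in> carrier AutL" if "lie_automorphism l1 l2 \<Gamma> S S'" for S S'
    using that unfolding Aut_Lie_iff by blast
  show sL: "s \<in> carrier AutL" unfolding s by (rule in_L[OF n])
  have "s \<otimes>\<^bsub>AutL\<^esub> s = low (\<lambda>w. ?n (?n w))"
    using Aut_low_mult(1)[OF lin] sL unfolding s by blast
  also have "\<dots> = \<one>\<^bsub>AutL\<^esub>"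
    unfolding Aut_one low_eq_iff by (simp add: adjoint_uminus adjoint_adjoint)
  finally show "s \<otimes>\<^bsub>AutL\<^esub> s = \<one>\<^bsub>AutL\<^esub>" .
  show "s \<notin> E"
  proof
    assume "s \<in> E"
    then obtain S where "s = low S" "S 1 = 1" unfolding E_def using E_setD by metis
    then have "?n 1 = 1" unfolding s low_eq_iff using Wc_one by metis
    then have "kst (- 1) = (kst 1 :: 'f walg)" by (simp add: adjoint_one kst_uminus)
    then show False unfolding kst_eq_iff by simp
  qed
  show "x \<in> E \<or> x \<otimes>\<^bsub>AutL\<^esub> s \<in> E" if x: "x \<in> carrier AutL"
  proof -
    obtain S S' where S: "x = low S" "lie_automorphism l1 l2 \<Gamma> S S'" using x unfolding Aut_Lie_iff by blast
    interpret S: lie_automorphism l1 l2 \<Gamma> S S' by (rule S(2))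
    have "S.scalar = 1 \<or> S.scalar = - 1" using S.decomposition by metis
    then show ?thesis
    proof
      assume "S.scalar = 1"
      then have "S 1 = 1" using S.scalar(2) by simp
      then show ?thesis using E_setI[OF S(2)] by (simp add: E_def S(1))
    next
      assume "S.scalar = - 1"
      then have "S (?n 1) = 1" using S.scalar(2) by (simp add: adjoint_one S.phi_lin(5) kst_uminus)
      then have "low (\<lambda>w. S (?n w)) \<in> E" unfolding E_def by (intro E_setI[OF lie_automorphism_comp[OF S(2) n]])
      moreover have "x \<otimes>\<^bsub>AutL\<^esub> s = low (\<lambda>w. S (?n w))"
        using Aut_low_mult(1)[OF lin] sL x unfolding s S(1) by blast
      ultimately show ?thesis by simp
    qed
  qed
  show "s \<otimes>\<^bsub>AutL\<^esub> e \<otimes>\<^bsub>AutL\<^esub> s \<in> E" if e: "e \<in> E"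
  proof -
    obtain S S' where S: "e = low S" "S 1 = 1" "assoc_hom S" "assoc_hom S'"
      "\<And>w. w \<in> Wc \<Longrightarrow> S' (S w) = w" "\<And>w. w \<in> Wc \<Longrightarrow> S (S' w) = w"
      using E_setD[OF e[unfolded E_def]] by metis
    have auto_S: "lie_automorphism l1 l2 \<Gamma> S S'"
      by unfold_locales (use S in \<open>simp_all add: assoc_hom_lie_hom\<close>)
    note nS = lie_automorphism_comp[OF n auto_S]
    have eL: "low S \<in> carrier AutL" by (rule in_L[OF auto_S])
    have "s \<otimes>\<^bsub>AutL\<^esub> e = low (\<lambda>w. ?n (S w))"
      using Aut_low_mult(1)[OF assoc_homD(1)[OF S(3)]] sL eL unfolding s S(1) by blast
    then have "s \<otimes>\<^bsub>AutL\<^esub> e \<otimes>\<^bsub>AutL\<^esub> s = low (\<lambda>w. ?n (S (?n w)))"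
      using Aut_low_mult(1)[OF lin in_L[OF nS]] sL unfolding s by simp
    moreover have "?n (S (?n 1)) = 1"
      using linear_mapD(5)[OF assoc_homD(1)[OF S(3)] Wc_one] by (simp add: adjoint_one adjoint_uminus S(2))
    ultimately show ?thesis
      using E_setI[OF lie_automorphism_comp[OF nS n]] by (simp add: E_def)
  qed
qed

end

theorem theorem2p3:
  fixes l1 l2 :: nat and \<Gamma> :: "(nat \<Rightarrow>\<^sub>0 'f::field_char_0) set"
  assumes "0 < l1 + l2"
    and "nondegenerate_subgroup (l1 + l2) \<Gamma>"
  shows
    "let AutW = Aut_assoc l1 l2 \<Gamma>; AutL = Aut_Lie l1 l2 \<Gamma>;
         E = E_set l1 l2 \<Gamma>; s = sigma1 l1 l2 \<Gamma>; S = generate AutL {s};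
         \<theta> = conj_action AutL E
     in subgroup E AutW \<and>
        (\<lambda>e. e) \<in> iso (AutW\<lparr>carrier := E\<rparr>) AutW \<and>
        subgroup E AutL \<and>
        s \<in> carrier AutL \<and> group.ord AutL s = 2 \<and>
        \<theta> \<in> hom (AutL\<lparr>carrier := S\<rparr>) (AutoGroup (AutL\<lparr>carrier := E\<rparr>)) \<and>
        (\<lambda>(e, t). e \<otimes>\<^bsub>AutL\<^esub> t)
          \<in> iso (semidirect (AutL\<lparr>carrier := E\<rparr>) (AutL\<lparr>carrier := S\<rparr>) \<theta>) AutL"
proof -
  interpret weyl_type l1 l2 \<Gamma> by (rule weyl_type.intro) (fact assms)+
  note split = group.semidirect_involution[OF group_Aut(1) subgroup_E_set sigma1_facts(1-5)]
  have "subgroup (E_set l1 l2 \<Gamma>) AutW"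
    unfolding E_set_eq by (rule group.subgroup_self[OF group_Aut(2)])
  moreover have "(\<lambda>e. e) \<in> iso (AutW\<lparr>carrier := E_set l1 l2 \<Gamma>\<rparr>) AutW"
    unfolding E_set_eq using iso_set_refl[of AutW] by simp
  ultimately show ?thesis
    unfolding Let_def using subgroup_E_set sigma1_facts(1) split by blast
qed

end
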